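(* Let $Q\in L^2(D)$, $(u_0,v_0,\theta_0)\in H$, and let $(u_1,v_1,\theta_1)$ and $(u_2,v_2,\theta_2)$ be two weak solutions of the 2D viscous primitive equations with the same initial data $(u_0,v_0,\theta_0)$. Suppose that for some $T>0$ each of the three functions $\partial_z u_1,\ \partial_z v_1,\ \partial_z\theta_1$ belongs to $$L^4(0,T;L^2(D))\ \cup\ L^2\big(0,T;L^\infty_x(L^2_z)\big),$$ that is, $$(\partial_z u_1,\partial_z v_1,\partial_z\theta_1)\in\Big[L^4(0,T;L^2(D))\cup L^2(0,T;L^\infty_x(L^2_z))\Big]^3 .$$ Then $(u_1,v_1,\theta_1)(t)=(u_2,v_2,\theta_2)(t)$ for all $t\in[0,T]$.
   Context: Setting. $h>0$ is fixed, $D=\{(x,z)\in\mathbb{R}^2: 0<x<1,\ -h<z<0\}$, $\alpha_1,\alpha_2,\alpha_3\ge 0$ are constants, $Q\in L^2(D)$ is independent of time. $\Gamma_b=\{z=-h\}$ and $\Gamma_l=\{x=0\}\cup\{x=1\}$ are parts of $\partial D$. $\|\cdot\|$ is the norm of $L^2(D)$ and $\langle\cdot,\cdot\rangle$ the $L^2(D)$ inner product (and the corresponding duality pairing $V_i',V_i$). $\nabla=(\partial_x,\partial_z)$. $\|\varphi\|_{L^\infty_x(L^2_z)}=\operatorname{ess\,sup}_{x\in(0,1)}\big(\int_{-h}^0|\varphi(x,z)|^2dz\big)^{1/2}$. Spaces. $H=H_1\times H_2\times H_3$, $V=V_1\times V_2\times V_3$, where $H_1=\{\varphi\in L^2(D):\int_{-h}^0\varphi(x,z)dz=0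 \text{ for a.e. } x\}$, $V_1=\{\varphi\in H^1(D):\int_{-h}^0\varphi\,dz=0,\ \varphi|_{\Gamma_l\cup\Gamma_b}=0\}$, $H_2=L^2(D)$, $V_2=\{\varphi\in H^1(D):\varphi|_{\Gamma_l\cup\Gamma_b}=0\}$; if $\alpha_3>0$, $H_3=L^2(D)$ and $V_3=H^1(D)$; if $\alpha_3=0$, $H_3=\{\varphi\in L^2(D):\int_D\varphi=0\}$ and $V_3=H_3\cap H^1(D)$. $H_i$ carries the $L^2(D)$ norm. For $i=1,2,3$, $a_i(\phi,\varphi)=\int_D\nabla\phi\cdot\nabla\varphi\,dxdz+\alpha_i\int_0^1\phi(x,0)\varphi(x,0)dx$ on $V_i\times V_i$, and $\|\varphi\|_{V_i}^2=a_i(\varphi,\varphi)$ (a norm equivalent to the $H^1$ norm on $V_i$). Equations. The 2D viscous primitive equations for $(u,v,\theta)$ are, with $w(x,z,t)=\int_z^0u_x(x,\zeta,t)d\zeta$ and unknown surface pressure $q(x,t)$: $u_t-\Delta u+uu_x+wu_z+q_x+\int_z^0\theta_x d\zeta=v$, $v_t-\Delta v+uv_x+wv_z=-u$, $\theta_t-\Delta\theta+u\theta_x+w\theta_z=Q$, with boundary conditions $u_z+\alpha_1u|_{z=0}=u|_{z=-h}=u|_{x=0,1}=0$, $v_z+\alpha_2v|_{z=0}=v|_{z=-h}=v|_{x=0,1}=0$, $\int_{-h}^0u_xd\zeta=0$, $\theta_z+\alpha_3\theta|_{z=0}=\theta_z|_{z=-h}=\theta_x|_{x=0,1}=0$, and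 initial data $(u_0,v_0,\theta_0)$. Weak solution on $(0,T)$: a triple $(u,v,\theta)\in L^\infty(0,T;H)\cap L^2(0,T;V)$ such that, in the sense of distributions on $(0,T)$, $\langle u_t,\varphi\rangle+a_1(u,\varphi)+\langle(u,w)\cdot\nabla u-v+\int_z^0\theta_x,\varphi\rangle=0$ for all $\varphi\in V_1$; $\langle v_t,\varphi\rangle+a_2(v,\varphi)+\langle(u,w)\cdot\nabla v+u,\varphi\rangle=0$ for all $\varphi\in V_2$; $\langle\theta_t,\varphi\rangle+a_3(\theta,\varphi)+\langle(u,w)\cdot\nabla\theta-Q,\varphi\rangle=0$ for all $\varphi\in V_3$; $(u(t),v(t),\theta(t))\to(u_0,v_0,\theta_0)$ weakly in $H$ as $t\to0^+$; and the energy inequalities $\|u(t)\|^2+2\int_{t_0}^t(\|u\|_{V_1}^2+\langle -v+\int_z^0\theta_x,u\rangle)ds\le\|u(t_0)\|^2$, $\|v(t)\|^2+2\int_{t_0}^t(\|v\|_{V_2}^2+\langle u,v\rangle)ds\le\|v(t_0)\|^2$, $\|\theta(t)\|^2+2\int_{t_0}^t(\|\theta\|_{V_3}^2-\langle Q,\theta\rangle)ds\le\|\theta(t_0)\|^2$ hold for almost every $t_0\in[0,T)$ and almost every $t\in(t_0,T)$, and also for $t_0=0$ and almost every $t\in(0,T)$. It is global if this holds for every $T>0$. Weak solutions are identified with their weakly continuous representatives $[0,T]\to H$. *)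

theory Defs
  imports "HOL-Analysis.Analysis" "HOL-Probability.Essential_Supremum"
begin

text \<open>
  Elements of Lebesgue, Sobolev and Bochner spaces are represented by functions, and two
  representatives are identified when they agree almost everywhere. All integrals are Lebesgue
  integrals with respect to the completed Lebesgue measure.
\<close>

section \<open>Test functions, weak derivatives, traces\<close>

fun Ck :: "nat \<Rightarrow> ('a::euclidean_space \<Rightarrow> real) \<Rightarrow> bool" where
  "Ck 0 f \<longleftrightarrow> continuous_on UNIV f"
| "Ck (Suc k) f \<longleftrightarrow> (\<forall>x. f differentiable (at x)) \<and>
     (\<forall>v. Ck k (\<lambda>x. frechet_derivative f (at x) v))"

definition smooth :: "('a::euclidean_space \<Rightarrow> real) \<Rightarrow> bool" where
  "smooth f \<longleftrightarrow> (\<forall>k. Ck k f)"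

definition test_function :: "'a::euclidean_space set \<Rightarrow> ('a \<Rightarrow> real) \<Rightarrow> bool" where
  "test_function S \<phi> \<longleftrightarrow> smooth \<phi> \<and> compact (closure {x. \<phi> x \<noteq> 0}) \<and> closure {x. \<phi> x \<noteq> 0} \<subseteq> S"

definition L2 :: "'a::euclidean_space set \<Rightarrow> ('a \<Rightarrow> real) set" where
  "L2 S = {f. f \<in> borel_measurable (lebesgue_on S) \<and> integrable (lebesgue_on S) (\<lambda>x. (f x)\<^sup>2)}"

definition L2_inner :: "'a::euclidean_space set \<Rightarrow> ('a \<Rightarrow> real) \<Rightarrow> ('a \<Rightarrow> real) \<Rightarrow> real" where
  "L2_inner S f g = (LINT x|lebesgue_on S. f x * g x)"

definition L2_norm :: "'a::euclidean_space set \<Rightarrow> ('a \<Rightarrow> real) \<Rightarrow> real" where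
  "L2_norm S f = sqrt (L2_inner S f f)"

definition has_weak_deriv ::
    "'a::euclidean_space set \<Rightarrow> 'a \<Rightarrow> ('a \<Rightarrow> real) \<Rightarrow> ('a \<Rightarrow> real) \<Rightarrow> bool" where
  "has_weak_deriv S e f g \<longleftrightarrow> (\<forall>\<phi>. test_function S \<phi> \<longrightarrow>
     (LINT x|lebesgue_on S. f x * frechet_derivative \<phi> (at x) e) =
     - (LINT x|lebesgue_on S. g x * \<phi> x))"

definition Sobolev1 :: "'a::euclidean_space set \<Rightarrow> ('a \<Rightarrow> real) set" where
  "Sobolev1 S = {f \<in> L2 S. \<forall>e\<in>Basis. \<exists>g\<in>L2 S. has_weak_deriv S e f g}"

text \<open>
  A representative of the weak derivative in direction \<open>e\<close>; it is meaningful for \<open>f \<in> Sobolev1 S\<close>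
  and \<open>S\<close> open, where it is determined up to a null set.
\<close>
definition weak_deriv :: "'a::euclidean_space set \<Rightarrow> 'a \<Rightarrow> ('a \<Rightarrow> real) \<Rightarrow> 'a \<Rightarrow> real" where
  "weak_deriv S e f = (SOME g. g \<in> L2 S \<and> has_weak_deriv S e f g)"

definition Sobolev1_norm :: "'a::euclidean_space set \<Rightarrow> ('a \<Rightarrow> real) \<Rightarrow> real" where
  "Sobolev1_norm S f =
     sqrt ((L2_norm S f)\<^sup>2 + (\<Sum>e\<in>Basis. (L2_norm S (weak_deriv S e f))\<^sup>2))"

text \<open>
  The trace of \<open>f \<in> Sobolev1 S\<close> along the curve \<open>\<gamma>\<close>, defined on the interval \<open>I\<close> and running in
  the boundary of \<open>S\<close>, is the continuous extension of the restriction map: \<open>f\<close> is the limit in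
  \<open>Sobolev1 S\<close> of functions smooth up to the boundary whose restrictions to \<open>\<gamma>\<close> converge
  to \<open>g\<close> in \<open>L2 I\<close>. It is used for segments parametrised by arc length only.
\<close>
definition has_trace ::
    "'a::euclidean_space set \<Rightarrow> real set \<Rightarrow> (real \<Rightarrow> 'a) \<Rightarrow> ('a \<Rightarrow> real) \<Rightarrow> (real \<Rightarrow> real) \<Rightarrow> bool" where
  "has_trace S I \<gamma> f g \<longleftrightarrow> f \<in> Sobolev1 S \<and> g \<in> L2 I \<and>
     (\<exists>F. (\<forall>n::nat. smooth (F n)) \<and>
       (\<lambda>n. Sobolev1_norm S (\<lambda>x. F n x - f x)) \<longlonglongrightarrow> 0 \<and>
       (\<lambda>n. L2_norm I (\<lambda>s. F n (\<gamma> s) - g s)) \<longlonglongrightarrow> 0)"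

section \<open>Functions of time with values in a function space\<close>

text \<open>
  Bochner measurability and Bochner spaces for a space \<open>X\<close> of (representatives of) functions with
  (semi)norm \<open>N\<close>. A curve in \<open>X\<close> need take values in \<open>X\<close> only for almost every time.
\<close>
definition Bochner_measurable ::
    "real set \<Rightarrow> ('a \<Rightarrow> real) set \<Rightarrow> (('a \<Rightarrow> real) \<Rightarrow> real) \<Rightarrow> (real \<Rightarrow> 'a \<Rightarrow> real) \<Rightarrow> bool" where
  "Bochner_measurable I X N f \<longleftrightarrow>
     (AE t in lebesgue_on I. f t \<in> X) \<and>
     (\<exists>s. (\<forall>n::nat. simple_function (lebesgue_on I) (s n) \<and> s n ` I \<subseteq> X) \<and>
       (AE t in lebesgue_on I. (\<lambda>n. N (\<lambda>x. s n t x - f t x)) \<longlonglongrightarrow> 0))"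

definition Bochner_Lp ::
    "nat \<Rightarrow> real set \<Rightarrow> ('a \<Rightarrow> real) set \<Rightarrow> (('a \<Rightarrow> real) \<Rightarrow> real) \<Rightarrow> (real \<Rightarrow> 'a \<Rightarrow> real) set" where
  "Bochner_Lp p I X N =
     {f. Bochner_measurable I X N f \<and> integrable (lebesgue_on I) (\<lambda>t. N (f t) ^ p)}"

definition Bochner_Linf ::
    "real set \<Rightarrow> ('a \<Rightarrow> real) set \<Rightarrow> (('a \<Rightarrow> real) \<Rightarrow> real) \<Rightarrow> (real \<Rightarrow> 'a \<Rightarrow> real) set" where
  "Bochner_Linf I X N =
     {f. Bochner_measurable I X N f \<and> (\<exists>C. AE t in lebesgue_on I. N (f t) \<le> C)}"

definition weakly_continuous_on ::
    "real set \<Rightarrow> 'a::euclidean_space set \<Rightarrow> ('a \<Rightarrow> real) set \<Rightarrow> (real \<Rightarrow> 'a \<Rightarrow> real) \<Rightarrow> bool" where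
  "weakly_continuous_on I S X f \<longleftrightarrow> (\<forall>t\<in>I. f t \<in> X) \<and>
     (\<forall>\<phi>\<in>X. continuous_on I (\<lambda>t. L2_inner S (f t) \<phi>))"

section \<open>The domain and the spaces \<open>H\<close> and \<open>V\<close>\<close>

definition Dom :: "real \<Rightarrow> (real \<times> real) set" where
  "Dom h = {0<..<1} \<times> {- h<..<0}"

abbreviation dx :: "real \<Rightarrow> (real \<times> real \<Rightarrow> real) \<Rightarrow> real \<times> real \<Rightarrow> real" where
  "dx h \<equiv> weak_deriv (Dom h) (1, 0)"

abbreviation dz :: "real \<Rightarrow> (real \<times> real \<Rightarrow> real) \<Rightarrow> real \<times> real \<Rightarrow> real" where
  "dz h \<equiv> weak_deriv (Dom h) (0, 1)"

definition zero_vertical_mean :: "real \<Rightarrow> (real \<times> real \<Rightarrow> real) \<Rightarrow> bool" where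
  "zero_vertical_mean h \<phi> \<longleftrightarrow>
     (AE x in lebesgue_on {0<..<1}. (LINT z|lebesgue_on {- h<..<0}. \<phi> (x, z)) = 0)"

definition zero_trace_lateral_bottom :: "real \<Rightarrow> (real \<times> real \<Rightarrow> real) \<Rightarrow> bool" where
  "zero_trace_lateral_bottom h \<phi> \<longleftrightarrow>
     has_trace (Dom h) {- h<..<0} (\<lambda>z. (0, z)) \<phi> (\<lambda>_. 0) \<and>
     has_trace (Dom h) {- h<..<0} (\<lambda>z. (1, z)) \<phi> (\<lambda>_. 0) \<and>
     has_trace (Dom h) {0<..<1} (\<lambda>x. (x, - h)) \<phi> (\<lambda>_. 0)"

definition top_trace :: "real \<Rightarrow> (real \<times> real \<Rightarrow> real) \<Rightarrow> real \<Rightarrow> real" where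
  "top_trace h \<phi> = (SOME g. has_trace (Dom h) {0<..<1} (\<lambda>x. (x, 0)) \<phi> g)"

definition H_1 :: "real \<Rightarrow> (real \<times> real \<Rightarrow> real) set" where
  "H_1 h = {\<phi> \<in> L2 (Dom h). zero_vertical_mean h \<phi>}"

definition V_1 :: "real \<Rightarrow> (real \<times> real \<Rightarrow> real) set" where
  "V_1 h = {\<phi> \<in> Sobolev1 (Dom h). zero_vertical_mean h \<phi> \<and> zero_trace_lateral_bottom h \<phi>}"

definition H_2 :: "real \<Rightarrow> (real \<times> real \<Rightarrow> real) set" where
  "H_2 h = L2 (Dom h)"

definition V_2 :: "real \<Rightarrow> (real \<times> real \<Rightarrow> real) set" where
  "V_2 h = {\<phi> \<in> Sobolev1 (Dom h). zero_trace_lateral_bottom h \<phi>}"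

definition H_3 :: "real \<Rightarrow> real \<Rightarrow> (real \<times> real \<Rightarrow> real) set" where
  "H_3 h \<alpha>\<^sub>3 = (if \<alpha>\<^sub>3 > 0 then L2 (Dom h)
     else {\<phi> \<in> L2 (Dom h). (LINT p|lebesgue_on (Dom h). \<phi> p) = 0})"

definition V_3 :: "real \<Rightarrow> real \<Rightarrow> (real \<times> real \<Rightarrow> real) set" where
  "V_3 h \<alpha>\<^sub>3 = H_3 h \<alpha>\<^sub>3 \<inter> Sobolev1 (Dom h)"

text \<open>The form \<open>a\<^sub>i\<close> is \<open>a_form h \<alpha>\<^sub>i\<close>, and the norm of \<open>V\<^sub>i\<close> is \<open>V_norm h \<alpha>\<^sub>i\<close>.\<close>
definition a_form ::
    "real \<Rightarrow> real \<Rightarrow> (real \<times> real \<Rightarrow> real) \<Rightarrow> (real \<times> real \<Rightarrow> real) \<Rightarrow> real" where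
  "a_form h \<alpha> \<phi> \<psi> =
     (LINT p|lebesgue_on (Dom h). dx h \<phi> p * dx h \<psi> p + dz h \<phi> p * dz h \<psi> p) +
     \<alpha> * (LINT x|lebesgue_on {0<..<1}. top_trace h \<phi> x * top_trace h \<psi> x)"

definition V_norm :: "real \<Rightarrow> real \<Rightarrow> (real \<times> real \<Rightarrow> real) \<Rightarrow> real" where
  "V_norm h \<alpha> \<phi> = sqrt (a_form h \<alpha> \<phi> \<phi>)"

section \<open>Weak solutions of the 2D viscous primitive equations\<close>

definition int_to_top :: "(real \<times> real \<Rightarrow> real) \<Rightarrow> real \<times> real \<Rightarrow> real" where
  "int_to_top f = (\<lambda>(x, z). LINT \<zeta>|lebesgue_on {z<..<0}. f (x, \<zeta>))"

text \<open>The transport term \<open>(u, w) \<bullet> \<nabla>f\<close> with \<open>w = \<integral>\<^sub>z\<^sup>0 u\<^sub>x d\<zeta>\<close>.\<close>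
definition transport ::
    "real \<Rightarrow> (real \<times> real \<Rightarrow> real) \<Rightarrow> (real \<times> real \<Rightarrow> real) \<Rightarrow> real \<times> real \<Rightarrow> real" where
  "transport h u f = (\<lambda>p. u p * dx h f p + int_to_top (dx h u) p * dz h f p)"

text \<open>
  \<open>\<langle>f\<^sub>t, \<phi>\<rangle> + a(f, \<phi>) + \<langle>g, \<phi>\<rangle> = 0\<close> for all \<open>\<phi> \<in> V\<close> in the sense of distributions on \<open>(0, T)\<close>. For
  the terms \<open>g\<close> below and \<open>\<phi>\<close> in \<open>V\<close>, the duality pairing is an absolutely convergent integral,
  since \<open>\<integral>\<^sub>z\<^sup>0 u\<^sub>x d\<zeta>\<close> is square integrable in \<open>x\<close> uniformly in \<open>z\<close>, and \<open>\<phi>\<close> is square integrable in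
  \<open>z\<close> uniformly in \<open>x\<close>.
\<close>
definition weak_equation ::
    "real \<Rightarrow> real \<Rightarrow> real \<Rightarrow> (real \<times> real \<Rightarrow> real) set \<Rightarrow>
     (real \<Rightarrow> real \<times> real \<Rightarrow> real) \<Rightarrow> (real \<Rightarrow> real \<times> real \<Rightarrow> real) \<Rightarrow> bool" where
  "weak_equation h T \<alpha> V f g \<longleftrightarrow> (\<forall>\<phi>\<in>V. \<forall>\<psi>. test_function {0<..<T} \<psi> \<longrightarrow>
     - (LINT t|lebesgue_on {0<..<T}. L2_inner (Dom h) (f t) \<phi> * deriv \<psi> t) +
     (LINT t|lebesgue_on {0<..<T}. (a_form h \<alpha> (f t) \<phi> + L2_inner (Dom h) (g t) \<phi>) * \<psi> t) = 0)"

definition energy_bound_from ::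
    "real \<Rightarrow> real \<Rightarrow> real \<Rightarrow> (real \<Rightarrow> real \<times> real \<Rightarrow> real) \<Rightarrow>
     (real \<Rightarrow> real \<times> real \<Rightarrow> real) \<Rightarrow> real \<Rightarrow> bool" where
  "energy_bound_from h T \<alpha> f g t\<^sub>0 \<longleftrightarrow> (AE t in lebesgue_on {t\<^sub>0<..<T}.
     (L2_norm (Dom h) (f t))\<^sup>2 +
     2 * (LINT s|lebesgue_on {t\<^sub>0<..<t}. (V_norm h \<alpha> (f s))\<^sup>2 + L2_inner (Dom h) (g s) (f s))
     \<le> (L2_norm (Dom h) (f t\<^sub>0))\<^sup>2)"

definition energy_inequality ::
    "real \<Rightarrow> real \<Rightarrow> real \<Rightarrow> (real \<Rightarrow> real \<times> real \<Rightarrow> real) \<Rightarrow>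
     (real \<Rightarrow> real \<times> real \<Rightarrow> real) \<Rightarrow> bool" where
  "energy_inequality h T \<alpha> f g \<longleftrightarrow>
     (AE t\<^sub>0 in lebesgue_on {0..<T}. energy_bound_from h T \<alpha> f g t\<^sub>0) \<and>
     energy_bound_from h T \<alpha> f g 0"

definition weak_initial_value ::
    "real \<Rightarrow> (real \<times> real \<Rightarrow> real) set \<Rightarrow> (real \<Rightarrow> real \<times> real \<Rightarrow> real) \<Rightarrow>
     (real \<times> real \<Rightarrow> real) \<Rightarrow> bool" where
  "weak_initial_value h X f f\<^sub>0 \<longleftrightarrow> (\<forall>\<phi>\<in>X.
     ((\<lambda>t. L2_inner (Dom h) (f t) \<phi>) \<longlongrightarrow> L2_inner (Dom h) f\<^sub>0 \<phi>) (at_right 0))"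

text \<open>
  Weak solutions on \<open>(0, T)\<close>, given by their weakly continuous representative on \<open>[0, T]\<close>. In
  particular the value at time 0, which enters the energy inequality, is the initial value.
\<close>
definition weak_solution ::
    "real \<Rightarrow> real \<Rightarrow> real \<Rightarrow> real \<Rightarrow> (real \<times> real \<Rightarrow> real) \<Rightarrow>
     (real \<times> real \<Rightarrow> real) \<Rightarrow> (real \<times> real \<Rightarrow> real) \<Rightarrow> (real \<times> real \<Rightarrow> real) \<Rightarrow> real \<Rightarrow>
     (real \<Rightarrow> real \<times> real \<Rightarrow> real) \<Rightarrow> (real \<Rightarrow> real \<times> real \<Rightarrow> real) \<Rightarrow>
     (real \<Rightarrow> real \<times> real \<Rightarrow> real) \<Rightarrow> bool" where
  "weak_solution h \<alpha>\<^sub>1 \<alpha>\<^sub>2 \<alpha>\<^sub>3 Q u\<^sub>0 v\<^sub>0 \<theta>\<^sub>0 T u v \<theta> \<longleftrightarrow>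
     u \<in> Bochner_Linf {0<..<T} (H_1 h) (L2_norm (Dom h)) \<and>
     v \<in> Bochner_Linf {0<..<T} (H_2 h) (L2_norm (Dom h)) \<and>
     \<theta> \<in> Bochner_Linf {0<..<T} (H_3 h \<alpha>\<^sub>3) (L2_norm (Dom h)) \<and>
     u \<in> Bochner_Lp 2 {0<..<T} (V_1 h) (V_norm h \<alpha>\<^sub>1) \<and>
     v \<in> Bochner_Lp 2 {0<..<T} (V_2 h) (V_norm h \<alpha>\<^sub>2) \<and>
     \<theta> \<in> Bochner_Lp 2 {0<..<T} (V_3 h \<alpha>\<^sub>3) (V_norm h \<alpha>\<^sub>3) \<and>
     weakly_continuous_on {0..T} (Dom h) (H_1 h) u \<and>
     weakly_continuous_on {0..T} (Dom h) (H_2 h) v \<and>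
     weakly_continuous_on {0..T} (Dom h) (H_3 h \<alpha>\<^sub>3) \<theta> \<and>
     weak_equation h T \<alpha>\<^sub>1 (V_1 h) u
       (\<lambda>t p. transport h (u t) (u t) p - v t p + int_to_top (dx h (\<theta> t)) p) \<and>
     weak_equation h T \<alpha>\<^sub>2 (V_2 h) v (\<lambda>t p. transport h (u t) (v t) p + u t p) \<and>
     weak_equation h T \<alpha>\<^sub>3 (V_3 h \<alpha>\<^sub>3) \<theta> (\<lambda>t p. transport h (u t) (\<theta> t) p - Q p) \<and>
     weak_initial_value h (H_1 h) u u\<^sub>0 \<and>
     weak_initial_value h (H_2 h) v v\<^sub>0 \<and>
     weak_initial_value h (H_3 h \<alpha>\<^sub>3) \<theta> \<theta>\<^sub>0 \<and>
     energy_inequality h T \<alpha>\<^sub>1 u (\<lambda>t p. - v t p + int_to_top (dx h (\<theta> t)) p) \<and>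
     energy_inequality h T \<alpha>\<^sub>2 v u \<and>
     energy_inequality h T \<alpha>\<^sub>3 \<theta> (\<lambda>t p. - Q p)"

section \<open>The regularity class\<close>

definition Linfx_L2z_norm :: "real \<Rightarrow> (real \<times> real \<Rightarrow> real) \<Rightarrow> ennreal" where
  "Linfx_L2z_norm h \<phi> = esssup (lebesgue_on {0<..<1})
     (\<lambda>x. ennreal (sqrt (LINT z|lebesgue_on {- h<..<0}. (\<phi> (x, z))\<^sup>2)))"

text \<open>As \<open>(0, 1)\<close> is bounded, membership in \<open>L2 (Dom h)\<close> is no restriction.\<close>
definition Linfx_L2z :: "real \<Rightarrow> (real \<times> real \<Rightarrow> real) set" where
  "Linfx_L2z h = {\<phi> \<in> L2 (Dom h). Linfx_L2z_norm h \<phi> < \<infinity>}"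

text \<open>
  \<open>L\<^sup>2(0, T; L\<^sup>\<infinity>\<^sub>x(L\<^sup>2\<^sub>z))\<close>. As usual for such mixed norm spaces, whose value space is not separable,
  measurability in time is not required in the norm of \<open>L\<^sup>\<infinity>\<^sub>x(L\<^sup>2\<^sub>z)\<close> but only in \<open>L\<^sup>2\<close>, so this
  space contains the Bochner space in the strict sense.
\<close>
definition L2_time_Linfx_L2z :: "real \<Rightarrow> real \<Rightarrow> (real \<Rightarrow> real \<times> real \<Rightarrow> real) set" where
  "L2_time_Linfx_L2z h T = {f. Bochner_measurable {0<..<T} (L2 (Dom h)) (L2_norm (Dom h)) f \<and>
     (AE t in lebesgue_on {0<..<T}. f t \<in> Linfx_L2z h) \<and>
     integrable (lebesgue_on {0<..<T}) (\<lambda>t. (enn2real (Linfx_L2z_norm h (f t)))\<^sup>2)}"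

definition regularity_class :: "real \<Rightarrow> real \<Rightarrow> (real \<Rightarrow> real \<times> real \<Rightarrow> real) set" where
  "regularity_class h T =
     Bochner_Lp 4 {0<..<T} (L2 (Dom h)) (L2_norm (Dom h)) \<union> L2_time_Linfx_L2z h T"

end

theory Submission
 imports Defs "HOL-Computational_Algebra.Polynomial"
begin

text \<open>
  The difference of the two solutions satisfies an energy inequality, which requires an identity for
  the inner products of \<open>f\<^sub>1(t)\<close> and \<open>f\<^sub>2(t)\<close> for each component \<open>f\<close>. Test functions are independent of
  time, so the increment over \<open>(s, t)\<close> is computed by testing the first equation with \<open>f\<^sub>2(t)\<close> and the
  second one with \<open>f\<^sub>1(s)\<close>. This gives integrals of forms evaluated at two different times, and the
  limit \<open>t - s \<rightarrow> 0\<close> is taken by continuity of translations in \<open>L\<^sup>1\<close>, for which the regularity of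
  \<open>\<partial>\<^sub>z f\<^sub>1\<close> provides the domination. In the resulting inequality the trilinear term contains only the
  derivatives of \<open>f\<^sub>1\<close>; anisotropic estimates bound it by a part of the dissipation plus an integrable
  function of time times the energy, and Gronwall's inequality concludes.
\<close>

text \<open>The obstacle is the transport term. For a mere weak solution it is bounded only by
  products of Sobolev norms, so nothing places f_t in the dual of L^2(0,T;V), and one solution
  cannot be inserted as a time-dependent test function into the equation of the other. The splitting
  <f1(t),f2(t)> - <f1(s),f2(s)> = <f1(t)-f1(s),f2(t)> + <f2(t)-f2(s),f1(s)> gets along with fixed
  test functions; antisymmetry of the transport form then moves the derivatives in the second term
  onto f1. Both alternatives of the regularity class are condensed into one number \<kappa>(t) with
  \<kappa>^4 integrable, which serves in the domination and again in Gronwall's inequality. At time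
  0, where the identity starts, strong continuity is extracted from the energy inequality. Sobolev
  functions on the rectangle are approached through cosine series: cosines are Neumann
  eigenfunctions, so the series converges in the full Sobolev norm whatever the boundary values are.
  Density of smooth functions, traces and the Poincare inequalities rest on this.\<close>

type_synonym field = "real \<times> real \<Rightarrow> real"

abbreviation seq_limit :: "(nat \<Rightarrow> 'a::topological_space) \<Rightarrow> 'a \<Rightarrow> bool" (infixr "---->" 60) where
 "X ----> L \<equiv> filterlim X (nhds L) sequentially"

abbreviation (input) lborel2 :: "(real \<times> real) measure" where
 "lborel2 \<equiv> lborel \<Otimes>\<^sub>M lborel"

abbreviation (input) px :: "field \<Rightarrow> field" where
 "px F p \<equiv> frechet_derivative F (at p) (1, 0)"

abbreviation (input) py :: "field \<Rightarrow> field" where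
 "py F p \<equiv> frechet_derivative F (at p) (0, 1)"

lemmas integrable_plus = Bochner_Integration.integrable_add
lemmas integrable_dominated = Bochner_Integration.integrable_bound
lemmas integral_plus = Bochner_Integration.integral_add

section \<open>Square integrable functions\<close>

lemma L2_measurable: "f \<in> L2 S ==> f \<in> borel_measurable (lebesgue_on S)" by (simp add: L2_def)

lemma L2_square_integrable: "f \<in> L2 S ==> integrable (lebesgue_on S) (%x. (f x)^2)" by (simp add: L2_def)

lemma L2_mult_integrable:
 assumes "f \<in> L2 S" "g \<in> L2 S"
 shows "integrable (lebesgue_on S) (%x. f x * g x)"
proof (rule integrable_dominated)
 show "integrable (lebesgue_on S) (%x. (f x)^2 + (g x)^2)"
  using assms by (intro integrable_plus) (auto simp: L2_def)
 show "(%x. f x * g x) \<in> borel_measurable (lebesgue_on S)"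
  using assms by (intro borel_measurable_times) (auto simp: L2_def)
 have "\<bar>a * b\<bar> <= a^2 + b^2" for a b :: real
  using sum_squares_bound[of "\<bar>a\<bar>" "\<bar>b\<bar>"] mult_nonneg_nonneg[of "\<bar>a\<bar>" "\<bar>b\<bar>"]
  unfolding abs_mult power2_abs by linarith
 then show "AE x in lebesgue_on S. norm (f x * g x) <= norm ((f x)^2 + (g x)^2)" by (auto simp: abs_mult)
qed

lemma L2_zero [simp]: "(%_. 0) \<in> L2 S" by (simp add: L2_def)

lemma L2_cmult: "f \<in> L2 S ==> (%x. c * f x) \<in> L2 S" by (auto simp: L2_def power_mult_distrib)

lemma L2_uminus: "f \<in> L2 S ==> (%x. - f x) \<in> L2 S" by (auto simp: L2_def)

lemma L2_add:
 assumes "f \<in> L2 S" "g \<in> L2 S"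
 shows "(%x. f x + g x) \<in> L2 S"
proof -
 have "integrable (lebesgue_on S) (%x. (f x)^2 + 2 * (f x * g x) + (g x)^2)"
  using assms L2_mult_integrable[OF assms] by (auto simp: L2_def)
 also have "(%x. (f x)^2 + 2 * (f x * g x) + (g x)^2) = (%x. (f x + g x)^2)"
  by (auto simp: power2_eq_square algebra_simps)
 finally show ?thesis using assms by (auto simp: L2_def)
qed

lemma L2_diff: "f \<in> L2 S ==> g \<in> L2 S ==> (%x. f x - g x) \<in> L2 S"
 using L2_add[of f S "%x. - g x"] L2_uminus[of g S] by simp

lemma L2_sum:
 assumes "!!i. i \<in> I ==> f i \<in> L2 S"
 shows "(%x. \<Sum>i\<in>I. f i x) \<in> L2 S"
 using assms by (induction I rule: infinite_finite_induct) (auto intro: L2_add)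

lemma L2_abs: "f \<in> L2 S ==> (%x. \<bar>f x\<bar>) \<in> L2 S" by (auto simp: L2_def)

lemma L2_bounded_mult:
 assumes "f \<in> L2 S" "g \<in> borel_measurable (lebesgue_on S)"
  and "AE x in lebesgue_on S. \<bar>g x\<bar> <= C"
 shows "(%x. g x * f x) \<in> L2 S"
proof -
 have "integrable (lebesgue_on S) (%x. (g x * f x)^2)"
 proof (rule integrable_dominated)
  show "integrable (lebesgue_on S) (%x. C^2 * (f x)^2)" using assms by (auto simp: L2_def)
  show "(%x. (g x * f x)^2) \<in> borel_measurable (lebesgue_on S)" using assms by (auto simp: L2_def)
  show "AE x in lebesgue_on S. norm ((g x * f x)^2) <= norm (C^2 * (f x)^2)" using assms(3)
  proof eventually_elim
   case (elim x)
   then have "(g x)^2 <= C^2" by (simp add: abs_le_square_iff[symmetric])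
   then show ?case by (simp add: power_mult_distrib mult_right_mono)
  qed
 qed
 then show ?thesis using assms by (auto simp: L2_def)
qed

text \<open>Completeness of Lebesgue measure gives this: the extension of \<open>f\<close> by zero
  agrees almost everywhere with a Borel function \<open>k\<close>, and whatever agrees almost
  everywhere with \<open>k\<close> is again Lebesgue measurable.\<close>

lemma AE_lebesgue_on_measurable:
 fixes f g :: "'a::euclidean_space => real"
 assumes "AE x in lebesgue_on S. f x = g x" "S \<in> sets lebesgue"
  and "f \<in> borel_measurable (lebesgue_on S)"
 shows "g \<in> borel_measurable (lebesgue_on S)"
proof -
 have "AE x in lebesgue. x \<in> S --> f x = g x"
  using assms by (subst (asm) AE_restrict_space_iff) (auto simp: Int_def)
 then have ae: "AE x in lebesgue. (if x \<in> S then f x else 0) = (if x \<in> S then g x else 0)"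
  by eventually_elim auto
 have "(%x. if x \<in> S then f x else 0) \<in> borel_measurable lebesgue"
  using assms by (simp add: borel_measurable_if_I)
 from completion_ex_borel_measurable_real[OF this] obtain k :: "'a => real"
  where k: "k \<in> borel_measurable lborel" "AE x in lborel. (if x \<in> S then f x else 0) = k x" by auto
 have "AE x in lebesgue. k x = (if x \<in> S then g x else 0)"
  using AE_completion[OF k(2)] ae by eventually_elim auto
 from borel_measurable_AE[OF measurable_completion[OF k(1)] this]
 have "(%x. if x \<in> S then g x else 0) \<in> borel_measurable lebesgue" .
 then show ?thesis using assms by (simp add: borel_measurable_if_D)
qed

text \<open>Measurability passes from one function to the other. If both fail to be measurable,
  neither is integrable and both integrals take the default value 0. This permits free passage
  between representatives.\<close>

lemma integral_lebesgue_on_cong_AE: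
 fixes f g :: "'a::euclidean_space => real"
 assumes "AE x in lebesgue_on S. f x = g x" "S \<in> sets lebesgue"
 shows "(LINT x|lebesgue_on S. f x) = (LINT x|lebesgue_on S. g x)"
  and "integrable (lebesgue_on S) f = integrable (lebesgue_on S) g"
proof -
 have sym: "AE x in lebesgue_on S. g x = f x" using assms(1) by eventually_elim simp
 have iff: "f \<in> borel_measurable (lebesgue_on S) \<longleftrightarrow> g \<in> borel_measurable (lebesgue_on S)"
  using AE_lebesgue_on_measurable[OF assms] AE_lebesgue_on_measurable[OF sym assms(2)] by blast
 show "integrable (lebesgue_on S) f = integrable (lebesgue_on S) g"
 proof (cases "f \<in> borel_measurable (lebesgue_on S)")
  case True
  then show ?thesis using iff assms(1) by (intro integrable_cong_AE) auto
 next
  case False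
  then show ?thesis using iff borel_measurable_integrable by blast
 qed
 show "(LINT x|lebesgue_on S. f x) = (LINT x|lebesgue_on S. g x)"
 proof (cases "f \<in> borel_measurable (lebesgue_on S)")
  case True
  then show ?thesis using iff assms(1) by (intro integral_cong_AE) auto
 next
  case False
  then show ?thesis using iff by (metis borel_measurable_integrable not_integrable_integral_eq)
 qed
qed

lemma L2_inner_cong_AE:
 assumes "AE x in lebesgue_on S. f x = f' x" "AE x in lebesgue_on S. g x = g' x" "S \<in> sets lebesgue"
 shows "L2_inner S f g = L2_inner S f' g'"
proof -
 have "AE x in lebesgue_on S. f x * g x = f' x * g' x" using assms(1,2) by eventually_elim simp
 from integral_lebesgue_on_cong_AE(1)[OF this assms(3)] show ?thesis by (simp add: L2_inner_def)
qed

lemma L2_norm_cong_AE: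
 assumes "AE x in lebesgue_on S. f x = g x" "S \<in> sets lebesgue"
 shows "L2_norm S f = L2_norm S g"
 unfolding L2_norm_def using L2_inner_cong_AE[OF assms(1) assms(1) assms(2)] by simp

lemma L2_inner_sym: "L2_inner S f g = L2_inner S g f" by (simp add: L2_inner_def mult.commute)

lemma L2_inner_add_left:
 "f \<in> L2 S ==> g \<in> L2 S ==> k \<in> L2 S ==> L2_inner S (%x. f x + g x) k = L2_inner S f k + L2_inner S g k"
 by (simp add: L2_inner_def algebra_simps L2_mult_integrable)

lemma L2_inner_diff_left:
 "f \<in> L2 S ==> g \<in> L2 S ==> k \<in> L2 S ==> L2_inner S (%x. f x - g x) k = L2_inner S f k - L2_inner S g k"
 by (simp add: L2_inner_def algebra_simps L2_mult_integrable)

lemma L2_inner_cmult_left: "L2_inner S (%x. c * f x) k = c * L2_inner S f k"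
 by (simp add: L2_inner_def mult.assoc)

lemma L2_inner_uminus_left: "L2_inner S (%x. - f x) k = - L2_inner S f k" by (simp add: L2_inner_def)

lemma L2_inner_add_right:
 "f \<in> L2 S ==> g \<in> L2 S ==> k \<in> L2 S ==> L2_inner S k (%x. f x + g x) = L2_inner S k f + L2_inner S k g"
 by (simp add: L2_inner_sym[of S k] L2_inner_add_left)

lemma L2_inner_diff_right:
 "f \<in> L2 S ==> g \<in> L2 S ==> k \<in> L2 S ==> L2_inner S k (%x. f x - g x) = L2_inner S k f - L2_inner S k g"
 by (simp add: L2_inner_sym[of S k] L2_inner_diff_left)

lemma L2_inner_cmult_right: "L2_inner S k (%x. c * f x) = c * L2_inner S k f"
 by (simp add: L2_inner_sym[of S k] L2_inner_cmult_left)

lemma L2_inner_sum_right: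
 assumes "!!i. i \<in> I ==> f i \<in> L2 S" "k \<in> L2 S"
 shows "L2_inner S k (%x. \<Sum>i\<in>I. f i x) = (\<Sum>i\<in>I. L2_inner S k (f i))" using assms(1)
proof (induction I rule: infinite_finite_induct)
 case (insert a I)
 then show ?case
  using L2_inner_add_right[of "f a" S "%x. \<Sum>i\<in>I. f i x" k] assms(2) L2_sum[of I f S] by auto
qed (auto simp: L2_inner_def)

lemma L2_inner_nonneg: "0 <= L2_inner S f f" by (simp add: L2_inner_def)

lemma L2_norm_nonneg [simp]: "0 <= L2_norm S f" by (simp add: L2_norm_def L2_inner_nonneg)

lemma L2_norm_square: "(L2_norm S f)^2 = L2_inner S f f" by (simp add: L2_norm_def L2_inner_nonneg)

lemma L2_norm_square_integral: "(L2_norm S f)^2 = (LINT x|lebesgue_on S. (f x)^2)"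
 unfolding L2_norm_square L2_inner_def by (simp add: power2_eq_square)

lemma L2_norm_zero [simp]: "L2_norm S (%_. 0) = 0" by (simp add: L2_norm_def L2_inner_def)

lemma L2_norm_cmult: "L2_norm S (%x. c * f x) = \<bar>c\<bar> * L2_norm S f"
 unfolding L2_norm_def L2_inner_cmult_left L2_inner_cmult_right mult.assoc[symmetric]
 by (simp add: real_sqrt_mult)

lemma L2_norm_uminus: "L2_norm S (%x. - f x) = L2_norm S f" by (simp add: L2_norm_def L2_inner_def)

lemma L2_norm_minus_commute: "L2_norm S (%x. f x - g x) = L2_norm S (%x. g x - f x)"
 using L2_norm_uminus[of S "%x. f x - g x"] by simp

lemma L2_norm_abs: "L2_norm S (%x. \<bar>f x\<bar>) = L2_norm S f" by (simp add: L2_norm_def L2_inner_def)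

text \<open>Elements of \<open>L2\<close> are representatives and \<open>L2_norm\<close> is only a
  seminorm on them, so the inequality is derived by hand from a nonnegative quadratic in
  \<open>t\<close>.\<close>

lemma L2_Cauchy_Schwarz_square:
 assumes "f \<in> L2 S" "g \<in> L2 S"
 shows "(L2_inner S f g)^2 <= L2_inner S f f * L2_inner S g g"
proof -
 define A B C where "A = L2_inner S f f" and "B = L2_inner S g g" and "C = L2_inner S f g"
 have q: "0 <= A - 2 * t * C + t^2 * B" for t
 proof -
  have tg: "(%x. t * g x) \<in> L2 S" by (rule L2_cmult[OF assms(2)])
  have "0 <= L2_inner S (%x. f x - t * g x) (%x. f x - t * g x)" by (rule L2_inner_nonneg)
  also have "... = A - 2 * t * C + t^2 * B" using assms tg L2_diff[OF assms(1) tg]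
   by (simp add: L2_inner_diff_left L2_inner_diff_right L2_inner_cmult_left L2_inner_cmult_right
     A_def B_def C_def L2_inner_sym[of S g f] power2_eq_square algebra_simps)
  finally show ?thesis .
 qed
 have "C^2 <= A * B"
 proof (cases "B = 0")
  case True
  have "C = 0"
  proof (rule ccontr)
   assume "C \<noteq> 0"
   \<comment> \<open>With \<open>B = 0\<close> the quadratic is affine in \<open>t\<close>, and at
     this \<open>t\<close> it has the value -1.\<close>
   then show False using q[of "(A + 1) / (2 * C)"] True by simp
  qed
  then show ?thesis using True by simp
 next
  case False
  then have "B > 0" using L2_inner_nonneg[of S g] by (simp add: B_def)
  then show ?thesis using q[of "C / B"] by (simp add: field_simps power2_eq_square)
 qed
 then show ?thesis by (simp add: A_def B_def C_def)
qed

lemma L2_Cauchy_Schwarz: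
 assumes "f \<in> L2 S" "g \<in> L2 S"
 shows "\<bar>L2_inner S f g\<bar> <= L2_norm S f * L2_norm S g"
 using real_sqrt_le_mono[OF L2_Cauchy_Schwarz_square[OF assms]] by (simp add: L2_norm_def real_sqrt_mult)

lemma L2_Cauchy_Schwarz_abs:
 assumes "f \<in> L2 S" "g \<in> L2 S"
 shows "(LINT x|lebesgue_on S. \<bar>f x * g x\<bar>) <= L2_norm S f * L2_norm S g"
 using L2_Cauchy_Schwarz[OF L2_abs[OF assms(1)] L2_abs[OF assms(2)]]
 by (simp add: L2_norm_abs L2_inner_def abs_mult)

lemma L2_triangle:
 assumes "f \<in> L2 S" "g \<in> L2 S"
 shows "L2_norm S (%x. f x + g x) <= L2_norm S f + L2_norm S g"
proof (rule power2_le_imp_le)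
 have "(L2_norm S (%x. f x + g x))^2 = (L2_norm S f)^2 + 2 * L2_inner S f g + (L2_norm S g)^2"
  using assms L2_add[OF assms]
  by (simp add: L2_norm_square L2_inner_add_left L2_inner_add_right L2_inner_sym[of S g f])
 also have "... <= (L2_norm S f + L2_norm S g)^2"
  using L2_Cauchy_Schwarz[OF assms] by (simp add: power2_eq_square algebra_simps)
 finally show "(L2_norm S (%x. f x + g x))^2 <= (L2_norm S f + L2_norm S g)^2" .
qed simp

lemma L2_triangle_diff:
 assumes "f \<in> L2 S" "g \<in> L2 S"
 shows "L2_norm S (%x. f x - g x) <= L2_norm S f + L2_norm S g"
 using L2_triangle[OF assms(1) L2_uminus[OF assms(2)]] by (simp add: L2_norm_uminus)

lemma L2_triangle_dist:
 assumes "f \<in> L2 S" "g \<in> L2 S" "k \<in> L2 S"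
 shows "L2_norm S (%x. f x - k x) <= L2_norm S (%x. f x - g x) + L2_norm S (%x. g x - k x)"
 using L2_triangle[OF L2_diff[OF assms(1,2)] L2_diff[OF assms(2,3)]] by simp

lemma L2_norm_diff_abs:
 assumes "f \<in> L2 S" "g \<in> L2 S"
 shows "\<bar>L2_norm S f - L2_norm S g\<bar> <= L2_norm S (%x. f x - g x)"
 using L2_triangle[OF L2_diff[OF assms] assms(2)] L2_triangle[OF L2_diff[OF assms(2,1)] assms(1)]
  L2_norm_minus_commute[of S f g] by simp

lemma L2_norm_tendsto:
 assumes "!!n. f n \<in> L2 S" "g \<in> L2 S" "(%n. L2_norm S (%x. f n x - g x)) ----> 0"
 shows "(%n. L2_norm S (f n)) ----> L2_norm S g"
proof (rule Lim_transform2[OF tendsto_const])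
 show "(%n. L2_norm S g - L2_norm S (f n)) ----> 0"
  using L2_norm_diff_abs[OF assms(2,1)] L2_norm_minus_commute[of S g]
  by (intro Lim_null_comparison[OF _ assms(3)]) (auto intro!: always_eventually)
qed

lemma L2_inner_tendsto:
 assumes "!!n. f n \<in> L2 S" "F \<in> L2 S" "(%n. L2_norm S (%x. f n x - F x)) ----> 0"
  and "!!n. g n \<in> L2 S" "G \<in> L2 S" "(%n. L2_norm S (%x. g n x - G x)) ----> 0"
 shows "(%n. L2_inner S (f n) (g n)) ----> L2_inner S F G"
proof -
 have b: "\<bar>L2_inner S (f n) (g n) - L2_inner S F G\<bar>
   <= L2_norm S (%x. f n x - F x) * L2_norm S (g n) + L2_norm S F * L2_norm S (%x. g n x - G x)" for n
 proof -
  have "L2_inner S (f n) (g n) - L2_inner S F G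
   = L2_inner S (%x. f n x - F x) (g n) + L2_inner S F (%x. g n x - G x)"
   using assms by (simp add: L2_inner_diff_left L2_inner_diff_right)
  then show ?thesis using L2_Cauchy_Schwarz[OF L2_diff[OF assms(1)[of n] assms(2)] assms(4)[of n]]
    L2_Cauchy_Schwarz[OF assms(2) L2_diff[OF assms(4)[of n] assms(5)]] by linarith
 qed
 have "(%n. L2_norm S (%x. f n x - F x) * L2_norm S (g n) + L2_norm S F * L2_norm S (%x. g n x - G x))
   ----> 0 * L2_norm S G + L2_norm S F * 0" by (intro tendsto_intros assms L2_norm_tendsto)
 then have "(%n. L2_inner S (f n) (g n) - L2_inner S F G) ----> 0"
  using b by (intro Lim_null_comparison[of "%n. L2_inner S (f n) (g n) - L2_inner S F G"])
   (auto intro!: always_eventually)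
 then show ?thesis by (simp add: LIM_zero_iff)
qed

lemma L2_norm_eq_0_AE:
 assumes "f \<in> L2 S" "L2_norm S f = 0"
 shows "AE x in lebesgue_on S. f x = 0"
proof -
 have "(LINT x|lebesgue_on S. (f x)^2) = 0" using assms(2) L2_norm_square_integral[of S f] by simp
 then have "AE x in lebesgue_on S. (f x)^2 = 0"
  using L2_square_integrable[OF assms(1)] by (subst (asm) integral_nonneg_eq_0_iff_AE) auto
 then show ?thesis by eventually_elim simp
qed

text \<open>The squares of the differences tend to 0 in L^1, which yields the subsequence.\<close>

lemma L2_tendsto_AE_subseq:
 assumes "!!n::nat. f n \<in> L2 S" "g \<in> L2 S" "(%n. L2_norm S (%x. f n x - g x)) ----> 0"
 obtains r where "strict_mono (r::nat => nat)" "AE x in lebesgue_on S. (%n. f (r n) x) ----> g x"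
proof -
 have i: "integrable (lebesgue_on S) (%x. (f n x - g x)^2)" for n
  using L2_square_integrable[OF L2_diff[OF assms(1,2)]] .
 have "(%n. (L2_norm S (%x. f n x - g x))^2) ----> 0^2" by (intro tendsto_intros assms)
 then have "(%n. LINT x|lebesgue_on S. norm ((f n x - g x)^2)) ----> 0" by (simp add: L2_norm_square_integral)
 from tendsto_L1_AE_subseq[OF i this] obtain r where r: "strict_mono (r::nat => nat)"
   "AE x in lebesgue_on S. (%n. (f (r n) x - g x)^2) ----> 0" by blast
 have "AE x in lebesgue_on S. (%n. f (r n) x) ----> g x" using r(2)
 proof eventually_elim
  case (elim x)
  then have "(%n. f (r n) x - g x) ----> 0"
   using tendsto_real_sqrt[OF elim] by (simp add: tendsto_rabs_zero_iff)
  then show ?case by (simp add: LIM_zero_iff)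
 qed
 with r(1) that show thesis by blast
qed

text \<open>Riesz-Fischer: along a subsequence with summable consecutive distances the absolute
  increments are summable at almost every point by monotone convergence. Fatou's lemma returns from
  the pointwise limit to the norm.\<close>

lemma L2_complete:
 assumes f: "!!n::nat. f n \<in> L2 S"
  and cauchy: "!!e. e > 0 ==> \<exists>N. \<forall>m\<ge>N. \<forall>n\<ge>N. L2_norm S (%x. f m x - f n x) < e"
 obtains g where "g \<in> L2 S" "(%n. L2_norm S (%x. f n x - g x)) ----> 0"
proof -
 have "\<exists>N. \<forall>m\<ge>N. \<forall>n\<ge>N. L2_norm S (%x. f m x - f n x) < (1/2)^k" for k
  by (rule cauchy) simp
 then obtain N where N: "!!k m n. m >= N k ==> n >= N k ==> L2_norm S (%x. f m x - f n x) < (1/2)^k" by metis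
 \<comment> \<open>The maximum makes \<open>r k\<close> admissible for every accuracy index
   \<open>j \<le> k\<close> at once; the summand \<open>k\<close> sends it to infinity.\<close>
 define r where "r k = Max (N ` {..k}) + k" for k
 have rN: "r k >= N j" if "j <= k" for j k
  using that Max_ge[of "N ` {..k}" "N j"] unfolding r_def by (simp add: trans_le_add1)
 have rk: "r k >= k" for k by (simp add: r_def)
 define d where "d k x = \<bar>f (r (Suc k)) x - f (r k) x\<bar>" for k x
 have d: "d k \<in> L2 S" for k unfolding d_def by (intro L2_abs L2_diff f)
 have dn: "L2_norm S (d k) <= (1/2)^k" for k using N[of k "r (Suc k)" "r k"] rN[of k "Suc k"] rN[of k k]
  unfolding d_def L2_norm_abs by simp
 have Dn: "L2_norm S (%x. \<Sum>k<K. d k x) <= 2" for K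
 proof -
  have "L2_norm S (%x. \<Sum>k<K. d k x) <= (\<Sum>k<K. (1/2)^k)"
  proof (induction K)
   case (Suc K)
   then show ?case using L2_triangle[OF L2_sum[of "{..<K}" d S] d[of K]] d dn[of K] by simp
  qed simp
  also have "... <= 2" by (simp add: sum_gp_strict)
  finally show ?thesis .
 qed
 define u where "u K x = ennreal ((\<Sum>k<K. d k x)^2)" for K x
 have um: "u K \<in> borel_measurable (lebesgue_on S)" for K
  unfolding u_def using L2_measurable[OF L2_sum[of "{..<K}" d S]] d by auto
 have uK: "(\<integral>\<^sup>+x. u K x \<partial>lebesgue_on S) <= 4" for K
 proof -
  have "(\<integral>\<^sup>+x. u K x \<partial>lebesgue_on S) = ennreal (LINT x|lebesgue_on S. (\<Sum>k<K. d k x)^2)"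
   unfolding u_def using L2_square_integrable[OF L2_sum[of "{..<K}" d S]] d
   by (intro nn_integral_eq_integral) auto
  also have "... = ennreal ((L2_norm S (%x. \<Sum>k<K. d k x))^2)" by (simp add: L2_norm_square_integral)
  also have "... <= ennreal (2^2)" by (intro ennreal_leI power_mono Dn) simp
  finally show ?thesis by simp
 qed
 have "incseq u" unfolding incseq_def le_fun_def u_def
 proof (intro allI impI ennreal_leI power_mono sum_mono2)
  show "0 <= (\<Sum>k<m. d k x)" for m x by (intro sum_nonneg) (simp add: d_def)
 qed (auto simp: d_def)
 then have "(\<integral>\<^sup>+x. (SUP K. u K x) \<partial>lebesgue_on S) = (SUP K. \<integral>\<^sup>+x. u K x \<partial>lebesgue_on S)"
  by (intro nn_integral_monotone_convergence_SUP um)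
 also have "... <= 4" by (intro SUP_least uK)
 finally have fin: "(\<integral>\<^sup>+x. (SUP K. u K x) \<partial>lebesgue_on S) \<noteq> \<infinity>"
  by (auto simp: top_unique)
 have "AE x in lebesgue_on S. (SUP K. u K x) \<noteq> \<infinity>"
  by (rule nn_integral_PInf_AE[OF _ fin]) (use um in measurable)
 then have conv: "AE x in lebesgue_on S. convergent (%k. f (r k) x)"
 proof eventually_elim
  case (elim x)
  then obtain B where B: "(SUP K. u K x) = ennreal B" "B >= 0" by (cases "SUP K. u K x") auto
  have "(\<Sum>k<K. d k x) <= sqrt B" for K
  proof -
   have "u K x <= ennreal B" unfolding B(1)[symmetric] by (intro SUP_upper) simp
   then have "(\<Sum>k<K. d k x)^2 <= B" using B(2) by (simp add: u_def ennreal_le_iff)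
   then show ?thesis by (simp add: real_le_rsqrt)
  qed
  from this[of "Suc _"] have "(\<Sum>k\<le>n. d k x) <= sqrt B" for n unfolding lessThan_Suc_atMost .
  then have "summable (%k. d k x)" by (intro bounded_imp_summable[where B="sqrt B"]) (auto simp: d_def)
  then have "summable (%k. f (r (Suc k)) x - f (r k) x)" unfolding d_def by (rule summable_rabs_cancel)
  then have "convergent (%n. \<Sum>k<n. f (r (Suc k)) x - f (r k) x)" by (simp add: summable_iff_convergent)
  then have "convergent (%n. f (r n) x - f (r 0) x)"
   by (simp only: sum_lessThan_telescope[of "%k. f (r k) x"])
  then show ?case
   using convergent_add[of "%n. f (r n) x - f (r 0) x" "%_. f (r 0) x"] by (simp add: convergent_const)
 qed
 define g where "g x = lim (%k. f (r k) x)" for x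
 have gm: "g \<in> borel_measurable (lebesgue_on S)" unfolding g_def using L2_measurable[OF f] by measurable
 have lim: "AE x in lebesgue_on S. (%k. f (r k) x) ----> g x"
  using conv unfolding g_def by eventually_elim (simp add: convergent_LIMSEQ_iff)
 \<comment> \<open>Fatou in the second index only: the bound holds for every
   \<open>m \<ge> N k\<close>, so the whole sequence converges and not just the subsequence.\<close>
 have fatou: "(\<integral>\<^sup>+x. ennreal ((f m x - g x)^2) \<partial>lebesgue_on S) <= ennreal (((1/2)^k)^2)" if "m >= N k" for k m
 proof -
  have "(\<integral>\<^sup>+x. ennreal ((f m x - g x)^2) \<partial>lebesgue_on S)
    = (\<integral>\<^sup>+x. liminf (%j. ennreal ((f m x - f (r j) x)^2)) \<partial>lebesgue_on S)"
  proof (intro nn_integral_cong_AE)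
   show "AE x in lebesgue_on S. ennreal ((f m x - g x)^2) = liminf (%j. ennreal ((f m x - f (r j) x)^2))"
    using lim
   proof eventually_elim
    case (elim x)
    then have "(%j. ennreal ((f m x - f (r j) x)^2)) ----> ennreal ((f m x - g x)^2)"
     by (intro tendsto_ennrealI tendsto_intros)
    from lim_imp_Liminf[OF _ this] show ?case by simp
   qed
  qed
  also have "... <= liminf (%j. \<integral>\<^sup>+x. ennreal ((f m x - f (r j) x)^2) \<partial>lebesgue_on S)"
   using L2_measurable[OF f] by (intro nn_integral_liminf) auto
  also have "... <= ennreal (((1/2)^k)^2)"
  proof (rule Liminf_le)
   show "\<forall>\<^sub>F j in sequentially. (\<integral>\<^sup>+x. ennreal ((f m x - f (r j) x)^2) \<partial>lebesgue_on S) <= ennreal (((1/2)^k)^2)"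
   proof (rule eventually_sequentiallyI[of k])
    fix j assume "k <= j"
    then have "L2_norm S (%x. f m x - f (r j) x) < (1/2)^k" using N[of k m "r j"] that rN[of k j] by simp
    then have "(L2_norm S (%x. f m x - f (r j) x))^2 <= ((1/2)^k)^2" by (intro power_mono) auto
    moreover have "(\<integral>\<^sup>+x. ennreal ((f m x - f (r j) x)^2) \<partial>lebesgue_on S)
      = ennreal ((L2_norm S (%x. f m x - f (r j) x))^2)" unfolding L2_norm_square_integral
     by (intro nn_integral_eq_integral L2_square_integrable L2_diff f) auto
    ultimately show "(\<integral>\<^sup>+x. ennreal ((f m x - f (r j) x)^2) \<partial>lebesgue_on S) <= ennreal (((1/2)^k)^2)"
     by (simp add: ennreal_leI)
   qed
  qed simp
  finally show ?thesis .
 qed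
 have diffL2: "(%x. f m x - g x) \<in> L2 S" if "m >= N k" for k m
 proof -
  have "integrable (lebesgue_on S) (%x. (f m x - g x)^2)" using fatou[OF that] L2_measurable[OF f] gm
   by (intro integrableI_nn_integral_finite[where x="enn2real (\<integral>\<^sup>+x. ennreal ((f m x - g x)^2) \<partial>lebesgue_on S)"])
    (auto intro!: ennreal_enn2real[symmetric] le_less_trans[OF fatou[OF that]])
  then show ?thesis using L2_measurable[OF f] gm by (auto simp: L2_def)
 qed
 have gL2: "g \<in> L2 S" using L2_diff[OF f[of "N 0"] diffL2[of 0 "N 0"]] by simp
 have bnd: "L2_norm S (%x. f m x - g x) <= (1/2)^k" if "m >= N k" for k m
 proof (rule power2_le_imp_le)
  have "ennreal ((L2_norm S (%x. f m x - g x))^2) = (\<integral>\<^sup>+x. ennreal ((f m x - g x)^2) \<partial>lebesgue_on S)"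
   unfolding L2_norm_square_integral
   by (intro nn_integral_eq_integral[symmetric] L2_square_integrable diffL2[OF that]) auto
  also note fatou[OF that]
  finally show "(L2_norm S (%x. f m x - g x))^2 <= ((1/2)^k)^2" by (simp add: ennreal_le_iff)
 qed simp
 have "(%n. L2_norm S (%x. f n x - g x)) ----> 0"
 proof (rule LIMSEQ_I)
  fix e :: real assume "e > 0"
  then obtain k where "(1/2)^k < e" using real_arch_pow_inv[of e "1/2"] by auto
  then show "\<exists>no. \<forall>n\<ge>no. norm (L2_norm S (%x. f n x - g x) - 0) < e"
   using bnd[of k] by (intro exI[of _ "N k"]) (auto intro: le_less_trans)
 qed
 with gL2 that show thesis by blast
qed

section \<open>Product sets\<close>

lemma lebesgue_Times_sets:
 assumes "A \<in> sets borel" "B \<in> sets (borel :: real measure)"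
 shows "(A :: real set) \<times> B \<in> sets borel" "A \<times> B \<in> sets lebesgue"
proof -
 show "A \<times> B \<in> sets borel" using assms by (simp add: borel_prod[symmetric])
 then show "A \<times> B \<in> sets lebesgue" by simp
qed

text \<open>Integrals under \<open>lebesgue_on S\<close> are carried over to Borel functions under
  \<open>lborel\<close>, where product measures and sections are well behaved. Vanishing outside
  \<open>S\<close> makes the two integrals equal.\<close>

lemma borel_representative:
 fixes f :: "'a::euclidean_space => real"
 assumes "S \<in> sets borel" "f \<in> borel_measurable (lebesgue_on S)"
 obtains g where "g \<in> borel_measurable borel" "AE x in lebesgue_on S. f x = g x" "!!x. x \<notin> S ==> g x = 0"
proof -
 have "(%x. if x \<in> S then f x else 0) \<in> borel_measurable lebesgue"
  using assms by (simp add: borel_measurable_if_I)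
 from completion_ex_borel_measurable_real[OF this] obtain k :: "'a => real"
  where k: "k \<in> borel_measurable lborel" "AE x in lborel. (if x \<in> S then f x else 0) = k x" by auto
 define g where "g x = (if x \<in> S then k x else 0)" for x
 have "g \<in> borel_measurable borel" unfolding g_def using k(1) assms(1) by auto
 moreover have "AE x in lebesgue_on S. f x = g x" using AE_completion[OF k(2)] assms(1)
  by (subst AE_restrict_space_iff) (auto simp: g_def elim!: eventually_mono)
 ultimately show thesis using that by (auto simp: g_def)
qed

lemma lebesgue_on_borel_integral:
 fixes g :: "'a::euclidean_space => real"
 assumes "S \<in> sets borel" "g \<in> borel_measurable borel" "!!x. x \<notin> S ==> g x = 0"
 shows "(LINT x|lebesgue_on S. g x) = (LINT x|lborel. g x)"
  and "integrable (lebesgue_on S) g \<longleftrightarrow> integrable lborel g"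
proof -
 have e: "(%x. indicator S x * g x) = g"
  by (rule ext) (use assms(3) in \<open>auto simp: indicator_def\<close>)
 show "(LINT x|lebesgue_on S. g x) = (LINT x|lborel. g x)"
  using assms by (subst integral_restrict_space) (auto simp: e integral_completion)
 show "integrable (lebesgue_on S) g \<longleftrightarrow> integrable lborel g"
  using assms by (subst integrable_restrict_space) (auto simp: e integrable_completion)
qed

lemma AE_lebesgue_on_iff_lborel:
 assumes "S \<in> sets borel"
 shows "(AE x in lebesgue_on S. P x) \<longleftrightarrow> (AE x in lborel. x \<in> S --> P x)"
 using assms by (subst AE_restrict_space_iff) (auto simp: AE_completion_iff)

lemma AE_lebesgue_on_sections:
 fixes A B :: "real set"
 assumes "A \<in> sets borel" "B \<in> sets borel" "AE p in lebesgue_on (A \<times> B). P p"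
 shows "AE x in lebesgue_on A. AE z in lebesgue_on B. P (x, z)"
  and "AE z in lebesgue_on B. AE x in lebesgue_on A. P (x, z)"
proof -
 have *: "AE p in lborel2. p \<in> A \<times> B --> P p"
  using assms(3) lebesgue_Times_sets[OF assms(1,2)] by (simp only: AE_lebesgue_on_iff_lborel lborel_prod)
 have "AE x in lborel. AE z in lborel. (x, z) \<in> A \<times> B --> P (x, z)"
  using lborel_pair.AE_pair[OF *] .
 then show "AE x in lebesgue_on A. AE z in lebesgue_on B. P (x, z)"
  using assms by (auto simp: AE_lebesgue_on_iff_lborel elim!: eventually_mono)
 \<comment> \<open>Exchanging the two almost-everywhere quantifiers requires a measurable predicate,
   so the exceptional set is first enlarged to a measurable null set.\<close>
 from * obtain N where N: "{p \<in> space lborel2. \<not> (p \<in> A \<times> B --> P p)} \<subseteq> N"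
   "N \<in> null_sets lborel2" by (auto elim!: AE_E simp: null_sets_def)
 have "AE x in lborel. AE z in lborel. (x, z) \<notin> N" by (rule lborel_pair.AE_pair[OF AE_not_in[OF N(2)]])
 moreover have "N \<in> sets lborel2" using N(2) by auto
 then have "{p \<in> space lborel2. (fst p, snd p) \<notin> N} \<in> sets lborel2"
  using sets.Diff[OF sets.top, of N "lborel2"] by (simp add: set_diff_eq)
 ultimately have "AE z in lborel. AE x in lborel. (x, z) \<notin> N"
  using lborel_pair.AE_commute[of "%x z. (x, z) \<notin> N"] by (simp add: case_prod_beta)
 then have "AE z in lborel. AE x in lborel. (x, z) \<in> A \<times> B --> P (x, z)"
  using N(1) by (auto simp: space_pair_measure elim!: eventually_mono)
 then show "AE z in lebesgue_on B. AE x in lebesgue_on A. P (x, z)"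
  using assms by (auto simp: AE_lebesgue_on_iff_lborel elim!: eventually_mono)
qed

section \<open>Smooth functions\<close>

lemma Ck_continuous: "Ck k f ==> continuous_on UNIV f"
proof (cases k)
 case (Suc j)
 assume "Ck k f"
 with Suc have "f differentiable_on UNIV" by (auto simp: differentiable_on_def)
 then show ?thesis by (rule differentiable_imp_continuous_on)
qed simp

lemma Ck_Suc_imp: "Ck (Suc k) f ==> Ck k f"
proof (induction k arbitrary: f)
 case 0
 show ?case using Ck_continuous[OF 0] by simp
next
 case (Suc k)
 then show ?case by (metis Ck.simps(2))
qed

lemma smooth_differentiable: "smooth f ==> f differentiable (at x)"
 unfolding smooth_def using Ck.simps(2) by blast

lemma smooth_frechet_derivative: "smooth f ==> smooth (%x. frechet_derivative f (at x) v)"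
 unfolding smooth_def using Ck.simps(2) by blast

lemma smooth_continuous: "smooth f ==> continuous_on S f"
 unfolding smooth_def using Ck_continuous continuous_on_subset by blast

lemma smooth_measurable: "smooth f ==> f \<in> borel_measurable borel"
 using smooth_continuous borel_measurable_continuous_onI by blast

lemma smooth_has_derivative: "smooth f ==> (f has_derivative frechet_derivative f (at x)) (at x)"
 using smooth_differentiable frechet_derivative_works by blast

text \<open>Induction on the order: differentiability of all members gives continuity, and
  derivatives stay in the class. Smoothness of a concrete function thus amounts to finding a class
  stable under differentiation.\<close>

lemma smooth_coinduct:
 assumes "P f" and "!!f x. P f ==> f differentiable (at x)"
  and "!!f v. P f ==> P (%x. frechet_derivative f (at x) v)"
 shows "smooth f"
proof -
 have "P g ==> Ck k g" for k g
 proof (induction k arbitrary: g)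
  case 0
  show ?case
  proof -
   have "g differentiable_on UNIV" using assms(2)[OF 0] by (auto simp: differentiable_on_def)
   from differentiable_imp_continuous_on[OF this] show ?thesis by simp
  qed
 next
  case (Suc k)
  then show ?case using assms by simp
 qed
 then show ?thesis using assms(1) by (simp add: smooth_def)
qed

lemma Ck_const: "Ck k (%_. c)"
proof (induction k arbitrary: c)
 case (Suc k)
 have "frechet_derivative (%_::'a. c) (at x) = (%_. 0)" for x :: 'a
  by (rule frechet_derivative_at[symmetric]) simp
 then show ?case using Suc by simp
qed simp

lemma Ck_add: "Ck k f ==> Ck k g ==> Ck k (%x. f x + g x)"
proof (induction k arbitrary: f g)
 case 0
 then show ?case by (auto intro: continuous_intros)
next
 case (Suc k)
 have "frechet_derivative (%x. f x + g x) (at x) =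
   (%v. frechet_derivative f (at x) v + frechet_derivative g (at x) v)" for x
  using Suc.prems by (intro frechet_derivative_at[symmetric] has_derivative_add)
   (auto simp: frechet_derivative_works[symmetric])
 then show ?case using Suc by auto
qed

lemma Ck_mult: "Ck k f ==> Ck k g ==> Ck k (%x. f x * g x)"
proof (induction k arbitrary: f g)
 case 0
 then show ?case by (auto intro: continuous_intros)
next
 case (Suc k)
 have d: "frechet_derivative (%x. f x * g x) (at x) =
   (%v. f x * frechet_derivative g (at x) v + frechet_derivative f (at x) v * g x)" for x
  using Suc.prems by (intro frechet_derivative_at[symmetric] has_derivative_mult)
   (auto simp: frechet_derivative_works[symmetric])
 have "Ck k (%x. f x * frechet_derivative g (at x) v + frechet_derivative f (at x) v * g x)" for v
  using Suc Ck_Suc_imp by (intro Ck_add Suc.IH) auto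
 then show ?case using Suc.prems unfolding Ck.simps d by auto
qed

lemma Ck_linear:
 assumes "bounded_linear L" "Ck k f"
 shows "Ck k (%x. f (L x))" using assms(2)
proof (induction k arbitrary: f)
 case 0
 then show ?case using continuous_on_compose2[of UNIV f UNIV L] linear_continuous_on[OF assms(1)] by auto
next
 case (Suc k)
 have hd: "((%x. f (L x)) has_derivative (%v. frechet_derivative f (at (L x)) (L v))) (at x)" for x
  using has_derivative_compose[OF bounded_linear_imp_has_derivative[OF assms(1)], of f
    "frechet_derivative f (at (L x))" x UNIV] Suc.prems by (simp add: frechet_derivative_works[symmetric])
 have d: "frechet_derivative (%x. f (L x)) (at x) = (%v. frechet_derivative f (at (L x)) (L v))" for x
  by (rule frechet_derivative_at[symmetric, OF hd])
 show ?case using Suc hd unfolding Ck.simps d by (auto simp: differentiable_def)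
qed

lemma Ck_translate:
 assumes "Ck k f"
 shows "Ck k (%x. f (c + x))" using assms
proof (induction k arbitrary: f)
 case 0
 have "continuous_on UNIV (%x. c + x)" by (intro continuous_intros)
 with 0 show ?case using continuous_on_compose2[of UNIV f UNIV "%x. c + x"] by auto
next
 case (Suc k)
 have hd: "((%x. f (c + x)) has_derivative (%v. frechet_derivative f (at (c + x)) v)) (at x)" for x
 proof -
  have "((%x. c + x) has_derivative (%v. 0 + v)) (at x)"
   by (intro has_derivative_add has_derivative_const has_derivative_ident)
  from has_derivative_compose[OF this, of f "frechet_derivative f (at (c + x))"] show ?thesis
   using Suc.prems by (simp add: frechet_derivative_works[symmetric])
 qed
 have d: "frechet_derivative (%x. f (c + x)) (at x) = (%v. frechet_derivative f (at (c + x)) v)" for x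
  by (rule frechet_derivative_at[symmetric, OF hd])
 show ?case using Suc hd unfolding Ck.simps d by (auto simp: differentiable_def)
qed

lemma Ck_inverse: 
 assumes "Ck k f" "!!x. f x \<noteq> 0"
 shows "Ck k (%x. inverse (f x))" using assms
proof (induction k arbitrary: f)
 case 0
 then show ?case by (auto intro!: continuous_intros)
next
 case (Suc k)
 have hd: "((%x. inverse (f x)) has_derivative
   (%v. - (inverse (f x) * frechet_derivative f (at x) v * inverse (f x)))) (at x)" for x
  using Suc.prems by (intro Deriv.has_derivative_inverse) (auto simp: frechet_derivative_works[symmetric])
 have d: "frechet_derivative (%x. inverse (f x)) (at x) =
   (%v. (-1) * (inverse (f x) * frechet_derivative f (at x) v * inverse (f x)))" for x
  using frechet_derivative_at[symmetric, OF hd] by simp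
 have i: "Ck k (%x. inverse (f x))" using Suc Ck_Suc_imp by blast
 have "Ck k (%x. (-1) * (inverse (f x) * frechet_derivative f (at x) v * inverse (f x)))" for v
  using Suc.prems by (intro Ck_mult Ck_const i) auto
 then show ?case using hd unfolding Ck.simps d by (auto simp: differentiable_def)
qed

lemma smooth_const [simp]: "smooth (%_. c)" by (simp add: smooth_def Ck_const)

lemma smooth_add: "smooth f ==> smooth g ==> smooth (%x. f x + g x)" by (simp add: smooth_def Ck_add)

lemma smooth_mult: "smooth f ==> smooth g ==> smooth (%x. f x * g x)" by (simp add: smooth_def Ck_mult)

lemma smooth_cmult: "smooth f ==> smooth (%x. c * f x)" by (simp add: smooth_mult)

lemma smooth_sum: "(!!i. i \<in> I ==> smooth (f i)) ==> smooth (%x. \<Sum>i\<in>I. f i x)"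
 by (induction I rule: infinite_finite_induct) (auto intro: smooth_add)

lemma smooth_linear: "bounded_linear L ==> smooth f ==> smooth (%x. f (L x))"
 by (simp add: smooth_def Ck_linear)

lemma smooth_inverse: "smooth f ==> (!!x. f x \<noteq> 0) ==> smooth (%x. inverse (f x))"
 by (simp add: smooth_def Ck_inverse)

lemma smooth_affine:
 fixes f :: "real => real"
 assumes "smooth f"
 shows "smooth (%x. f (c + a * x))"
proof -
 have "smooth (%x. f (c + x))" using assms by (simp add: smooth_def Ck_translate)
 from smooth_linear[OF bounded_linear_mult_right[of a] this] show ?thesis .
qed

lemma frechet_derivative_real:
 fixes f :: "real => real"
 assumes "(f has_real_derivative d) (at x)"
 shows "frechet_derivative f (at x) v = d * v"
proof -
 have "(*) d = frechet_derivative f (at x)"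
  using assms unfolding has_field_derivative_def by (rule frechet_derivative_at)
 then show ?thesis by metis
qed

lemma smooth_deriv:
 fixes f :: "real => real"
 assumes "smooth f"
 shows "(f has_real_derivative deriv f x) (at x)" "smooth (deriv f)"
proof -
 have *: "(f has_real_derivative deriv f x) (at x)" for x
  using smooth_differentiable[OF assms] DERIV_deriv_iff_real_differentiable by blast
 then show "(f has_real_derivative deriv f x) (at x)" .
 have "deriv f = (%x. frechet_derivative f (at x) 1)" using frechet_derivative_real[OF *] by auto
 then show "smooth (deriv f)" using smooth_frechet_derivative[OF assms] by simp
qed

text \<open>The Frechet derivative in direction \<open>v\<close> is \<open>v\<close> times the
  ordinary derivative, so the class is closed under constant multiples before
  \<open>smooth_coinduct\<close> is applied.\<close>

lemma smooth_real_coinduct: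
 fixes f :: "real => real"
 assumes "P f" and step: "!!f. P f ==> \<exists>f'. P f' & (\<forall>x. (f has_real_derivative f' x) (at x))"
 shows "smooth f"
proof (rule smooth_coinduct[where P="%f. \<exists>c g. P g & f = (%x. c * g x)"])
 show "\<exists>c g. P g & f = (%x. c * g x)" using assms(1) by (intro exI[of _ 1] exI[of _ f]) auto
next
 fix f :: "real => real" and x
 assume "\<exists>c g. P g & f = (%x. c * g x)"
 then obtain c g where "P g" and f: "f = (%x. c * g x)" by auto
 with step obtain g' where "(g has_real_derivative g' x) (at x)" by blast
 from DERIV_cmult[OF this, of c] show "f differentiable (at x)"
  unfolding f using real_differentiable_def by blast
next
 fix f :: "real => real" and v
 assume "\<exists>c g. P g & f = (%x. c * g x)"
 then obtain c g where "P g" and f: "f = (%x. c * g x)" by auto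
 with step obtain g' where g': "P g'" "!!x. (g has_real_derivative g' x) (at x)" by blast
 have "frechet_derivative f (at x) v = (v * c) * g' x" for x
  using frechet_derivative_real[OF DERIV_cmult[OF g'(2), of c]] unfolding f by simp
 then show "\<exists>c g. P g & (%x. frechet_derivative f (at x) v) = (%x. c * g x)" using g'(1) by blast
qed

section \<open>Concrete smooth functions: trigonometric functions, steps and plateaus\<close>

lemma smooth_trig: "smooth (%x::real. a * sin (c * x) + b * cos (c * x))"
proof (rule smooth_real_coinduct[where P="%f. \<exists>a b. f = (%x. a * sin (c * x) + b * cos (c * x))"])
 fix f :: "real => real" assume "\<exists>a b. f = (%x. a * sin (c * x) + b * cos (c * x))"
 then obtain a b where f: "f = (%x. a * sin (c * x) + b * cos (c * x))" by blast
 have "(f has_real_derivative (- b * c) * sin (c * x) + (a * c) * cos (c * x)) (at x)" for x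
  unfolding f by (auto intro!: derivative_eq_intros)
 then show "\<exists>f'. (\<exists>a b. f' = (%x. a * sin (c * x) + b * cos (c * x))) &
   (\<forall>x. (f has_real_derivative f' x) (at x))"
  by (intro exI[of _ "%x. (- b * c) * sin (c * x) + (a * c) * cos (c * x)"]) blast
qed blast

lemma smooth_cos: "smooth (%x::real. cos (c * x))" using smooth_trig[of 0 c 1] by simp

lemma poly_mult_exp_minus_tendsto_0:
 fixes p :: "real poly"
 shows "((%y. poly p y * exp (- y)) \<longlongrightarrow> 0) at_top"
proof -
 have "((%y. \<Sum>i\<le>degree p. coeff p i * (y ^ i / exp y)) \<longlongrightarrow> (\<Sum>i\<le>degree p. coeff p i * 0)) at_top"
  by (intro tendsto_intros tendsto_power_div_exp_0)
 then show ?thesis by (simp add: poly_altdef exp_minus divide_inverse sum_distrib_right mult.assoc)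
qed

text \<open>The functions p(1/x) exp(-1/x), extended by 0 to x \<le> 0, form a class stable under
  differentiation.\<close>

lemma smooth_poly_exp:
 "smooth (%x::real. if x > 0 then poly p (1 / x) * exp (- (1 / x)) else 0)"
proof (rule smooth_real_coinduct[where
   P="%f. \<exists>p. f = (%x::real. if x > 0 then poly p (1 / x) * exp (- (1 / x)) else 0)"])
 fix f :: "real => real"
 assume "\<exists>p. f = (%x::real. if x > 0 then poly p (1 / x) * exp (- (1 / x)) else 0)"
 then obtain p where f: "f = (%x::real. if x > 0 then poly p (1 / x) * exp (- (1 / x)) else 0)" by blast
 \<comment> \<open>With y = 1/x the derivative d/dx is -y^2 d/dy, and d/dy of p(y) exp(-y) is (p' -
   p)(y) exp(-y).\<close>
 define q where "q = [:0, 0, 1:] * (p - pderiv p)"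
 have q: "poly q y = y^2 * (poly p y - poly (pderiv p) y)" for y by (simp add: q_def power2_eq_square)
 have "(f has_real_derivative (if x > 0 then poly q (1 / x) * exp (- (1 / x)) else 0)) (at x)" for x
 proof (cases x "0::real" rule: linorder_cases)
  case greater
  have "((%x. poly p (1 / x) * exp (- (1 / x))) has_real_derivative poly q (1 / x) * exp (- (1 / x))) (at x)"
   using greater by (auto intro!: derivative_eq_intros simp: q field_simps power2_eq_square)
  then show ?thesis
   using greater by (subst DERIV_cong_ev[OF refl _ refl, where g="%x. poly p (1 / x) * exp (- (1 / x))"])
    (auto simp: f intro: eventually_mono[OF eventually_gt_at_top] order_tendstoD(1)[OF tendsto_ident_at]
     intro!: eventually_nhds_in_open[of "{0<..}", THEN eventually_mono])
 next
  case less
  have "((%x. 0) has_real_derivative 0) (at x)" by simp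
  then show ?thesis using less by (subst DERIV_cong_ev[OF refl _ refl, where g="%x. 0"])
    (auto simp: f intro!: eventually_nhds_in_open[of "{..<0}", THEN eventually_mono])
 next
  case equal
  \<comment> \<open>From the right the difference quotient at 0 is y p(y) exp(-y) with y = 1/h, and
    y tends to infinity.\<close>
  have r: "((%h. f h / h) \<longlongrightarrow> 0) (at_right 0)"
  proof -
   have "((%h::real. poly (pCons 0 p) (1 / h) * exp (- (1 / h))) \<longlongrightarrow> 0) (at_right 0)"
    using filterlim_compose[OF poly_mult_exp_minus_tendsto_0[of "pCons 0 p"] filterlim_inverse_at_top_right]
    by (simp add: inverse_eq_divide)
   then show ?thesis by (rule Lim_transform_eventually)
     (auto simp: f eventually_at_filter)
  qed
  have l: "((%h. f h / h) \<longlongrightarrow> 0) (at_left 0)"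
   by (rule Lim_transform_eventually[OF tendsto_const]) (auto simp: f eventually_at_filter)
  have "((%h. f h / h) \<longlongrightarrow> 0) (at 0)" using l r by (rule filterlim_split_at_real)
  then show ?thesis using equal by (simp add: DERIV_def f cong: if_cong)
 qed
 then show "\<exists>f'. (\<exists>p. f' = (%x::real. if x > 0 then poly p (1 / x) * exp (- (1 / x)) else 0)) &
   (\<forall>x. (f has_real_derivative f' x) (at x))"
  by (intro exI[of _ "%x. if x > 0 then poly q (1 / x) * exp (- (1 / x)) else 0"]) blast
qed blast

definition flat_exp :: "real => real" where
 "flat_exp x = (if x > 0 then exp (- (1 / x)) else 0)"

text \<open>The denominator is positive because x and 1 - x are never both nonpositive.\<close>

definition smooth_step :: "real => real" where
 "smooth_step x = flat_exp x * inverse (flat_exp x + flat_exp (1 - x))"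

lemma smooth_smooth_step: "smooth smooth_step"
proof -
 have *: "smooth flat_exp" using smooth_poly_exp[of 1] by (simp add: flat_exp_def[abs_def] cong: if_cong)
 have "flat_exp x + flat_exp (1 - x) \<noteq> 0" for x
  by (auto simp: flat_exp_def add_pos_pos order.strict_implies_not_eq[symmetric])
 then have "smooth (%x. flat_exp x * inverse (flat_exp x + flat_exp (1 - x)))"
  using smooth_affine[OF *, of 1 "-1"] by (intro smooth_mult smooth_inverse smooth_add *) auto
 then show ?thesis by (simp add: smooth_step_def[abs_def])
qed

lemma smooth_step_left: "x <= 0 ==> smooth_step x = 0" by (simp add: smooth_step_def flat_exp_def)

lemma smooth_step_right: "x >= 1 ==> smooth_step x = 1" by (simp add: smooth_step_def flat_exp_def)

lemma smooth_step_bounds: "0 <= smooth_step x" "smooth_step x <= 1"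
proof -
 have *: "flat_exp x >= 0" "flat_exp (1 - x) >= 0" "flat_exp x + flat_exp (1 - x) > 0"
  by (auto simp: flat_exp_def add_pos_pos)
 then show "0 <= smooth_step x" by (simp add: smooth_step_def)
 show "smooth_step x <= 1"
  using * unfolding smooth_step_def divide_inverse[symmetric] by (subst divide_le_eq_1_pos) auto
qed

lemma smooth_step_deriv_eq_0:
 assumes "x < 0 \<or> x > 1"
 shows "deriv smooth_step x = 0"
proof -
 have "eventually (%y. smooth_step y = (if x < 0 then 0 else 1)) (nhds x)" using assms
 proof
  assume "x < 0"
  then show ?thesis
   by (intro eventually_nhds_in_open[of "{..<0}", THEN eventually_mono]) (auto simp: smooth_step_left)
 next
  assume "x > 1"
  then show ?thesis
   by (intro eventually_nhds_in_open[of "{1<..}", THEN eventually_mono]) (auto simp: smooth_step_right)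
 qed
 from deriv_cong_ev[OF this refl] show ?thesis by simp
qed

lemma smooth_step_deriv_bounded:
 obtains M where "M > 0" "!!x. \<bar>deriv smooth_step x\<bar> <= M"
proof -
 have "compact (deriv smooth_step ` {0..1})"
  using smooth_continuous[OF smooth_deriv(2)[OF smooth_smooth_step]] by (intro compact_continuous_image) auto
 from compact_imp_bounded[OF this]
 obtain B where B: "!!y. y \<in> deriv smooth_step ` {0..1} ==> norm y <= B" unfolding bounded_iff by blast
 have "\<bar>deriv smooth_step x\<bar> <= \<bar>B\<bar> + 1" for x
 proof (cases "0 <= x & x <= 1")
  case True
  then show ?thesis using B[of "deriv smooth_step x"] by auto
 next
  case False
  then show ?thesis using smooth_step_deriv_eq_0[of x] by auto
 qed
 then show thesis by (intro that[of "\<bar>B\<bar> + 1"]) auto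
qed

text \<open>Approximates the indicator of the open interval from inside: it vanishes outside the
  interval for every \<open>n\<close>, and its two ramps have width 1/n. The same family supplies
  test functions in space and in time.\<close>

definition plateau :: "nat => real => real => real => real" where
 "plateau n a b x = smooth_step (real n * (x - a)) * smooth_step (real n * (b - x))"

lemma smooth_plateau: "smooth (plateau n a b)"
proof -
 have "smooth (%x. smooth_step (- (real n * a) + real n * x) * smooth_step (real n * b + (- real n) * x))"
  by (intro smooth_mult smooth_affine smooth_smooth_step)
 then show ?thesis by (simp add: plateau_def[abs_def] algebra_simps)
qed

lemma plateau_bounds: "0 <= plateau n a b x" "plateau n a b x <= 1"
 unfolding plateau_def using smooth_step_bounds by (auto intro: mult_le_one)

lemma plateau_abs: "\<bar>plateau n a b x\<bar> <= 1" using plateau_bounds[of n a b x] by auto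

lemma plateau_outside: "x <= a \<or> b <= x ==> plateau n a b x = 0"
 unfolding plateau_def by (auto simp: smooth_step_left mult_nonneg_nonpos)

lemma plateau_inside: "1 <= real n * (x - a) ==> 1 <= real n * (b - x) ==> plateau n a b x = 1"
 unfolding plateau_def by (simp add: smooth_step_right)

lemma eventually_ge_real_mult:
 assumes "c > 0"
 shows "eventually (%n. B <= real n * c) sequentially"
proof -
 obtain N :: nat where "B / c < real N" using reals_Archimedean2 by blast
 then show ?thesis using assms by (intro eventually_sequentiallyI[of N])
   (metis divide_less_eq less_le_trans mult_right_mono of_nat_mono order.strict_implies_order)
qed

lemma plateau_tendsto: "(%n. plateau n a b x) ----> indicator {a<..<b} x"
proof (cases "x \<in> {a<..<b}")
 case True
 then have "eventually (%n. plateau n a b x = 1) sequentially"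
  using eventually_ge_real_mult[of "x - a" 1] eventually_ge_real_mult[of "b - x" 1]
  by (auto elim: eventually_elim2 intro: plateau_inside)
 then show ?thesis using True by (simp add: tendsto_eventually)
next
 case False
 then show ?thesis by (auto simp: plateau_outside)
qed

lemma plateau_has_derivative:
 "(plateau n a b has_real_derivative
  real n * deriv smooth_step (real n * (x - a)) * smooth_step (real n * (b - x))
  - real n * smooth_step (real n * (x - a)) * deriv smooth_step (real n * (b - x))) (at x)"
 unfolding plateau_def[abs_def]
 by (auto intro!: derivative_eq_intros DERIV_chain2[OF smooth_deriv(1)[OF smooth_smooth_step]])

section \<open>Integration over products of intervals\<close>

text \<open>The set where \<open>a\<close> differs from its Borel representative lies in a null set
  of the line, and the cylinder over a null set is null in the plane.\<close>

lemma lebesgue_on_measurable_fst: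
 fixes A B :: "real set" and a :: "real => real"
 assumes "A \<in> sets borel" "B \<in> sets borel" "a \<in> borel_measurable (lebesgue_on A)"
 shows "(%p. a (fst p)) \<in> borel_measurable (lebesgue_on (A \<times> B))"
proof -
 obtain a' where a': "a' \<in> borel_measurable borel" "AE x in lebesgue_on A. a x = a' x"
  using borel_representative[OF assms(1,3)] by blast
 have "AE x in lborel. x \<in> A --> a x = a' x" using a'(2) assms(1) by (simp add: AE_lebesgue_on_iff_lborel)
 then obtain N where N: "N \<in> null_sets lborel" "{x. \<not> (x \<in> A --> a x = a' x)} \<subseteq> N"
  by (auto elim!: AE_E simp: null_sets_def)
 have "N \<times> UNIV \<in> null_sets (lborel \<Otimes>\<^sub>M (lborel :: real measure))"
  using N(1) by (intro null_setsI) (auto simp: null_sets_def lborel.emeasure_pair_measure_Times)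
 then have "AE p in lborel. p \<notin> N \<times> (UNIV :: real set)"
  unfolding lborel_prod by (rule AE_not_in)
 then have ae: "AE p in lebesgue_on (A \<times> B). a' (fst p) = a (fst p)"
  unfolding AE_lebesgue_on_iff_lborel[OF lebesgue_Times_sets(1)[OF assms(1,2)]]
  by (rule eventually_mono) (use N(2) in auto)
 have "(%p. a' (fst p)) \<in> borel_measurable (borel :: (real \<times> real) measure)"
  using a'(1) by (intro measurable_compose[of fst, OF _ a'(1)]) (simp add: borel_prod[symmetric])
 then have "(%p. a' (fst p)) \<in> borel_measurable (lebesgue_on (A \<times> B))"
  by (intro measurable_restrict_space1 measurable_completion) simp
 from AE_lebesgue_on_measurable[OF ae lebesgue_Times_sets(2)[OF assms(1,2)] this] show ?thesis .
qed

lemma lebesgue_on_measurable_snd: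
 fixes A B :: "real set" and b :: "real => real"
 assumes "A \<in> sets borel" "B \<in> sets borel" "b \<in> borel_measurable (lebesgue_on B)"
 shows "(%p. b (snd p)) \<in> borel_measurable (lebesgue_on (A \<times> B))"
proof -
 obtain b' where b': "b' \<in> borel_measurable borel" "AE x in lebesgue_on B. b x = b' x"
  using borel_representative[OF assms(2,3)] by blast
 have "AE x in lborel. x \<in> B --> b x = b' x" using b'(2) assms(2) by (simp add: AE_lebesgue_on_iff_lborel)
 then obtain N where N: "N \<in> null_sets lborel" "{x. \<not> (x \<in> B --> b x = b' x)} \<subseteq> N"
  by (auto elim!: AE_E simp: null_sets_def)
 have "UNIV \<times> N \<in> null_sets ((lborel :: real measure) \<Otimes>\<^sub>M lborel)"
  using N(1) by (intro null_setsI) (auto simp: null_sets_def lborel.emeasure_pair_measure_Times)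
 then have "AE p in lborel. p \<notin> (UNIV :: real set) \<times> N"
  unfolding lborel_prod by (rule AE_not_in)
 then have ae: "AE p in lebesgue_on (A \<times> B). b' (snd p) = b (snd p)"
  unfolding AE_lebesgue_on_iff_lborel[OF lebesgue_Times_sets(1)[OF assms(1,2)]]
  by (rule eventually_mono) (use N(2) in auto)
 have "(%p. b' (snd p)) \<in> borel_measurable (borel :: (real \<times> real) measure)"
  using b'(1) by (intro measurable_compose[of snd, OF _ b'(1)]) (simp add: borel_prod[symmetric])
 then have "(%p. b' (snd p)) \<in> borel_measurable (lebesgue_on (A \<times> B))"
  by (intro measurable_restrict_space1 measurable_completion) simp
 from AE_lebesgue_on_measurable[OF ae lebesgue_Times_sets(2)[OF assms(1,2)] this] show ?thesis .
qed

text \<open>All six statements hold for a Borel representative \<open>g\<close> by the theorems on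
  product measures. Almost every section of \<open>f\<close> agrees almost everywhere with the
  section of \<open>g\<close>, which transfers them to \<open>f\<close>.\<close>

lemma Fubini_Times:
 fixes A B :: "real set" and f :: "field"
 assumes AB: "A \<in> sets borel" "B \<in> sets borel" and f: "integrable (lebesgue_on (A \<times> B)) f"
 shows "AE x in lebesgue_on A. integrable (lebesgue_on B) (%z. f (x, z))"
  and "integrable (lebesgue_on A) (%x. LINT z|lebesgue_on B. f (x, z))"
  and "(LINT p|lebesgue_on (A \<times> B). f p) = (LINT x|lebesgue_on A. LINT z|lebesgue_on B. f (x, z))"
  and "AE z in lebesgue_on B. integrable (lebesgue_on A) (%x. f (x, z))"
  and "integrable (lebesgue_on B) (%z. LINT x|lebesgue_on A. f (x, z))"
  and "(LINT p|lebesgue_on (A \<times> B). f p) = (LINT z|lebesgue_on B. LINT x|lebesgue_on A. f (x, z))"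
proof -
 note T = lebesgue_Times_sets[OF AB]
 obtain g where g: "g \<in> borel_measurable borel" "AE p in lebesgue_on (A \<times> B). f p = g p"
   "!!p. p \<notin> A \<times> B ==> g p = 0"
  using borel_representative[OF T(1) borel_measurable_integrable[OF f]] by blast
 have gi: "integrable lborel2 g"
  using integral_lebesgue_on_cong_AE(2)[OF g(2) T(2)] f lebesgue_on_borel_integral(2)[OF T(1) g(1)] g(3)
  by (simp add: lborel_prod)
 then have gi': "integrable lborel2 (%(x, z). g (x, z))" by (simp add: case_prod_beta)
 have gb: "g \<in> borel_measurable (borel \<Otimes>\<^sub>M borel)" using g(1) by (simp add: borel_prod)
 have s1: "(%z. g (x, z)) \<in> borel_measurable borel" for x using gb by measurable
 have s2: "(%x. g (x, z)) \<in> borel_measurable borel" for z using gb by measurable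
 have z1: "(LINT z|lebesgue_on B. g (x, z)) = (LINT z|lborel. g (x, z))"
  "integrable (lebesgue_on B) (%z. g (x, z)) = integrable lborel (%z. g (x, z))" for x
  using lebesgue_on_borel_integral[OF AB(2) s1[of x]] g(3) by auto
 have z2: "(LINT x|lebesgue_on A. g (x, z)) = (LINT x|lborel. g (x, z))"
  "integrable (lebesgue_on A) (%x. g (x, z)) = integrable lborel (%x. g (x, z))" for z
  using lebesgue_on_borel_integral[OF AB(1) s2[of z]] g(3) by auto
 have m1: "(%x. LINT z|lborel. g (x, z)) \<in> borel_measurable borel"
  using gb by (intro lborel.borel_measurable_lebesgue_integral) (simp add: case_prod_beta)
 have m2: "(%z. LINT x|lborel. g (x, z)) \<in> borel_measurable borel"
  using measurable_pair_swap[OF gb] by (intro lborel.borel_measurable_lebesgue_integral) (simp add: case_prod_beta)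
 have o1: "(LINT z|lborel. g (x, z)) = 0" if "x \<notin> A" for x using g(3) that by simp
 have o2: "(LINT x|lborel. g (x, z)) = 0" if "z \<notin> B" for z using g(3) that by simp
 have sec: "AE x in lebesgue_on A. AE z in lebesgue_on B. f (x, z) = g (x, z)"
  "AE z in lebesgue_on B. AE x in lebesgue_on A. f (x, z) = g (x, z)"
  using AE_lebesgue_on_sections[OF AB g(2)] by auto
 have Bl: "B \<in> sets lebesgue" "A \<in> sets lebesgue" using AB by auto
 have i1: "AE x in lebesgue_on A. (LINT z|lebesgue_on B. f (x, z)) = (LINT z|lborel. g (x, z))"
  using sec(1) by (rule eventually_mono) (simp add: integral_lebesgue_on_cong_AE(1)[OF _ Bl(1)] z1)
 have i2: "AE z in lebesgue_on B. (LINT x|lebesgue_on A. f (x, z)) = (LINT x|lborel. g (x, z))"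
  using sec(2) by (rule eventually_mono) (simp add: integral_lebesgue_on_cong_AE(1)[OF _ Bl(2)] z2)
 have "AE x in lborel. integrable lborel (%z. g (x, z))" using lborel_pair.AE_integrable_fst'[OF gi] .
 then have "AE x in lebesgue_on A. integrable (lebesgue_on B) (%z. g (x, z))"
  unfolding AE_lebesgue_on_iff_lborel[OF AB(1)] z1 by (rule eventually_mono) simp
 then show "AE x in lebesgue_on A. integrable (lebesgue_on B) (%z. f (x, z))"
  using sec(1) by eventually_elim (simp add: integral_lebesgue_on_cong_AE(2)[OF _ Bl(1)])
 have "AE z in lborel. integrable lborel (%x. g (x, z))"
  using lborel_pair.AE_integrable_fst'[OF lborel_pair.integrable_product_swap[OF gi]] by simp
 then have "AE z in lebesgue_on B. integrable (lebesgue_on A) (%x. g (x, z))"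
  unfolding AE_lebesgue_on_iff_lborel[OF AB(2)] z2 by (rule eventually_mono) simp
 then show "AE z in lebesgue_on B. integrable (lebesgue_on A) (%x. f (x, z))"
  using sec(2) by eventually_elim (simp add: integral_lebesgue_on_cong_AE(2)[OF _ Bl(2)])
 have "integrable lborel (%x. LINT z|lborel. g (x, z))" using lborel_pair.integrable_fst'[OF gi] by simp
 then show "integrable (lebesgue_on A) (%x. LINT z|lebesgue_on B. f (x, z))"
  unfolding integral_lebesgue_on_cong_AE(2)[OF i1 Bl(2)]
  using lebesgue_on_borel_integral(2)[OF AB(1) m1 o1] by simp
 have "integrable lborel (%z. LINT x|lborel. g (x, z))"
  using lborel_pair.integrable_fst'[OF lborel_pair.integrable_product_swap[OF gi]] by simp
 then show "integrable (lebesgue_on B) (%z. LINT x|lebesgue_on A. f (x, z))"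
  unfolding integral_lebesgue_on_cong_AE(2)[OF i2 Bl(1)]
  using lebesgue_on_borel_integral(2)[OF AB(2) m2 o2] by simp
 have e: "(LINT p|lebesgue_on (A \<times> B). f p) = (LINT p|lborel2. g p)"
  unfolding integral_lebesgue_on_cong_AE(1)[OF g(2) T(2)] lborel_prod
  using lebesgue_on_borel_integral(1)[OF T(1) g(1,3)] by simp
 also have "... = (LINT x|lborel. LINT z|lborel. g (x, z))" using lborel_pair.integral_fst'[OF gi] by simp
 also have "... = (LINT x|lebesgue_on A. LINT z|lebesgue_on B. f (x, z))"
  unfolding integral_lebesgue_on_cong_AE(1)[OF i1 Bl(2)]
  using lebesgue_on_borel_integral(1)[OF AB(1) m1 o1] by simp
 finally show "(LINT p|lebesgue_on (A \<times> B). f p) = (LINT x|lebesgue_on A. LINT z|lebesgue_on B. f (x, z))" .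
 have "(LINT p|lborel2. g p) = (LINT z|lborel. LINT x|lborel. g (x, z))"
  using lborel_pair.integral_product_swap[OF borel_measurable_integrable[OF gi]]
   lborel_pair.integral_fst'[OF lborel_pair.integrable_product_swap[OF gi]] by simp
 also have "... = (LINT z|lebesgue_on B. LINT x|lebesgue_on A. f (x, z))"
  unfolding integral_lebesgue_on_cong_AE(1)[OF i2 Bl(1)]
  using lebesgue_on_borel_integral(1)[OF AB(2) m2 o2] by simp
 finally show "(LINT p|lebesgue_on (A \<times> B). f p) = (LINT z|lebesgue_on B. LINT x|lebesgue_on A. f (x, z))"
  using e by simp
qed

lemma Tonelli_Times:
 fixes A B :: "real set" and f :: "field"
 assumes AB: "A \<in> sets borel" "B \<in> sets borel" and f: "f \<in> borel_measurable (lebesgue_on (A \<times> B))"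
  and nn: "!!p. 0 <= f p"
  and sec: "AE x in lebesgue_on A. integrable (lebesgue_on B) (%z. f (x, z))"
  and int: "integrable (lebesgue_on A) (%x. LINT z|lebesgue_on B. f (x, z))"
 shows "integrable (lebesgue_on (A \<times> B)) f"
proof -
 note T = lebesgue_Times_sets[OF AB]
 obtain k where k: "k \<in> borel_measurable borel" "AE p in lebesgue_on (A \<times> B). f p = k p"
   "!!p. p \<notin> A \<times> B ==> k p = 0" using borel_representative[OF T(1) f] by blast
 \<comment> \<open>The Borel representative is nonnegative only almost everywhere. Its absolute
   value is so everywhere and still represents \<open>f\<close>.\<close>
 define g where "g p = \<bar>k p\<bar>" for p
 have g: "g \<in> borel_measurable borel" "AE p in lebesgue_on (A \<times> B). f p = g p"
   "!!p. p \<notin> A \<times> B ==> g p = 0"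
 proof -
  show "g \<in> borel_measurable borel" using k(1) by (simp add: g_def[abs_def])
  show "AE p in lebesgue_on (A \<times> B). f p = g p" using k(2)
  proof (rule eventually_mono)
   fix p assume "f p = k p"
   then show "f p = g p" using nn[of p] by (simp add: g_def)
  qed
 qed (simp add: g_def k(3))
 have Bl: "B \<in> sets lebesgue" "A \<in> sets lebesgue" using AB by auto
 have gb: "g \<in> borel_measurable lborel2" using g(1) by (simp add: lborel_prod)
 have s1: "(%z. g (x, z)) \<in> borel_measurable borel" for x using gb by measurable
 have z1: "(LINT z|lebesgue_on B. g (x, z)) = (LINT z|lborel. g (x, z))"
  "integrable (lebesgue_on B) (%z. g (x, z)) = integrable lborel (%z. g (x, z))" for x
  using lebesgue_on_borel_integral[OF AB(2) s1[of x]] g(3) by auto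
 have sg: "AE x in lebesgue_on A. AE z in lebesgue_on B. f (x, z) = g (x, z)"
  using AE_lebesgue_on_sections[OF AB g(2)] by auto
 have m1: "(%x. LINT z|lborel. g (x, z)) \<in> borel_measurable borel"
  using gb by (intro lborel.borel_measurable_lebesgue_integral) (simp add: case_prod_beta)
 have i1: "AE x in lebesgue_on A. (LINT z|lebesgue_on B. f (x, z)) = (LINT z|lborel. g (x, z))"
  using sg by (rule eventually_mono) (simp add: integral_lebesgue_on_cong_AE(1)[OF _ Bl(1)] z1)
 have o1: "(LINT z|lborel. g (x, z)) = 0" if "x \<notin> A" for x using g(3) that by simp
 have "integrable lborel (%x. LINT z|lborel. g (x, z))"
  using int unfolding integral_lebesgue_on_cong_AE(2)[OF i1 Bl(2)]
  using lebesgue_on_borel_integral(2)[OF AB(1) m1 o1] by simp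
 moreover have "AE x in lebesgue_on A. integrable lborel (%z. g (x, z))"
  using sec sg by eventually_elim (simp add: integral_lebesgue_on_cong_AE(2)[OF _ Bl(1)] z1)
 then have "AE x in lborel. integrable lborel (%z. g (x, z))" unfolding AE_lebesgue_on_iff_lborel[OF AB(1)]
 proof (rule eventually_mono)
  fix x assume "x \<in> A --> integrable lborel (%z. g (x, z))"
  then show "integrable lborel (%z. g (x, z))" using g(3) by (cases "x \<in> A") auto
 qed
 ultimately have "integrable lborel2 g" using gb by (intro lborel_pair.Fubini_integrable) (auto simp: g_def)
 then show ?thesis
  using integral_lebesgue_on_cong_AE(2)[OF g(2) T(2)] lebesgue_on_borel_integral(2)[OF T(1) g(1)] g(3)
  by (simp add: lborel_prod)
qed

lemma integrable_product_Times:
 fixes A B :: "real set" and a b :: "real => real"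
 assumes AB: "A \<in> sets borel" "B \<in> sets borel"
  and a: "integrable (lebesgue_on A) a" and b: "integrable (lebesgue_on B) b"
 shows "integrable (lebesgue_on (A \<times> B)) (%p. a (fst p) * b (snd p))"
  and "(LINT p|lebesgue_on (A \<times> B). a (fst p) * b (snd p)) = (LINT x|lebesgue_on A. a x) * (LINT z|lebesgue_on B. b z)"
proof -
 have m: "(%p. a (fst p) * b (snd p)) \<in> borel_measurable (lebesgue_on (A \<times> B))"
  using lebesgue_on_measurable_fst[OF AB] lebesgue_on_measurable_snd[OF AB] a b
  by (intro borel_measurable_times) auto
 have "integrable (lebesgue_on (A \<times> B)) (%p. \<bar>a (fst p) * b (snd p)\<bar>)"
  using a b by (intro Tonelli_Times[OF AB] borel_measurable_abs m) (auto simp: abs_mult)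
 then show i: "integrable (lebesgue_on (A \<times> B)) (%p. a (fst p) * b (snd p))"
  using m by (simp add: integrable_abs_iff)
 show "(LINT p|lebesgue_on (A \<times> B). a (fst p) * b (snd p)) = (LINT x|lebesgue_on A. a x) * (LINT z|lebesgue_on B. b z)"
  using Fubini_Times(3)[OF AB i] by simp
qed

lemma integral_open_interval:
 fixes f :: "real => real"
 assumes "continuous_on {a..b} f"
 shows "integrable (lebesgue_on {a<..<b}) f" "(LINT x|lebesgue_on {a<..<b}. f x) = integral {a..b} f"
proof -
 have "integrable (lebesgue_on {a..b}) f" using assms by (rule continuous_imp_integrable_real)
 then have "set_integrable lebesgue {a..b} f" by (simp add: integrable_restrict_space set_integrable_def)
 then have "set_integrable lebesgue {a<..<b} f" by (rule set_integrable_subset) auto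
 then show i: "integrable (lebesgue_on {a<..<b}) f"
  by (simp add: integrable_restrict_space set_integrable_def)
 have "(LINT x|lebesgue_on {a<..<b}. f x) = integral {a<..<b} f"
  using i by (intro lebesgue_integral_eq_integral) auto
 then show "(LINT x|lebesgue_on {a<..<b}. f x) = integral {a..b} f" by (simp add: integral_open_interval_real)
qed

lemma integral_deriv_open_interval:
 fixes f :: "real => real"
 assumes "a <= b" "!!x. (f has_real_derivative f' x) (at x)" "continuous_on {a..b} f'"
 shows "(LINT x|lebesgue_on {a<..<b}. f' x) = f b - f a"
proof -
 have "(f' has_integral (f b - f a)) {a..b}" using assms(1) by (rule fundamental_theorem_of_calculus)
   (auto simp: has_real_derivative_iff_has_vector_derivative[symmetric] intro: has_field_derivative_at_within assms(2))
 then show ?thesis using integral_open_interval(2)[OF assms(3)] by (simp add: integral_unique)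
qed

section \<open>Weak derivatives on the domain\<close>

lemma Basis_real_pair: "Basis = {(1::real, 0::real), (0, 1)}" by (auto simp: Basis_prod_def)

lemma smooth_line_derivative:
 fixes F :: "field"
 assumes "smooth F"
 shows "((%x. F (x, z)) has_real_derivative px F (x, z)) (at x)"
  and "((%z. F (x, z)) has_real_derivative py F (x, z)) (at z)"
proof -
 let ?F' = "frechet_derivative F (at (x, z))"
 have F: "(F has_derivative ?F') (at (x, z))" by (rule smooth_has_derivative[OF assms])
 have lin: "linear ?F'" using F by (rule has_derivative_linear)
 have "((%x. (x, z)) has_derivative (%v. (v, 0))) (at x)"
  by (intro has_derivative_Pair has_derivative_ident has_derivative_const)
 from has_derivative_compose[OF this F] 
 have "((%x. F (x, z)) has_derivative (%v. ?F' (v, 0))) (at x)" .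
 moreover have "(%v. ?F' (v, 0)) = (*) (?F' (1, 0))"
 proof
  fix v show "?F' (v, 0) = ?F' (1, 0) * v" using linear_scale[OF lin, of v "(1, 0)"] by simp
 qed
 ultimately show "((%x. F (x, z)) has_real_derivative ?F' (1, 0)) (at x)"
  by (simp add: has_field_derivative_def)
 have "((%z. (x, z)) has_derivative (%v. (0, v))) (at z)"
  by (intro has_derivative_Pair has_derivative_ident has_derivative_const)
 from has_derivative_compose[OF this F] 
 have "((%z. F (x, z)) has_derivative (%v. ?F' (0, v))) (at z)" .
 moreover have "(%v. ?F' (0, v)) = (*) (?F' (0, 1))"
 proof
  fix v show "?F' (0, v) = ?F' (0, 1) * v" using linear_scale[OF lin, of v "(0, 1)"] by simp
 qed
 ultimately show "((%z. F (x, z)) has_real_derivative ?F' (0, 1)) (at z)"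
  by (simp add: has_field_derivative_def)
qed

lemma frechet_derivative_smooth_mult:
 assumes "smooth F" "smooth G"
 shows "frechet_derivative (%x. F x * G x) (at p) v =
  F p * frechet_derivative G (at p) v + frechet_derivative F (at p) v * G p"
 using frechet_derivative_at[OF has_derivative_mult[OF smooth_has_derivative[OF assms(1)]
    smooth_has_derivative[OF assms(2)], of p]] by metis

lemma smooth_fst: "smooth a ==> smooth (%p::real \<times> real. a (fst p))" for a :: "real => real"
 by (rule smooth_linear[OF bounded_linear_fst])

lemma smooth_snd: "smooth a ==> smooth (%p::real \<times> real. a (snd p))" for a :: "real => real"
 by (rule smooth_linear[OF bounded_linear_snd])

lemma frechet_derivative_tensor:
 fixes a b :: "real => real"
 assumes "smooth a" "smooth b"
 shows "px (%p. a (fst p) * b (snd p)) p = deriv a (fst p) * b (snd p)"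
  and "py (%p. a (fst p) * b (snd p)) p = a (fst p) * deriv b (snd p)"
proof -
 obtain x z where p: "p = (x, z)" by (cases p)
 have s: "smooth (%p. a (fst p) * b (snd p))" by (intro smooth_mult smooth_fst smooth_snd assms)
 have "((%x. a x * b z) has_real_derivative deriv a x * b z) (at x)"
  by (auto intro!: derivative_eq_intros smooth_deriv(1)[OF assms(1)])
 from DERIV_unique[OF smooth_line_derivative(1)[OF s, of z x, simplified] this]
 show "px (%p. a (fst p) * b (snd p)) p = deriv a (fst p) * b (snd p)" by (simp add: p)
 have "((%z. a x * b z) has_real_derivative a x * deriv b z) (at z)"
  by (auto intro!: derivative_eq_intros smooth_deriv(1)[OF assms(2)])
 from DERIV_unique[OF smooth_line_derivative(2)[OF s, of x z, simplified] this]
 show "py (%p. a (fst p) * b (snd p)) p = a (fst p) * deriv b (snd p)" by (simp add: p)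
qed

locale strip =
 fixes h :: real
 assumes h_pos: "0 < h"
begin

abbreviation "D \<equiv> Dom h"
abbreviation "IX \<equiv> lebesgue_on {0<..<1::real}"
abbreviation "IZ \<equiv> lebesgue_on {- h<..<0}"
abbreviation "ID \<equiv> lebesgue_on D"
abbreviation "W1 \<equiv> Sobolev1 D"
abbreviation "nrm \<equiv> L2_norm D"
abbreviation "ip \<equiv> L2_inner D"

lemma D_borel: "D \<in> sets borel" and D_lebesgue: "D \<in> sets lebesgue"
 using lebesgue_Times_sets[of "{0<..<1}" "{- h<..<0}"] by (auto simp: Dom_def)

lemma D_lmeasurable: "D \<in> lmeasurable"
proof (rule bounded_set_imp_lmeasurable[OF _ D_lebesgue])
 have "bounded (cbox (0, - h) (1::real, 0::real))" by (rule bounded_cbox)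
 moreover have "D \<subseteq> cbox (0, - h) (1, 0)" by (auto simp: Dom_def cbox_Pair_eq)
 ultimately show "bounded D" by (rule bounded_subset)
qed

lemma finite_measure_D: "finite_measure (ID)" using D_lmeasurable by (rule finite_measure_lebesgue_on)

lemma finite_measure_IX: "finite_measure IX" and finite_measure_IZ: "finite_measure IZ"
 by (auto intro!: finite_measure_lebesgue_on)

lemma continuous_bounded_D:
 assumes "continuous_on UNIV (f :: field)"
 obtains B where "B > 0" "!!x z. 0 <= x ==> x <= 1 ==> - h <= z ==> z <= 0 ==> \<bar>f (x, z)\<bar> <= B"
proof -
 have "compact (f ` cbox (0, - h) (1, 0))"
  using assms by (intro compact_continuous_image) (auto intro: continuous_on_subset)
 from compact_imp_bounded[OF this] obtain B where B: "!!y. y \<in> f ` cbox (0, - h) (1, 0) ==> norm y <= B"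
  unfolding bounded_iff by blast
 show thesis
 proof (rule that[of "\<bar>B\<bar> + 1"])
  fix x z :: real assume "0 <= x" "x <= 1" "- h <= z" "z <= 0"
  then have "f (x, z) \<in> f ` cbox (0, - h) (1, 0)" by (intro imageI) (simp add: cbox_Pair_eq)
  from B[OF this] show "\<bar>f (x, z)\<bar> <= \<bar>B\<bar> + 1" by simp
 qed auto
qed

lemma continuous_measurable_D:
 fixes f :: "field"
 assumes "continuous_on UNIV f"
 shows "f \<in> borel_measurable (ID)" using borel_measurable_continuous_onI[OF assms]
 by (intro measurable_restrict_space1 measurable_completion) simp

lemma bounded_integrable_D:
 fixes f :: "field"
 assumes "f \<in> borel_measurable (ID)" "!!p. p \<in> D ==> \<bar>f p\<bar> <= B"
 shows "integrable (ID) f"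
 using assms by (intro finite_measure.integrable_const_bound[OF finite_measure_D, of f B]) (auto intro!: AE_I2)

lemma continuous_integrable_D:
 fixes f :: "field"
 assumes "continuous_on UNIV f"
 shows "integrable (ID) f"
proof -
 obtain B where "B > 0" "!!x z. 0 <= x ==> x <= 1 ==> - h <= z ==> z <= 0 ==> \<bar>f (x, z)\<bar> <= B"
  by (rule continuous_bounded_D[OF assms]) (rule that, assumption, assumption)
 then show ?thesis by (intro bounded_integrable_D[of f B] continuous_measurable_D assms) (auto simp: Dom_def)
qed

lemma continuous_L2_D:
 fixes f :: "field"
 assumes "continuous_on UNIV f"
 shows "f \<in> L2 D"
proof -
 have "continuous_on UNIV (%p. (f p)^2)" using assms by (intro continuous_intros)
 then show ?thesis using continuous_integrable_D continuous_measurable_D[OF assms] by (simp add: L2_def)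
qed

lemma smooth_L2: "smooth f ==> f \<in> L2 D" by (intro continuous_L2_D smooth_continuous)

lemma smooth_frechet_L2: "smooth f ==> (%p. frechet_derivative f (at p) e) \<in> L2 D"
 by (intro smooth_L2 smooth_frechet_derivative)

lemma L2_integrable_D: "f \<in> L2 D ==> integrable (ID) f"
 using L2_mult_integrable[of f D "%_. 1"] continuous_L2_D[of "%_. 1"] by simp

lemmas Fubini_D = Fubini_Times[of "{0<..<1}" "{- h<..<0}", folded Dom_def, simplified]
lemmas Tonelli_D = Tonelli_Times[of "{0<..<1}" "{- h<..<0}", folded Dom_def, simplified]
lemmas integrable_product_D = integrable_product_Times[of "{0<..<1}" "{- h<..<0}", folded Dom_def, simplified]
lemmas AE_D_sections = AE_lebesgue_on_sections[of "{0<..<1}" "{- h<..<0}", folded Dom_def, simplified]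
lemmas measurable_D_fst = lebesgue_on_measurable_fst[of "{0<..<1}" "{- h<..<0}", folded Dom_def, simplified]
lemmas measurable_D_snd = lebesgue_on_measurable_snd[of "{0<..<1}" "{- h<..<0}", folded Dom_def, simplified]

lemma continuous_on_line:
 fixes f :: "field"
 assumes "continuous_on UNIV f"
 shows "continuous_on S (%x. f (x, z))" "continuous_on S (%z. f (x, z))"
 by (intro continuous_on_compose2[OF assms] continuous_intros; simp)+

lemma integral_x_derivative:
 assumes "smooth g"
 shows "(LINT p|ID. px g p) = (LINT z|IZ. g (1, z) - g (0, z))"
proof -
 have c: "continuous_on UNIV (%p. px g p)" by (intro smooth_continuous smooth_frechet_derivative assms)
 have "(LINT x|IX. px g (x, z)) = g (1, z) - g (0, z)" for z
  by (rule integral_deriv_open_interval[of 0 1 "%x. g (x, z)"])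
   (auto intro: smooth_line_derivative assms continuous_on_line[OF c])
 then show ?thesis using Fubini_D(6)[OF continuous_integrable_D[OF c]] by simp
qed

lemma integral_z_derivative:
 assumes "smooth g"
 shows "(LINT p|ID. py g p) = (LINT x|IX. g (x, 0) - g (x, - h))"
proof -
 have c: "continuous_on UNIV (%p. py g p)" by (intro smooth_continuous smooth_frechet_derivative assms)
 have "(LINT z|IZ. py g (x, z)) = g (x, 0) - g (x, - h)" for x
  using h_pos by (intro integral_deriv_open_interval[of "- h" 0 "%z. g (x, z)"])
   (auto intro: smooth_line_derivative assms continuous_on_line[OF c])
 then show ?thesis using Fubini_D(3)[OF continuous_integrable_D[OF c]] by simp
qed

lemma test_function_smooth: "test_function D ph ==> smooth ph" by (simp add: test_function_def)

lemma test_function_outside: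
 assumes "test_function S ph" "p \<notin> S"
 shows "ph p = 0"
proof (rule ccontr)
 assume "ph p \<noteq> 0"
 then have "p \<in> closure {x. ph x \<noteq> 0}" by (intro subsetD[OF closure_subset]) simp
 then show False using assms by (auto simp: test_function_def)
qed

text \<open>The product with a test function vanishes on all four sides, so the integral of its
  derivative is 0.\<close>

lemma smooth_has_weak_deriv:
 assumes F: "smooth F" and e: "e \<in> Basis"
 shows "has_weak_deriv D e F (%p. frechet_derivative F (at p) e)" unfolding has_weak_deriv_def
proof (intro allI impI)
 fix ph assume t: "test_function D ph"
 note ph = test_function_smooth[OF t]
 have o: "ph (1, z) = 0" "ph (0, z) = 0" "ph (x, 0) = 0" "ph (x, - h) = 0" for x z
  using test_function_outside[OF t] by (auto simp: Dom_def)
 have s: "smooth (%p. F p * ph p)" by (rule smooth_mult[OF F ph])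
 have "(LINT p|ID. frechet_derivative (%p. F p * ph p) (at p) e) = 0"
  using e integral_x_derivative[OF s] integral_z_derivative[OF s] by (auto simp: Basis_real_pair o)
 moreover have "integrable (ID) (%p. F p * frechet_derivative ph (at p) e)"
  "integrable (ID) (%p. frechet_derivative F (at p) e * ph p)"
  using F ph by (auto intro!: L2_mult_integrable smooth_L2 smooth_frechet_derivative)
 ultimately show "(LINT x|ID. F x * frechet_derivative ph (at x) e) =
   - (LINT x|ID. frechet_derivative F (at x) e * ph x)" by (simp add: frechet_derivative_smooth_mult[OF F ph])
qed

lemma test_function_plateau_tensor:
 assumes "0 < a" "b < 1" "- h < c" "d < 0"
 shows "test_function D (%p. plateau n a b (fst p) * plateau n c d (snd p))" unfolding test_function_def
proof (intro conjI)
 show "smooth (%p. plateau n a b (fst p) * plateau n c d (snd p))"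
  by (intro smooth_mult smooth_fst smooth_snd smooth_plateau)
 let ?S = "{p::real \<times> real. plateau n a b (fst p) * plateau n c d (snd p) \<noteq> 0}"
 have s: "closure ?S \<subseteq> {a..b} \<times> {c..d}"
 proof (rule closure_minimal)
  show "?S \<subseteq> {a..b} \<times> {c..d}"
   using plateau_outside[of _ a b n] plateau_outside[of _ c d n] by (fastforce simp: not_le intro: ccontr)
 qed (intro closed_Times closed_atLeastAtMost)
 have "compact (({a..b} \<times> {c..d}) \<inter> closure ?S)"
  by (intro compact_Int_closed compact_Times compact_Icc closed_closure)
 then show "compact (closure ?S)" using s by (simp only: Int_absorb1)
 show "closure ?S \<subseteq> D" using s assms by (force simp: Dom_def)
qed

text \<open>The fundamental lemma of the calculus of variations with tensor products of plateaus as
  the only test functions. Letting \<open>n\<close> tend to infinity turns orthogonality into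
  vanishing integrals over rectangles inside \<open>D\<close>; differentiation of the integral along
  shrinking squares then gives \<open>f\<close> at almost every point.\<close>

lemma AE_zero_if_orthogonal_plateaus:
 assumes f: "integrable (ID) f"
  and orth: "!!n a b c d. 0 < a ==> a < b ==> b < 1 ==> - h < c ==> c < d ==> d < 0 ==>
   (LINT p|ID. f p * (plateau n a b (fst p) * plateau n c d (snd p))) = 0"
 shows "AE p in ID. f p = 0"
proof -
 define F where "F p = (if p \<in> D then f p else 0)" for p
 have Fi: "integrable lebesgue F"
  unfolding F_def by (rule Lebesgue_Measure.integrable_restrict_UNIV[OF D_lebesgue, THEN iffD2, OF f])
 have im: "(indicator {a<..<b} :: real => real) \<in> borel_measurable (lebesgue_on A)" for a b A
  by (intro measurable_restrict_space1 borel_measurable_indicator) auto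
 have box0: "integral (cbox (a, c) (b, d)) F = 0" if "0 < a" "a < b" "b < 1" "- h < c" "c < d" "d < 0" for a b c d
 proof -
  have "(%n. LINT p|ID. f p * (plateau n a b (fst p) * plateau n c d (snd p)))
    ----> (LINT p|ID. f p * (indicator {a<..<b} (fst p) * indicator {c<..<d} (snd p)))"
  proof (rule integral_dominated_convergence[where w="%p. \<bar>f p\<bar>"])
   show "(%p. f p * (indicator {a<..<b} (fst p) * indicator {c<..<d} (snd p))) \<in> borel_measurable (ID)"
    using f by (intro borel_measurable_times measurable_D_fst measurable_D_snd im) auto
   show "(%p. f p * (plateau n a b (fst p) * plateau n c d (snd p))) \<in> borel_measurable (ID)" for n
    by (rule borel_measurable_times[OF borel_measurable_integrable[OF f] continuous_measurable_D])
     (intro smooth_continuous smooth_mult smooth_fst smooth_snd smooth_plateau)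
   show "AE p in ID. (%n. f p * (plateau n a b (fst p) * plateau n c d (snd p)))
     ----> f p * (indicator {a<..<b} (fst p) * indicator {c<..<d} (snd p))"
    by (intro AE_I2 tendsto_intros plateau_tendsto)
   show "AE p in ID. norm (f p * (plateau n a b (fst p) * plateau n c d (snd p))) <= \<bar>f p\<bar>" for n
   proof (intro AE_I2)
    fix p
    have "\<bar>plateau n a b (fst p) * plateau n c d (snd p)\<bar> <= 1"
     by (simp add: abs_mult plateau_abs mult_le_one)
    from mult_left_mono[OF this abs_ge_zero[of "f p"]]
    show "norm (f p * (plateau n a b (fst p) * plateau n c d (snd p))) <= \<bar>f p\<bar>"
     unfolding real_norm_def abs_mult[of "f p"] by simp
   qed
  qed (use f in auto)
  then have 0: "(LINT p|ID. f p * (indicator {a<..<b} (fst p) * indicator {c<..<d} (snd p))) = 0"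
   using orth[OF that] by (simp add: LIMSEQ_const_iff)
  have bx: "box (a, c) (b, d) = {a<..<b} \<times> {c<..<d}" by (auto simp: box_def Basis_real_pair)
  have "integral (cbox (a, c) (b, d)) F = integral (box (a, c) (b, d)) F"
   by (simp add: Henstock_Kurzweil_Integration.integral_open_interval)
  also have "... = integral UNIV (%p. if p \<in> box (a, c) (b, d) then F p else 0)"
   by (rule integral_restrict_UNIV[symmetric])
  also have "(%p. if p \<in> box (a, c) (b, d) then F p else 0)
   = (%p. if p \<in> D then f p * (indicator {a<..<b} (fst p) * indicator {c<..<d} (snd p)) else 0)"
   using that by (auto simp: F_def bx Dom_def indicator_def fun_eq_iff)
  also have "integral UNIV ... = integral D (%p. f p * (indicator {a<..<b} (fst p) * indicator {c<..<d} (snd p)))"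
   by (rule integral_restrict_UNIV)
  also have "... = (LINT p|ID. f p * (indicator {a<..<b} (fst p) * indicator {c<..<d} (snd p)))"
  proof (rule lebesgue_integral_eq_integral[symmetric, OF _ D_lebesgue])
   show "integrable (ID) (%p. f p * (indicator {a<..<b} (fst p) * indicator {c<..<d} (snd p)))"
    using f by (intro integrable_dominated[OF f] borel_measurable_times measurable_D_fst measurable_D_snd im)
     (auto simp: indicator_def)
  qed
  finally show ?thesis using 0 by simp
 qed
 have "F integrable_on cbox a b" for a b using Fi integrable_on_lebesgue integrable_on_subcbox by blast
 from integrable_ccontinuous_explicit[of F, OF this] obtain N where N: "negligible N"
  "!!x e. x \<notin> N ==> 0 < e ==> \<exists>d>0. \<forall>k. 0 < k & k < d -->
   norm (integral (cbox x (x + k *\<^sub>R One)) F /\<^sub>R k ^ DIM(real \<times> real) - F x) < e" by metis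
 have z: "f p = 0" if pD: "p \<in> D" and pN: "p \<notin> N" for p
 proof (rule ccontr)
  assume nz: "f p \<noteq> 0"
  obtain x z where p: "p = (x, z)" by (cases p)
  have xz: "0 < x" "x < 1" "- h < z" "z < 0" using pD by (auto simp: p Dom_def)
  obtain d where d: "d > 0" "!!k. 0 < k ==> k < d ==>
   norm (integral (cbox p (p + k *\<^sub>R One)) F /\<^sub>R k ^ DIM(real \<times> real) - F p) < \<bar>f p\<bar>"
   using N(2)[OF pN, of "\<bar>f p\<bar>"] nz by auto
  \<comment> \<open>Small enough for the square of side \<open>k\<close> with lower left corner
    \<open>p\<close> to stay inside \<open>D\<close>.\<close>
  define k where "k = min (d / 2) (min ((1 - x) / 2) (- z / 2))"
  have k: "0 < k" "k < d" "x + k < 1" "z + k < 0" using d(1) xz by (auto simp: k_def min_def field_simps)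
  have "p + k *\<^sub>R One = (x + k, z + k)" by (simp add: p Basis_real_pair)
  then have "integral (cbox p (p + k *\<^sub>R One)) F = 0"
   using box0[of x "x + k" z "z + k"] xz k by (simp add: p)
  then show False using d(2)[OF k(1,2)] pD by (simp add: F_def)
 qed
 have "N \<in> null_sets lebesgue" using N(1) by (simp add: negligible_iff_null_sets)
 then have "AE p in lebesgue. p \<notin> N" by (rule AE_not_in)
 then show ?thesis using D_lebesgue by (subst AE_restrict_space_iff) (auto elim!: eventually_mono intro: z)
qed

lemma has_weak_deriv_unique:
 assumes e: "e \<in> Basis" and g: "g1 \<in> L2 D" "g2 \<in> L2 D"
  and w: "has_weak_deriv D e f g1" "has_weak_deriv D e f g2"
 shows "AE p in ID. g1 p = g2 p"
proof -
 have "AE p in ID. g1 p - g2 p = 0"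
 proof (rule AE_zero_if_orthogonal_plateaus)
  show "integrable (ID) (%p. g1 p - g2 p)" by (intro L2_integrable_D L2_diff g)
  fix n a b c d assume abcd: "0 < (a::real)" "a < b" "b < 1" "- h < c" "c < d" "d < 0"
  let ?ph = "%p. plateau n a b (fst p) * plateau n c d (snd p)"
  have t: "test_function D ?ph" using abcd by (intro test_function_plateau_tensor)
  have p: "?ph \<in> L2 D" by (rule smooth_L2[OF test_function_smooth[OF t]])
  have "(LINT p|ID. g1 p * ?ph p) = (LINT p|ID. g2 p * ?ph p)"
   using w(1)[unfolded has_weak_deriv_def, rule_format, OF t]
    w(2)[unfolded has_weak_deriv_def, rule_format, OF t] by linarith
  then show "(LINT p|ID. (g1 p - g2 p) * ?ph p) = 0"
   using L2_mult_integrable[OF g(1) p] L2_mult_integrable[OF g(2) p] by (simp add: left_diff_distrib)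
 qed
 then show ?thesis by eventually_elim simp
qed

section \<open>Calculus of weak derivatives\<close>

lemma weak_deriv_works:
 assumes "f \<in> W1" "e \<in> Basis"
 shows "weak_deriv D e f \<in> L2 D" "has_weak_deriv D e f (weak_deriv D e f)"
proof -
 have "\<exists>g. g \<in> L2 D & has_weak_deriv D e f g" using assms unfolding Sobolev1_def by blast
 from someI_ex[OF this] show "weak_deriv D e f \<in> L2 D" "has_weak_deriv D e f (weak_deriv D e f)"
  by (auto simp: weak_deriv_def)
qed

lemma weak_deriv_eq:
 assumes e: "e \<in> Basis" and "g \<in> L2 D" "has_weak_deriv D e f g"
 shows "AE p in ID. weak_deriv D e f p = g p"
proof -
 have "\<exists>g. g \<in> L2 D & has_weak_deriv D e f g" using assms by blast
 from someI_ex[OF this] show ?thesis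
  using has_weak_deriv_unique[OF e _ assms(2) _ assms(3)] by (simp add: weak_deriv_def)
qed

lemma has_weak_deriv_add:
 assumes e: "e \<in> Basis" and L: "f1 \<in> L2 D" "f2 \<in> L2 D" "g1 \<in> L2 D" "g2 \<in> L2 D"
  and w: "has_weak_deriv D e f1 g1" "has_weak_deriv D e f2 g2"
 shows "has_weak_deriv D e (%p. f1 p + f2 p) (%p. g1 p + g2 p)" unfolding has_weak_deriv_def
proof (intro allI impI)
 fix ph assume t: "test_function D ph"
 have s: "smooth ph" by (rule test_function_smooth[OF t])
 show "(LINT x|ID. (f1 x + f2 x) * frechet_derivative ph (at x) e) =
    - (LINT x|ID. (g1 x + g2 x) * ph x)"
  using w t L2_mult_integrable[OF L(1) smooth_frechet_L2[OF s]] L2_mult_integrable[OF L(2) smooth_frechet_L2[OF s]]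
   L2_mult_integrable[OF L(3) smooth_L2[OF s]] L2_mult_integrable[OF L(4) smooth_L2[OF s]]
  by (simp add: distrib_right has_weak_deriv_def)
qed

lemma has_weak_deriv_cmult:
 assumes "has_weak_deriv D e f g"
 shows "has_weak_deriv D e (%p. c * f p) (%p. c * g p)"
 using assms by (simp add: has_weak_deriv_def mult.assoc)

lemma Sobolev1_L2: "f \<in> W1 ==> f \<in> L2 D" by (simp add: Sobolev1_def)

lemma Sobolev1I:
 assumes "f \<in> L2 D" "g1 \<in> L2 D" "has_weak_deriv D (1, 0) f g1" "g2 \<in> L2 D" "has_weak_deriv D (0, 1) f g2"
 shows "f \<in> W1" "AE p in ID. dx h f p = g1 p" "AE p in ID. dz h f p = g2 p"
 using assms weak_deriv_eq[of _ _ f] by (auto simp: Sobolev1_def Basis_real_pair)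

lemma dx_works: "f \<in> W1 ==> dx h f \<in> L2 D" "f \<in> W1 ==> has_weak_deriv D (1, 0) f (dx h f)"
 and dz_works: "f \<in> W1 ==> dz h f \<in> L2 D" "f \<in> W1 ==> has_weak_deriv D (0, 1) f (dz h f)"
 using weak_deriv_works[of f] by (auto simp: Basis_real_pair)

lemma Sobolev1_add:
 assumes "f \<in> W1" "g \<in> W1"
 shows "(%p. f p + g p) \<in> W1"
  and "AE p in ID. dx h (%p. f p + g p) p = dx h f p + dx h g p"
  and "AE p in ID. dz h (%p. f p + g p) p = dz h f p + dz h g p"
proof -
 note a = Sobolev1_L2[OF assms(1)] Sobolev1_L2[OF assms(2)]
 note x = dx_works[OF assms(1)] dx_works[OF assms(2)]
 note z = dz_works[OF assms(1)] dz_works[OF assms(2)]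
 have "has_weak_deriv D (1, 0) (%p. f p + g p) (%p. dx h f p + dx h g p)"
  "has_weak_deriv D (0, 1) (%p. f p + g p) (%p. dz h f p + dz h g p)"
  by (rule has_weak_deriv_add; use a x z in \<open>auto simp: Basis_real_pair\<close>)+
 from Sobolev1I[OF L2_add[OF a] L2_add[OF x(1,3)] this(1) L2_add[OF z(1,3)] this(2)]
 show "(%p. f p + g p) \<in> W1"
  and "AE p in ID. dx h (%p. f p + g p) p = dx h f p + dx h g p"
  and "AE p in ID. dz h (%p. f p + g p) p = dz h f p + dz h g p" by auto
qed

lemma Sobolev1_cmult:
 assumes "f \<in> W1"
 shows "(%p. c * f p) \<in> W1"
  and "AE p in ID. dx h (%p. c * f p) p = c * dx h f p"
  and "AE p in ID. dz h (%p. c * f p) p = c * dz h f p"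
 using Sobolev1I[OF L2_cmult[OF Sobolev1_L2[OF assms]] L2_cmult[OF dx_works(1)[OF assms]]
   has_weak_deriv_cmult[OF dx_works(2)[OF assms]] L2_cmult[OF dz_works(1)[OF assms]]
   has_weak_deriv_cmult[OF dz_works(2)[OF assms]]] by auto

lemma Sobolev1_diff:
 assumes "f \<in> W1" "g \<in> W1"
 shows "(%p. f p - g p) \<in> W1"
  and "AE p in ID. dx h (%p. f p - g p) p = dx h f p - dx h g p"
  and "AE p in ID. dz h (%p. f p - g p) p = dz h f p - dz h g p"
proof -
 have g: "(%p. (-1) * g p) \<in> W1"
  "AE p in ID. dx h (%p. (-1) * g p) p = (-1) * dx h g p"
  "AE p in ID. dz h (%p. (-1) * g p) p = (-1) * dz h g p" by (rule Sobolev1_cmult[OF assms(2)])+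
 have e: "(%p. f p + (-1) * g p) = (%p. f p - g p)" by simp
 note s = Sobolev1_add[OF assms(1) g(1), unfolded e]
 show "(%p. f p - g p) \<in> W1" by (rule s(1))
 show "AE p in ID. dx h (%p. f p - g p) p = dx h f p - dx h g p" using s(2) g(2) by eventually_elim simp
 show "AE p in ID. dz h (%p. f p - g p) p = dz h f p - dz h g p" using s(3) g(3) by eventually_elim simp
qed

lemma smooth_Sobolev1:
 assumes "smooth F"
 shows "F \<in> W1"
  and "AE p in ID. dx h F p = px F p"
  and "AE p in ID. dz h F p = py F p"
 using Sobolev1I[OF smooth_L2[OF assms] smooth_frechet_L2[OF assms] smooth_has_weak_deriv[OF assms, of "(1, 0)"]
   smooth_frechet_L2[OF assms] smooth_has_weak_deriv[OF assms, of "(0, 1)"]] by (auto simp: Basis_real_pair)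

lemma zero_Sobolev1: "(%_. 0) \<in> W1" by (rule smooth_Sobolev1) simp

text \<open>Equivalent to \<open>Sobolev1_norm\<close>, but a plain sum of three L2 norms, so that
  the triangle inequality and limits reduce to each of them separately.\<close>

definition N1 :: "field => real" where
 "N1 f = nrm f + nrm (dx h f) + nrm (dz h f)"

lemma N1_nonneg [simp]: "0 <= N1 f" by (simp add: N1_def)

lemma N1_bounds: "nrm f <= N1 f" "nrm (dx h f) <= N1 f" "nrm (dz h f) <= N1 f" by (simp_all add: N1_def)

lemma dx_diff_norm:
 assumes "f \<in> W1" "g \<in> W1"
 shows "nrm (dx h (%p. f p - g p)) = nrm (%p. dx h f p - dx h g p)"
  and "nrm (dz h (%p. f p - g p)) = nrm (%p. dz h f p - dz h g p)"
 by (intro L2_norm_cong_AE Sobolev1_diff assms D_lebesgue)+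

lemma N1_triangle:
 assumes f: "f \<in> W1" and g: "g \<in> W1" and k: "k \<in> W1"
 shows "N1 (%p. f p - k p) <= N1 (%p. f p - g p) + N1 (%p. g p - k p)"
 using L2_triangle_dist[OF Sobolev1_L2[OF f] Sobolev1_L2[OF g] Sobolev1_L2[OF k]]
  L2_triangle_dist[OF dx_works(1)[OF f] dx_works(1)[OF g] dx_works(1)[OF k]]
  L2_triangle_dist[OF dz_works(1)[OF f] dz_works(1)[OF g] dz_works(1)[OF k]]
 by (simp add: N1_def dx_diff_norm f g k)

lemma N1_minus_commute:
 assumes "f \<in> W1" "g \<in> W1"
 shows "N1 (%p. f p - g p) = N1 (%p. g p - f p)"
 using L2_norm_minus_commute[of D f g] L2_norm_minus_commute[of D "dx h f"] L2_norm_minus_commute[of D "dz h f"]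
 by (simp add: N1_def dx_diff_norm assms)

lemma N1_diff_abs:
 assumes f: "f \<in> W1" and g: "g \<in> W1"
 shows "\<bar>N1 f - N1 g\<bar> <= N1 (%p. f p - g p)"
 using L2_norm_diff_abs[OF Sobolev1_L2[OF f] Sobolev1_L2[OF g]]
  L2_norm_diff_abs[OF dx_works(1)[OF f] dx_works(1)[OF g]]
  L2_norm_diff_abs[OF dz_works(1)[OF f] dz_works(1)[OF g]] by (simp add: N1_def dx_diff_norm f g)

lemma N1_tendstoD:
 assumes "!!n::nat. f n \<in> W1" "g \<in> W1" "(%n. N1 (%p. f n p - g p)) ----> 0"
 shows "(%n. nrm (%p. f n p - g p)) ----> 0"
  and "(%n. nrm (%p. dx h (f n) p - dx h g p)) ----> 0"
  and "(%n. nrm (%p. dz h (f n) p - dz h g p)) ----> 0" using N1_bounds[of "%p. f _ p - g p"]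
 by (auto intro!: Lim_null_comparison[OF always_eventually assms(3)] simp: dx_diff_norm[OF assms(1,2), symmetric])

lemma Sobolev1_norm_eq:
 "Sobolev1_norm D f = sqrt ((nrm f)^2 + (nrm (dx h f))^2 + (nrm (dz h f))^2)"
 by (simp add: Sobolev1_norm_def Basis_real_pair)

lemma Sobolev1_norm_N1: "Sobolev1_norm D f <= N1 f" "N1 f <= 3 * Sobolev1_norm D f"
proof -
 have "sqrt (a^2 + b^2 + c^2) <= a + b + c" if "0 <= a" "0 <= b" "0 <= c" for a b c :: real
  using that by (intro real_le_lsqrt) (auto simp: power2_eq_square algebra_simps)
 then show "Sobolev1_norm D f <= N1 f" unfolding Sobolev1_norm_eq N1_def by simp
 have "a + b + c <= 3 * sqrt (a^2 + b^2 + c^2)" for a b c :: real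
 proof -
  have "a <= sqrt (a^2 + b^2 + c^2)" "b <= sqrt (a^2 + b^2 + c^2)" "c <= sqrt (a^2 + b^2 + c^2)"
   by (auto intro!: real_le_rsqrt)
  then show ?thesis by linarith
 qed
 then show "N1 f <= 3 * Sobolev1_norm D f" unfolding Sobolev1_norm_eq N1_def by simp
qed

lemma Sobolev1_norm_tendsto_iff:
 "(%n::nat. Sobolev1_norm D (f n)) ----> 0 \<longleftrightarrow> (%n. N1 (f n)) ----> 0"
proof
 assume "(%n. Sobolev1_norm D (f n)) ----> 0"
 then have "(%n. 3 * Sobolev1_norm D (f n)) ----> 0" by (rule tendsto_mult_right_zero)
 then show "(%n. N1 (f n)) ----> 0"
  by (rule Lim_null_comparison[rotated]) (use Sobolev1_norm_N1(2) in \<open>auto intro!: always_eventually\<close>)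
next
 assume "(%n. N1 (f n)) ----> 0"
 then show "(%n. Sobolev1_norm D (f n)) ----> 0" using Sobolev1_norm_N1(1)
  by (intro Lim_null_comparison[of "%n. Sobolev1_norm D (f n)"]) (auto intro!: always_eventually simp: Sobolev1_norm_eq)
qed

end

section \<open>Density of smooth functions\<close>

text \<open>Bessel's inequality bounds the sums of squares by the norm of \<open>g\<close>, so the
  partial sums are Cauchy. The limit \<open>G\<close> is not identified with \<open>g\<close> here;
  that takes completeness of the system. The condition on \<open>c\<close> has product form and so
  covers elements of norm zero.\<close>

lemma orthogonal_series:
 assumes e: "!!i. e i \<in> L2 S" and orth: "!!i j. i \<noteq> j ==> L2_inner S (e i) (e j) = 0"
  and g: "g \<in> L2 S" and c: "!!i. L2_inner S g (e i) = c i * L2_inner S (e i) (e i)"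
  and fin: "!!n::nat. finite (J n)" and mono: "!!m n. m <= n ==> J m \<subseteq> J n"
 obtains G where "G \<in> L2 S" "(%n. L2_norm S (%x. (\<Sum>i\<in>J n. c i * e i x) - G x)) ----> 0"
  "!!i n. i \<in> J n ==> L2_inner S G (e i) = c i * L2_inner S (e i) (e i)"
proof -
 define s where "s K = (\<Sum>i\<in>K. (c i)^2 * L2_inner S (e i) (e i))" for K
 define P where "P K x = (\<Sum>i\<in>K. c i * e i x)" for K x
 have P: "P K \<in> L2 S" for K unfolding P_def by (intro L2_sum L2_cmult e)
 have inner: "L2_inner S k (P K) = (\<Sum>i\<in>K. c i * L2_inner S k (e i))" if "k \<in> L2 S" for k K
  unfolding P_def using that by (simp add: L2_inner_sum_right L2_cmult e L2_inner_cmult_right)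
 have Pe: "L2_inner S (P K) (e i) = (if i \<in> K then c i * L2_inner S (e i) (e i) else 0)" if "finite K" for K i
 proof -
  have "L2_inner S (P K) (e i) = (\<Sum>j\<in>K. c j * L2_inner S (e i) (e j))"
   using inner[OF e] by (simp add: L2_inner_sym[of S "P K"])
  also have "... = (\<Sum>j\<in>K. if j = i then c i * L2_inner S (e i) (e i) else 0)"
   by (intro sum.cong) (auto simp: orth)
  finally show ?thesis using that by simp
 qed
 have PP: "L2_inner S (P K) (P K) = s K" if "finite K" for K
  unfolding inner[OF P] s_def by (intro sum.cong) (auto simp: Pe that power2_eq_square)
 have gP: "L2_inner S g (P K) = s K" for K
  unfolding inner[OF g] s_def by (simp add: c power2_eq_square mult.assoc)
 have s0: "0 <= s K" for K unfolding s_def by (intro sum_nonneg) (simp add: L2_inner_nonneg)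
 \<comment> \<open>By \<open>gP\<close> and \<open>PP\<close>, Cauchy-Schwarz reads s^2 \<le> <g,g>
   s.\<close>
 have sb: "s K <= L2_inner S g g" if "finite K" for K
 proof (cases "s K = 0")
  case False
  then show ?thesis using L2_Cauchy_Schwarz_square[OF g P, of K] s0[of K] unfolding gP PP[OF that]
   by (simp add: power2_eq_square)
 qed (simp add: L2_inner_nonneg)
 have "\<exists>L. (%n. s (J n)) ----> L"
 proof -
  have "incseq (%n. s (J n))"
   unfolding incseq_def s_def using mono fin by (intro allI impI sum_mono2) (auto simp: L2_inner_nonneg)
  then show ?thesis using incseq_convergent[of "%n. s (J n)" "L2_inner S g g"] sb[OF fin] by blast
 qed
 then have Cs: "Cauchy (%n. s (J n))" using convergent_def convergent_Cauchy by blast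
 have diff: "(L2_norm S (%x. P (J m) x - P (J n) x))^2 = s (J m) - s (J n)" if "n <= m" for m n
 proof -
  have sub: "J n \<subseteq> J m" by (rule mono[OF that])
  have "(%x. P (J m) x - P (J n) x) = P (J m - J n)" unfolding P_def using sub fin by (simp add: sum_diff)
  then have "(L2_norm S (%x. P (J m) x - P (J n) x))^2 = s (J m - J n)"
   using PP[of "J m - J n"] fin by (simp add: L2_norm_square)
  also have "... = s (J m) - s (J n)" unfolding s_def using sub fin by (simp add: sum_diff)
  finally show ?thesis .
 qed
 have cauchy: "\<exists>N. \<forall>m\<ge>N. \<forall>n\<ge>N. L2_norm S (%x. P (J m) x - P (J n) x) < r" if "r > 0" for r
 proof -
  obtain N where N: "!!m n. m >= N ==> n >= N ==> \<bar>s (J m) - s (J n)\<bar> < r^2"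
   using Cs[unfolded Cauchy_def dist_real_def, rule_format, of "r^2"] \<open>r > 0\<close> by auto
  have "L2_norm S (%x. P (J m) x - P (J n) x) < r" if "m >= N" "n >= N" for m n
  proof (rule power2_less_imp_less)
   show "(L2_norm S (%x. P (J m) x - P (J n) x))^2 < r^2"
   proof (cases "n <= m")
    case True
    then show ?thesis using diff[OF True] N[OF that] by simp
   next
    case False
    then show ?thesis using diff[of m n] N[OF that] L2_norm_minus_commute[of S "P (J m)" "P (J n)"] by simp
   qed
  qed (use \<open>r > 0\<close> in simp)
  then show ?thesis by blast
 qed
 obtain G where G: "G \<in> L2 S" "(%n. L2_norm S (%x. P (J n) x - G x)) ----> 0"
  using L2_complete[of "%n. P (J n)" S, OF P cauchy] by blast
 have "L2_inner S G (e i) = c i * L2_inner S (e i) (e i)" if "i \<in> J n" for i n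
 proof (rule LIMSEQ_unique)
  show "(%n. L2_inner S (P (J n)) (e i)) ----> L2_inner S G (e i)" by (rule L2_inner_tendsto[OF P G e e]) simp
  have "eventually (%n. L2_inner S (P (J n)) (e i) = c i * L2_inner S (e i) (e i)) sequentially"
   using that mono[of n] by (intro eventually_sequentiallyI[of n]) (auto simp: Pe fin)
  then show "(%n. L2_inner S (P (J n)) (e i)) ----> c i * L2_inner S (e i) (e i)" by (rule tendsto_eventually)
 qed
 with G show thesis using that by (auto simp: P_def[abs_def])
qed

section \<open>Cutoffs and testing up to the boundary\<close>

lemma smooth_Lipschitz_interval:
 fixes a :: "real => real"
 assumes "smooth a"
 obtains L where "L >= 0" "!!x y. x \<in> {l..r} ==> y \<in> {l..r} ==> \<bar>a x - a y\<bar> <= L * \<bar>x - y\<bar>"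
proof -
 have "compact (deriv a ` {l..r})"
  by (intro compact_continuous_image smooth_continuous smooth_deriv assms compact_Icc)
 from compact_imp_bounded[OF this]
 obtain B where B: "!!y. y \<in> deriv a ` {l..r} ==> norm y <= B" unfolding bounded_iff by blast
 have "\<bar>a x - a y\<bar> <= \<bar>B\<bar> * \<bar>x - y\<bar>" if "x \<in> {l..r}" "y \<in> {l..r}" for x y
 proof -
  have "norm (a x - a y) <= \<bar>B\<bar> * norm (x - y)"
  proof (rule field_differentiable_bound[OF _ _ _ that])
   show "(a has_field_derivative deriv a t) (at t within {l..r})" for t
    using smooth_deriv(1)[OF assms] by (rule has_field_derivative_at_within)
   show "norm (deriv a t) <= \<bar>B\<bar>" if "t \<in> {l..r}" for t using B[of "deriv a t"] that by auto
  qed simp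
  then show ?thesis by simp
 qed
 then show thesis by (intro that[of "\<bar>B\<bar>"]) auto
qed

text \<open>The support keeps the distance 1/(n+1) from the endpoints, hence is compact inside the
  open interval as test functions require. The value 1 is reached at distance 2/(n+1).\<close>

definition cutoff :: "nat => real => real => real => real" where
 "cutoff n l r = plateau (Suc n) (l + 1 / real (Suc n)) (r - 1 / real (Suc n))"

lemma smooth_cutoff: "smooth (cutoff n l r)" by (simp add: cutoff_def smooth_plateau)

lemma cutoff_abs: "\<bar>cutoff n l r x\<bar> <= 1" by (simp add: cutoff_def plateau_abs)

lemma cutoff_eventually:
 assumes "l < x" "x < r"
 shows "eventually (%n. cutoff n l r x = 1 & deriv (cutoff n l r) x = 0) sequentially"
proof -
 \<comment> \<open>The number 3 leaves room for the margin, for the ramp, and for the strict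
   inequality under which the derivative of the step vanishes.\<close>
 have "eventually (%n. 3 <= real n * (x - l) & 3 <= real n * (r - x)) sequentially"
  using assms eventually_ge_real_mult[of "x - l" 3] eventually_ge_real_mult[of "r - x" 3]
  by (auto intro: eventually_conj)
 then show ?thesis
 proof (rule eventually_mono)
  fix n assume n: "3 <= real n * (x - l) & 3 <= real n * (r - x)"
  let ?m = "real (Suc n)"
  have "real n * (x - l) <= ?m * (x - l)" "real n * (r - x) <= ?m * (r - x)"
   using assms by (auto intro!: mult_right_mono)
  then have *: "3 <= ?m * (x - l)" "3 <= ?m * (r - x)" using n by linarith+
  have 1: "?m * (x - (l + 1 / ?m)) = ?m * (x - l) - 1" "?m * (r - 1 / ?m - x) = ?m * (r - x) - 1"
   by (simp_all add: field_simps del: of_nat_Suc)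
  have "cutoff n l r x = 1"
   unfolding cutoff_def by (rule plateau_inside) (use * in \<open>auto simp only: 1\<close>)
  moreover have "deriv (cutoff n l r) x = 0" unfolding cutoff_def DERIV_imp_deriv[OF plateau_has_derivative] 1
   using * by (simp add: smooth_step_deriv_eq_0 del: of_nat_Suc)
  ultimately show "cutoff n l r x = 1 & deriv (cutoff n l r) x = 0" by simp
 qed
qed

lemma cutoff_tendsto:
 assumes "l < x" "x < r"
 shows "(%n. cutoff n l r x) ----> 1" "(%n. deriv (cutoff n l r) x) ----> 0"
 using cutoff_eventually[OF assms] by (auto intro!: tendsto_eventually elim: eventually_mono)

text \<open>The derivatives of the cutoffs blow up at the endpoints only at the rate at which \<open>a\<close> vanishes there.\<close>
lemma cutoff_deriv_bounded:
 assumes a: "smooth a" "a l = 0" "a r = 0" and lr: "l < r"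
 obtains B where "!!n x. l < x ==> x < r ==> \<bar>deriv (cutoff n l r) x * a x\<bar> <= B"
proof -
 obtain L where L: "L >= 0" "!!x y. x \<in> {l..r} ==> y \<in> {l..r} ==> \<bar>a x - a y\<bar> <= L * \<bar>x - y\<bar>"
  using smooth_Lipschitz_interval[OF a(1)] by metis
 obtain M where M: "M > 0" "!!x. \<bar>deriv smooth_step x\<bar> <= M"
  using smooth_step_deriv_bounded by metis
 have key: "\<bar>real (Suc n) * deriv smooth_step (real (Suc n) * d - 1) * A\<bar> <= 2 * M * L"
  if "d >= 0" "\<bar>A\<bar> <= L * d" for n d A
 proof (cases "real (Suc n) * d <= 2")
  case True
  have "\<bar>real (Suc n) * deriv smooth_step (real (Suc n) * d - 1) * A\<bar>
    = real (Suc n) * \<bar>deriv smooth_step (real (Suc n) * d - 1)\<bar> * \<bar>A\<bar>"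
   by (simp add: abs_mult del: of_nat_Suc)
  also have "... <= real (Suc n) * M * (L * d)"
   using M that L by (intro mult_mono) (auto simp del: of_nat_Suc)
  also have "... = (real (Suc n) * d) * (M * L)" by simp
  also have "... <= 2 * (M * L)" using True M L by (intro mult_right_mono) auto
  finally show ?thesis by simp
 next
  case False
  then have "deriv smooth_step (real (Suc n) * d - 1) = 0" by (intro smooth_step_deriv_eq_0) simp
  then show ?thesis using M L by simp
 qed
 have "\<bar>deriv (cutoff n l r) x * a x\<bar> <= 4 * M * L" if x: "l < x" "x < r" for n x
 proof -
  let ?m = "real (Suc n)"
  have 1: "?m * (x - (l + 1 / ?m)) = ?m * (x - l) - 1" "?m * (r - 1 / ?m - x) = ?m * (r - x) - 1"
   by (simp_all add: field_simps del: of_nat_Suc)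
  have A: "\<bar>a x\<bar> <= L * (x - l)" "\<bar>a x\<bar> <= L * (r - x)"
   using L(2)[of x l] L(2)[of x r] x a by auto
  let ?u = "?m * deriv smooth_step (?m * (x - l) - 1) * a x"
  let ?v = "?m * deriv smooth_step (?m * (r - x) - 1) * a x"
  have "deriv (cutoff n l r) x * a x
   = smooth_step (?m * (r - x) - 1) * ?u - smooth_step (?m * (x - l) - 1) * ?v"
   unfolding cutoff_def DERIV_imp_deriv[OF plateau_has_derivative] 1 by (simp add: algebra_simps del: of_nat_Suc)
  also have "\<bar>...\<bar> <= 1 * (2 * M * L) + 1 * (2 * M * L)"
  proof (rule order_trans[OF abs_triangle_ineq4 add_mono])
   have k: "\<bar>?u\<bar> <= 2 * M * L" "\<bar>?v\<bar> <= 2 * M * L"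
    using key[of "x - l" "a x" n] key[of "r - x" "a x" n] A x by auto
   show "\<bar>smooth_step (?m * (r - x) - 1) * ?u\<bar> <= 1 * (2 * M * L)"
    unfolding abs_mult[of "smooth_step _"] using k(1) smooth_step_bounds by (intro mult_mono) auto
   show "\<bar>smooth_step (?m * (x - l) - 1) * ?v\<bar> <= 1 * (2 * M * L)"
    unfolding abs_mult[of "smooth_step _"] using k(2) smooth_step_bounds by (intro mult_mono) auto
  qed
  finally show ?thesis by (simp only: mult_1_left)
 qed
 then show thesis by (rule that)
qed

context strip
begin

lemma continuous_bounded_on_D:
 fixes f :: "field"
 assumes "continuous_on UNIV f"
 shows "\<exists>B. \<forall>p\<in>D. \<bar>f p\<bar> <= B"
proof -
 obtain B where B: "B > 0" "!!x z. 0 <= x ==> x <= 1 ==> - h <= z ==> z <= 0 ==> \<bar>f (x, z)\<bar> <= B"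
  by (rule continuous_bounded_D[OF assms]) (rule that, assumption, assumption)
 have "\<bar>f p\<bar> <= B" if "p \<in> D" for p using B(2)[of "fst p" "snd p"] that by (auto simp: Dom_def)
 then show ?thesis by blast
qed

lemma test_function_cutoff:
 assumes "smooth ps"
 shows "test_function D (%p. (cutoff n 0 1 (fst p) * cutoff n (- h) 0 (snd p)) * ps p)"
proof -
 let ?ph = "%p. cutoff n 0 1 (fst p) * cutoff n (- h) 0 (snd p)"
 have t: "test_function D ?ph" unfolding cutoff_def by (rule test_function_plateau_tensor) auto
 have sub: "closure {p. ?ph p * ps p \<noteq> 0} \<subseteq> closure {p. ?ph p \<noteq> 0}"
  by (intro closure_mono) auto
 have "compact (closure {p. ?ph p \<noteq> 0} \<inter> closure {p. ?ph p * ps p \<noteq> 0})"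
  using t by (intro compact_Int_closed closed_closure) (simp add: test_function_def)
 then have "compact (closure {p. ?ph p * ps p \<noteq> 0})" using sub by (simp only: Int_absorb1)
 then show ?thesis using t assms sub unfolding test_function_def by (auto intro: smooth_mult)
qed

text \<open>Multiplied by cutoffs the tensor product becomes a test function. Where the derivative
  in direction \<open>e\<close> falls on a cutoff, the vanishing of the corresponding factor at the
  endpoints keeps the product bounded; it tends to 0 at each point and drops out by dominated
  convergence.\<close>

lemma weak_deriv_tensor_limit:
 assumes e: "e = (1, 0) \<or> e = (0, 1)"
  and f: "f \<in> L2 D" and g: "g \<in> L2 D" "has_weak_deriv D e f g"
  and s: "smooth a" "smooth b"
  and b: "e = (1, 0) ==> a 0 = 0 & a 1 = 0" "e = (0, 1) ==> b (- h) = 0 & b 0 = 0"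
 shows "ip g (%p. a (fst p) * b (snd p))
  = - ip f (%p. frechet_derivative (%p. a (fst p) * b (snd p)) (at p) e)"
proof -
 define ps where "ps p = a (fst p) * b (snd p)" for p :: "real \<times> real"
 define et where "et n p = cutoff n 0 1 (fst p) * cutoff n (- h) 0 (snd p)" for n and p :: "real \<times> real"
 have ps: "smooth ps" unfolding ps_def by (intro smooth_mult smooth_fst smooth_snd s)
 have et: "smooth (et n)" for n unfolding et_def by (intro smooth_mult smooth_fst smooth_snd smooth_cutoff)
 have et1: "\<bar>et n p\<bar> <= 1" for n p unfolding et_def abs_mult by (simp add: cutoff_abs mult_le_one)
 have etlim: "(%n. et n p) ----> 1" if "p \<in> D" for p
  using tendsto_mult[OF cutoff_tendsto(1)[of 0 "fst p" 1] cutoff_tendsto(1)[of "- h" "snd p" 0]] that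
  by (auto simp: et_def Dom_def)
 let ?d = "%F p. frechet_derivative F (at p) e"
 have detps: "?d (%p. et n p * ps p) p = et n p * ?d ps p + ?d (et n) p * ps p" for n p
  by (rule frechet_derivative_smooth_mult[OF et ps])
 obtain B where B: "!!n p. p \<in> D ==> \<bar>?d (et n) p * ps p\<bar> <= B"
  and lim0: "!!p. p \<in> D ==> (%n. ?d (et n) p * ps p) ----> 0"
 proof -
  have bnd: "\<exists>B. \<forall>p\<in>D. \<bar>c (snd p)\<bar> <= B" "\<exists>B. \<forall>p\<in>D. \<bar>c (fst p)\<bar> <= B" if "smooth c" for c :: "real => real"
   by (rule continuous_bounded_on_D, intro smooth_continuous smooth_snd smooth_fst that)+
  show thesis
  proof (cases "e = (1, 0)")
   case True
   obtain B1 where B1: "!!n x. 0 < x ==> x < 1 ==> \<bar>deriv (cutoff n 0 1) x * a x\<bar> <= B1"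
    using cutoff_deriv_bounded[OF s(1), of 0 1] b(1)[OF True] by auto
   obtain B2 where B2: "!!p. p \<in> D ==> \<bar>b (snd p)\<bar> <= B2" using bnd(1)[OF s(2)] by blast
   have eq: "?d (et n) p * ps p = (deriv (cutoff n 0 1) (fst p) * a (fst p)) * (cutoff n (- h) 0 (snd p) * b (snd p))" for n p
    unfolding et_def ps_def True frechet_derivative_tensor[OF smooth_cutoff smooth_cutoff] by simp
   show thesis
   proof (rule that)
    fix n p assume p: "p \<in> D"
    have "\<bar>cutoff n (- h) 0 (snd p) * b (snd p)\<bar> <= 1 * B2"
     unfolding abs_mult using B2[OF p] cutoff_abs by (intro mult_mono) auto
    moreover have "\<bar>deriv (cutoff n 0 1) (fst p) * a (fst p)\<bar> <= B1"
     using p by (intro B1) (auto simp: Dom_def)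
    ultimately show "\<bar>?d (et n) p * ps p\<bar> <= B1 * (1 * B2)"
     unfolding eq abs_mult[of "deriv (cutoff n 0 1) (fst p) * a (fst p)"]
     by (intro mult_mono) (auto intro: order_trans[OF abs_ge_zero])
   next
    fix p assume p: "p \<in> D"
    have "(%n. (deriv (cutoff n 0 1) (fst p) * a (fst p)) * (cutoff n (- h) 0 (snd p) * b (snd p)))
      ----> (0 * a (fst p)) * (1 * b (snd p))"
     using p by (intro tendsto_intros cutoff_tendsto) (auto simp: Dom_def)
    then show "(%n. ?d (et n) p * ps p) ----> 0" unfolding eq by simp
   qed
  next
   case False
   then have e2: "e = (0, 1)" using e by simp
   obtain B1 where B1: "!!n x. - h < x ==> x < 0 ==> \<bar>deriv (cutoff n (- h) 0) x * b x\<bar> <= B1"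
    using cutoff_deriv_bounded[OF s(2), of "- h" 0] b(2)[OF e2] h_pos by auto
   obtain B2 where B2: "!!p. p \<in> D ==> \<bar>a (fst p)\<bar> <= B2" using bnd(2)[OF s(1)] by blast
   have eq: "?d (et n) p * ps p = (deriv (cutoff n (- h) 0) (snd p) * b (snd p)) * (cutoff n 0 1 (fst p) * a (fst p))" for n p
    unfolding et_def ps_def e2 frechet_derivative_tensor[OF smooth_cutoff smooth_cutoff] by simp
   show thesis
   proof (rule that)
    fix n p assume p: "p \<in> D"
    have "\<bar>cutoff n 0 1 (fst p) * a (fst p)\<bar> <= 1 * B2"
     unfolding abs_mult using B2[OF p] cutoff_abs by (intro mult_mono) auto
    moreover have "\<bar>deriv (cutoff n (- h) 0) (snd p) * b (snd p)\<bar> <= B1"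
     using p by (intro B1) (auto simp: Dom_def)
    ultimately show "\<bar>?d (et n) p * ps p\<bar> <= B1 * (1 * B2)"
     unfolding eq abs_mult[of "deriv (cutoff n (- h) 0) (snd p) * b (snd p)"]
     by (intro mult_mono) (auto intro: order_trans[OF abs_ge_zero])
   next
    fix p assume p: "p \<in> D"
    have "(%n. (deriv (cutoff n (- h) 0) (snd p) * b (snd p)) * (cutoff n 0 1 (fst p) * a (fst p)))
      ----> (0 * b (snd p)) * (1 * a (fst p))"
     using p by (intro tendsto_intros cutoff_tendsto) (auto simp: Dom_def)
    then show "(%n. ?d (et n) p * ps p) ----> 0" unfolding eq by simp
   qed
  qed
 qed
 obtain Bps where Bps: "!!p. p \<in> D ==> \<bar>ps p\<bar> <= Bps"
  using continuous_bounded_on_D[OF smooth_continuous[OF ps]] by blast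
 have "continuous_on UNIV (?d ps)" by (intro smooth_continuous smooth_frechet_derivative ps)
 from continuous_bounded_on_D[OF this] obtain Bd where Bd: "!!p. p \<in> D ==> \<bar>?d ps p\<bar> <= Bd"
  by blast
 have id: "(LINT p|ID. f p * ?d (%p. et n p * ps p) p) = - (LINT p|ID. g p * (et n p * ps p))" for n
  using g(2) test_function_cutoff[OF ps, of n] unfolding has_weak_deriv_def et_def by blast
 have l1: "(%n. LINT p|ID. g p * (et n p * ps p)) ----> (LINT p|ID. g p * (1 * ps p))"
 proof (rule integral_dominated_convergence[where w="%p. \<bar>g p\<bar> * Bps"])
  show "AE p in ID. (%n. g p * (et n p * ps p)) ----> g p * (1 * ps p)"
   by (intro AE_I2 tendsto_intros etlim) simp
  show "AE p in ID. norm (g p * (et n p * ps p)) <= \<bar>g p\<bar> * Bps" for n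
  proof (intro AE_I2)
   fix p assume "p \<in> space (ID)"
   then have "\<bar>et n p\<bar> * \<bar>ps p\<bar> <= 1 * Bps"
    using Bps[of p] et1[of n p] by (intro mult_mono) auto
   then show "norm (g p * (et n p * ps p)) <= \<bar>g p\<bar> * Bps" by (simp add: abs_mult mult_left_mono)
  qed
  show "(%p. g p * (et n p * ps p)) \<in> borel_measurable (ID)" for n
   using L2_measurable[OF g(1)] L2_measurable[OF smooth_L2[OF et]] L2_measurable[OF smooth_L2[OF ps]]
   by (intro borel_measurable_times)
  show "(%p. g p * (1 * ps p)) \<in> borel_measurable (ID)"
   using L2_measurable[OF g(1)] L2_measurable[OF smooth_L2[OF ps]] by (intro borel_measurable_times) auto
  show "integrable (ID) (%p. \<bar>g p\<bar> * Bps)" using L2_integrable_D[OF g(1)] by simp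
 qed
 have mdet: "?d F \<in> borel_measurable (ID)" if "smooth F" for F
  by (rule L2_measurable[OF smooth_frechet_L2[OF that]])
 have l2: "(%n. LINT p|ID. f p * ?d (%p. et n p * ps p) p) ----> (LINT p|ID. f p * (1 * ?d ps p + 0))"
  unfolding detps
 proof (rule integral_dominated_convergence[where w="%p. \<bar>f p\<bar> * (1 * Bd + B)"])
  show "AE p in ID. (%n. f p * (et n p * ?d ps p + ?d (et n) p * ps p)) ----> f p * (1 * ?d ps p + 0)"
   by (intro AE_I2 tendsto_intros etlim lim0) auto
  show "AE p in ID. norm (f p * (et n p * ?d ps p + ?d (et n) p * ps p)) <= \<bar>f p\<bar> * (1 * Bd + B)" for n
  proof (intro AE_I2)
   fix p assume p: "p \<in> space (ID)"
   then have "\<bar>et n p * ?d ps p\<bar> <= 1 * Bd"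
    unfolding abs_mult using Bd[of p] et1[of n p] by (intro mult_mono) auto
   then have "\<bar>et n p * ?d ps p + ?d (et n) p * ps p\<bar> <= 1 * Bd + B"
    using B[of p n] p by (intro order_trans[OF abs_triangle_ineq] add_mono) auto
   then show "norm (f p * (et n p * ?d ps p + ?d (et n) p * ps p)) <= \<bar>f p\<bar> * (1 * Bd + B)"
    unfolding real_norm_def abs_mult by (intro mult_left_mono) auto
  qed
  show "(%p. f p * (et n p * ?d ps p + ?d (et n) p * ps p)) \<in> borel_measurable (ID)" for n
   using L2_measurable[OF f] L2_measurable[OF smooth_L2[OF et]] L2_measurable[OF smooth_L2[OF ps]] mdet[OF et] mdet[OF ps]
   by (intro borel_measurable_times borel_measurable_add)
  show "(%p. f p * (1 * ?d ps p + 0)) \<in> borel_measurable (ID)"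
   using L2_measurable[OF f] mdet[OF ps] by (intro borel_measurable_times borel_measurable_add) auto
  show "integrable (ID) (%p. \<bar>f p\<bar> * (1 * Bd + B))" using L2_integrable_D[OF f] by simp
 qed
 have "(LINT p|ID. f p * (1 * ?d ps p + 0)) = - (LINT p|ID. g p * (1 * ps p))"
  by (rule LIMSEQ_unique[OF l2]) (use tendsto_minus[OF l1] in \<open>simp add: id\<close>)
 then show ?thesis unfolding L2_inner_def ps_def by simp
qed

end

lemma orthogonal_sum_norm:
 assumes e: "!!i. e i \<in> L2 S" and orth: "!!i j. i \<noteq> j ==> L2_inner S (e i) (e j) = 0" and "finite K"
 shows "(L2_norm S (%x. \<Sum>i\<in>K. c i * e i x))^2 = (\<Sum>i\<in>K. (c i)^2 * L2_inner S (e i) (e i))"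
proof -
 have P: "(%x. \<Sum>i\<in>K. c i * e i x) \<in> L2 S" by (intro L2_sum L2_cmult e)
 have "(L2_norm S (%x. \<Sum>i\<in>K. c i * e i x))^2
   = (\<Sum>i\<in>K. c i * L2_inner S (%x. \<Sum>j\<in>K. c j * e j x) (e i))"
  unfolding L2_norm_square by (simp add: L2_inner_sum_right[OF _ P] L2_cmult e L2_inner_cmult_right)
 also have "... = (\<Sum>i\<in>K. c i * (\<Sum>j\<in>K. c j * L2_inner S (e i) (e j)))"
  unfolding L2_inner_sym[of S "%x. \<Sum>j\<in>K. c j * e j x"]
  by (simp add: L2_inner_sum_right L2_cmult e L2_inner_cmult_right)
 also have "... = (\<Sum>i\<in>K. c i * (\<Sum>j\<in>K. if j = i then c i * L2_inner S (e i) (e i) else 0))"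
  by (intro sum.cong refl arg_cong2[where f="(*)"]) (auto simp: orth)
 also have "... = (\<Sum>i\<in>K. (c i)^2 * L2_inner S (e i) (e i))"
  using \<open>finite K\<close> by (simp add: power2_eq_square mult.assoc)
 finally show ?thesis .
qed

lemma frechet_derivative_smooth_sum:
 assumes "finite K" "!!i. smooth (e i)"
 shows "frechet_derivative (%x. \<Sum>i\<in>K. c i * e i x) (at p) v = (\<Sum>i\<in>K. c i * frechet_derivative (e i) (at p) v)"
proof -
 have "((%x. \<Sum>i\<in>K. c i * e i x) has_derivative (%v. \<Sum>i\<in>K. c i * frechet_derivative (e i) (at p) v)) (at p)"
  by (intro has_derivative_sum has_derivative_mult_right smooth_has_derivative assms)
 from fun_cong[OF frechet_derivative_at[OF this], of v] show ?thesis by simp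
qed

text \<open>A function orthogonal to all \<open>cos (k \<pi> s)\<close> is orthogonal to all polynomials in \<open>cos (\<pi> s)\<close>,
  hence by the Weierstrass theorem to all continuous functions of \<open>s\<close>.\<close>
lemma orthogonal_cos_imp_orthogonal_continuous:
 fixes s :: "'a => real" and g :: "'a => real" and a :: "real => real"
 assumes g: "integrable M g" and s: "s \<in> borel_measurable M" "!!p. p \<in> space M ==> 0 <= s p & s p <= 1"
  and cos0: "!!k::nat. (LINT p|M. g p * cos (real k * pi * s p)) = 0"
  and a: "continuous_on UNIV a"
 shows "(LINT p|M. g p * a (s p)) = 0"
proof -
 have int: "integrable M (%p. g p * b p)" if "b \<in> borel_measurable M" "!!p. p \<in> space M ==> \<bar>b p\<bar> <= C" for b C
 proof (rule integrable_dominated)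
  show "integrable M (%p. C * g p)" using g by simp
  show "(%p. g p * b p) \<in> borel_measurable M" using g that by auto
  show "AE p in M. norm (g p * b p) <= norm (C * g p)"
  proof (rule AE_I2)
   fix p assume "p \<in> space M"
   from that(2)[OF this] have "\<bar>b p\<bar> <= \<bar>C\<bar>" by simp
   from mult_right_mono[OF this abs_ge_zero[of "g p"]] show "norm (g p * b p) <= norm (C * g p)"
    by (simp add: abs_mult mult.commute)
  qed
 qed
 have cint: "integrable M (%p. g p * (cos (pi * s p) ^ j * cos (real k * pi * s p)))" for j k :: nat
 proof (rule int)
  show "(%p. cos (pi * s p) ^ j * cos (real k * pi * s p)) \<in> borel_measurable M" using s(1) by measurable
  show "\<bar>cos (pi * s p) ^ j * cos (real k * pi * s p)\<bar> <= 1" for p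
   unfolding abs_mult by (intro mult_le_one) (auto simp: power_abs power_le_one)
 qed
 have pc: "(LINT p|M. g p * (cos (pi * s p) ^ j * cos (real k * pi * s p))) = 0" for j k :: nat
 proof (induction j arbitrary: k)
  case 0
  then show ?case using cos0 by simp
 next
  case (Suc j)
  \<comment> \<open>This is |k - 1|: cosine is even, so for k = 0 the lower frequency is 1.\<close>
  let ?k' = "if k = 0 then 1 else k - 1"
  have "cos (pi * t) * cos (real k * pi * t) = (cos (real (Suc k) * pi * t) + cos (real ?k' * pi * t)) / 2" for t
  proof (cases "k = 0")
   case False
   then have "real ?k' * pi * t = real k * pi * t - pi * t" by (simp add: of_nat_diff algebra_simps)
   moreover have "real (Suc k) * pi * t = real k * pi * t + pi * t" by (simp add: algebra_simps)
   ultimately show ?thesis by (simp only: cos_add cos_diff) simp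
  qed simp
  note key = this
  have "cos (pi * s p) ^ Suc j * cos (real k * pi * s p) =
   (cos (pi * s p) ^ j * cos (real (Suc k) * pi * s p) + cos (pi * s p) ^ j * cos (real ?k' * pi * s p)) / 2" for p
   unfolding power_Suc2 mult.assoc[of "cos (pi * s p) ^ j"] key
   by (simp only: distrib_left times_divide_eq_right)
  then have "(LINT p|M. g p * (cos (pi * s p) ^ Suc j * cos (real k * pi * s p))) =
   (LINT p|M. (g p * (cos (pi * s p) ^ j * cos (real (Suc k) * pi * s p))
    + g p * (cos (pi * s p) ^ j * cos (real ?k' * pi * s p))) / 2)"
   by (simp only: distrib_left times_divide_eq_right)
  also have "... = 0" using Suc.IH cint by (simp del: of_nat_Suc)
  finally show ?case .
 qed
 define b where "b y = a (arccos y / pi)" for y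
 have "continuous_on {-1..1} b" unfolding b_def by (intro continuous_on_compose2[OF a] continuous_intros) auto
 have ab: "a (s p) = b (cos (pi * s p))" if "p \<in> space M" for p
  using s(2)[OF that] by (simp add: b_def arccos_cos)
 have am: "(%p. a (s p)) \<in> borel_measurable M"
  by (rule measurable_compose[OF s(1) borel_measurable_continuous_onI[OF a]])
 have "compact (a ` {0..1})" using a by (intro compact_continuous_image) (auto intro: continuous_on_subset)
 from compact_imp_bounded[OF this] obtain B where B: "!!y. y \<in> a ` {0..1} ==> norm y <= B"
  unfolding bounded_iff by blast
 have ai: "integrable M (%p. g p * a (s p))" using s(2) B by (intro int[OF am, of B]) auto
 have "\<bar>LINT p|M. g p * a (s p)\<bar> <= e * (LINT p|M. \<bar>g p\<bar>)" if e: "e > 0" for e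
 proof -
  obtain q where q: "real_polynomial_function q" "!!x. x \<in> {-1..1} ==> \<bar>b x - q x\<bar> < e"
   using Stone_Weierstrass_real_polynomial_function[OF compact_Icc \<open>continuous_on {-1..1} b\<close> e] by blast
  then obtain c n where qs: "q = (%x. \<Sum>i\<le>n. c i * x ^ i)"
   using real_polynomial_function_iff_sum by blast
  have qi0: "integrable M (%p. g p * cos (pi * s p) ^ i)" for i using cint[of i 0] by simp
  have "(%p. g p * q (cos (pi * s p))) = (%p. \<Sum>i\<le>n. c i * (g p * cos (pi * s p) ^ i))"
   unfolding qs by (simp add: sum_distrib_left algebra_simps)
  then have q0: "(LINT p|M. g p * q (cos (pi * s p))) = 0" and qi: "integrable M (%p. g p * q (cos (pi * s p)))"
   using pc[of _ 0] qi0 by (auto simp: Bochner_Integration.integral_sum)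
  have "\<bar>LINT p|M. g p * a (s p)\<bar> = \<bar>LINT p|M. g p * a (s p) - g p * q (cos (pi * s p))\<bar>"
   using ai qi q0 by simp
  also have "... <= (LINT p|M. e * \<bar>g p\<bar>)"
  proof (rule order_trans[OF integral_abs_bound integral_mono])
   fix p assume p: "p \<in> space M"
   have "\<bar>b (cos (pi * s p)) - q (cos (pi * s p))\<bar> <= e" using q(2)[of "cos (pi * s p)"] by simp
   from mult_right_mono[OF this abs_ge_zero[of "g p"]]
   show "\<bar>g p * a (s p) - g p * q (cos (pi * s p))\<bar> <= e * \<bar>g p\<bar>"
    unfolding ab[OF p] right_diff_distrib[symmetric] abs_mult by (simp add: mult.commute)
  qed (use ai qi g in auto)
  finally show ?thesis by simp
 qed
 note le = this
 define K where "K = (LINT p|M. \<bar>g p\<bar>)"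
 have "K >= 0" by (simp add: K_def)
 show ?thesis
 proof (rule ccontr)
  assume nz: "\<not> ?thesis"
  let ?A = "\<bar>LINT p|M. g p * a (s p)\<bar>"
  \<comment> \<open>At this accuracy the bound is at most half of \<open>?A\<close>; taking
    \<open>K + 1\<close> avoids a division by zero.\<close>
  have "?A / (2 * (K + 1)) > 0" using nz \<open>K >= 0\<close> by simp
  from le[OF this] have "?A <= (?A / (2 * (K + 1))) * K" unfolding K_def .
  also have "... <= (?A / (2 * (K + 1))) * (K + 1)" using \<open>K >= 0\<close> by (intro mult_left_mono) auto
  also have "... = ?A / 2" using \<open>K >= 0\<close> by (simp add: field_simps)
  finally show False using nz by simp
 qed
qed

context strip
begin

section \<open>The cosine basis of the rectangle\<close>

definition cosx :: "nat => real => real" where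
 "cosx k x = cos (real k * pi * x)"

definition cosz :: "nat => real => real" where
 "cosz m z = cos (real m * pi / h * z)"

text \<open>The Neumann eigenfunctions of the rectangle. Their normal derivatives vanish on the
  boundary, so a weak derivative can be paired with their derivatives without any boundary condition
  on the function.\<close>

definition cosb :: "nat \<times> nat => field" where
 "cosb i p = cosx (fst i) (fst p) * cosz (snd i) (snd p)"

lemma smooth_cosx: "smooth (cosx k)" and smooth_cosz: "smooth (cosz m)"
 unfolding cosx_def[abs_def] cosz_def[abs_def] by (rule smooth_cos)+

lemma smooth_cosb: "smooth (cosb i)"
 unfolding cosb_def[abs_def] by (intro smooth_mult smooth_fst smooth_snd smooth_cosx smooth_cosz)

lemma deriv_cosx: "deriv (cosx k) = (%x. - (real k * pi) * sin (real k * pi * x))"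
 unfolding cosx_def[abs_def] by (rule ext, rule DERIV_imp_deriv) (auto intro!: derivative_eq_intros)

lemma deriv_cosz: "deriv (cosz m) = (%z. - (real m * pi / h) * sin (real m * pi / h * z))"
 unfolding cosz_def[abs_def] by (rule ext, rule DERIV_imp_deriv) (use h_pos in \<open>auto intro!: derivative_eq_intros\<close>)

lemma deriv2_cosx: "deriv (deriv (cosx k)) = (%x. - ((real k * pi)^2 * cosx k x))"
 unfolding deriv_cosx cosx_def
 by (rule ext, rule DERIV_imp_deriv) (auto intro!: derivative_eq_intros simp: power2_eq_square)

lemma deriv2_cosz: "deriv (deriv (cosz m)) = (%z. - ((real m * pi / h)^2 * cosz m z))"
 unfolding deriv_cosz cosz_def
 by (rule ext, rule DERIV_imp_deriv) (use h_pos in \<open>auto intro!: derivative_eq_intros simp: power2_eq_square\<close>)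

text \<open>The derivative of \<open>cosx\<close> vanishes at 0 and 1 and is therefore admissible in
  \<open>weak_deriv_tensor_limit\<close>. Differentiating it once more reproduces the cosine with
  its eigenvalue.\<close>

lemma inner_dx_cosb:
 assumes "f \<in> L2 D" "g \<in> L2 D" "has_weak_deriv D (1, 0) f g"
 shows "ip g (%p. px (cosb i) p) = (real (fst i) * pi)^2 * ip f (cosb i)"
proof -
 note sx = smooth_deriv(2)[OF smooth_cosx[of "fst i"]]
 have "ip g (%p. deriv (cosx (fst i)) (fst p) * cosz (snd i) (snd p))
  = - ip f (%p. deriv (deriv (cosx (fst i))) (fst p) * cosz (snd i) (snd p))"
  using weak_deriv_tensor_limit[OF _ assms sx smooth_cosz[of "snd i"]] 
  unfolding frechet_derivative_tensor[OF sx smooth_cosz[of "snd i"]] by (simp add: deriv_cosx)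
 then show ?thesis
  unfolding cosb_def[abs_def] frechet_derivative_tensor[OF smooth_cosx smooth_cosz] deriv2_cosx
  by (simp add: L2_inner_uminus_left L2_inner_sym[of D f] mult.assoc L2_inner_cmult_left)
qed

lemma inner_dz_cosb:
 assumes "f \<in> L2 D" "g \<in> L2 D" "has_weak_deriv D (0, 1) f g"
 shows "ip g (%p. py (cosb i) p) = (real (snd i) * pi / h)^2 * ip f (cosb i)"
proof -
 note sz = smooth_deriv(2)[OF smooth_cosz[of "snd i"]]
 have "deriv (cosz (snd i)) (- h) = 0" "deriv (cosz (snd i)) 0 = 0" using h_pos by (auto simp: deriv_cosz)
 then have "ip g (%p. cosx (fst i) (fst p) * deriv (cosz (snd i)) (snd p))
  = - ip f (%p. cosx (fst i) (fst p) * deriv (deriv (cosz (snd i))) (snd p))"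
  using weak_deriv_tensor_limit[OF _ assms smooth_cosx[of "fst i"] sz]
  unfolding frechet_derivative_tensor[OF smooth_cosx[of "fst i"] sz] by simp
 moreover have "(%p. cosx (fst i) (fst p) * - ((real (snd i) * pi / h)^2 * cosz (snd i) (snd p)))
  = (%p. - ((real (snd i) * pi / h)^2 * (cosx (fst i) (fst p) * cosz (snd i) (snd p))))"
  by (auto simp: algebra_simps)
 ultimately show ?thesis
  unfolding cosb_def[abs_def] frechet_derivative_tensor[OF smooth_cosx smooth_cosz] deriv2_cosz
  by (simp only: L2_inner_uminus_left L2_inner_sym[of D f] L2_inner_cmult_left minus_minus)
qed

abbreviation cosb_x :: "nat \<times> nat => field" where
 "cosb_x i \<equiv> %p. px (cosb i) p"

abbreviation cosb_z :: "nat \<times> nat => field" where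
 "cosb_z i \<equiv> %p. py (cosb i) p"

lemma cosb_L2: "cosb i \<in> L2 D" "cosb_x i \<in> L2 D" "cosb_z i \<in> L2 D"
 by (intro smooth_L2 smooth_frechet_L2 smooth_cosb)+

text \<open>The preceding identities with the smooth function \<open>cosb i\<close> and its
  classical derivative in place of \<open>f\<close> and \<open>g\<close>.\<close>

lemma inner_cosb_x: "ip (cosb_x i) (cosb_x j) = (real (fst j) * pi)^2 * ip (cosb i) (cosb j)"
 and inner_cosb_z: "ip (cosb_z i) (cosb_z j) = (real (snd j) * pi / h)^2 * ip (cosb i) (cosb j)"
 by (rule inner_dx_cosb inner_dz_cosb, auto intro: cosb_L2 smooth_has_weak_deriv smooth_cosb simp: Basis_real_pair)+

text \<open>The left side of \<open>inner_cosb_x\<close> is symmetric in \<open>i\<close> and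
  \<open>j\<close>, the eigenvalue on the right is not. If the frequencies differ in one variable,
  the inner product has to vanish; no integral is computed.\<close>

lemma cosb_orthogonal:
 assumes "i \<noteq> j"
 shows "ip (cosb i) (cosb j) = 0"
proof (cases "fst i = fst j")
 case False
 then have "(real (fst i) * pi)^2 \<noteq> (real (fst j) * pi)^2" by (simp add: power2_eq_iff_nonneg)
 then show ?thesis using inner_cosb_x[of i j] inner_cosb_x[of j i]
  by (simp add: L2_inner_sym[of D "cosb_x j"] L2_inner_sym[of D "cosb j"])
next
 case True
 with assms have "snd i \<noteq> snd j" by (simp add: prod_eq_iff)
 then have "(real (snd i) * pi / h)^2 \<noteq> (real (snd j) * pi / h)^2"
  using h_pos by (simp add: power2_eq_iff_nonneg)
 then show ?thesis using inner_cosb_z[of i j] inner_cosb_z[of j i]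
  by (simp add: L2_inner_sym[of D "cosb_z j"] L2_inner_sym[of D "cosb j"])
qed

text \<open>The one-dimensional statement is applied twice: in x with the z factor absorbed into
  \<open>f\<close>, then in z, rescaled to the unit interval by -z/h, with the x factor
  absorbed.\<close>

lemma cosb_complete:
 assumes f: "f \<in> L2 D" and orth: "!!i. ip f (cosb i) = 0"
 shows "AE p in ID. f p = 0"
proof (rule AE_zero_if_orthogonal_plateaus[OF L2_integrable_D[OF f]])
 fix n a b c d
 let ?a = "plateau n a b" and ?c = "plateau n c d"
 have sm: "fst \<in> borel_measurable (ID)" "(%p. - snd p / h) \<in> borel_measurable (ID)"
  using h_pos by (auto intro!: continuous_measurable_D continuous_intros)
 have fi: "integrable (ID) (%p. f p * k p)" if "smooth k" for k
  by (rule L2_mult_integrable[OF f smooth_L2[OF that]])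
 have 1: "(LINT p|ID. (f p * cosz m (snd p)) * ?a (fst p)) = 0" for m
 proof (rule orthogonal_cos_imp_orthogonal_continuous[of _ _ fst])
  show "integrable (ID) (%p. f p * cosz m (snd p))" by (intro fi smooth_snd smooth_cosz)
  show "(LINT p|ID. (f p * cosz m (snd p)) * cos (real k * pi * fst p)) = 0" for k
   using orth[of "(k, m)"] by (simp add: L2_inner_def cosb_def cosx_def mult_ac)
 qed (rule sm, auto simp: Dom_def intro!: smooth_continuous smooth_plateau)
 have 2: "(LINT p|ID. (f p * ?a (fst p)) * (%y. ?c (- h * y)) (- snd p / h)) = 0"
 proof (rule orthogonal_cos_imp_orthogonal_continuous[of _ _ "%p. - snd p / h"])
  show "integrable (ID) (%p. f p * ?a (fst p))" by (intro fi smooth_fst smooth_plateau)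
  have eq: "cos (real k * pi * (- z / h)) = cosz k z" for k z
   using cos_minus[of "real k * pi / h * z"] by (simp add: cosz_def)
  show "(LINT p|ID. (f p * ?a (fst p)) * cos (real k * pi * (- snd p / h))) = 0" for k
   unfolding eq using 1[of k] by (simp add: mult_ac)
  show "continuous_on UNIV (%y. ?c (- h * y))"
   using smooth_affine[OF smooth_plateau, of n c d 0 "- h"] by (intro smooth_continuous) simp
  show "0 <= - snd p / h & - snd p / h <= 1" if "p \<in> space (ID)" for p
   using that h_pos by (auto simp: Dom_def field_simps)
 qed (rule sm)
 then show "(LINT p|ID. f p * (?a (fst p) * ?c (snd p))) = 0" using h_pos by (simp add: mult.assoc)
qed

lemma has_weak_deriv_limit:
 assumes w: "!!n::nat. has_weak_deriv D e (f n) (g n)"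
  and f: "!!n. f n \<in> L2 D" "F \<in> L2 D" "(%n. nrm (%p. f n p - F p)) ----> 0"
  and g: "!!n. g n \<in> L2 D" "G \<in> L2 D" "(%n. nrm (%p. g n p - G p)) ----> 0"
 shows "has_weak_deriv D e F G" unfolding has_weak_deriv_def
proof (intro allI impI)
 fix ph assume t: "test_function D ph"
 note s = test_function_smooth[OF t]
 have "(%n. ip (f n) (%x. frechet_derivative ph (at x) e)) ----> ip F (%x. frechet_derivative ph (at x) e)"
  by (rule L2_inner_tendsto[OF f smooth_frechet_L2[OF s] smooth_frechet_L2[OF s]]) simp
 moreover have "(%n. - ip (g n) ph) ----> - ip G ph"
  by (intro tendsto_minus, rule L2_inner_tendsto[OF g smooth_L2[OF s] smooth_L2[OF s]]) simp
 moreover have "ip (f n) (%x. frechet_derivative ph (at x) e) = - ip (g n) ph" for n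
  using w[of n] t by (simp add: has_weak_deriv_def L2_inner_def)
 ultimately show "(LINT x|ID. F x * frechet_derivative ph (at x) e) = - (LINT x|ID. G x * ph x)"
  unfolding L2_inner_def[symmetric] by (auto intro: LIMSEQ_unique)
qed

text \<open>Pairing \<open>dx h f\<close> with \<open>cosb_x i\<close> gives the eigenvalue times
  the coefficient of \<open>f\<close>. Hence the derivatives of the partial sums are expansions with
  the same coefficients \<open>c\<close> in the orthogonal families \<open>cosb_x\<close> and
  \<open>cosb_z\<close>; they converge too, and by closedness their limits are the weak derivatives
  of \<open>f\<close>. The last conclusion is the spectral gap for these particular
  approximations.\<close>

lemma smooth_dense_aux:
 assumes f: "f \<in> W1"
 obtains F where "!!n::nat. smooth (F n)" "(%n. N1 (%p. F n p - f p)) ----> 0"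
  "!!n. (LINT p|ID. f p) = 0 ==>
   (nrm (F n))^2 <= max 1 h ^ 2 * ((nrm (dx h (F n)))^2 + (nrm (dz h (F n)))^2)"
proof -
 define \<nu> where "\<nu> i = ip (cosb i) (cosb i)" for i
 define c where "c i = ip f (cosb i) / \<nu> i" for i
 define J where "J n = ({..<n} \<times> {..<n} :: (nat \<times> nat) set)" for n
 define F where "F n p = (\<Sum>i\<in>J n. c i * cosb i p)" for n p
 have J: "finite (J n)" "m <= n ==> J m \<subseteq> J n" for m n by (auto simp: J_def)
 note fL = Sobolev1_L2[OF f] and x = dx_works[OF f] and z = dz_works[OF f]
 \<comment> \<open>Cauchy-Schwarz covers a possible zero norm, where the division in
   \<open>c\<close> gives the default 0.\<close>
 have c0: "ip f (cosb i) = c i * \<nu> i" for i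
 proof (cases "\<nu> i = 0")
  case True
  then show ?thesis using L2_Cauchy_Schwarz_square[OF fL cosb_L2(1)[of i]] by (simp add: \<nu>_def)
 qed (simp add: c_def)
 have sF: "smooth (F n)" for n unfolding F_def by (intro smooth_sum smooth_cmult smooth_cosb)
 have dF: "frechet_derivative (F n) (at p) v = (\<Sum>i\<in>J n. c i * frechet_derivative (cosb i) (at p) v)" for n p v
  unfolding F_def by (rule frechet_derivative_smooth_sum[OF J(1) smooth_cosb])
 obtain G where G: "G \<in> L2 D" "(%n. nrm (%p. F n p - G p)) ----> 0"
   "!!i n. i \<in> J n ==> ip G (cosb i) = c i * \<nu> i" unfolding F_def \<nu>_def
  by (rule orthogonal_series[where e=cosb and J=J and c=c and S=D and g=f])
   (use cosb_L2 cosb_orthogonal fL c0 J \<nu>_def in auto)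
 obtain Gx where Gx: "Gx \<in> L2 D" "(%n. nrm (%p. px (F n) p - Gx p)) ----> 0" unfolding dF
  by (rule orthogonal_series[where e=cosb_x and J=J and c=c and S=D and g="dx h f"])
   (use cosb_L2 x J in \<open>auto simp: inner_cosb_x cosb_orthogonal inner_dx_cosb[OF fL x] c0 \<nu>_def\<close>)
 obtain Gz where Gz: "Gz \<in> L2 D" "(%n. nrm (%p. py (F n) p - Gz p)) ----> 0" unfolding dF
  by (rule orthogonal_series[where e=cosb_z and J=J and c=c and S=D and g="dz h f"])
   (use cosb_L2 z J in \<open>auto simp: inner_cosb_z cosb_orthogonal inner_dz_cosb[OF fL z] c0 \<nu>_def\<close>)
 have "AE p in ID. f p - G p = 0"
 proof (rule cosb_complete)
  show "(%p. f p - G p) \<in> L2 D" by (intro L2_diff fL G)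
  show "ip (%p. f p - G p) (cosb i) = 0" for i using G(3)[of i "Suc (max (fst i) (snd i))"] c0[of i]
   by (simp add: L2_inner_diff_left fL G cosb_L2 J_def less_Suc_eq_le mem_Times_iff)
 qed
 then have fG: "AE p in ID. G p = f p" by eventually_elim simp
 have 0: "(%n. nrm (%p. F n p - f p)) ----> 0"
 proof -
  have "nrm (%p. F n p - f p) = nrm (%p. F n p - G p)" for n
   by (rule L2_norm_cong_AE[OF _ D_lebesgue]) (use fG in eventually_elim, simp)
  then show ?thesis using G(2) by simp
 qed
 have wd: "has_weak_deriv D (1, 0) f Gx" "has_weak_deriv D (0, 1) f Gz"
  by (rule has_weak_deriv_limit[OF _ smooth_L2[OF sF] fL 0 smooth_frechet_L2[OF sF] Gx]
    has_weak_deriv_limit[OF _ smooth_L2[OF sF] fL 0 smooth_frechet_L2[OF sF] Gz],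
    simp add: smooth_has_weak_deriv sF Basis_real_pair)+
 note ae = Sobolev1I(2,3)[OF fL Gx(1) wd(1) Gz(1) wd(2)]
 note sS = smooth_Sobolev1[OF sF]
 have nx: "nrm (dx h (%p. F n p - f p)) = nrm (%p. px (F n) p - Gx p)" for n
  unfolding dx_diff_norm[OF sS(1) f]
  by (rule L2_norm_cong_AE[OF _ D_lebesgue]) (use ae(1) sS(2)[of n] in eventually_elim, simp)
 have nz: "nrm (dz h (%p. F n p - f p)) = nrm (%p. py (F n) p - Gz p)" for n
  unfolding dx_diff_norm[OF sS(1) f]
  by (rule L2_norm_cong_AE[OF _ D_lebesgue]) (use ae(2) sS(3)[of n] in eventually_elim, simp)
 have "(%n. N1 (%p. F n p - f p)) ----> 0 + 0 + 0" unfolding N1_def nx nz by (intro tendsto_add 0 Gx Gz)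
 moreover have "(nrm (F n))^2 <= max 1 h ^ 2 * ((nrm (dx h (F n)))^2 + (nrm (dz h (F n)))^2)"
  if mean: "(LINT p|ID. f p) = 0" for n
 proof -
  \<comment> \<open>\<open>cosb (0, 0)\<close> is the constant 1, so this coefficient is a multiple
    of the mean.\<close>
  have "c (0, 0) = 0" using mean by (simp add: c_def L2_inner_def cosb_def cosx_def cosz_def)
  have \<nu>0: "\<nu> i >= 0" for i by (simp add: \<nu>_def L2_inner_nonneg)
  have "(nrm (dx h (F n)))^2 = (\<Sum>i\<in>J n. (c i)^2 * ip (cosb_x i) (cosb_x i))"
   unfolding L2_norm_cong_AE[OF sS(2) D_lebesgue] dF
   by (rule orthogonal_sum_norm) (auto simp: cosb_L2 inner_cosb_x cosb_orthogonal J)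
  moreover have "(nrm (dz h (F n)))^2 = (\<Sum>i\<in>J n. (c i)^2 * ip (cosb_z i) (cosb_z i))"
   unfolding L2_norm_cong_AE[OF sS(3) D_lebesgue] dF
   by (rule orthogonal_sum_norm) (auto simp: cosb_L2 inner_cosb_z cosb_orthogonal J)
  ultimately have g: "max 1 h ^ 2 * ((nrm (dx h (F n)))^2 + (nrm (dz h (F n)))^2)
   = (\<Sum>i\<in>J n. (max 1 h ^ 2 * ((real (fst i) * pi)^2 + (real (snd i) * pi / h)^2)) * ((c i)^2 * \<nu> i))"
   by (simp add: inner_cosb_x inner_cosb_z \<nu>_def sum.distrib[symmetric] sum_distrib_left algebra_simps)
  have "(nrm (F n))^2 = (\<Sum>i\<in>J n. (c i)^2 * \<nu> i)"
   unfolding F_def \<nu>_def by (rule orthogonal_sum_norm) (auto simp: cosb_L2 cosb_orthogonal J)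
  also have "... <= (\<Sum>i\<in>J n. (max 1 h ^ 2 * ((real (fst i) * pi)^2 + (real (snd i) * pi / h)^2)) * ((c i)^2 * \<nu> i))"
  proof (rule sum_mono)
   fix i
   show "(c i)^2 * \<nu> i <= (max 1 h ^ 2 * ((real (fst i) * pi)^2 + (real (snd i) * pi / h)^2)) * ((c i)^2 * \<nu> i)"
   proof (cases "i = (0, 0)")
    case True
    then show ?thesis using \<open>c (0, 0) = 0\<close> by simp
   next
    case False
    have pi1: "1 <= pi" using pi_gt3 by simp
    \<comment> \<open>The eigenvalue of a nonconstant mode is at least 1 or at least 1/h^2,
      according to the variable in which it oscillates.\<close>
    have "1 <= max 1 h ^ 2 * ((real (fst i) * pi)^2 + (real (snd i) * pi / h)^2)"
    proof (cases "fst i = 0")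
     case True
     with False have "1 <= real (snd i)" by (cases i) auto
     then have "1 <= real (snd i) * pi" using pi1 mult_mono[of 1 "real (snd i)" 1 pi] by simp
     then have "1 * 1 <= (max 1 h / h) * (real (snd i) * pi)"
      using h_pos by (intro mult_mono) (auto simp: field_simps)
     then have "1 <= (max 1 h * (real (snd i) * pi / h))^2" by (intro one_le_power) (simp add: field_simps)
     then show ?thesis using True by (simp add: power_mult_distrib power_divide)
    next
     case F: False
     then have "1 <= real (fst i)" by linarith
     then have "1 <= real (fst i) * pi" using pi1 mult_mono[of 1 "real (fst i)" 1 pi] by simp
     then have "1 * 1 <= max 1 h ^ 2 * ((real (fst i) * pi)^2 + (real (snd i) * pi / h)^2)"
      by (intro mult_mono add_increasing2 one_le_power) auto
     then show ?thesis by simp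
    qed
    from mult_right_mono[OF this, of "(c i)^2 * \<nu> i"] show ?thesis using \<nu>0 by simp
   qed
  qed
  finally show ?thesis unfolding g .
 qed
 ultimately show thesis using that[OF sF] by simp
qed

lemma smooth_dense:
 assumes "f \<in> W1"
 obtains F where "!!n::nat. smooth (F n)" "(%n. N1 (%p. F n p - f p)) ----> 0"
 by (rule smooth_dense_aux[OF assms]) (rule that, assumption, assumption)

lemma Poincare_mean:
 assumes f: "f \<in> W1" and mean: "(LINT p|ID. f p) = 0"
 shows "(nrm f)^2 <= max 1 h ^ 2 * ((nrm (dx h f))^2 + (nrm (dz h f))^2)"
proof -
 obtain F where F: "!!n::nat. smooth (F n)" "(%n. N1 (%p. F n p - f p)) ----> 0"
  "!!n. (LINT p|ID. f p) = 0 ==> (nrm (F n))^2 <= max 1 h ^ 2 * ((nrm (dx h (F n)))^2 + (nrm (dz h (F n)))^2)"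
  by (rule smooth_dense_aux[OF f]) (rule that, assumption, assumption, assumption)
 note sS = smooth_Sobolev1(1)[OF F(1)]
 note t = N1_tendstoD[OF sS f F(2)]
 show ?thesis
 proof (rule LIMSEQ_le)
  show "(%n. (nrm (F n))^2) ----> (nrm f)^2"
   by (intro tendsto_power L2_norm_tendsto[OF Sobolev1_L2[OF sS] Sobolev1_L2[OF f] t(1)])
  show "(%n. max 1 h ^ 2 * ((nrm (dx h (F n)))^2 + (nrm (dz h (F n)))^2))
   ----> max 1 h ^ 2 * ((nrm (dx h f))^2 + (nrm (dz h f))^2)"
   by (intro tendsto_intros L2_norm_tendsto[OF dx_works(1)[OF sS] dx_works(1)[OF f] t(2)]
     L2_norm_tendsto[OF dz_works(1)[OF sS] dz_works(1)[OF f] t(3)])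
 qed (use F(3)[OF mean] in blast)
qed

end

section \<open>Traces, Poincare inequalities and anisotropic bounds\<close>

lemma LIMSEQ_null_bound:
 fixes a b :: "nat => real"
 assumes "!!n. 0 <= a n" "!!n. a n <= b n" "b ----> 0"
 shows "a ----> 0" by (rule tendsto_sandwich[OF _ _ tendsto_const assms(3)]) (simp_all add: assms)

text \<open>Fatou's lemma for the squares. It carries the product estimates from smooth
  approximations to Sobolev functions, and membership in \<open>L2\<close> comes with the
  bound.\<close>

lemma L2_Fatou:
 assumes a: "!!n::nat. a n \<in> L2 S" and lim: "AE x in lebesgue_on S. (%n. a n x) ----> b x"
  and bm: "b \<in> borel_measurable (lebesgue_on S)"
  and B: "!!n. (L2_norm S (a n))^2 <= B n" "B ----> C"
 shows "b \<in> L2 S" "(L2_norm S b)^2 <= C"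
proof -
 have B0: "B n >= 0" for n using B(1)[of n] zero_le_power2[of "L2_norm S (a n)"] by linarith
 then have C0: "C >= 0" by (intro LIMSEQ_le_const[OF B(2)]) auto
 have "(\<integral>\<^sup>+x. ennreal ((b x)^2) \<partial>lebesgue_on S) = (\<integral>\<^sup>+x. liminf (%n. ennreal ((a n x)^2)) \<partial>lebesgue_on S)"
 proof (intro nn_integral_cong_AE)
  show "AE x in lebesgue_on S. ennreal ((b x)^2) = liminf (%n. ennreal ((a n x)^2))" using lim
  proof eventually_elim
   case (elim x)
   then have "(%n. ennreal ((a n x)^2)) ----> ennreal ((b x)^2)" by (intro tendsto_ennrealI tendsto_intros)
   from lim_imp_Liminf[OF _ this] show ?case by simp
  qed
 qed
 also have "... <= liminf (%n. \<integral>\<^sup>+x. ennreal ((a n x)^2) \<partial>lebesgue_on S)"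
  using L2_measurable[OF a] by (intro nn_integral_liminf) auto
 also have "(%n. \<integral>\<^sup>+x. ennreal ((a n x)^2) \<partial>lebesgue_on S) = (%n. ennreal ((L2_norm S (a n))^2))"
  unfolding L2_norm_square_integral by (intro ext nn_integral_eq_integral L2_square_integrable a) auto
 also have "liminf ... <= liminf (%n. ennreal (B n))"
  by (intro Liminf_mono always_eventually allI ennreal_leI B)
 also have "... = ennreal C" using B(2) by (intro lim_imp_Liminf tendsto_ennrealI) auto
 finally have le: "(\<integral>\<^sup>+x. ennreal ((b x)^2) \<partial>lebesgue_on S) <= ennreal C" .
 have i: "integrable (lebesgue_on S) (%x. (b x)^2)"
 proof (rule integrableI_bounded)
  show "(\<integral>\<^sup>+x. ennreal (norm ((b x)^2)) \<partial>lebesgue_on S) < \<infinity>"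
   using le_less_trans[OF le] by (simp add: ennreal_less_top)
 qed (use bm in auto)
 then show "b \<in> L2 S" using bm by (simp add: L2_def)
 have "ennreal ((L2_norm S b)^2) = (\<integral>\<^sup>+x. ennreal ((b x)^2) \<partial>lebesgue_on S)"
  unfolding L2_norm_square_integral by (intro nn_integral_eq_integral[symmetric] i) auto
 also note le
 finally show "(L2_norm S b)^2 <= C" using C0 by (simp add: ennreal_le_iff)
qed

lemma const_L2: "S \<in> lmeasurable ==> (%_. c) \<in> L2 S"
 using finite_measure.integrable_const[OF finite_measure_lebesgue_on] by (simp add: L2_def)

lemma integral_square_le:
 assumes f: "f \<in> L2 S" and S: "S \<in> lmeasurable"
 shows "(LINT x|lebesgue_on S. f x)^2 <= measure lebesgue S * (LINT x|lebesgue_on S. (f x)^2)"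
proof -
 have "L2_inner S (%_. 1) (%_. 1) = measure lebesgue S"
  using S by (simp add: L2_inner_def measure_restrict_space)
 then show ?thesis using L2_Cauchy_Schwarz_square[OF f const_L2[OF S, of 1]]
  by (simp add: L2_inner_def power2_eq_square mult.commute)
qed

context strip
begin

lemma measure_IZ: "measure lebesgue {- h<..<0} = h" and measure_IX: "measure lebesgue {0<..<1::real} = 1"
 using h_pos by (auto simp: measure_def)

lemma lmeasurable_intervals: "{- h<..<0} \<in> lmeasurable" "{0<..<1::real} \<in> lmeasurable" by auto

section \<open>Integration along lines and traces\<close>

lemma L2_sections:
 assumes "G \<in> L2 D"
 shows "AE x in IX. (%z. G (x, z)) \<in> L2 {- h<..<0}" "AE z in IZ. (%x. G (x, z)) \<in> L2 {0<..<1}"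
proof -
 note i1 = L2_integrable_D[OF assms] and i2 = L2_square_integrable[OF assms]
 have "AE x in IX. integrable IZ (%z. G (x, z))" "AE x in IX. integrable IZ (%z. (G (x, z))^2)"
  using Fubini_D(1)[OF i1] Fubini_D(1)[OF i2] by auto
 then show "AE x in IX. (%z. G (x, z)) \<in> L2 {- h<..<0}" by eventually_elim (auto simp: L2_def)
 have "AE z in IZ. integrable IX (%x. G (x, z))" "AE z in IZ. integrable IX (%x. (G (x, z))^2)"
  using Fubini_D(4)[OF i1] Fubini_D(4)[OF i2] by auto
 then show "AE z in IZ. (%x. G (x, z)) \<in> L2 {0<..<1}" by eventually_elim (auto simp: L2_def)
qed

lemma L2_vertical_integral:
 assumes G: "G \<in> L2 D"
 shows "(%x. LINT z|IZ. G (x, z)) \<in> L2 {0<..<1}"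
  and "L2_norm {0<..<1} (%x. LINT z|IZ. G (x, z)) <= sqrt h * nrm G"
proof -
 note i1 = L2_integrable_D[OF G] and i2 = L2_square_integrable[OF G]
 have le: "AE x in IX. (LINT z|IZ. G (x, z))^2 <= h * (LINT z|IZ. (G (x, z))^2)" using L2_sections(1)[OF G]
 proof eventually_elim
  case (elim x)
  from integral_square_le[OF elim lmeasurable_intervals(1)] show ?case unfolding measure_IZ .
 qed
 have m: "(%x. LINT z|IZ. G (x, z)) \<in> borel_measurable IX" using Fubini_D(2)[OF i1] by auto
 have i: "integrable IX (%x. h * (LINT z|IZ. (G (x, z))^2))" using Fubini_D(2)[OF i2] by simp
 have ii: "integrable IX (%x. (LINT z|IZ. G (x, z))^2)"
 proof (rule integrable_dominated[OF i])
  show "AE x in IX. norm ((LINT z|IZ. G (x, z))^2) <= norm (h * (LINT z|IZ. (G (x, z))^2))"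
   using le by eventually_elim simp
 qed (use m in auto)
 with m show "(%x. LINT z|IZ. G (x, z)) \<in> L2 {0<..<1}" by (simp add: L2_def)
 have "(L2_norm {0<..<1} (%x. LINT z|IZ. G (x, z)))^2 <= (LINT x|IX. h * (LINT z|IZ. (G (x, z))^2))"
  unfolding L2_norm_square_integral by (intro integral_mono_AE ii i le)
 also have "... = h * (nrm G)^2" using Fubini_D(3)[OF i2] by (simp add: L2_norm_square_integral)
 also have "... = (sqrt h * nrm G)^2" using h_pos by (simp add: power_mult_distrib)
 finally show "L2_norm {0<..<1} (%x. LINT z|IZ. G (x, z)) <= sqrt h * nrm G"
  by (rule power2_le_imp_le) (use h_pos in simp)
qed

lemma L2_horizontal_integral:
 assumes G: "G \<in> L2 D"
 shows "(%z. LINT x|IX. G (x, z)) \<in> L2 {- h<..<0}"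
  and "L2_norm {- h<..<0} (%z. LINT x|IX. G (x, z)) <= nrm G"
proof -
 note i1 = L2_integrable_D[OF G] and i2 = L2_square_integrable[OF G]
 have le: "AE z in IZ. (LINT x|IX. G (x, z))^2 <= (LINT x|IX. (G (x, z))^2)" using L2_sections(2)[OF G]
 proof eventually_elim
  case (elim z)
  from integral_square_le[OF elim lmeasurable_intervals(2)] show ?case unfolding measure_IX by simp
 qed
 have m: "(%z. LINT x|IX. G (x, z)) \<in> borel_measurable IZ" using Fubini_D(5)[OF i1] by auto
 have i: "integrable IZ (%z. LINT x|IX. (G (x, z))^2)" using Fubini_D(5)[OF i2] by simp
 have ii: "integrable IZ (%z. (LINT x|IX. G (x, z))^2)"
 proof (rule integrable_dominated[OF i])
  show "AE z in IZ. norm ((LINT x|IX. G (x, z))^2) <= norm (LINT x|IX. (G (x, z))^2)"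
   using le by eventually_elim simp
 qed (use m in auto)
 with m show "(%z. LINT x|IX. G (x, z)) \<in> L2 {- h<..<0}" by (simp add: L2_def)
 have "(L2_norm {- h<..<0} (%z. LINT x|IX. G (x, z)))^2 <= (LINT z|IZ. LINT x|IX. (G (x, z))^2)"
  unfolding L2_norm_square_integral by (intro integral_mono_AE ii i le)
 also have "... = (nrm G)^2" using Fubini_D(6)[OF i2] by (simp add: L2_norm_square_integral)
 finally show "L2_norm {- h<..<0} (%z. LINT x|IX. G (x, z)) <= nrm G" by (rule power2_le_imp_le) simp
qed

text \<open>Integrating \<open>((z + ka) f)\<^sub>z\<close> over a vertical line recovers the value of \<open>f\<close> at the top for
  \<open>ka = h\<close> and at the bottom for \<open>ka = 0\<close>; \<open>side_trace\<close> does the same on horizontal lines, at the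
  left for \<open>ka = 1\<close> and at the right for \<open>ka = 0\<close>. Applied to weak derivatives, these formulas
  give the traces.\<close>
definition end_trace :: "real => field => real => real" where
 "end_trace ka f x = (LINT z|IZ. (f (x, z) + (z + ka) * dz h f (x, z)) / h)"

definition side_trace :: "real => field => real => real" where
 "side_trace ka f z = (LINT x|IX. f (x, z) + (x - ka) * dx h f (x, z))"

lemma end_integrand_L2:
 assumes "f \<in> W1"
 shows "(%p. (f p + (snd p + ka) * dz h f p) / h) \<in> L2 D"
  and "nrm (%p. (f p + (snd p + ka) * dz h f p) / h) <= (1 + (h + \<bar>ka\<bar>)) / h * N1 f"
proof -
 have b: "\<bar>snd p + ka\<bar> <= h + \<bar>ka\<bar>" if "p \<in> D" for p
  using that by (auto simp: Dom_def)
 have m: "(%p. snd p + ka) \<in> borel_measurable (ID)" by (intro continuous_measurable_D continuous_intros)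
 have w: "(%p. (snd p + ka) * dz h f p) \<in> L2 D"
  by (rule L2_bounded_mult[OF dz_works(1)[OF assms] m]) (auto intro!: AE_I2 b)
 have s: "(%p. f p + (snd p + ka) * dz h f p) \<in> L2 D" by (intro L2_add w Sobolev1_L2 assms)
 have e: "(%p. (f p + (snd p + ka) * dz h f p) / h) = (%p. (1 / h) * (f p + (snd p + ka) * dz h f p))" by simp
 show "(%p. (f p + (snd p + ka) * dz h f p) / h) \<in> L2 D" unfolding e by (rule L2_cmult[OF s])
 have "nrm (%p. (snd p + ka) * dz h f p) <= (h + \<bar>ka\<bar>) * nrm (dz h f)"
 proof (rule power2_le_imp_le)
  have "(nrm (%p. (snd p + ka) * dz h f p))^2 <= (LINT p|ID. (h + \<bar>ka\<bar>)^2 * (dz h f p)^2)"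
   unfolding L2_norm_square_integral
  proof (rule integral_mono)
   fix p assume "p \<in> space (ID)"
   then have "(snd p + ka)^2 <= (h + \<bar>ka\<bar>)^2"
    using b[of p] h_pos by (intro abs_le_square_iff[THEN iffD1]) auto
   then show "((snd p + ka) * dz h f p)^2 <= (h + \<bar>ka\<bar>)^2 * (dz h f p)^2"
    by (simp add: power_mult_distrib mult_right_mono)
  qed (use L2_square_integrable[OF w] L2_square_integrable[OF dz_works(1)[OF assms]] in auto)
  then show "(nrm (%p. (snd p + ka) * dz h f p))^2 <= ((h + \<bar>ka\<bar>) * nrm (dz h f))^2"
   by (simp add: L2_norm_square_integral power_mult_distrib)
 qed (use h_pos in auto)
 also have "... <= (h + \<bar>ka\<bar>) * N1 f" using h_pos by (intro mult_left_mono N1_bounds) auto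
 finally have "nrm (%p. f p + (snd p + ka) * dz h f p) <= N1 f + (h + \<bar>ka\<bar>) * N1 f"
  using L2_triangle[OF Sobolev1_L2[OF assms] w] N1_bounds(1)[of f] by linarith
 then show "nrm (%p. (f p + (snd p + ka) * dz h f p) / h) <= (1 + (h + \<bar>ka\<bar>)) / h * N1 f"
  unfolding e L2_norm_cmult using h_pos by (simp add: field_simps)
qed

lemma side_integrand_L2:
 assumes "f \<in> W1"
 shows "(%p. f p + (fst p - ka) * dx h f p) \<in> L2 D"
  and "nrm (%p. f p + (fst p - ka) * dx h f p) <= (2 + \<bar>ka\<bar>) * N1 f"
proof -
 have b: "\<bar>fst p - ka\<bar> <= 1 + \<bar>ka\<bar>" if "p \<in> D" for p
  using that by (auto simp: Dom_def)
 have m: "(%p. fst p - ka) \<in> borel_measurable (ID)" by (intro continuous_measurable_D continuous_intros)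
 have w: "(%p. (fst p - ka) * dx h f p) \<in> L2 D"
  by (rule L2_bounded_mult[OF dx_works(1)[OF assms] m]) (auto intro!: AE_I2 b)
 show s: "(%p. f p + (fst p - ka) * dx h f p) \<in> L2 D" by (intro L2_add w Sobolev1_L2 assms)
 have "nrm (%p. (fst p - ka) * dx h f p) <= (1 + \<bar>ka\<bar>) * nrm (dx h f)"
 proof (rule power2_le_imp_le)
  have "(nrm (%p. (fst p - ka) * dx h f p))^2 <= (LINT p|ID. (1 + \<bar>ka\<bar>)^2 * (dx h f p)^2)"
   unfolding L2_norm_square_integral
  proof (rule integral_mono)
   fix p assume "p \<in> space (ID)"
   then have "(fst p - ka)^2 <= (1 + \<bar>ka\<bar>)^2"
    using b[of p] by (intro abs_le_square_iff[THEN iffD1]) auto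
   then show "((fst p - ka) * dx h f p)^2 <= (1 + \<bar>ka\<bar>)^2 * (dx h f p)^2"
    by (simp add: power_mult_distrib mult_right_mono)
  qed (use L2_square_integrable[OF w] L2_square_integrable[OF dx_works(1)[OF assms]] in auto)
  then show "(nrm (%p. (fst p - ka) * dx h f p))^2 <= ((1 + \<bar>ka\<bar>) * nrm (dx h f))^2"
   by (simp add: L2_norm_square_integral power_mult_distrib)
 qed auto
 also have "... <= (1 + \<bar>ka\<bar>) * N1 f" by (intro mult_left_mono N1_bounds) auto
 finally show "nrm (%p. f p + (fst p - ka) * dx h f p) <= (2 + \<bar>ka\<bar>) * N1 f"
  using L2_triangle[OF Sobolev1_L2[OF assms] w] N1_bounds(1)[of f] by (simp add: algebra_simps)
qed

lemma end_trace_L2: "f \<in> W1 ==> end_trace ka f \<in> L2 {0<..<1}"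
 and end_trace_bound: "f \<in> W1 ==> L2_norm {0<..<1} (end_trace ka f) <= sqrt h * ((1 + (h + \<bar>ka\<bar>)) / h) * N1 f"
proof -
 assume f: "f \<in> W1"
 note e = end_integrand_L2[OF f, of ka]
 show "end_trace ka f \<in> L2 {0<..<1}"
  using L2_vertical_integral(1)[OF e(1)] by (simp add: end_trace_def[abs_def])
 have "L2_norm {0<..<1} (end_trace ka f) <= sqrt h * nrm (%p. (f p + (snd p + ka) * dz h f p) / h)"
  using L2_vertical_integral(2)[OF e(1)] by (simp add: end_trace_def[abs_def])
 also have "... <= sqrt h * ((1 + (h + \<bar>ka\<bar>)) / h * N1 f)"
  using e(2) h_pos by (intro mult_left_mono) auto
 finally show "L2_norm {0<..<1} (end_trace ka f) <= sqrt h * ((1 + (h + \<bar>ka\<bar>)) / h) * N1 f" by simp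
qed

lemma side_trace_L2: "f \<in> W1 ==> side_trace ka f \<in> L2 {- h<..<0}"
 and side_trace_bound: "f \<in> W1 ==> L2_norm {- h<..<0} (side_trace ka f) <= (2 + \<bar>ka\<bar>) * N1 f"
proof -
 assume f: "f \<in> W1"
 note e = side_integrand_L2[OF f, of ka]
 show "side_trace ka f \<in> L2 {- h<..<0}"
  using L2_horizontal_integral(1)[OF e(1)] by (simp add: side_trace_def[abs_def])
 have "L2_norm {- h<..<0} (side_trace ka f) <= nrm (%p. f p + (fst p - ka) * dx h f p)"
  using L2_horizontal_integral(2)[OF e(1)] by (simp add: side_trace_def[abs_def])
 also note e(2)
 finally show "L2_norm {- h<..<0} (side_trace ka f) <= (2 + \<bar>ka\<bar>) * N1 f" .
qed

lemma integral_sections_cong: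
 fixes F G :: "field"
 assumes "AE p in ID. F p = G p"
 shows "AE x in IX. (LINT z|IZ. F (x, z)) = (LINT z|IZ. G (x, z))"
  and "AE z in IZ. (LINT x|IX. F (x, z)) = (LINT x|IX. G (x, z))"
proof -
 show "AE x in IX. (LINT z|IZ. F (x, z)) = (LINT z|IZ. G (x, z))" using AE_D_sections(1)[OF assms]
 proof (rule eventually_mono)
  fix x assume "AE z in IZ. F (x, z) = G (x, z)"
  from integral_lebesgue_on_cong_AE(1)[OF this] show "(LINT z|IZ. F (x, z)) = (LINT z|IZ. G (x, z))" by simp
 qed
 show "AE z in IZ. (LINT x|IX. F (x, z)) = (LINT x|IX. G (x, z))" using AE_D_sections(2)[OF assms]
 proof (rule eventually_mono)
  fix z assume "AE x in IX. F (x, z) = G (x, z)"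
  from integral_lebesgue_on_cong_AE(1)[OF this] show "(LINT x|IX. F (x, z)) = (LINT x|IX. G (x, z))" by simp
 qed
qed

lemma integral_sections_add:
 assumes "F \<in> L2 D" "G \<in> L2 D"
 shows "AE x in IX. (LINT z|IZ. c * F (x, z) + d * G (x, z)) = c * (LINT z|IZ. F (x, z)) + d * (LINT z|IZ. G (x, z))"
  and "AE z in IZ. (LINT x|IX. c * F (x, z) + d * G (x, z)) = c * (LINT x|IX. F (x, z)) + d * (LINT x|IX. G (x, z))"
proof -
 note i = L2_integrable_D[OF assms(1)] L2_integrable_D[OF assms(2)]
 show "AE x in IX. (LINT z|IZ. c * F (x, z) + d * G (x, z)) = c * (LINT z|IZ. F (x, z)) + d * (LINT z|IZ. G (x, z))"
  using Fubini_D(1)[OF i(1)] Fubini_D(1)[OF i(2)] by eventually_elim simp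
 show "AE z in IZ. (LINT x|IX. c * F (x, z) + d * G (x, z)) = c * (LINT x|IX. F (x, z)) + d * (LINT x|IX. G (x, z))"
  using Fubini_D(4)[OF i(1)] Fubini_D(4)[OF i(2)] by eventually_elim simp
qed

lemma end_trace_diff:
 assumes f: "f \<in> W1" and g: "g \<in> W1"
 shows "AE x in IX. end_trace ka (%p. f p - g p) x = end_trace ka f x - end_trace ka g x"
proof -
 let ?I = "%f p. (f p + (snd p + ka) * dz h f p) / h"
 have "AE p in ID. ?I (%p. f p - g p) p = 1 * ?I f p + (- 1) * ?I g p" using Sobolev1_diff(3)[OF f g]
 proof eventually_elim
  case (elim p)
  show ?case unfolding elim by (simp add: algebra_simps diff_divide_distrib add_divide_distrib)
 qed
 from integral_sections_cong(1)[OF this] integral_sections_add(1)[OF end_integrand_L2(1)[OF f] end_integrand_L2(1)[OF g], of 1 ka "-1" ka]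
 show ?thesis unfolding end_trace_def by eventually_elim simp
qed

lemma side_trace_diff:
 assumes f: "f \<in> W1" and g: "g \<in> W1"
 shows "AE z in IZ. side_trace ka (%p. f p - g p) z = side_trace ka f z - side_trace ka g z"
proof -
 let ?I = "%f p. f p + (fst p - ka) * dx h f p"
 have "AE p in ID. ?I (%p. f p - g p) p = 1 * ?I f p + (- 1) * ?I g p" using Sobolev1_diff(2)[OF f g]
 proof eventually_elim
  case (elim p)
  show ?case unfolding elim by (simp add: algebra_simps)
 qed
 from integral_sections_cong(2)[OF this] integral_sections_add(2)[OF side_integrand_L2(1)[OF f] side_integrand_L2(1)[OF g], of 1 ka "-1" ka]
 show ?thesis unfolding side_trace_def by eventually_elim simp
qed

lemma end_trace_smooth:
 assumes F: "smooth F" and ka: "ka = h & z0 = 0 \<or> ka = 0 & z0 = - h"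
 shows "AE x in IX. end_trace ka F x = F (x, z0)"
proof -
 have c: "continuous_on UNIV (%p. (F p + (snd p + ka) * py F p) / h)"
  using h_pos by (intro continuous_intros smooth_continuous smooth_frechet_derivative F) auto
 have "AE p in ID. (F p + (snd p + ka) * dz h F p) / h = (F p + (snd p + ka) * py F p) / h"
  using smooth_Sobolev1(3)[OF F] by eventually_elim simp
 from integral_sections_cong(1)[OF this] show ?thesis
 proof (rule eventually_mono)
  fix x
  have "(LINT z|IZ. (F (x, z) + (z + ka) * py F (x, z)) / h) = (0 + ka) * F (x, 0) / h - (- h + ka) * F (x, - h) / h"
   using h_pos continuous_on_line(2)[OF c]
  proof (intro integral_deriv_open_interval[where f="%z. (z + ka) * F (x, z) / h"])
   show "((%z. (z + ka) * F (x, z) / h) has_real_derivative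
     (F (x, z) + (z + ka) * py F (x, z)) / h) (at z)" for z
    by (rule DERIV_cong[OF DERIV_cdivide[OF DERIV_mult[OF DERIV_add[OF DERIV_ident DERIV_const] smooth_line_derivative(2)[OF F]]]])
     simp
  qed auto
  also have "... = F (x, z0)" using ka h_pos by auto
  finally show "(LINT z|IZ. (F (x, z) + (snd (x, z) + ka) * dz h F (x, z)) / h) =
    (LINT z|IZ. (F (x, z) + (snd (x, z) + ka) * py F (x, z)) / h) ==>
    end_trace ka F x = F (x, z0)" by (simp only: end_trace_def snd_conv)
 qed
qed

lemma side_trace_smooth:
 assumes F: "smooth F" and ka: "ka = 1 & x0 = 0 \<or> ka = 0 & x0 = 1"
 shows "AE z in IZ. side_trace ka F z = F (x0, z)"
proof -
 have c: "continuous_on UNIV (%p. F p + (fst p - ka) * px F p)"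
  by (intro continuous_intros smooth_continuous smooth_frechet_derivative F)
 have "AE p in ID. F p + (fst p - ka) * dx h F p = F p + (fst p - ka) * px F p"
  using smooth_Sobolev1(2)[OF F] by eventually_elim simp
 from integral_sections_cong(2)[OF this] show ?thesis
 proof (rule eventually_mono)
  fix z
  have "(LINT x|IX. F (x, z) + (x - ka) * px F (x, z)) = (1 - ka) * F (1, z) - (0 - ka) * F (0, z)"
   using continuous_on_line(1)[OF c]
  proof (intro integral_deriv_open_interval[where f="%x. (x - ka) * F (x, z)"])
   show "((%x. (x - ka) * F (x, z)) has_real_derivative
     F (x, z) + (x - ka) * px F (x, z)) (at x)" for x
    by (rule DERIV_cong[OF DERIV_mult[OF DERIV_diff[OF DERIV_ident DERIV_const] smooth_line_derivative(1)[OF F]]])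
     simp
  qed auto
  also have "... = F (x0, z)" using ka by auto
  finally show "(LINT x|IX. F (x, z) + (fst (x, z) - ka) * dx h F (x, z)) =
    (LINT x|IX. F (x, z) + (fst (x, z) - ka) * px F (x, z)) ==>
    side_trace ka F z = F (x0, z)" by (simp only: side_trace_def fst_conv)
 qed
qed

text \<open>\<open>end_trace\<close> is linear up to null sets, bounded by \<open>N1\<close>, and
  equal to the restriction on smooth functions.\<close>

lemma end_trace_tendsto:
 assumes F: "!!n::nat. smooth (F n)" "(%n. N1 (%p. F n p - f p)) ----> 0" and f: "f \<in> W1"
  and ka: "ka = h & z0 = 0 \<or> ka = 0 & z0 = - h"
 shows "(%n. L2_norm {0<..<1} (%x. F n (x, z0) - end_trace ka f x)) ----> 0"
proof -
 note S = smooth_Sobolev1(1)[OF F(1)]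
 let ?C = "sqrt h * ((1 + (h + \<bar>ka\<bar>)) / h)"
 have b: "L2_norm {0<..<1} (%x. F n (x, z0) - end_trace ka f x) <= ?C * N1 (%p. F n p - f p)" for n
 proof -
  have "AE x in IX. F n (x, z0) - end_trace ka f x = end_trace ka (%p. F n p - f p) x"
   using end_trace_diff[OF S[of n] f, of ka] end_trace_smooth[OF F(1) ka, of n] by eventually_elim simp
  then have "L2_norm {0<..<1} (%x. F n (x, z0) - end_trace ka f x) = L2_norm {0<..<1} (end_trace ka (%p. F n p - f p))"
   by (rule L2_norm_cong_AE) simp
  then show ?thesis using end_trace_bound[OF Sobolev1_diff(1)[OF S f]] by simp
 qed
 have "(%n. ?C * N1 (%p. F n p - f p)) ----> 0" by (intro tendsto_mult_right_zero F)
 from LIMSEQ_null_bound[OF L2_norm_nonneg b this] show ?thesis .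
qed

lemma side_trace_tendsto:
 assumes F: "!!n::nat. smooth (F n)" "(%n. N1 (%p. F n p - f p)) ----> 0" and f: "f \<in> W1"
  and ka: "ka = 1 & x0 = 0 \<or> ka = 0 & x0 = 1"
 shows "(%n. L2_norm {- h<..<0} (%z. F n (x0, z) - side_trace ka f z)) ----> 0"
proof -
 note S = smooth_Sobolev1(1)[OF F(1)]
 have b: "L2_norm {- h<..<0} (%z. F n (x0, z) - side_trace ka f z) <= (2 + \<bar>ka\<bar>) * N1 (%p. F n p - f p)" for n
 proof -
  have "AE z in IZ. F n (x0, z) - side_trace ka f z = side_trace ka (%p. F n p - f p) z"
   using side_trace_diff[OF S[of n] f, of ka] side_trace_smooth[OF F(1) ka, of n] by eventually_elim simp
  then have "L2_norm {- h<..<0} (%z. F n (x0, z) - side_trace ka f z) = L2_norm {- h<..<0} (side_trace ka (%p. F n p - f p))"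
   by (rule L2_norm_cong_AE) simp
  then show ?thesis using side_trace_bound[OF Sobolev1_diff(1)[OF S f]] by simp
 qed
 have "(%n. (2 + \<bar>ka\<bar>) * N1 (%p. F n p - f p)) ----> 0" by (intro tendsto_mult_right_zero F)
 from LIMSEQ_null_bound[OF L2_norm_nonneg b this] show ?thesis .
qed

lemma continuous_L2_line:
 assumes "continuous_on UNIV (f :: real => real)"
 shows "f \<in> L2 {a<..<b}"
proof -
 have "continuous_on {a..b} f" "continuous_on {a..b} (%x. (f x)^2)"
  using assms by (auto intro!: continuous_intros intro: continuous_on_subset)
 then show ?thesis
  using integral_open_interval(1)[of a b f] integral_open_interval(1)[of a b "%x. (f x)^2"] by (auto simp: L2_def)
qed

lemma L2_limit_unique:
 assumes "!!n::nat. a n \<in> L2 S" "g \<in> L2 S" "k \<in> L2 S" "S \<in> sets lebesgue"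
  "(%n. L2_norm S (%x. a n x - g x)) ----> 0" "(%n. L2_norm S (%x. a n x - k x)) ----> 0"
 shows "AE x in lebesgue_on S. g x = k x"
proof -
 have "L2_norm S (%x. g x - k x) <= L2_norm S (%x. a n x - g x) + L2_norm S (%x. a n x - k x)" for n
  using L2_triangle_dist[OF assms(2,1,3), of n] L2_norm_minus_commute[of S g "a n"] by simp
 then have "L2_norm S (%x. g x - k x) <= 0 + 0" by (intro LIMSEQ_le_const[OF tendsto_add[OF assms(5,6)]]) auto
 then have "L2_norm S (%x. g x - k x) = 0" using L2_norm_nonneg[of S "%x. g x - k x"] by linarith
 from L2_norm_eq_0_AE[OF L2_diff[OF assms(2,3)] this] show ?thesis by eventually_elim simp
qed

text \<open>Uniqueness of traces: whichever smooth approximation witnesses \<open>has_trace\<close>,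
  its restrictions also converge to \<open>end_trace\<close>, which depends on \<open>f\<close>
  alone. Zero trace conditions thereby become equations between explicit integrals.\<close>

lemma has_trace_end:
 assumes t: "has_trace D {0<..<1} (%x. (x, z0)) f g" and ka: "ka = h & z0 = 0 \<or> ka = 0 & z0 = - h"
 shows "AE x in IX. g x = end_trace ka f x"
proof -
 obtain F where f: "f \<in> W1" and g: "g \<in> L2 {0<..<1}" and F: "!!n::nat. smooth (F n)"
   "(%n. N1 (%x. F n x - f x)) ----> 0" "(%n. L2_norm {0<..<1} (%s. F n (s, z0) - g s)) ----> 0"
  using t unfolding has_trace_def Sobolev1_norm_tendsto_iff by blast
 show ?thesis
  by (rule L2_limit_unique[OF continuous_L2_line[OF continuous_on_line(1)[OF smooth_continuous[OF F(1)]]]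
     g end_trace_L2[OF f] _ F(3) end_trace_tendsto[OF F(1,2) f ka]]) simp
qed

lemma has_trace_side:
 assumes t: "has_trace D {- h<..<0} (%z. (x0, z)) f g" and ka: "ka = 1 & x0 = 0 \<or> ka = 0 & x0 = 1"
 shows "AE z in IZ. g z = side_trace ka f z"
proof -
 obtain F where f: "f \<in> W1" and g: "g \<in> L2 {- h<..<0}" and F: "!!n::nat. smooth (F n)"
   "(%n. N1 (%x. F n x - f x)) ----> 0" "(%n. L2_norm {- h<..<0} (%s. F n (x0, s) - g s)) ----> 0"
  using t unfolding has_trace_def Sobolev1_norm_tendsto_iff by blast
 show ?thesis
  by (rule L2_limit_unique[OF continuous_L2_line[OF continuous_on_line(2)[OF smooth_continuous[OF F(1)]]]
     g side_trace_L2[OF f] _ F(3) side_trace_tendsto[OF F(1,2) f ka]]) simp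
qed

text \<open>Density provides a trace, so the choice in \<open>top_trace\<close> picks a genuine one,
  and uniqueness identifies it.\<close>

lemma top_trace_eq:
 assumes f: "f \<in> W1"
 shows "AE x in IX. top_trace h f x = end_trace h f x" "top_trace h f \<in> L2 {0<..<1}"
proof -
 obtain F where F: "!!n::nat. smooth (F n)" "(%n. N1 (%p. F n p - f p)) ----> 0"
  by (rule smooth_dense[OF f]) (rule that, assumption, assumption)
 have "has_trace D {0<..<1} (%x. (x, 0)) f (end_trace h f)" unfolding has_trace_def Sobolev1_norm_tendsto_iff
  using f F end_trace_L2[OF f, of h] end_trace_tendsto[OF F f, of h 0] by blast
 then have *: "has_trace D {0<..<1} (%x. (x, 0)) f (top_trace h f)"
  unfolding top_trace_def by (rule someI[where P="has_trace D {0<..<1} (%x. (x, 0)) f"])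
 show "AE x in IX. top_trace h f x = end_trace h f x" by (rule has_trace_end[OF *]) simp
 show "top_trace h f \<in> L2 {0<..<1}" using * by (simp add: has_trace_def)
qed

text \<open>The fundamental theorem of calculus between \<open>z\<close> and \<open>z0\<close>,
  combined with s^2 \<le> 2 t^2 + 2 (s - t)^2. One factor \<open>h\<close> comes from Cauchy-Schwarz
  on the vertical line, the other from the integration over \<open>z\<close>.\<close>

lemma end_Poincare_smooth:
 assumes F: "smooth F" and z0: "z0 = 0 \<or> z0 = - h"
 shows "(nrm F)^2 <= 2 * h * (L2_norm {0<..<1} (%x. F (x, z0)))^2 + 2 * h^2 * (nrm (dz h F))^2"
proof -
 let ?Fz = "%p. py F p"
 have c: "continuous_on UNIV F" "continuous_on UNIV ?Fz" "continuous_on UNIV (%p. (?Fz p)^2)" "continuous_on UNIV (%p. (F p)^2)"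
  by (intro continuous_intros smooth_continuous smooth_frechet_derivative F)+
 have pt: "(F (x, z))^2 <= 2 * (F (x, z0))^2 + 2 * h * (LINT z|IZ. (?Fz (x, z))^2)" if z: "- h < z" "z < 0" for x z
 proof -
  define a where "a = min z z0" define b where "b = max z z0"
  have ab: "- h <= a" "a <= b" "b <= 0" "b - a <= h" using z z0 h_pos by (auto simp: a_def b_def)
  have "(LINT z|lebesgue_on {a<..<b}. ?Fz (x, z)) = F (x, b) - F (x, a)"
   by (rule integral_deriv_open_interval[OF ab(2)]) (auto intro!: smooth_line_derivative F continuous_on_line c)
  moreover have "(LINT z|lebesgue_on {a<..<b}. ?Fz (x, z))^2 <= measure lebesgue {a<..<b} * (LINT z|lebesgue_on {a<..<b}. (?Fz (x, z))^2)"
   by (intro integral_square_le continuous_L2_line continuous_on_line c) auto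
  moreover have "measure lebesgue {a<..<b} = b - a" using ab by (simp add: measure_def)
  moreover have "(LINT z|lebesgue_on {a<..<b}. (?Fz (x, z))^2) <= (LINT z|IZ. (?Fz (x, z))^2)"
   using ab by (intro integral_mono_lebesgue_on_AE integral_open_interval(1) continuous_on_line c) auto
  ultimately have "(F (x, b) - F (x, a))^2 <= (b - a) * (LINT z|IZ. (?Fz (x, z))^2)"
   using ab by (smt (verit) mult_left_mono)
  also have "... <= h * (LINT z|IZ. (?Fz (x, z))^2)" using ab by (intro mult_right_mono) auto
  finally have "(F (x, z) - F (x, z0))^2 <= h * (LINT z|IZ. (?Fz (x, z))^2)"
   by (cases "z <= z0") (auto simp: a_def b_def min_def max_def power2_commute)
  moreover have "s^2 <= 2 * t^2 + 2 * (s - t)^2" for s t :: real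
   using zero_le_power2[of "s - 2 * t"] by (simp add: power2_eq_square algebra_simps)
  from this[of "F (x, z)" "F (x, z0)"] show ?thesis using calculation by linarith
 qed
 have i1: "integrable IX (%x. (F (x, z0))^2)"
  using integral_open_interval(1)[of 0 1] continuous_on_line(1)[OF c(4)] by blast
 have i2: "integrable IX (%x. LINT z|IZ. (?Fz (x, z))^2)"
  by (rule Fubini_D(2)[OF continuous_integrable_D[OF c(3)]])
 have "(nrm F)^2 = (LINT x|IX. LINT z|IZ. (F (x, z))^2)"
  unfolding L2_norm_square_integral by (rule Fubini_D(3)[OF continuous_integrable_D[OF c(4)]])
 also have "... <= (LINT x|IX. h * (2 * (F (x, z0))^2 + 2 * h * (LINT z|IZ. (?Fz (x, z))^2)))"
 proof (rule integral_mono)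
  fix x
  have "(LINT z|IZ. (F (x, z))^2) <= (LINT z|IZ. 2 * (F (x, z0))^2 + 2 * h * (LINT z|IZ. (?Fz (x, z))^2))"
   using pt integral_open_interval(1)[of "- h" 0] continuous_on_line(2)[OF c(4)]
   by (intro integral_mono finite_measure.integrable_const finite_measure_IZ) auto
  then show "(LINT z|IZ. (F (x, z))^2) <= h * (2 * (F (x, z0))^2 + 2 * h * (LINT z|IZ. (?Fz (x, z))^2))"
   by (simp add: measure_restrict_space measure_IZ)
 qed (use i1 i2 Fubini_D(2)[OF continuous_integrable_D[OF c(4)]] in auto)
 also have "... = 2 * h * (L2_norm {0<..<1} (%x. F (x, z0)))^2 + 2 * h^2 * (nrm ?Fz)^2"
 proof -
  have "(LINT x|IX. h * (2 * (F (x, z0))^2 + 2 * h * (LINT z|IZ. (?Fz (x, z))^2)))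
    = h * (2 * (LINT x|IX. (F (x, z0))^2) + 2 * h * (LINT x|IX. LINT z|IZ. (?Fz (x, z))^2))"
   using i1 i2 by simp
  then show ?thesis unfolding L2_norm_square_integral Fubini_D(3)[OF continuous_integrable_D[OF c(3)]]
   by (simp add: power2_eq_square[of h] algebra_simps)
 qed
 also have "nrm ?Fz = nrm (dz h F)"
  by (rule L2_norm_cong_AE[OF _ D_lebesgue]) (use smooth_Sobolev1(3)[OF F] in eventually_elim, simp)
 finally show ?thesis .
qed

lemma end_Poincare:
 assumes f: "f \<in> W1" and ka: "ka = h \<or> ka = 0"
 shows "(nrm f)^2 <= 2 * h * (L2_norm {0<..<1} (end_trace ka f))^2 + 2 * h^2 * (nrm (dz h f))^2"
proof -
 obtain z0 where z0: "ka = h & z0 = 0 \<or> ka = 0 & z0 = - h" using ka by blast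
 then have z0': "z0 = 0 \<or> z0 = - h" by blast
 obtain F where F: "!!n::nat. smooth (F n)" "(%n. N1 (%p. F n p - f p)) ----> 0"
  by (rule smooth_dense[OF f]) (rule that, assumption, assumption)
 note sS = smooth_Sobolev1(1)[OF F(1)]
 note t = N1_tendstoD[OF sS f F(2)]
 have l: "(%x. F n (x, z0)) \<in> L2 {0<..<1}" for n
  by (intro continuous_L2_line continuous_on_line smooth_continuous F)
 show ?thesis
 proof (rule LIMSEQ_le)
  show "(%n. (nrm (F n))^2) ----> (nrm f)^2"
   by (intro tendsto_power L2_norm_tendsto[OF Sobolev1_L2[OF sS] Sobolev1_L2[OF f] t(1)])
  show "(%n. 2 * h * (L2_norm {0<..<1} (%x. F n (x, z0)))^2 + 2 * h^2 * (nrm (dz h (F n)))^2)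
   ----> 2 * h * (L2_norm {0<..<1} (end_trace ka f))^2 + 2 * h^2 * (nrm (dz h f))^2"
   by (intro tendsto_intros L2_norm_tendsto[OF l end_trace_L2[OF f] end_trace_tendsto[OF F f z0]]
     L2_norm_tendsto[OF dz_works(1)[OF sS] dz_works(1)[OF f] t(3)])
 qed (use end_Poincare_smooth[OF F(1) z0'] in blast)
qed

end

section \<open>The bilinear and trilinear forms\<close>

context strip
begin

lemma AE_D_fst:
 assumes "AE x in IX. P x"
 shows "AE p in ID. P (fst p)"
proof -
 have "AE x in lborel. x \<in> {0<..<1} --> P x" using assms by (simp add: AE_lebesgue_on_iff_lborel)
 then obtain N where N: "N \<in> null_sets lborel" "{x. \<not> (x \<in> {0<..<1} --> P x)} \<subseteq> N"
  by (auto elim!: AE_E simp: null_sets_def)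
 have "N \<times> UNIV \<in> null_sets (lborel \<Otimes>\<^sub>M (lborel :: real measure))"
  using N(1) by (intro null_setsI) (auto simp: null_sets_def lborel.emeasure_pair_measure_Times)
 then have "AE p in lborel. p \<notin> N \<times> (UNIV :: real set)"
  unfolding lborel_prod by (rule AE_not_in)
 then show ?thesis unfolding AE_lebesgue_on_iff_lborel[OF D_borel]
  by (rule eventually_mono) (use N(2) in \<open>auto simp: Dom_def\<close>)
qed

text \<open>Replaces the chosen trace by \<open>end_trace\<close>, which is linear and
  bounded.\<close>

lemma a_form_eq:
 assumes f: "f \<in> W1" and g: "g \<in> W1"
 shows "a_form h \<alpha> f g = ip (dx h f) (dx h g) + ip (dz h f) (dz h g)
  + \<alpha> * L2_inner {0<..<1} (end_trace h f) (end_trace h g)"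
proof -
 have "(LINT p|ID. dx h f p * dx h g p + dz h f p * dz h g p)
   = ip (dx h f) (dx h g) + ip (dz h f) (dz h g)" unfolding L2_inner_def
  by (intro integral_plus L2_mult_integrable dx_works(1) dz_works(1) f g)
 moreover have "(LINT x|IX. top_trace h f x * top_trace h g x) = L2_inner {0<..<1} (end_trace h f) (end_trace h g)"
  using L2_inner_cong_AE[OF top_trace_eq(1)[OF f] top_trace_eq(1)[OF g]] by (simp add: L2_inner_def)
 ultimately show ?thesis by (simp add: a_form_def)
qed

lemma a_form_sym: "a_form h \<alpha> f g = a_form h \<alpha> g f" by (simp add: a_form_def mult.commute)

lemma a_form_diff_left:
 assumes f: "f \<in> W1" and g: "g \<in> W1" and k: "k \<in> W1"
 shows "a_form h \<alpha> (%p. f p - g p) k = a_form h \<alpha> f k - a_form h \<alpha> g k"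
proof -
 note d = Sobolev1_diff[OF f g]
 have X: "ip (dx h (%p. f p - g p)) (dx h k) = ip (dx h f) (dx h k) - ip (dx h g) (dx h k)"
  using L2_inner_cong_AE[OF d(2) _ D_lebesgue, of "dx h k" "dx h k"]
  by (simp add: L2_inner_diff_left dx_works f g k)
 have Z: "ip (dz h (%p. f p - g p)) (dz h k) = ip (dz h f) (dz h k) - ip (dz h g) (dz h k)"
  using L2_inner_cong_AE[OF d(3) _ D_lebesgue, of "dz h k" "dz h k"]
  by (simp add: L2_inner_diff_left dz_works f g k)
 have E: "L2_inner {0<..<1} (end_trace h (%p. f p - g p)) (end_trace h k)
   = L2_inner {0<..<1} (end_trace h f) (end_trace h k) - L2_inner {0<..<1} (end_trace h g) (end_trace h k)"
  using L2_inner_cong_AE[OF end_trace_diff[OF f g, of h], of "end_trace h k" "end_trace h k"]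
  by (simp add: L2_inner_diff_left end_trace_L2 f g k)
 show ?thesis
  unfolding a_form_eq[OF f k] a_form_eq[OF g k] a_form_eq[OF d(1) k] X Z E by (simp add: algebra_simps)
qed

lemma a_form_diff_right:
 assumes "f \<in> W1" "g \<in> W1" "k \<in> W1"
 shows "a_form h \<alpha> k (%p. f p - g p) = a_form h \<alpha> k f - a_form h \<alpha> k g"
 using a_form_diff_left[OF assms] by (simp add: a_form_sym)

text \<open>Two gradient terms with constant 1 each, and \<open>end_trace_bound\<close> for
  \<open>ka = h\<close> applied to both arguments of the boundary term.\<close>

definition a_const :: "real => real" where
 "a_const \<alpha> = 2 + \<bar>\<alpha>\<bar> * (sqrt h * ((1 + (h + h)) / h))^2"

lemma a_form_bound:
 assumes f: "f \<in> W1" and g: "g \<in> W1"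
 shows "\<bar>a_form h \<alpha> f g\<bar> <= a_const \<alpha> * (N1 f * N1 g)"
proof -
 let ?C = "sqrt h * ((1 + (h + h)) / h)"
 have C: "?C >= 0" using h_pos by simp
 have "\<bar>ip (dx h f) (dx h g)\<bar> <= N1 f * N1 g"
  using L2_Cauchy_Schwarz[OF dx_works(1)[OF f] dx_works(1)[OF g]] mult_mono[OF N1_bounds(2)[of f] N1_bounds(2)[of g]]
  by simp
 moreover have "\<bar>ip (dz h f) (dz h g)\<bar> <= N1 f * N1 g"
  using L2_Cauchy_Schwarz[OF dz_works(1)[OF f] dz_works(1)[OF g]] mult_mono[OF N1_bounds(3)[of f] N1_bounds(3)[of g]]
  by simp
 moreover have "\<bar>L2_inner {0<..<1} (end_trace h f) (end_trace h g)\<bar> <= (?C * N1 f) * (?C * N1 g)"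
  using L2_Cauchy_Schwarz[OF end_trace_L2[OF f] end_trace_L2[OF g], of h h]
   mult_mono[OF end_trace_bound[OF f, of h] end_trace_bound[OF g, of h]] C h_pos by simp
 then have "\<bar>\<alpha> * L2_inner {0<..<1} (end_trace h f) (end_trace h g)\<bar> <= \<bar>\<alpha>\<bar> * ((?C * N1 f) * (?C * N1 g))"
  unfolding abs_mult by (intro mult_left_mono) auto
 ultimately have "\<bar>a_form h \<alpha> f g\<bar> <= N1 f * N1 g + N1 f * N1 g + \<bar>\<alpha>\<bar> * ((?C * N1 f) * (?C * N1 g))"
  unfolding a_form_eq[OF f g] by linarith
 also have "... = a_const \<alpha> * (N1 f * N1 g)"
  by (simp only: a_const_def power2_eq_square) (simp only: algebra_simps)
 finally show ?thesis .
qed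

section \<open>Coercivity of the forms\<close>

abbreviation grad2 :: "field => real" where
 "grad2 f \<equiv> (nrm (dx h f))^2 + (nrm (dz h f))^2"

lemma V_norm_square:
 assumes f: "f \<in> W1" and "\<alpha> >= 0"
 shows "(V_norm h \<alpha> f)^2 = grad2 f + \<alpha> * (L2_norm {0<..<1} (end_trace h f))^2"
proof -
 have "a_form h \<alpha> f f = grad2 f + \<alpha> * (L2_norm {0<..<1} (end_trace h f))^2"
  by (simp add: a_form_eq[OF f f] L2_norm_square)
 moreover have "... >= 0" using assms(2) by simp
 ultimately show ?thesis by (simp add: V_norm_def)
qed

lemma V_norm_square_ge:
 assumes "f \<in> W1" and "\<alpha> >= 0"
 shows "grad2 f <= (V_norm h \<alpha> f)^2" using V_norm_square[OF assms] assms(2) by simp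

lemma V_norm_square_a_form:
 assumes "f \<in> W1" and "\<alpha> >= 0"
 shows "(V_norm h \<alpha> f)^2 = a_form h \<alpha> f f"
 by (simp add: V_norm_square[OF assms] a_form_eq assms(1) L2_norm_square)

lemma V_norm_nonneg: "V_norm h \<alpha> f >= 0" if "f \<in> W1" "\<alpha> >= 0"
 using V_norm_square_ge[OF that] by (simp add: V_norm_def a_form_eq that L2_norm_square[symmetric])

text \<open>The spaces \<open>V\<^sub>i\<close> enter only through this property, in which \<open>f - g\<close> need not be known to lie in \<open>V\<close>.\<close>
definition coercive :: "real => field set => bool" where
 "coercive \<alpha> V \<longleftrightarrow> V \<subseteq> W1 &
  (\<exists>C. \<forall>f\<in>V. N1 f <= C * V_norm h \<alpha> f & (\<forall>g\<in>V. N1 (%p. f p - g p) <= C * V_norm h \<alpha> (%p. f p - g p)))"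

lemma N1_le_V_norm:
 assumes f: "f \<in> W1" and "\<alpha> >= 0" and C: "C >= 0" "(nrm f)^2 <= C^2 * (V_norm h \<alpha> f)^2"
 shows "N1 f <= (C + 2) * V_norm h \<alpha> f"
proof -
 note V = V_norm_square_ge[OF f assms(2)] and V0 = V_norm_nonneg[OF f assms(2)]
 have "nrm (dx h f) <= V_norm h \<alpha> f" "nrm (dz h f) <= V_norm h \<alpha> f"
  by (rule power2_le_imp_le[OF _ V0], use V zero_le_power2[of "nrm (dx h f)"]
    zero_le_power2[of "nrm (dz h f)"] in linarith)+
 moreover have "nrm f <= C * V_norm h \<alpha> f"
  by (rule power2_le_imp_le) (use C V0 in \<open>simp_all add: power_mult_distrib\<close>)
 ultimately show ?thesis by (simp add: N1_def algebra_simps)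
qed

text \<open>A vanishing bottom trace reduces \<open>end_Poincare\<close> for \<open>ka = 0\<close>
  to a bound by the vertical derivative alone, and it is inherited by differences.\<close>

lemma coercive_bottom:
 assumes "\<alpha> >= 0" and V: "!!f. f \<in> V ==> f \<in> W1 & (AE x in IX. end_trace 0 f x = 0)"
 shows "coercive \<alpha> V"
proof -
 have key: "N1 f <= (sqrt (2 * h^2) + 2) * V_norm h \<alpha> f" if f: "f \<in> W1" "AE x in IX. end_trace 0 f x = 0" for f
 proof (rule N1_le_V_norm[OF f(1) assms(1)])
  have "L2_norm {0<..<1} (end_trace 0 f) = 0" using L2_norm_cong_AE[OF f(2)] by simp
  then have "(nrm f)^2 <= 2 * h^2 * (nrm (dz h f))^2" using end_Poincare[OF f(1), of 0] by simp
  also have "... <= 2 * h^2 * (V_norm h \<alpha> f)^2"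
   using V_norm_square_ge[OF f(1) assms(1)] zero_le_power2[of "nrm (dx h f)"]
   by (intro mult_left_mono) (linarith, simp)
  finally show "(nrm f)^2 <= (sqrt (2 * h^2))^2 * (V_norm h \<alpha> f)^2" by simp
 qed simp
 have "N1 (%p. f p - g p) <= (sqrt (2 * h^2) + 2) * V_norm h \<alpha> (%p. f p - g p)" if "f \<in> V" "g \<in> V" for f g
 proof (rule key)
  have s: "f \<in> W1" "g \<in> W1" and z: "AE x in IX. end_trace 0 f x = 0" "AE x in IX. end_trace 0 g x = 0"
   using V that by auto
  show "(%p. f p - g p) \<in> W1" by (rule Sobolev1_diff[OF s])
  show "AE x in IX. end_trace 0 (%p. f p - g p) x = 0"
   using end_trace_diff[OF s, of 0] z by eventually_elim simp
 qed
 then show ?thesis unfolding coercive_def using key V by blast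
qed

lemma zero_trace_facts:
 assumes "zero_trace_lateral_bottom h f"
 shows "AE x in IX. end_trace 0 f x = 0" "AE z in IZ. side_trace 1 f z = 0" "AE z in IZ. side_trace 0 f z = 0"
 using has_trace_end[of "- h" f "%_. 0" 0] has_trace_side[of 0 f "%_. 0" 1] has_trace_side[of 1 f "%_. 0" 0] assms
 unfolding zero_trace_lateral_bottom_def by (auto elim!: eventually_mono)

lemma coercive_V_1: "\<alpha> >= 0 ==> coercive \<alpha> (V_1 h)"
 and coercive_V_2: "\<alpha> >= 0 ==> coercive \<alpha> (V_2 h)"
 by (rule coercive_bottom; auto simp: V_1_def V_2_def intro: zero_trace_facts)+

text \<open>For \<alpha> > 0 the boundary term controls the top trace and with it the L2 norm; for
  \<alpha> = 0 the zero mean built into the space does so through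
  \<open>Poincare_mean\<close>.\<close>

lemma coercive_V_3:
 assumes "\<alpha> >= 0"
 shows "coercive \<alpha> (V_3 h \<alpha>)"
proof (cases "\<alpha> > 0")
 case True
 \<comment> \<open>From \<open>end_Poincare\<close> at the top, where the squared trace is charged
   to the boundary term of the form at the price of a division by \<alpha>.\<close>
 define C where "C = sqrt (2 * h / \<alpha> + 2 * h^2)"
 have C2: "C^2 = 2 * h / \<alpha> + 2 * h^2" and C0: "C >= 0" unfolding C_def using True h_pos by auto
 have key: "N1 f <= (C + 2) * V_norm h \<alpha> f" if f: "f \<in> W1" for f
 proof (rule N1_le_V_norm[OF f assms C0])
  let ?e = "(L2_norm {0<..<1} (end_trace h f))^2" and ?z = "(nrm (dz h f))^2"
  have V: "?z + \<alpha> * ?e <= (V_norm h \<alpha> f)^2"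
   using V_norm_square[OF f assms] zero_le_power2[of "nrm (dx h f)"] by linarith
  have ae: "0 <= \<alpha> * ?e" using True by simp
  have "(nrm f)^2 <= 2 * h * ?e + 2 * h^2 * ?z" by (rule end_Poincare[OF f]) simp
  also have "2 * h * ?e = (2 * h / \<alpha>) * (\<alpha> * ?e)" using True by simp
  also have "(2 * h / \<alpha>) * (\<alpha> * ?e) + 2 * h^2 * ?z <= (2 * h / \<alpha>) * (V_norm h \<alpha> f)^2 + 2 * h^2 * (V_norm h \<alpha> f)^2"
   using V ae True h_pos zero_le_power2[of "nrm (dz h f)"] by (intro add_mono mult_left_mono) (linarith | simp)+
  also have "... = C^2 * (V_norm h \<alpha> f)^2" by (simp add: C2 distrib_right)
  finally show "(nrm f)^2 <= C^2 * (V_norm h \<alpha> f)^2" .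
 qed
 then have "N1 (%p. f p - g p) <= (C + 2) * V_norm h \<alpha> (%p. f p - g p)" if "f \<in> W1" "g \<in> W1" for f g
  using Sobolev1_diff(1)[OF that] by blast
 moreover have "V_3 h \<alpha> \<subseteq> W1" by (auto simp: V_3_def)
 ultimately show ?thesis unfolding coercive_def using key by blast
next
 case False
 define C where "C = max 1 h"
 have C0: "C >= 0" by (simp add: C_def)
 have key: "N1 f <= (C + 2) * V_norm h \<alpha> f" if f: "f \<in> W1" "(LINT p|ID. f p) = 0" for f
 proof (rule N1_le_V_norm[OF f(1) assms C0])
  have "(nrm f)^2 <= C^2 * grad2 f" using Poincare_mean[OF f] by (simp add: C_def)
  also have "... <= C^2 * (V_norm h \<alpha> f)^2" by (intro mult_left_mono V_norm_square_ge f assms) simp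
  finally show "(nrm f)^2 <= C^2 * (V_norm h \<alpha> f)^2" .
 qed
 have V: "f \<in> W1 & (LINT p|ID. f p) = 0" if "f \<in> V_3 h \<alpha>" for f
  using that False by (auto simp: V_3_def H_3_def)
 have "N1 (%p. f p - g p) <= (C + 2) * V_norm h \<alpha> (%p. f p - g p)" if "f \<in> V_3 h \<alpha>" "g \<in> V_3 h \<alpha>" for f g
 proof (rule key)
  have s: "f \<in> W1" "g \<in> W1" and z: "(LINT p|ID. f p) = 0" "(LINT p|ID. g p) = 0" using V that by auto
  show "(%p. f p - g p) \<in> W1" by (rule Sobolev1_diff[OF s])
  show "(LINT p|ID. f p - g p) = 0"
   using z L2_integrable_D[OF Sobolev1_L2[OF s(1)]] L2_integrable_D[OF Sobolev1_L2[OF s(2)]] by simp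
 qed
 then show ?thesis unfolding coercive_def using key V by blast
qed

section \<open>The vertical antiderivative\<close>

lemma int_to_top_cong:
 assumes "AE p in ID. f p = g p"
 shows "AE p in ID. int_to_top f p = int_to_top g p"
proof -
 \<comment> \<open>The value at (x, z) involves a whole vertical segment, so the exceptional set is
   sought as a cylinder over a null set of x.\<close>
 have "AE x in IX. \<forall>z. - h < z --> int_to_top f (x, z) = int_to_top g (x, z)"
  using AE_D_sections(1)[OF assms]
 proof eventually_elim
  case (elim x)
  show ?case
  proof (intro allI impI)
   fix z assume "- h < z"
   then have "AE \<zeta> in lebesgue_on {z<..<0}. f (x, \<zeta>) = g (x, \<zeta>)"
    using elim by (auto simp: AE_lebesgue_on_iff_lborel elim!: eventually_mono)
   from integral_lebesgue_on_cong_AE(1)[OF this] show "int_to_top f (x, z) = int_to_top g (x, z)"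
    by (simp add: int_to_top_def)
  qed
 qed
 from AE_D_fst[OF this] show ?thesis unfolding AE_lebesgue_on_iff_lborel[OF D_borel]
  by (rule eventually_mono) (auto simp: Dom_def)
qed

lemma int_to_top_measurable:
 assumes "f \<in> L2 D"
 shows "int_to_top f \<in> borel_measurable (ID)"
proof -
 obtain g where g: "g \<in> borel_measurable borel" "AE p in ID. f p = g p" "!!p. p \<notin> D ==> g p = 0"
  using borel_representative[OF D_borel L2_measurable[OF assms]] by blast
 have gb: "g \<in> borel_measurable (borel \<Otimes>\<^sub>M borel)" using g(1) by (simp add: borel_prod)
 \<comment> \<open>The variable limit of integration is moved into a factor, so that joint
   measurability follows from that of a parameter integral over the whole line.\<close>
 define k where "k p = (LINT \<zeta>|lborel. (if snd p < \<zeta> & \<zeta> < 0 then 1 else 0) * g (fst p, \<zeta>))" for p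
 have "(%p. (if snd (fst p) < snd p & snd p < 0 then 1 else 0) * g (fst (fst p), snd p))
  \<in> borel_measurable ((borel \<Otimes>\<^sub>M borel) \<Otimes>\<^sub>M (borel :: real measure))"
  using gb by measurable
 then have "(%p. LINT \<zeta>|lborel. (if snd p < \<zeta> & \<zeta> < 0 then 1 else 0) * g (fst p, \<zeta>)) \<in> borel_measurable (borel \<Otimes>\<^sub>M borel)"
  by (intro lborel.borel_measurable_lebesgue_integral) (simp add: case_prod_beta cong: measurable_cong_sets)
 then have k: "k \<in> borel_measurable borel" by (simp add: k_def[abs_def] borel_prod)
 have s: "(%\<zeta>. g (x, \<zeta>)) \<in> borel_measurable borel" for x using gb by measurable
 have "int_to_top g p = k p" for p
 proof -
  have sb: "(%\<zeta>. indicator {snd p<..<0} \<zeta> * g (fst p, \<zeta>)) \<in> borel_measurable borel"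
   using s by measurable
  have "int_to_top g p = (LINT \<zeta>|lebesgue. indicator {snd p<..<0} \<zeta> * g (fst p, \<zeta>))"
   by (simp add: int_to_top_def case_prod_beta integral_restrict_space)
  also have "... = (LINT \<zeta>|lborel. indicator {snd p<..<0} \<zeta> * g (fst p, \<zeta>))"
   using sb by (intro integral_completion) simp
  also have "... = k p"
   unfolding k_def by (intro Bochner_Integration.integral_cong) (auto simp: indicator_def)
  finally show ?thesis .
 qed
 then have "AE p in ID. k p = int_to_top f p" using int_to_top_cong[OF g(2)] by (auto elim!: eventually_mono)
 moreover have "k \<in> borel_measurable (ID)"
  using k by (intro measurable_restrict_space1 measurable_completion) simp
 ultimately show ?thesis using AE_lebesgue_on_measurable[OF _ D_lebesgue] by blast
qed

text \<open>The majorant does not depend on z; this is how the vertical velocity is controlled in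
  L^2 in x uniformly in z.\<close>

lemma int_to_top_le:
 assumes f: "f \<in> L2 D"
 shows "AE p in ID. \<bar>int_to_top f p\<bar> <= (LINT z|IZ. \<bar>f (fst p, z)\<bar>)"
proof -
 have "AE x in IX. \<forall>z. - h < z --> \<bar>int_to_top f (x, z)\<bar> <= (LINT z|IZ. \<bar>f (x, z)\<bar>)"
  using Fubini_D(1)[OF L2_integrable_D[OF f]]
 proof eventually_elim
  case (elim x)
  show ?case
  proof (intro allI impI)
   fix z assume z: "- h < z"
   have "\<bar>int_to_top f (x, z)\<bar> <= (LINT \<zeta>|lebesgue_on {z<..<0}. \<bar>f (x, \<zeta>)\<bar>)"
    unfolding int_to_top_def by (simp add: integral_abs_bound)
   also have "... <= (LINT z|IZ. \<bar>f (x, z)\<bar>)"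
    using z elim by (intro integral_mono_lebesgue_on_AE integrable_abs) auto
   finally show "\<bar>int_to_top f (x, z)\<bar> <= (LINT z|IZ. \<bar>f (x, z)\<bar>)" .
  qed
 qed
 from AE_D_fst[OF this] show ?thesis unfolding AE_lebesgue_on_iff_lborel[OF D_borel]
  by (rule eventually_mono) (auto simp: Dom_def)
qed

lemma int_to_top_diff:
 assumes f: "f \<in> L2 D" and g: "g \<in> L2 D"
 shows "AE p in ID. int_to_top (%p. f p - g p) p = int_to_top f p - int_to_top g p"
proof -
 have "AE x in IX. \<forall>z. - h < z --> int_to_top (%p. f p - g p) (x, z) = int_to_top f (x, z) - int_to_top g (x, z)"
  using Fubini_D(1)[OF L2_integrable_D[OF f]] Fubini_D(1)[OF L2_integrable_D[OF g]]
 proof eventually_elim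
  case (elim x)
  have sub: "integrable (lebesgue_on {z<..<0}) k" if "integrable IZ k" "- h < z" for z and k :: "real => real"
  proof -
   have "set_integrable lebesgue {- h<..<0} k"
    using that(1) by (simp add: integrable_restrict_space set_integrable_def)
   then have "set_integrable lebesgue {z<..<0} k" by (rule set_integrable_subset) (use that(2) in auto)
   then show ?thesis by (simp add: integrable_restrict_space set_integrable_def)
  qed
  show ?case unfolding int_to_top_def using sub[OF elim(1)] sub[OF elim(2)] by simp
 qed
 from AE_D_fst[OF this] show ?thesis unfolding AE_lebesgue_on_iff_lborel[OF D_borel]
  by (rule eventually_mono) (auto simp: Dom_def)
qed

section \<open>Anisotropic estimates\<close>

definition vint :: "field => real => real" where
 "vint f x = (LINT z|IZ. \<bar>f (x, z)\<bar>)"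

lemma vint_L2:
 assumes "f \<in> L2 D"
 shows "vint f \<in> L2 {0<..<1}" "L2_norm {0<..<1} (vint f) <= sqrt h * nrm f"
 using L2_vertical_integral[OF L2_abs[OF assms]] by (simp_all add: vint_def[abs_def] L2_norm_abs)

text \<open>For smooth functions \<open>pz f\<close> bounds the integral over x of the supremum over
  z of f^2, and \<open>rx f\<close> the integral over z of the supremum over x. The first summand of
  each, an average of f^2, takes the place of boundary values.\<close>

definition pz :: "field => real" where
 "pz f = (nrm f)^2 / h + 2 * (nrm f * nrm (dz h f))"

definition rx :: "field => real" where
 "rx f = (nrm f)^2 + 2 * (nrm f * nrm (dx h f))"

lemma pz_nonneg: "pz f >= 0" and rx_nonneg: "rx f >= 0" using h_pos by (auto simp: pz_def rx_def)

text \<open>A value of f^2 exceeds its value at any other point by at most the integral of |(f^2)'|;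
  averaging over the other point produces the mean.\<close>

lemma square_le_mean_plus_variation:
 fixes f f' :: "real => real"
 assumes ab: "a < b" and f: "!!t. (f has_real_derivative f' t) (at t)" and c: "continuous_on UNIV f'"
  and x: "a < x" "x < b"
 shows "(f x)^2 <= (LINT t|lebesgue_on {a<..<b}. (f t)^2 / (b - a) + 2 * \<bar>f t * f' t\<bar>)"
proof -
 have cf: "continuous_on UNIV f" using f by (intro continuous_at_imp_continuous_on) (auto intro: DERIV_isCont)
 have cs: "continuous_on S (%t. 2 * \<bar>f t * f' t\<bar>)" "continuous_on S (%t. (f t)^2 / (b - a))" "continuous_on S (%t. 2 * (f t * f' t))" for S
  using ab by (auto intro!: continuous_intros continuous_on_subset[OF cf] continuous_on_subset[OF c])
 let ?K = "LINT t|lebesgue_on {a<..<b}. 2 * \<bar>f t * f' t\<bar>"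
 have d: "((%t. (f t)^2) has_real_derivative 2 * (f t * f' t)) (at t)" for t
  using DERIV_power[OF f[of t], of 2] by (simp add: mult_ac)
 have osc: "(f s)^2 - (f t)^2 <= ?K" if "a <= t" "t <= s" "s <= b" for s t
 proof -
  have "(f s)^2 - (f t)^2 = (LINT r|lebesgue_on {t<..<s}. 2 * (f r * f' r))"
   using integral_deriv_open_interval[OF that(2) d cs(3)] by simp
  also have "... <= (LINT r|lebesgue_on {a<..<b}. 2 * \<bar>f r * f' r\<bar>)"
   using that by (intro integral_mono_lebesgue_on_AE integral_open_interval(1) cs) auto
  finally show ?thesis .
 qed
 have osc': "(f t)^2 - (f s)^2 <= ?K" if "a <= t" "t <= s" "s <= b" for s t
 proof -
  have "(f t)^2 - (f s)^2 = (LINT r|lebesgue_on {t<..<s}. - (2 * (f r * f' r)))"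
   using integral_deriv_open_interval[OF that(2) d cs(3)] by simp
  also have "... <= (LINT r|lebesgue_on {a<..<b}. 2 * \<bar>f r * f' r\<bar>)"
   using that by (intro integral_mono_lebesgue_on_AE integral_open_interval(1) cs continuous_on_minus) auto
  finally show ?thesis .
 qed
 have le: "(f x)^2 <= (f t)^2 + ?K" if "a < t" "t < b" for t
  using osc[of t x] osc'[of x t] that x by (cases "t <= x") auto
 have m: "measure lebesgue {a<..<b} = b - a" using ab by (simp add: measure_def)
 have fin: "finite_measure (lebesgue_on {a<..<b})" by (rule finite_measure_lebesgue_on) auto
 have i2: "integrable (lebesgue_on {a<..<b}) (%t. (f t)^2 / (b - a))"
  by (rule integral_open_interval(1)[OF cs(2)])
 have "(f x)^2 = (LINT t|lebesgue_on {a<..<b}. (f x)^2 / (b - a))"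
  using ab by (simp add: measure_restrict_space m)
 also have "... <= (LINT t|lebesgue_on {a<..<b}. (f t)^2 / (b - a) + ?K / (b - a))"
 proof (rule integral_mono)
  show "integrable (lebesgue_on {a<..<b}) (%t. (f x)^2 / (b - a))"
   by (intro finite_measure.integrable_const fin)
  show "integrable (lebesgue_on {a<..<b}) (%t. (f t)^2 / (b - a) + ?K / (b - a))"
   by (intro integrable_plus i2 finite_measure.integrable_const fin)
  fix t assume "t \<in> space (lebesgue_on {a<..<b})"
  then show "(f x)^2 / (b - a) <= (f t)^2 / (b - a) + ?K / (b - a)"
   using le[of t] ab unfolding add_divide_distrib[symmetric] by (intro divide_right_mono) auto
 qed
 also have "... = (LINT t|lebesgue_on {a<..<b}. (f t)^2 / (b - a)) + ?K"
  using ab by (subst integral_plus[OF i2 finite_measure.integrable_const[OF fin]])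
   (simp add: measure_restrict_space m divide_eq_eq; simp add: algebra_simps)
 also have "... = (LINT t|lebesgue_on {a<..<b}. (f t)^2 / (b - a) + 2 * \<bar>f t * f' t\<bar>)"
  by (rule integral_plus[symmetric, OF i2 integral_open_interval(1)[OF cs(1)]])
 finally show ?thesis .
qed

text \<open>The one-dimensional inequality on vertical lines gives a majorant of F^2 depending on x
  only, on horizontal lines one depending on z only. Cauchy-Schwarz bounds their integrals.\<close>

lemma smooth_pointwise_bounds:
 assumes F: "smooth F"
 defines "P \<equiv> %x. LINT z|IZ. (F (x, z))^2 / h + 2 * \<bar>F (x, z) * py F (x, z)\<bar>"
  and "R \<equiv> %z. LINT x|IX. (F (x, z))^2 + 2 * \<bar>F (x, z) * px F (x, z)\<bar>"
 shows "integrable IX P" "(LINT x|IX. P x) <= pz F" "!!x z. (x, z) \<in> D ==> (F (x, z))^2 <= P x"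
  and "integrable IZ R" "(LINT z|IZ. R z) <= rx F" "!!x z. (x, z) \<in> D ==> (F (x, z))^2 <= R z"
proof -
 let ?Fx = "%p. px F p" and ?Fz = "%p. py F p"
 have c: "continuous_on UNIV F" "continuous_on UNIV ?Fx" "continuous_on UNIV ?Fz"
  by (intro smooth_continuous smooth_frechet_derivative F)+
 have c2: "continuous_on UNIV (%p. (F p)^2 / h + 2 * \<bar>F p * ?Fz p\<bar>)" "continuous_on UNIV (%p. (F p)^2 + 2 * \<bar>F p * ?Fx p\<bar>)"
  using c h_pos by (auto intro!: continuous_intros)
 note i = continuous_integrable_D[OF c2(1)] continuous_integrable_D[OF c2(2)]
 note L = smooth_L2[OF F] smooth_frechet_L2[OF F, of "(1, 0)"] smooth_frechet_L2[OF F, of "(0, 1)"]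
 show "integrable IX P" unfolding P_def by (rule Fubini_D(2)[OF i(1)])
 show "integrable IZ R" unfolding R_def by (rule Fubini_D(5)[OF i(2)])
 have n: "nrm ?Fx = nrm (dx h F)" "nrm ?Fz = nrm (dz h F)"
  by (rule L2_norm_cong_AE[OF _ D_lebesgue], use smooth_Sobolev1(2)[OF F] in eventually_elim, simp)
   (rule L2_norm_cong_AE[OF _ D_lebesgue], use smooth_Sobolev1(3)[OF F] in eventually_elim, simp)
 have "(LINT x|IX. P x) = (LINT p|ID. (F p)^2 / h + 2 * \<bar>F p * ?Fz p\<bar>)"
  unfolding P_def by (rule Fubini_D(3)[OF i(1), symmetric])
 also have "... = (nrm F)^2 / h + 2 * (LINT p|ID. \<bar>F p * ?Fz p\<bar>)"
  using L2_square_integrable[OF L(1)] L2_mult_integrable[OF L(1,3)] by (simp add: L2_norm_square_integral)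
 also have "... <= pz F" using L2_Cauchy_Schwarz_abs[OF L(1,3)] by (simp add: pz_def n)
 finally show "(LINT x|IX. P x) <= pz F" .
 have "(LINT z|IZ. R z) = (LINT p|ID. (F p)^2 + 2 * \<bar>F p * ?Fx p\<bar>)"
  unfolding R_def by (rule Fubini_D(6)[OF i(2), symmetric])
 also have "... = (nrm F)^2 + 2 * (LINT p|ID. \<bar>F p * ?Fx p\<bar>)"
  using L2_square_integrable[OF L(1)] L2_mult_integrable[OF L(1,2)] by (simp add: L2_norm_square_integral)
 also have "... <= rx F" using L2_Cauchy_Schwarz_abs[OF L(1,2)] by (simp add: rx_def n)
 finally show "(LINT z|IZ. R z) <= rx F" .
 fix x z assume "(x, z) \<in> D"
 then have xz: "0 < x" "x < 1" "- h < z" "z < 0" by (auto simp: Dom_def)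
 show "(F (x, z))^2 <= P x"
  using square_le_mean_plus_variation[of "- h" 0 "%z. F (x, z)" "%z. ?Fz (x, z)" z] xz h_pos
   smooth_line_derivative(2)[OF F] continuous_on_line(2)[OF c(3)] by (simp add: P_def)
 show "(F (x, z))^2 <= R z" using square_le_mean_plus_variation[of 0 1 "%x. F (x, z)" "%x. ?Fx (x, z)" x] xz
   smooth_line_derivative(1)[OF F] continuous_on_line(1)[OF c(2)] by (simp add: R_def)
qed

lemma pz_tendsto:
 assumes f: "!!n::nat. F n \<in> W1" "f \<in> W1" "(%n. N1 (%p. F n p - f p)) ----> 0"
 shows "(%n. pz (F n)) ----> pz f" "(%n. rx (F n)) ----> rx f"
proof -
 note t = N1_tendstoD[OF f]
 note l = L2_norm_tendsto[OF Sobolev1_L2[OF f(1)] Sobolev1_L2[OF f(2)] t(1)]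
  L2_norm_tendsto[OF dx_works(1)[OF f(1)] dx_works(1)[OF f(2)] t(2)]
  L2_norm_tendsto[OF dz_works(1)[OF f(1)] dz_works(1)[OF f(2)] t(3)]
 show "(%n. pz (F n)) ----> pz f" "(%n. rx (F n)) ----> rx f"
  unfolding pz_def rx_def using h_pos by (intro tendsto_intros l; simp)+
qed

lemma smooth_dense_AE:
 assumes f: "f \<in> W1"
 obtains F where "!!n::nat. smooth (F n)" "(%n. N1 (%p. F n p - f p)) ----> 0"
  "AE p in ID. (%n. F n p) ----> f p"
proof -
 obtain F where F: "!!n::nat. smooth (F n)" "(%n. N1 (%p. F n p - f p)) ----> 0"
  by (rule smooth_dense[OF f]) (rule that, assumption, assumption)
 obtain r where r: "strict_mono (r :: nat => nat)" "AE p in ID. (%n. F (r n) p) ----> f p"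
  using L2_tendsto_AE_subseq[OF smooth_L2[OF F(1)] Sobolev1_L2[OF f]
    N1_tendstoD(1)[OF smooth_Sobolev1(1)[OF F(1)] f F(2)]] by blast
 show thesis
 proof (rule that[of "%n. F (r n)"])
  show "(%n. N1 (%p. F (r n) p - f p)) ----> 0" using LIMSEQ_subseq_LIMSEQ[OF F(2) r(1)] by (simp add: o_def)
 qed (use F r in auto)
qed

text \<open>For smooth functions (u g)^2 is at most a function of x times a function of z, so its
  integral is at most a product of two integrals. This estimate of Ladyzhenskaya type passes to the
  limit by \<open>L2_Fatou\<close>.\<close>

lemma product_L2:
 assumes u: "u \<in> W1" and g: "g \<in> W1"
 shows "(%p. u p * g p) \<in> L2 D" "(nrm (%p. u p * g p))^2 <= pz u * rx g"
proof -
 obtain U where U: "!!n::nat. smooth (U n)" "(%n. N1 (%p. U n p - u p)) ----> 0"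
  "AE p in ID. (%n. U n p) ----> u p"
  by (rule smooth_dense_AE[OF u]) (rule that, assumption, assumption, assumption)
 obtain G where G: "!!n::nat. smooth (G n)" "(%n. N1 (%p. G n p - g p)) ----> 0"
  "AE p in ID. (%n. G n p) ----> g p"
  by (rule smooth_dense_AE[OF g]) (rule that, assumption, assumption, assumption)
 have bound: "(nrm (%p. U n p * G n p))^2 <= pz (U n) * rx (G n)" for n
 proof -
  note PU = smooth_pointwise_bounds(1-3)[OF U(1)[of n]] and RG = smooth_pointwise_bounds(4-6)[OF G(1)[of n]]
  let ?P = "%x. LINT z|IZ. (U n (x, z))^2 / h + 2 * \<bar>U n (x, z) * py (U n) (x, z)\<bar>"
  let ?R = "%z. LINT x|IX. (G n (x, z))^2 + 2 * \<bar>G n (x, z) * px (G n) (x, z)\<bar>"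
  have "(nrm (%p. U n p * G n p))^2 <= (LINT p|ID. ?P (fst p) * ?R (snd p))" unfolding L2_norm_square_integral
  proof (rule integral_mono)
   show "integrable (ID) (%p. (U n p * G n p)^2)" by (intro L2_square_integrable smooth_L2 smooth_mult U G)
   show "integrable (ID) (%p. ?P (fst p) * ?R (snd p))" by (rule integrable_product_D(1)[OF PU(1) RG(1)])
   fix p assume "p \<in> space (ID)"
   then have p: "(fst p, snd p) \<in> D" by simp
   show "(U n p * G n p)^2 <= ?P (fst p) * ?R (snd p)"
    using mult_mono[OF PU(3)[OF p] RG(3)[OF p]] order_trans[OF zero_le_power2 PU(3)[OF p]] by (simp add: power_mult_distrib)
  qed
  also have "... = (LINT x|IX. ?P x) * (LINT z|IZ. ?R z)" by (rule integrable_product_D(2)[OF PU(1) RG(1)])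
  also have "... <= pz (U n) * rx (G n)"
   using PU(2) RG(2) by (intro mult_mono pz_nonneg integral_nonneg_AE AE_I2) auto
  finally show ?thesis .
 qed
 have L: "(%p. U n p * G n p) \<in> L2 D" for n by (intro smooth_L2 smooth_mult U G)
 have lim: "AE p in ID. (%n. U n p * G n p) ----> u p * g p"
  using U(3) G(3) by eventually_elim (rule tendsto_mult)
 have m: "(%p. u p * g p) \<in> borel_measurable (ID)"
  by (intro borel_measurable_times L2_measurable Sobolev1_L2 u g)
 have "(%n. pz (U n) * rx (G n)) ----> pz u * rx g" by (intro tendsto_mult pz_tendsto smooth_Sobolev1 U G u g)
 from L2_Fatou[OF L lim m bound this]
 show "(%p. u p * g p) \<in> L2 D" "(nrm (%p. u p * g p))^2 <= pz u * rx g" by auto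
qed

text \<open>The same splitting, with a given square integrable function of x in place of the
  majorant of u^2.\<close>

lemma fst_product_L2:
 assumes W: "W \<in> L2 {0<..<1}" and g: "g \<in> W1"
 shows "(%p. W (fst p) * g p) \<in> L2 D" "(nrm (%p. W (fst p) * g p))^2 <= (L2_norm {0<..<1} W)^2 * rx g"
proof -
 obtain G where G: "!!n::nat. smooth (G n)" "(%n. N1 (%p. G n p - g p)) ----> 0"
  "AE p in ID. (%n. G n p) ----> g p"
  by (rule smooth_dense_AE[OF g]) (rule that, assumption, assumption, assumption)
 have Wm: "(%p. W (fst p)) \<in> borel_measurable (ID)" by (rule measurable_D_fst[OF L2_measurable[OF W]])
 have mG: "(%p. W (fst p) * G n p) \<in> borel_measurable (ID)" for n
  by (rule borel_measurable_times[OF Wm L2_measurable[OF smooth_L2[OF G(1)]]])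
 have b: "(%p. W (fst p) * G n p) \<in> L2 D & (nrm (%p. W (fst p) * G n p))^2 <= (L2_norm {0<..<1} W)^2 * rx (G n)" for n
 proof -
  note RG = smooth_pointwise_bounds(4-6)[OF G(1)[of n]]
  let ?R = "%z. LINT x|IX. (G n (x, z))^2 + 2 * \<bar>G n (x, z) * px (G n) (x, z)\<bar>"
  have i: "integrable (ID) (%p. (W (fst p))^2 * ?R (snd p))"
   by (rule integrable_product_D(1)[OF L2_square_integrable[OF W] RG(1)])
  have le: "(W (fst p) * G n p)^2 <= (W (fst p))^2 * ?R (snd p)" if "p \<in> D" for p
   using mult_left_mono[OF RG(3)[of "fst p" "snd p"], of "(W (fst p))^2"] that by (simp add: power_mult_distrib)
  have R0: "0 <= ?R z" for z by (rule integral_nonneg_AE) simp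
  have "integrable (ID) (%p. (W (fst p) * G n p)^2)"
  proof (rule integrable_dominated[OF i])
   show "AE p in ID. norm ((W (fst p) * G n p)^2) <= norm ((W (fst p))^2 * ?R (snd p))"
    by (rule AE_I2) (use le R0 in \<open>simp add: abs_mult\<close>)
  qed (use mG in auto)
  then have L: "(%p. W (fst p) * G n p) \<in> L2 D" using mG by (simp add: L2_def)
  have "(nrm (%p. W (fst p) * G n p))^2 <= (LINT p|ID. (W (fst p))^2 * ?R (snd p))"
   unfolding L2_norm_square_integral by (rule integral_mono[OF L2_square_integrable[OF L] i]) (use le in simp)
  also have "... = (L2_norm {0<..<1} W)^2 * (LINT z|IZ. ?R z)"
   unfolding L2_norm_square_integral by (rule integrable_product_D(2)[OF L2_square_integrable[OF W] RG(1)])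
  also have "... <= (L2_norm {0<..<1} W)^2 * rx (G n)" using RG(2) by (intro mult_left_mono) auto
  finally show ?thesis using L by blast
 qed
 have lim: "AE p in ID. (%n. W (fst p) * G n p) ----> W (fst p) * g p"
  using G(3) by eventually_elim (intro tendsto_intros)
 have m: "(%p. W (fst p) * g p) \<in> borel_measurable (ID)"
  by (rule borel_measurable_times[OF Wm L2_measurable[OF Sobolev1_L2[OF g]]])
 have "(%n. (L2_norm {0<..<1} W)^2 * rx (G n)) ----> (L2_norm {0<..<1} W)^2 * rx g"
  by (intro tendsto_intros pz_tendsto smooth_Sobolev1 G g)
 from L2_Fatou[OF _ lim m _ this] b
 show "(%p. W (fst p) * g p) \<in> L2 D" "(nrm (%p. W (fst p) * g p))^2 <= (L2_norm {0<..<1} W)^2 * rx g" by auto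
qed

end

lemma integral_lebesgue_on_if:
 fixes f :: "'a::euclidean_space => real"
 assumes "S \<subseteq> T" "S \<in> sets lebesgue" "T \<in> sets lebesgue"
 shows "(LINT x|lebesgue_on T. (if x \<in> S then f x else 0)) = (LINT x|lebesgue_on S. f x)"
 using assms by (subst Lebesgue_Measure.integral_restrict) auto

lemma smooth_translate: "smooth f ==> smooth (%x. f (c + x))" by (simp add: smooth_def Ck_translate)

context strip
begin

lemma int_to_top_product_L2:
 assumes k: "k \<in> L2 D" and g: "g \<in> W1"
 shows "(%p. int_to_top k p * g p) \<in> L2 D"
  and "nrm (%p. int_to_top k p * g p) <= sqrt h * nrm k * sqrt (rx g)"
proof -
 note W = fst_product_L2[OF vint_L2(1)[OF k] g]
 have m: "(%p. int_to_top k p * g p) \<in> borel_measurable (ID)"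
  by (rule borel_measurable_times[OF int_to_top_measurable[OF k] L2_measurable[OF Sobolev1_L2[OF g]]])
 have le: "AE p in ID. (int_to_top k p * g p)^2 <= (vint k (fst p) * g p)^2" using int_to_top_le[OF k]
 proof eventually_elim
  case (elim p)
  have "0 <= vint k (fst p)" unfolding vint_def by (rule integral_nonneg_AE) simp
  with elim have "\<bar>int_to_top k p\<bar> <= \<bar>vint k (fst p)\<bar>" by (simp add: vint_def)
  then have "(int_to_top k p)^2 <= (vint k (fst p))^2" by (simp add: abs_le_square_iff)
  then show ?case by (simp add: power_mult_distrib mult_right_mono)
 qed
 have i: "integrable (ID) (%p. (int_to_top k p * g p)^2)"
 proof (rule integrable_dominated[OF L2_square_integrable[OF W(1)]])
  show "AE p in ID. norm ((int_to_top k p * g p)^2) <= norm ((vint k (fst p) * g p)^2)"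
   using le by eventually_elim simp
 qed (use m in auto)
 then show L: "(%p. int_to_top k p * g p) \<in> L2 D" using m by (simp add: L2_def)
 have "(nrm (%p. int_to_top k p * g p))^2 <= (nrm (%p. vint k (fst p) * g p))^2"
  unfolding L2_norm_square_integral by (rule integral_mono_AE[OF i L2_square_integrable[OF W(1)] le])
 also have "... <= (L2_norm {0<..<1} (vint k))^2 * rx g" by (rule W(2))
 also have "... <= (sqrt h * nrm k)^2 * rx g" by (intro mult_right_mono power_mono vint_L2 k rx_nonneg) auto
 also have "... = (sqrt h * nrm k * sqrt (rx g))^2" using rx_nonneg by (simp add: power_mult_distrib)
 finally show "nrm (%p. int_to_top k p * g p) <= sqrt h * nrm k * sqrt (rx g)"
  by (rule power2_le_imp_le) (use h_pos rx_nonneg in simp)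
qed

lemma int_to_top_L2:
 assumes k: "k \<in> L2 D"
 shows "int_to_top k \<in> L2 D" "nrm (int_to_top k) <= h * nrm k"
proof -
 \<comment> \<open>The product estimate is applied with the constant 1 as second factor, for which
   \<open>rx\<close> is the area \<open>h\<close>.\<close>
 let ?one = "%_::real \<times> real. 1 :: real"
 have o: "?one \<in> W1" by (rule smooth_Sobolev1) simp
 have "px ?one p = 0" for p using frechet_derivative_at[of ?one "%_. 0" p] by (metis has_derivative_const)
 then have dx0: "nrm (dx h ?one) = 0" using L2_norm_cong_AE[OF smooth_Sobolev1(2)[of ?one] D_lebesgue] by simp
 have "integrable IX (%_. 1::real)" "integrable IZ (%_. 1::real)"
  by (rule finite_measure.integrable_const[OF finite_measure_IX] finite_measure.integrable_const[OF finite_measure_IZ])+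
 from integrable_product_D(2)[OF this]
 have "(LINT p|ID. (1::real) * 1) = (LINT x|IX. 1) * (LINT z|IZ. 1)" .
 then have "(nrm ?one)^2 = h"
  by (simp add: L2_norm_square_integral measure_restrict_space measure_IX measure_IZ)
 then have "rx ?one = h" by (simp add: rx_def dx0)
 then show "int_to_top k \<in> L2 D" "nrm (int_to_top k) <= h * nrm k"
  using int_to_top_product_L2[OF k o] h_pos mult.commute[of "sqrt h * nrm k" "sqrt h"]
  by (auto simp: mult.assoc[symmetric])
qed

text \<open>The arguments of \<open>Bx\<close> and \<open>Bz\<close> are grouped so that each is an
  inner product of two L2 functions: the product with \<open>g\<close> is square integrable by the
  anisotropic estimates, and the other factor is a weak derivative of \<open>f\<close>.\<close>

definition Bx :: "field => field => field => real" where
 "Bx u f g = ip (%p. u p * g p) (dx h f)"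

definition Bz :: "field => field => field => real" where
 "Bz u f g = ip (%p. int_to_top (dx h u) p * g p) (dz h f)"

definition B :: "field => field => field => real" where
 "B u f g = Bx u f g + Bz u f g"

lemma transport_product_integrable:
 assumes u: "u \<in> W1" and f: "f \<in> W1" and g: "g \<in> W1"
 shows "integrable (ID) (%p. transport h u f p * g p)" "ip (transport h u f) g = B u f g"
proof -
 have i: "integrable (ID) (%p. (u p * g p) * dx h f p)"
  "integrable (ID) (%p. (int_to_top (dx h u) p * g p) * dz h f p)"
  by (intro L2_mult_integrable product_L2 int_to_top_product_L2 dx_works dz_works u f g)+
 have e: "(%p. transport h u f p * g p)
   = (%p. (u p * g p) * dx h f p + (int_to_top (dx h u) p * g p) * dz h f p)"
  by (simp add: transport_def algebra_simps)
 show "integrable (ID) (%p. transport h u f p * g p)" unfolding e using i by simp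
 show "ip (transport h u f) g = B u f g" unfolding L2_inner_def e B_def Bx_def Bz_def using i by simp
qed

lemma Bx_bound:
 assumes u: "u \<in> W1" and f: "f \<in> W1" and g: "g \<in> W1"
 shows "\<bar>Bx u f g\<bar> <= sqrt (pz u * rx g) * nrm (dx h f)"
proof -
 have "nrm (%p. u p * g p) <= sqrt (pz u * rx g)" using product_L2(2)[OF u g] by (simp add: real_le_rsqrt)
 then have "nrm (%p. u p * g p) * nrm (dx h f) <= sqrt (pz u * rx g) * nrm (dx h f)"
  by (intro mult_right_mono) auto
 then show ?thesis
  using L2_Cauchy_Schwarz[OF product_L2(1)[OF u g] dx_works(1)[OF f]] unfolding Bx_def by linarith
qed

lemma Bz_bound:
 assumes u: "u \<in> W1" and f: "f \<in> W1" and g: "g \<in> W1"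
 shows "\<bar>Bz u f g\<bar> <= sqrt h * nrm (dx h u) * sqrt (rx g) * nrm (dz h f)"
proof -
 have "nrm (%p. int_to_top (dx h u) p * g p) * nrm (dz h f)
  <= sqrt h * nrm (dx h u) * sqrt (rx g) * nrm (dz h f)"
  by (intro mult_right_mono int_to_top_product_L2 dx_works u g) auto
 then show ?thesis
  using L2_Cauchy_Schwarz[OF int_to_top_product_L2(1)[OF dx_works(1)[OF u] g] dz_works(1)[OF f]]
  unfolding Bz_def by linarith
qed

text \<open>If the vertical norm of f_z is at most \<open>m\<close> on almost every line, then
  \<open>vint (dx h u)\<close> times f_z is square integrable by Tonelli. So \<open>g\<close> enters
  through its L2 norm alone and none of its derivatives is spent.\<close>

lemma Bz_bound_sup:
 assumes u: "u \<in> W1" and f: "f \<in> W1" and g: "g \<in> W1"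
  and m: "m >= 0" "AE x in IX. (LINT z|IZ. (dz h f (x, z))^2) <= m^2"
 shows "\<bar>Bz u f g\<bar> <= sqrt h * nrm (dx h u) * m * nrm g"
proof -
 note k = dx_works(1)[OF u] and fz = dz_works(1)[OF f] and gL = Sobolev1_L2[OF g]
 define W where "W = vint (dx h u)"
 have W: "W \<in> L2 {0<..<1}" and Wn: "L2_norm {0<..<1} W <= sqrt h * nrm (dx h u)"
  unfolding W_def using vint_L2[OF k] by auto
 have W0: "0 <= W x" for x unfolding W_def vint_def by (rule integral_nonneg_AE) simp
 have Wm: "(%p. W (fst p)) \<in> borel_measurable (ID)" by (rule measurable_D_fst[OF L2_measurable[OF W]])
 have mW: "(%p. W (fst p) * dz h f p) \<in> borel_measurable (ID)"
  by (rule borel_measurable_times[OF Wm L2_measurable[OF fz]])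
 have s1: "AE x in IX. (LINT z|IZ. (W x * dz h f (x, z))^2) <= m^2 * (W x)^2" using m(2)
 proof eventually_elim
  case (elim x)
  from mult_left_mono[OF this, of "(W x)^2"] show ?case by (simp add: power_mult_distrib mult.commute)
 qed
 have meas: "(%x. LINT z|IZ. (W x * dz h f (x, z))^2) \<in> borel_measurable IX"
 proof -
  have "(%x. (W x)^2 * (LINT z|IZ. (dz h f (x, z))^2)) \<in> borel_measurable IX"
   using Fubini_D(2)[OF L2_square_integrable[OF fz]] L2_measurable[OF W]
   by (intro borel_measurable_times borel_measurable_power) auto
  then show ?thesis by (simp add: power_mult_distrib)
 qed
 have ib: "integrable IX (%x. m^2 * (W x)^2)" using L2_square_integrable[OF W] by simp
 have ii: "integrable IX (%x. LINT z|IZ. (W x * dz h f (x, z))^2)"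
 proof (rule integrable_dominated[OF ib meas])
  show "AE x in IX. norm (LINT z|IZ. (W x * dz h f (x, z))^2) <= norm (m^2 * (W x)^2)"
   using s1 by eventually_elim simp
 qed
 have i: "integrable (ID) (%p. (W (fst p) * dz h f p)^2)"
 proof (rule Tonelli_D)
  show "AE x in IX. integrable IZ (%z. (W (fst (x, z)) * dz h f (x, z))^2)"
   using Fubini_D(1)[OF L2_square_integrable[OF fz]] by eventually_elim (simp add: power_mult_distrib)
 qed (use mW ii in auto)
 have L: "(%p. W (fst p) * dz h f p) \<in> L2 D" using mW i by (simp add: L2_def)
 have "(nrm (%p. W (fst p) * dz h f p))^2 = (LINT x|IX. LINT z|IZ. (W x * dz h f (x, z))^2)"
  unfolding L2_norm_square_integral using Fubini_D(3)[OF i] by simp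
 also have "... <= (LINT x|IX. m^2 * (W x)^2)" by (rule integral_mono_AE[OF ii ib s1])
 also have "... = (m * L2_norm {0<..<1} W)^2" by (simp add: L2_norm_square_integral power_mult_distrib)
 finally have n: "nrm (%p. W (fst p) * dz h f p) <= m * L2_norm {0<..<1} W"
  by (rule power2_le_imp_le) (use m in simp)
 have "\<bar>Bz u f g\<bar> <= (LINT p|ID. \<bar>(int_to_top (dx h u) p * g p) * dz h f p\<bar>)"
  unfolding Bz_def L2_inner_def by (rule integral_abs_bound)
 also have "... <= (LINT p|ID. \<bar>(W (fst p) * dz h f p) * g p\<bar>)"
 proof (rule integral_mono_AE)
  show "integrable (ID) (%p. \<bar>(int_to_top (dx h u) p * g p) * dz h f p\<bar>)"
   by (intro integrable_abs L2_mult_integrable int_to_top_product_L2 k g fz)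
  show "integrable (ID) (%p. \<bar>(W (fst p) * dz h f p) * g p\<bar>)"
   by (intro integrable_abs L2_mult_integrable L gL)
  show "AE p in ID. \<bar>(int_to_top (dx h u) p * g p) * dz h f p\<bar> <= \<bar>(W (fst p) * dz h f p) * g p\<bar>"
   using int_to_top_le[OF k]
  proof eventually_elim
   case (elim p)
   then have "\<bar>int_to_top (dx h u) p\<bar> <= \<bar>W (fst p)\<bar>"
    using W0[of "fst p"] by (simp add: W_def vint_def)
   from mult_right_mono[OF this, of "\<bar>g p\<bar> * \<bar>dz h f p\<bar>"] show ?case
    by (simp add: abs_mult mult_ac)
  qed
 qed
 also have "... <= nrm (%p. W (fst p) * dz h f p) * nrm g" by (rule L2_Cauchy_Schwarz_abs[OF L gL])
 also have "... <= (m * (sqrt h * nrm (dx h u))) * nrm g"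
  using n mult_left_mono[OF Wn m(1)] by (intro mult_right_mono) auto
 finally show ?thesis by (simp add: mult_ac)
qed

lemma L2_mult_cong_diff:
 assumes "AE p in ID. F p = F1 p - F2 p" "AE p in ID. G p = G1 p"
  "F1 \<in> L2 D" "F2 \<in> L2 D" "G1 \<in> L2 D"
 shows "ip F G = ip F1 G1 - ip F2 G1"
 using L2_inner_cong_AE[OF assms(1,2) D_lebesgue] assms(3-5) by (simp add: L2_inner_diff_left)

lemma B_diff:
 assumes u: "u \<in> W1" and v: "v \<in> W1" and f: "f \<in> W1" and g: "g \<in> W1"
 shows "B (%p. u p - v p) f g = B u f g - B v f g"
  and "B f (%p. u p - v p) g = B f u g - B f v g"
  and "B f g (%p. u p - v p) = B f g u - B f g v"
proof -
 note d = Sobolev1_diff[OF u v]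
 note L = product_L2(1) dx_works(1) dz_works(1)
 note L' = int_to_top_product_L2(1)[OF dx_works(1)] dx_works(1) dz_works(1)
 have iu: "AE p in ID. int_to_top (dx h (%p. u p - v p)) p = int_to_top (dx h u) p - int_to_top (dx h v) p"
  using int_to_top_cong[OF d(2)] int_to_top_diff[OF dx_works(1)[OF u] dx_works(1)[OF v]] by eventually_elim simp
 have "Bx (%p. u p - v p) f g = Bx u f g - Bx v f g"
  unfolding Bx_def by (rule L2_mult_cong_diff) (auto simp: algebra_simps intro!: L u v f g)
 moreover have "Bz (%p. u p - v p) f g = Bz u f g - Bz v f g" unfolding Bz_def
 proof (rule L2_mult_cong_diff)
  show "AE p in ID. int_to_top (dx h (%p. u p - v p)) p * g p = int_to_top (dx h u) p * g p - int_to_top (dx h v) p * g p"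
   using iu
  proof eventually_elim
   case (elim p)
   show ?case unfolding elim by (simp add: algebra_simps)
  qed
 qed (auto intro!: L' u v f g)
 ultimately show "B (%p. u p - v p) f g = B u f g - B v f g" unfolding B_def by simp
 have "Bx f (%p. u p - v p) g = Bx f u g - Bx f v g" unfolding Bx_def L2_inner_sym[of D "%p. f p * g p"]
  by (rule L2_mult_cong_diff[OF d(2)]) (auto intro!: L u v f g)
 moreover have "Bz f (%p. u p - v p) g = Bz f u g - Bz f v g"
  unfolding Bz_def L2_inner_sym[of D "%p. int_to_top (dx h f) p * g p"]
  by (rule L2_mult_cong_diff[OF d(3)]) (auto intro!: L' u v f g)
 ultimately show "B f (%p. u p - v p) g = B f u g - B f v g" unfolding B_def by simp
 have "Bx f g (%p. u p - v p) = Bx f g u - Bx f g v"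
  unfolding Bx_def by (rule L2_mult_cong_diff) (auto simp: algebra_simps intro!: L u v f g)
 moreover have "Bz f g (%p. u p - v p) = Bz f g u - Bz f g v"
  unfolding Bz_def by (rule L2_mult_cong_diff) (auto simp: right_diff_distrib intro!: L' u v f g)
 ultimately show "B f g (%p. u p - v p) = B f g u - B f g v" unfolding B_def by simp
qed

lemma pz_le: "pz u <= (1 / h + 2) * (N1 u)^2" and rx_le: "rx u <= 3 * (N1 u)^2"
proof -
 have 1: "(nrm u)^2 <= (N1 u)^2" by (intro power_mono N1_bounds) auto
 have 2: "nrm u * nrm (dx h u) <= (N1 u)^2" "nrm u * nrm (dz h u) <= (N1 u)^2"
  unfolding power2_eq_square by (intro mult_mono N1_bounds; simp)+
 show "rx u <= 3 * (N1 u)^2" unfolding rx_def using 1 2 by linarith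
 show "pz u <= (1 / h + 2) * (N1 u)^2"
 proof -
  have "(nrm u)^2 / h <= (1 / h) * (N1 u)^2"
   using divide_right_mono[OF 1 less_imp_le[OF h_pos]] by (simp only: times_divide_eq_left mult_1_left)
  then show ?thesis unfolding pz_def distrib_right using 2 by linarith
 qed
qed

text \<open>The first summand combines the constants of \<open>pz_le\<close> and
  \<open>rx_le\<close> for \<open>Bx\<close>; the second comes from
  \<open>int_to_top_product_L2\<close> and \<open>rx_le\<close> for \<open>Bz\<close>.\<close>

definition B_const :: real where
 "B_const = sqrt ((1 / h + 2) * 3) + sqrt h * sqrt 3"

lemma B_const_nonneg: "B_const >= 0" using h_pos by (simp add: B_const_def)

lemma B_bound:
 assumes u: "u \<in> W1" and f: "f \<in> W1" and g: "g \<in> W1"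
 shows "\<bar>B u f g\<bar> <= B_const * (N1 u * N1 f * N1 g)"
proof -
 have s: "sqrt ((s * a^2) * (3 * b^2)) = sqrt (s * 3) * (a * b)" if "a >= 0" "b >= 0" for s a b :: real
  by (simp add: real_sqrt_mult that mult_ac)
 have "sqrt (pz u * rx g) <= sqrt (((1 / h + 2) * (N1 u)^2) * (3 * (N1 g)^2))"
  using h_pos by (intro real_sqrt_le_mono mult_mono pz_le rx_le pz_nonneg rx_nonneg) auto
 also have "... = sqrt ((1 / h + 2) * 3) * (N1 u * N1 g)" by (rule s) simp_all
 finally have "sqrt (pz u * rx g) * nrm (dx h f) <= (sqrt ((1 / h + 2) * 3) * (N1 u * N1 g)) * N1 f"
  using h_pos by (intro mult_mono N1_bounds) auto
 moreover have "sqrt (rx g) <= sqrt 3 * N1 g"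
  using real_sqrt_le_mono[OF rx_le[of g]] by (simp add: real_sqrt_mult)
 then have "sqrt h * nrm (dx h u) * sqrt (rx g) * nrm (dz h f) <= sqrt h * N1 u * (sqrt 3 * N1 g) * N1 f"
  using h_pos by (intro mult_mono N1_bounds order_refl) (auto intro: mult_nonneg_nonneg rx_nonneg)
 ultimately show ?thesis
  using Bx_bound[OF u f g] Bz_bound[OF u f g] unfolding B_def B_const_def by (simp add: algebra_simps)
qed

lemma B_tendsto:
 assumes u: "!!n::nat. U n \<in> W1" "u \<in> W1" "(%n. N1 (%p. U n p - u p)) ----> 0"
  and f: "!!n::nat. F n \<in> W1" "f \<in> W1" "(%n. N1 (%p. F n p - f p)) ----> 0"
  and g: "!!n::nat. G n \<in> W1" "g \<in> W1" "(%n. N1 (%p. G n p - g p)) ----> 0"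
 shows "(%n. B (U n) (F n) (G n)) ----> B u f g"
proof -
 have N1_lim: "(%n. N1 (F n)) ----> N1 f"
  if "!!n::nat. F n \<in> W1" "f \<in> W1" "(%n. N1 (%p. F n p - f p)) ----> 0" for F f
 proof -
  have "(%n. N1 (F n) - N1 f) ----> 0"
   by (rule Lim_null_comparison[OF always_eventually that(3)]) (use N1_diff_abs[OF that(1,2)] in simp)
  then show ?thesis by (simp add: LIM_zero_iff)
 qed
 let ?b = "%n. B_const * (N1 (%p. U n p - u p) * N1 (F n) * N1 (G n)) + B_const * (N1 u * N1 (%p. F n p - f p) * N1 (G n))
   + B_const * (N1 u * N1 f * N1 (%p. G n p - g p))"
 have "(%n. B (U n) (F n) (G n) - B u f g) ----> 0"
 proof (rule Lim_null_comparison[OF always_eventually])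
  have "?b ----> B_const * (0 * N1 f * N1 g) + B_const * (N1 u * 0 * N1 g) + B_const * (N1 u * N1 f * 0)"
   by (intro tendsto_intros N1_lim u f g)
  then show "?b ----> 0" by simp
  show "\<forall>n. norm (B (U n) (F n) (G n) - B u f g) <= ?b n"
  proof
   fix n
   have "B (U n) (F n) (G n) - B u f g = B (%p. U n p - u p) (F n) (G n) + B u (%p. F n p - f p) (G n) + B u f (%p. G n p - g p)"
    by (simp add: B_diff u f g)
   then show "norm (B (U n) (F n) (G n) - B u f g) <= ?b n"
    using B_bound[OF Sobolev1_diff(1)[OF u(1)[of n] u(2)] f(1)[of n] g(1)[of n]]
     B_bound[OF u(2) Sobolev1_diff(1)[OF f(1)[of n] f(2)] g(1)[of n]]
     B_bound[OF u(2) f(2) Sobolev1_diff(1)[OF g(1)[of n] g(2)]] by simp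
  qed
 qed
 then show ?thesis by (simp add: LIM_zero_iff)
qed

section \<open>Antisymmetry of the transport form\<close>

lemma integral_tail_swap:
 fixes a b b' :: "real => real"
 assumes a: "integrable IZ a" and b: "!!t. (b has_real_derivative b' t) (at t)" "continuous_on UNIV b'"
 shows "(LINT z|IZ. (LINT \<zeta>|lebesgue_on {z<..<0}. a \<zeta>) * b' z) = (LINT \<zeta>|IZ. a \<zeta> * (b \<zeta> - b (- h)))"
proof -
 let ?J = "{- h<..<0}"
 have J: "?J \<in> sets borel" by simp
 \<comment> \<open>Extension by zero from the triangle z < \<zeta> to the square; the two orders of
   integration yield the two sides.\<close>
 define T where "T p = (if fst p < snd p then a (snd p) * b' (fst p) else 0)" for p
 have bi: "integrable IZ b'" by (intro integral_open_interval continuous_on_subset[OF b(2)]) auto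
 have prod: "integrable (lebesgue_on (?J \<times> ?J)) (%p. b' (fst p) * a (snd p))"
  by (rule integrable_product_Times(1)[OF J J bi a])
 have "open {p :: real \<times> real. fst p < snd p}" by (intro open_Collect_less continuous_intros)
 then have "{p :: real \<times> real. fst p < snd p} \<in> sets lebesgue" by simp
 then have "(indicator {p. fst p < snd p} :: field) \<in> borel_measurable (lebesgue_on (?J \<times> ?J))"
  by (intro measurable_restrict_space1 borel_measurable_indicator)
 from borel_measurable_times[OF this borel_measurable_integrable[OF prod]]
 have Tm: "T \<in> borel_measurable (lebesgue_on (?J \<times> ?J))"
  by (rule measurable_cong[THEN iffD1, rotated]) (auto simp: T_def indicator_def)
 have Ti: "integrable (lebesgue_on (?J \<times> ?J)) T"
  by (rule integrable_dominated[OF prod Tm]) (auto simp: T_def abs_mult)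
 have 1: "(LINT \<zeta>|IZ. T (z, \<zeta>)) = (LINT \<zeta>|lebesgue_on {z<..<0}. a \<zeta>) * b' z" if "z \<in> ?J" for z
 proof -
  have "(LINT \<zeta>|IZ. T (z, \<zeta>)) = (LINT \<zeta>|IZ. (if \<zeta> \<in> {z<..<0} then a \<zeta> * b' z else 0))"
   by (intro Bochner_Integration.integral_cong) (auto simp: T_def)
  also have "... = (LINT \<zeta>|lebesgue_on {z<..<0}. a \<zeta> * b' z)"
   using that by (intro integral_lebesgue_on_if) auto
  finally show ?thesis by simp
 qed
 have 2: "(LINT z|IZ. T (z, \<zeta>)) = a \<zeta> * (b \<zeta> - b (- h))" if "\<zeta> \<in> ?J" for \<zeta>
 proof -
  have "(LINT z|IZ. T (z, \<zeta>)) = (LINT z|IZ. (if z \<in> {- h<..<\<zeta>} then a \<zeta> * b' z else 0))"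
   by (intro Bochner_Integration.integral_cong) (auto simp: T_def)
  also have "... = (LINT z|lebesgue_on {- h<..<\<zeta>}. a \<zeta> * b' z)"
   using that by (intro integral_lebesgue_on_if) auto
  also have "... = a \<zeta> * (b \<zeta> - b (- h))"
   using integral_deriv_open_interval[of "- h" \<zeta> b b'] that b by (auto intro: continuous_on_subset)
  finally show ?thesis .
 qed
 have "(LINT z|IZ. (LINT \<zeta>|lebesgue_on {z<..<0}. a \<zeta>) * b' z) = (LINT z|IZ. LINT \<zeta>|IZ. T (z, \<zeta>))"
  by (intro Bochner_Integration.integral_cong) (auto simp: 1)
 also have "... = (LINT \<zeta>|IZ. LINT z|IZ. T (z, \<zeta>))" using Fubini_Times(3,6)[OF J J Ti] by simp
 also have "... = (LINT \<zeta>|IZ. a \<zeta> * (b \<zeta> - b (- h)))"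
  by (intro Bochner_Integration.integral_cong) (auto simp: 2)
 finally show ?thesis .
qed

lemma smooth_bottom:
 assumes "smooth Fu"
 shows "smooth (%p::real \<times> real. Fu (fst p, - h))"
proof -
 have "bounded_linear (%p::real \<times> real. (fst p, 0::real))"
  by (intro bounded_linear_Pair bounded_linear_fst bounded_linear_zero)
 from smooth_linear[OF this smooth_translate[OF assms, of "(0, - h)"]] show ?thesis by simp
qed

text \<open>Integration by parts in z, carried out with Fubini's theorem on vertical lines since
  \<open>k\<close> is only square integrable. The bottom value of \<open>Fu\<close> remains because
  the antiderivative of a general \<open>k\<close> does not vanish at the bottom.\<close>

lemma inner_int_to_top_dz:
 assumes k: "k \<in> L2 D" and Fu: "smooth Fu"
 shows "ip (int_to_top k) (%p. py Fu p)
  = ip k Fu - ip k (%p. Fu (fst p, - h))"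
proof -
 let ?d = "%p. py Fu p"
 note kt = int_to_top_L2(1)[OF k]
 have c: "continuous_on UNIV ?d" by (intro smooth_continuous smooth_frechet_derivative Fu)
 have i1: "integrable (ID) (%p. int_to_top k p * ?d p)" by (intro L2_mult_integrable kt smooth_frechet_L2 Fu)
 have L: "Fu \<in> L2 D" "(%p. Fu (fst p, - h)) \<in> L2 D" by (intro smooth_L2 smooth_bottom Fu)+
 have i2: "integrable (ID) (%p. k p * (Fu p - Fu (fst p, - h)))" by (intro L2_mult_integrable k L2_diff L)
 have ae: "AE x in IX. (LINT z|IZ. int_to_top k (x, z) * ?d (x, z)) = (LINT z|IZ. k (x, z) * (Fu (x, z) - Fu (x, - h)))"
  using Fubini_D(1)[OF L2_integrable_D[OF k]]
 proof eventually_elim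
  case (elim x)
  show ?case using integral_tail_swap[OF elim smooth_line_derivative(2)[OF Fu] continuous_on_line(2)[OF c]]
   by (simp add: int_to_top_def)
 qed
 have "ip (int_to_top k) ?d = (LINT x|IX. LINT z|IZ. int_to_top k (x, z) * ?d (x, z))"
  unfolding L2_inner_def by (rule Fubini_D(3)[OF i1])
 also have "... = (LINT x|IX. LINT z|IZ. k (x, z) * (Fu (x, z) - Fu (x, - h)))"
  by (rule integral_lebesgue_on_cong_AE(1)[OF ae]) simp
 also have "... = ip k (%p. Fu p - Fu (fst p, - h))" using Fubini_D(3)[OF i2] by (simp add: L2_inner_def)
 finally show ?thesis by (simp add: L2_inner_diff_right k L)
qed

text \<open>For smooth approximations of \<open>u\<close> the boundary terms are explicit, and they
  converge to inner products with the side traces, which are zero.\<close>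

lemma horizontal_integration_by_parts:
 assumes u: "u \<in> W1" and tr: "AE z in IZ. side_trace 1 u z = 0" "AE z in IZ. side_trace 0 u z = 0"
  and Fu: "smooth Fu"
 shows "ip u (%p. px Fu p) + ip (dx h u) Fu = 0"
proof -
 obtain U where U: "!!n::nat. smooth (U n)" "(%n. N1 (%p. U n p - u p)) ----> 0"
  by (rule smooth_dense[OF u]) (rule that, assumption, assumption)
 note sU = smooth_Sobolev1[OF U(1)]
 note t = N1_tendstoD[OF sU(1) u U(2)]
 let ?d = "%p. px Fu p"
 let ?I = "%u. ip u ?d + ip (dx h u) Fu"
 have l1: "(%n. ?I (U n)) ----> ?I u"
  by (intro tendsto_add L2_inner_tendsto[OF Sobolev1_L2[OF sU(1)] Sobolev1_L2[OF u] t(1)]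
    L2_inner_tendsto[OF dx_works(1)[OF sU(1)] dx_works(1)[OF u] t(2)])
   (simp_all add: smooth_L2 smooth_frechet_L2 Fu)
 have cl: "(%z. F (x, z)) \<in> L2 {- h<..<0}" if "smooth F" for F :: "field" and x
  by (rule continuous_L2_line[OF continuous_on_line(2)[OF smooth_continuous[OF that]]])
 have eq: "?I (U n) = L2_inner {- h<..<0} (%z. U n (1, z)) (%z. Fu (1, z)) - L2_inner {- h<..<0} (%z. U n (0, z)) (%z. Fu (0, z))" for n
 proof -
  have "?I (U n) = ip (U n) ?d + ip (%p. px (U n) p) Fu"
   using L2_inner_cong_AE[OF sU(2)[of n] _ D_lebesgue, of Fu Fu] by simp
  also have "... = (LINT p|ID. px (%p. U n p * Fu p) p)"
   unfolding L2_inner_def frechet_derivative_smooth_mult[OF U(1) Fu]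
   by (intro integral_plus[symmetric] L2_mult_integrable smooth_L2 smooth_frechet_L2 U Fu)
  also have "... = (LINT z|IZ. U n (1, z) * Fu (1, z) - U n (0, z) * Fu (0, z))"
   by (rule integral_x_derivative[OF smooth_mult[OF U(1) Fu]])
  also have "... = L2_inner {- h<..<0} (%z. U n (1, z)) (%z. Fu (1, z)) - L2_inner {- h<..<0} (%z. U n (0, z)) (%z. Fu (0, z))"
   unfolding L2_inner_def by (intro Bochner_Integration.integral_diff L2_mult_integrable cl U Fu)
  finally show ?thesis .
 qed
 have "(%n. ?I (U n)) ----> L2_inner {- h<..<0} (side_trace 0 u) (%z. Fu (1, z)) - L2_inner {- h<..<0} (side_trace 1 u) (%z. Fu (0, z))"
  unfolding eq
  by (intro tendsto_diff L2_inner_tendsto[OF cl[OF U(1)] side_trace_L2[OF u] side_trace_tendsto[OF U u]])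
   (simp_all add: cl Fu)
 moreover have "L2_inner {- h<..<0} (side_trace 0 u) (%z. Fu (1, z)) = 0" "L2_inner {- h<..<0} (side_trace 1 u) (%z. Fu (0, z)) = 0"
  using L2_inner_cong_AE[OF tr(2), of "%z. Fu (1, z)" "%z. Fu (1, z)"] L2_inner_cong_AE[OF tr(1), of "%z. Fu (0, z)" "%z. Fu (0, z)"]
  by (simp_all add: L2_inner_def)
 ultimately show ?thesis using LIMSEQ_unique[OF l1] by simp
qed

text \<open>The weak form of u_x + w_z = 0. The bottom term left by
  \<open>inner_int_to_top_dz\<close> becomes, after horizontal integration by parts, the integral of
  u times a function of x alone, and that is 0 by the zero vertical mean.\<close>

lemma transport_divergence_free:
 assumes u: "u \<in> V_1 h" and Fu: "smooth Fu"
 shows "ip u (%p. px Fu p)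
  + ip (int_to_top (dx h u)) (%p. py Fu p) = 0"
proof -
 have uS: "u \<in> W1" and mean: "zero_vertical_mean h u" and tr: "zero_trace_lateral_bottom h u"
  using u by (auto simp: V_1_def)
 note p = horizontal_integration_by_parts[OF uS zero_trace_facts(2,3)[OF tr]]
 let ?b = "%p::real \<times> real. Fu (fst p, - h)"
 have sb: "smooth ?b" by (rule smooth_bottom[OF Fu])
 have db: "px ?b (x, z) = deriv (%x. Fu (x, - h)) x" for x z
  using DERIV_imp_deriv[OF smooth_line_derivative(1)[OF sb, of z x]] by simp
 have i: "integrable (ID) (%p. u p * px ?b p)"
  by (intro L2_mult_integrable Sobolev1_L2 uS smooth_frechet_L2 sb)
 have "ip u (%p. px ?b p) = (LINT x|IX. LINT z|IZ. u (x, z) * px ?b (x, z))"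
  unfolding L2_inner_def by (rule Fubini_D(3)[OF i])
 also have "... = (LINT x|IX. 0)"
 proof (rule integral_lebesgue_on_cong_AE(1))
  show "AE x in IX. (LINT z|IZ. u (x, z) * px ?b (x, z)) = 0"
   using mean unfolding zero_vertical_mean_def db by eventually_elim simp
 qed simp
 finally have "ip u (%p. px ?b p) = 0" by simp
 then show ?thesis using p[OF Fu] p[OF sb] inner_int_to_top_dz[OF dx_works(1)[OF uS] Fu] by simp
qed

text \<open>For smooth \<open>F\<close> and \<open>G\<close> the product rule turns the sum into
  \<open>transport_divergence_free\<close> for \<open>F * G\<close>. The velocity has no normal
  component at the boundary, so \<open>F\<close> and \<open>G\<close> are arbitrary there, and
  density gives the whole Sobolev space.\<close>

lemma B_antisym:
 assumes u: "u \<in> V_1 h" and f: "f \<in> W1" and g: "g \<in> W1"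
 shows "B u f g = - B u g f"
proof -
 have uS: "u \<in> W1" using u by (auto simp: V_1_def)
 have smooth_case: "B u F G + B u G F = 0" if F: "smooth F" and G: "smooth G" for F G
 proof -
  note sF = smooth_Sobolev1[OF F] and sG = smooth_Sobolev1[OF G]
  let ?w = "int_to_top (dx h u)"
  have wL: "?w \<in> L2 D" by (rule int_to_top_L2[OF dx_works(1)[OF uS]])
  have i: "integrable (ID) (%p. (k p * G p) * frechet_derivative F (at p) e)"
   "integrable (ID) (%p. (k p * F p) * frechet_derivative G (at p) e)" if "k \<in> L2 D" for k e
   using L2_mult_integrable[OF that smooth_L2[OF smooth_mult[OF G smooth_frechet_derivative[OF F, of e]]]]
    L2_mult_integrable[OF that smooth_L2[OF smooth_mult[OF F smooth_frechet_derivative[OF G, of e]]]]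
   by (simp_all add: mult.assoc)
  have eq: "ip (%p. k p * G p) (%p. frechet_derivative F (at p) e)
    + ip (%p. k p * F p) (%p. frechet_derivative G (at p) e)
    = ip k (%p. frechet_derivative (%p. F p * G p) (at p) e)" if "k \<in> L2 D" for k e
   unfolding L2_inner_def frechet_derivative_smooth_mult[OF F G]
   by (subst integral_plus[symmetric, OF i[OF that]]) (simp add: algebra_simps)
  have x: "Bx u F G + Bx u G F = ip u (%p. px (%p. F p * G p) p)"
   unfolding Bx_def eq[OF Sobolev1_L2[OF uS], symmetric]
   by (intro arg_cong2[where f="(+)"] L2_inner_cong_AE D_lebesgue sF sG) auto
  have z: "Bz u F G + Bz u G F = ip ?w (%p. py (%p. F p * G p) p)" unfolding Bz_def eq[OF wL, symmetric]
   by (intro arg_cong2[where f="(+)"] L2_inner_cong_AE D_lebesgue sF sG) auto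
  show ?thesis using x z transport_divergence_free[OF u smooth_mult[OF F G]] by (simp add: B_def)
 qed
 obtain F where F: "!!n::nat. smooth (F n)" "(%n. N1 (%p. F n p - f p)) ----> 0"
  by (rule smooth_dense[OF f]) (rule that, assumption, assumption)
 obtain G where G: "!!n::nat. smooth (G n)" "(%n. N1 (%p. G n p - g p)) ----> 0"
  by (rule smooth_dense[OF g]) (rule that, assumption, assumption)
 have z: "N1 (%_. 0) = 0"
 proof -
  have "N1 (%p. (0::real) * 0) = 0"
   using L2_norm_cong_AE[OF Sobolev1_cmult(2)[OF zero_Sobolev1, of 0] D_lebesgue]
    L2_norm_cong_AE[OF Sobolev1_cmult(3)[OF zero_Sobolev1, of 0] D_lebesgue] by (simp add: N1_def)
  then show ?thesis by simp
 qed
 have "(%n. B u (F n) (G n) + B u (G n) (F n)) ----> B u f g + B u g f"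
  by (intro tendsto_add B_tendsto[OF uS uS] smooth_Sobolev1 F G f g) (simp_all add: z)
 then have "B u f g + B u g f = 0" unfolding smooth_case[OF F(1) G(1)] by (simp add: LIMSEQ_const_iff)
 then show ?thesis by simp
qed

end

section \<open>Differentiation along the diagonal\<close>

lemma integrable_translate:
 fixes f :: "real => real"
 assumes "integrable lborel f"
 shows "integrable lborel (%s. f (s + c))" "(LINT s|lborel. f (s + c)) = (LINT s|lborel. f s)"
 using lborel_integrable_real_affine[OF assms, of 1 c] lborel_integral_real_affine[of 1 f c]
 by (simp_all add: add.commute)

lemma nn_integral_translate:
 fixes f :: "real => ennreal"
 assumes "f \<in> borel_measurable borel"
 shows "(\<integral>\<^sup>+s. f (s + c) \<partial>lborel) = (\<integral>\<^sup>+s. f s \<partial>lborel)"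
 using nn_integral_real_affine[OF assms, of 1 c] by (simp add: add.commute)

text \<open>Outer regularity inserts an open set \<open>U\<close> of small excess. Points of an open
  set stay inside under small shifts, so the part of its indicator that a shift loses tends to 0 by
  dominated convergence.\<close>

lemma indicator_translate_L1:
 fixes A :: "real set"
 assumes A: "A \<in> sets borel" "emeasure lborel A < \<infinity>" and e: "e > 0"
 shows "\<exists>d>0. \<forall>et. \<bar>et\<bar> < d --> (LINT s|lborel. \<bar>indicator A (s + et) - indicator A s :: real\<bar>) < e"
proof -
 obtain U where U: "open U" "A \<subseteq> U" "emeasure lborel (U - A) < ennreal (e / 4)"
  using outer_regular_lborel[OF A(1), of "e / 4"] e by auto
 have Ub: "U \<in> sets borel" using U(1) by auto
 have "emeasure lborel U <= emeasure lborel A + emeasure lborel (U - A)"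
  using U(2) A(1) Ub emeasure_subadditive[of A lborel "U - A"] by (simp add: Un_absorb1)
 also have "... < \<infinity>" using A(2) U(3) by (auto simp: less_top[symmetric])
 finally have Uf: "emeasure lborel U < \<infinity>" .
 let ?a = "%s. indicator A s :: real" and ?u = "%s. indicator U s :: real"
 have ia: "integrable lborel ?a" and iu: "integrable lborel ?u"
  using A Uf Ub by (auto simp: integrable_indicator_iff)
 have ua: "(LINT s|lborel. \<bar>?u s - ?a s\<bar>) < e / 4"
 proof -
  have "\<bar>?u s - ?a s\<bar> = indicator (U - A) s" for s using U(2) by (auto simp: indicator_def)
  then have "(LINT s|lborel. \<bar>?u s - ?a s\<bar>) = measure lborel (U - A)" by simp
  also have "... < e / 4"
   using U(3) e by (cases "emeasure lborel (U - A)") (auto simp: measure_def ennreal_less_iff)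
  finally show ?thesis .
 qed
 have pos: "((%et. LINT s|lborel. max 0 (?u s - ?u (s + et))) \<longlongrightarrow> (LINT s|(lborel :: real measure). (0::real))) (at 0)"
 proof (rule tendsto_at_iff_sequentially[THEN iffD2], intro allI impI)
  fix X :: "nat => real" assume X: "\<forall>i. X i \<in> UNIV - {0}" "X ----> 0"
  show "((%et. LINT s|lborel. max 0 (?u s - ?u (s + et))) \<circ> X) ----> (LINT s|(lborel :: real measure). (0::real))"
   unfolding o_def
  proof (rule integral_dominated_convergence[where w="?u"])
   show "AE s in lborel. (%i. max 0 (?u s - ?u (s + X i))) ----> 0"
   proof (rule AE_I2)
    fix s
    show "(%i. max 0 (?u s - ?u (s + X i))) ----> 0"
    proof (cases "s \<in> U")
     case True
     have "(%i. s + X i) ----> s + 0" by (intro tendsto_intros X)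
     then have "eventually (%i. s + X i \<in> U) sequentially"
      using U(1) True by (intro topological_tendstoD[where l=s]) auto
     then show ?thesis by (intro tendsto_eventually) (auto elim!: eventually_mono simp: True)
    qed (auto simp: indicator_def)
   qed
   show "(%s. max 0 (?u s - ?u (s + X i))) \<in> borel_measurable lborel" for i using Ub by measurable
  qed (use iu Ub in \<open>auto simp: indicator_def\<close>)
 qed
 then have "eventually (%et. (LINT s|lborel. max 0 (?u s - ?u (s + et))) < e / 4) (at 0)"
  using e by (intro order_tendstoD(2)[OF pos]) simp
 then obtain d where d: "d > 0" "!!et. et \<noteq> 0 ==> \<bar>et\<bar> < d ==> (LINT s|lborel. max 0 (?u s - ?u (s + et))) < e / 4"
  unfolding eventually_at by (auto simp: dist_real_def)
 have "(LINT s|lborel. \<bar>?a (s + et) - ?a s\<bar>) < e" if et: "\<bar>et\<bar> < d" for et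
 proof (cases "et = 0")
  case False
  have iu': "integrable lborel (%s. ?u (s + et))" "(LINT s|lborel. ?u (s + et)) = (LINT s|lborel. ?u s)"
   using integrable_translate[OF iu] by auto
  have ia': "integrable lborel (%s. ?a (s + et))" using integrable_translate[OF ia] by auto
  have id: "integrable lborel (%s. \<bar>?u s - ?a s\<bar>)" using iu ia by simp
  have id': "integrable lborel (%s. \<bar>?u (s + et) - ?a (s + et)\<bar>)" "(LINT s|lborel. \<bar>?u (s + et) - ?a (s + et)\<bar>) < e / 4"
   using integrable_translate[OF id, of et] ua by auto
  have im: "integrable lborel (%s. max 0 (?u s - ?u (s + et)))" using iu iu' by auto
  \<comment> \<open>The part gained by the shift has the same integral as the part lost, because
    translation preserves the integral of \<open>?u\<close>.\<close>
  have "\<bar>?u (s + et) - ?u s\<bar> = 2 * max 0 (?u s - ?u (s + et)) + (?u (s + et) - ?u s)" for s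
   by (auto simp: indicator_def)
  then have "(LINT s|lborel. \<bar>?u (s + et) - ?u s\<bar>) = 2 * (LINT s|lborel. max 0 (?u s - ?u (s + et)))"
   using im iu iu' by simp
  also have "... < e / 2" using d(2)[OF False et] by simp
  finally have uu: "(LINT s|lborel. \<bar>?u (s + et) - ?u s\<bar>) < e / 2" .
  have "(LINT s|lborel. \<bar>?a (s + et) - ?a s\<bar>) <= (LINT s|lborel. \<bar>?u (s + et) - ?a (s + et)\<bar> + \<bar>?u (s + et) - ?u s\<bar> + \<bar>?u s - ?a s\<bar>)"
   using ia ia' iu iu' id id' by (intro integral_mono) auto
  also have "... = (LINT s|lborel. \<bar>?u (s + et) - ?a (s + et)\<bar>) + (LINT s|lborel. \<bar>?u (s + et) - ?u s\<bar>) + (LINT s|lborel. \<bar>?u s - ?a s\<bar>)"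
   using iu iu' id id' by simp
  also have "... < e" using id'(2) uu ua by linarith
  finally show ?thesis .
 qed (use e in simp)
 then show ?thesis using d(1) by blast
qed

lemma ennreal_abs_integral_le:
 fixes f :: "'a => real"
 shows "ennreal \<bar>integral\<^sup>L M f\<bar> <= (\<integral>\<^sup>+x. ennreal \<bar>f x\<bar> \<partial>M)"
proof (cases "integrable M f")
 case True
 then show ?thesis using integral_norm_bound_ennreal[OF True] by simp
qed (simp add: not_integrable_integral_eq)

text \<open>If \<open>F r\<close> is Lipschitz at \<open>f r\<close> with a constant depending on \<open>r\<close> and a slow growth bound holds, then
  shifting the second argument off the diagonal changes \<open>F\<close> little in the mean.\<close>
lemma diagonal_shift:
 fixes F d :: "real => real => real" and C K G :: "real => real"
 assumes F: "(%p. F (fst p) (snd p)) \<in> borel_measurable lborel2"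
  and d: "(%p. d (fst p) (snd p)) \<in> borel_measurable lborel2" "!!r t. 0 <= d r t"
  and C: "C \<in> borel_measurable borel"
  and KG: "integrable lborel K" "integrable lborel G" "!!t. 0 <= K t" "!!t. 0 <= G t"
  and Lip: "!!r t. \<bar>F r t - F r r\<bar> <= C r * d r t"
  and growth: "!!\<epsilon>. \<epsilon> > 0 ==> \<exists>A\<ge>0. \<forall>r t. \<bar>F r t\<bar> <= \<epsilon> * K t + A * G r"
  and trans: "!!e. e > 0 ==> \<exists>de>0. \<forall>et. \<bar>et\<bar> < de --> (\<integral>\<^sup>+r. ennreal (d r (r + et)) \<partial>lborel) <= ennreal e"
  and e: "e > 0"
 shows "\<exists>de>0. \<forall>et. \<bar>et\<bar> < de --> (\<integral>\<^sup>+r. ennreal \<bar>F r (r + et) - F r r\<bar> \<partial>lborel) <= ennreal e"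
proof -
 define k where "k = (LINT t|lborel. K t)"
 have k0: "k >= 0" unfolding k_def using KG by (intro integral_nonneg_AE) auto
 \<comment> \<open>\<open>K\<close> is used twice, at \<open>r\<close> and at the shifted time, and
   may cost e/3 in total.\<close>
 define \<epsilon> where "\<epsilon> = e / (6 * (k + 1))"
 have \<epsilon>: "\<epsilon> > 0" "2 * (\<epsilon> * k) <= e / 3"
  using e k0 by (auto simp: \<epsilon>_def field_simps)
 obtain A where A: "A >= 0" "!!r t. \<bar>F r t\<bar> <= \<epsilon> * K t + A * G r"
  using growth[OF \<epsilon>(1)] by blast
 \<comment> \<open>Where the Lipschitz constant exceeds \<open>n\<close>, only the growth bound
   helps: there \<open>G\<close> has small integral for large \<open>n\<close>, and the terms with
   \<open>K\<close> are small through \<epsilon>. Elsewhere \<open>n\<close> times the translation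
   error is small for small shifts.\<close>
 let ?bad = "%n::nat. indicator {r. C r > real n} :: real => real"
 have badm: "{r. C r > real n} \<in> sets borel" for n using C by measurable
 have "(%n. LINT r|lborel. ?bad n r * G r) ----> (LINT r|(lborel :: real measure). (0 :: real))"
 proof (rule integral_dominated_convergence[where w=G])
  show "AE r in lborel. (%n. ?bad n r * G r) ----> 0"
  proof (rule AE_I2)
   fix r
   obtain N :: nat where "C r < real N" using reals_Archimedean2 by blast
   then have "eventually (%n. ?bad n r * G r = 0) sequentially"
    by (intro eventually_sequentiallyI[of N]) (auto simp: indicator_def)
   then show "(%n. ?bad n r * G r) ----> 0" by (rule tendsto_eventually)
  qed
  show "AE r in lborel. norm (?bad n r * G r) <= G r" for n
   using KG by (intro AE_I2) (auto simp: indicator_def)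
  show "(%r. ?bad n r * G r) \<in> borel_measurable lborel" for n
   using KG(2) badm by (intro borel_measurable_times borel_measurable_indicator) auto
 qed (use KG in auto)
 then have "(%n. 2 * A * (LINT r|lborel. ?bad n r * G r)) ----> 2 * A * 0" by (intro tendsto_intros) simp
 then have "eventually (%n. 2 * A * (LINT r|lborel. ?bad n r * G r) < e / 3) sequentially"
  using e by (intro order_tendstoD(2)) auto
 then obtain n where n: "2 * A * (LINT r|lborel. ?bad n r * G r) < e / 3"
  unfolding eventually_sequentially by blast
 obtain de where de: "de > 0" "!!et. \<bar>et\<bar> < de ==> (\<integral>\<^sup>+r. ennreal (d r (r + et)) \<partial>lborel) <= ennreal (e / (3 * (real n + 1)))"
  using trans[of "e / (3 * (real n + 1))"] e by (auto simp: field_simps)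
 have "(\<integral>\<^sup>+r. ennreal \<bar>F r (r + et) - F r r\<bar> \<partial>lborel) <= ennreal e" if et: "\<bar>et\<bar> < de" for et
 proof -
  have Km: "K \<in> borel_measurable borel" and Gm: "G \<in> borel_measurable borel" using KG by auto
  have dm: "(%r. d r (r + et)) \<in> borel_measurable borel"
  proof -
   have "(%r. (r, r + et)) \<in> measurable lborel lborel2" by measurable
   from measurable_compose[OF this d(1)] show ?thesis by simp
  qed
  have pt: "\<bar>F r (r + et) - F r r\<bar> <= real n * d r (r + et) + \<epsilon> * K (r + et) + \<epsilon> * K r + 2 * A * (?bad n r * G r)" for r
  proof (cases "C r > real n")
   case True
   have "0 <= real n * d r (r + et)" using d(2) by simp
   moreover have "?bad n r = 1" using True by simp
   ultimately show ?thesis using A(2)[of r "r + et"] A(2)[of r r] by (simp only: mult_1_left)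
  next
   case False
   then have "C r * d r (r + et) <= real n * d r (r + et)" using d(2) by (intro mult_right_mono) auto
   moreover have "0 <= \<epsilon> * K (r + et)" "0 <= \<epsilon> * K r" using \<epsilon> KG by auto
   moreover have "?bad n r = 0" using False by simp
   ultimately show ?thesis using Lip[of r "r + et"] by simp
  qed
  have iK: "integrable lborel (%r. \<epsilon> * K (r + et) + \<epsilon> * K r + 2 * A * (?bad n r * G r))"
  proof (intro integrable_plus)
   have "integrable lborel (%r. ?bad n r * G r)"
   proof (rule integrable_dominated[OF KG(2)])
    show "(%r. ?bad n r * G r) \<in> borel_measurable lborel"
     using Gm badm by (intro borel_measurable_times borel_measurable_indicator) auto
   qed (auto simp: indicator_def)
   then show "integrable lborel (%r. 2 * A * (?bad n r * G r))" by simp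
  qed (use KG integrable_translate[OF KG(1)] in auto)
  have nn: "0 <= \<epsilon> * K (r + et) + \<epsilon> * K r + 2 * A * (?bad n r * G r)" for r
   using \<epsilon> KG A by auto
  have "(\<integral>\<^sup>+r. ennreal \<bar>F r (r + et) - F r r\<bar> \<partial>lborel)
   <= (\<integral>\<^sup>+r. ennreal (real n) * ennreal (d r (r + et)) + ennreal (\<epsilon> * K (r + et) + \<epsilon> * K r + 2 * A * (?bad n r * G r)) \<partial>lborel)"
  proof (rule nn_integral_mono)
   fix r
   have "\<bar>F r (r + et) - F r r\<bar> <= real n * d r (r + et) + (\<epsilon> * K (r + et) + \<epsilon> * K r + 2 * A * (?bad n r * G r))"
    using pt[of r] by linarith
   then have "ennreal \<bar>F r (r + et) - F r r\<bar> <= ennreal (real n * d r (r + et) + (\<epsilon> * K (r + et) + \<epsilon> * K r + 2 * A * (?bad n r * G r)))"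
    by (rule ennreal_leI)
   also have "... = ennreal (real n) * ennreal (d r (r + et)) + ennreal (\<epsilon> * K (r + et) + \<epsilon> * K r + 2 * A * (?bad n r * G r))"
    unfolding ennreal_plus[OF mult_nonneg_nonneg[OF of_nat_0_le_iff d(2)] nn] ennreal_mult[OF of_nat_0_le_iff d(2)] ..
   finally show "ennreal \<bar>F r (r + et) - F r r\<bar> <= ..." .
  qed
  also have "... = ennreal (real n) * (\<integral>\<^sup>+r. ennreal (d r (r + et)) \<partial>lborel)
    + (\<integral>\<^sup>+r. ennreal (\<epsilon> * K (r + et) + \<epsilon> * K r + 2 * A * (?bad n r * G r)) \<partial>lborel)"
   using dm borel_measurable_integrable[OF iK] by (subst nn_integral_add) (auto simp: nn_integral_cmult)
  also have "(\<integral>\<^sup>+r. ennreal (\<epsilon> * K (r + et) + \<epsilon> * K r + 2 * A * (?bad n r * G r)) \<partial>lborel)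
    = ennreal (LINT r|lborel. \<epsilon> * K (r + et) + \<epsilon> * K r + 2 * A * (?bad n r * G r))"
   using nn by (intro nn_integral_eq_integral iK) auto
  also have "(LINT r|lborel. \<epsilon> * K (r + et) + \<epsilon> * K r + 2 * A * (?bad n r * G r)) <= e / 3 + e / 3"
  proof -
   have i3: "integrable lborel (%r. ?bad n r * G r)"
   proof (rule integrable_dominated[OF KG(2)])
    show "(%r. ?bad n r * G r) \<in> borel_measurable lborel"
     using Gm badm by (intro borel_measurable_times borel_measurable_indicator) auto
   qed (auto simp: indicator_def)
   have "(LINT r|lborel. \<epsilon> * K (r + et) + \<epsilon> * K r + 2 * A * (?bad n r * G r))
    = \<epsilon> * k + \<epsilon> * k + 2 * A * (LINT r|lborel. ?bad n r * G r)"
    using KG integrable_translate[OF KG(1), of et] i3 by (simp add: k_def)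
   then show ?thesis using \<epsilon>(2) n by linarith
  qed
  then have "ennreal (LINT r|lborel. \<epsilon> * K (r + et) + \<epsilon> * K r + 2 * A * (?bad n r * G r)) <= ennreal (e / 3 + e / 3)"
   by (rule ennreal_leI)
  also have "ennreal (real n) * (\<integral>\<^sup>+r. ennreal (d r (r + et)) \<partial>lborel) <= ennreal (real n) * ennreal (e / (3 * (real n + 1)))"
   by (intro mult_left_mono de et) simp
  also have "... <= ennreal (e / 3)" using e by (simp add: ennreal_mult[symmetric] ennreal_leI field_simps)
  finally show ?thesis using e by (simp add: ennreal_plus[symmetric] del: ennreal_plus)
 qed
 then show ?thesis using de(1) by blast
qed

text \<open>Averages to the right of the point are the ones that telescoping produces in
  \<open>diagonal_rule\<close>.\<close>

lemma Lebesgue_differentiation: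
 fixes f :: "real => real"
 assumes f: "integrable lborel f"
 shows "AE x in lborel. \<forall>e>0. \<exists>d>0. \<forall>de. 0 < de & de < d -->
  \<bar>(LINT s|lborel. indicator {x<..<x + de} s * f s) / de - f x\<bar> < e"
proof -
 have fl: "integrable lebesgue f" using f by (simp add: integrable_completion borel_measurable_integrable)
 have io: "f integrable_on cbox a b" for a b
  using integrable_on_lebesgue[OF fl] integrable_on_subcbox by blast
 obtain N where N: "negligible N"
  "!!x e. x \<notin> N ==> 0 < e ==> \<exists>d>0. \<forall>h. 0 < h & h < d -->
   norm (integral (cbox x (x + h *\<^sub>R One)) f /\<^sub>R h ^ DIM(real) - f x) < e"
  by (rule integrable_ccontinuous_explicit[of f, OF io]) (rule that, assumption, assumption)
 have eq: "integral (cbox x (x + de *\<^sub>R One)) f /\<^sub>R de ^ DIM(real) = (LINT s|lborel. indicator {x<..<x + de} s * f s) / de" for x de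
 proof -
  have m: "(%s. indicator {x<..<x + de} s * f s) \<in> borel_measurable borel"
   using f by (intro borel_measurable_times borel_measurable_indicator) auto
  have "set_integrable lebesgue {x<..<x + de} f"
   using set_integrable_subset[of lebesgue UNIV f] fl by (auto simp: set_integrable_def)
  then have "integrable (lebesgue_on {x<..<x + de}) f"
   by (simp add: integrable_restrict_space set_integrable_def)
  then have "(LINT s|lebesgue_on {x<..<x + de}. f s) = integral {x<..<x + de} f"
   by (intro lebesgue_integral_eq_integral) auto
  moreover have "(LINT s|lebesgue_on {x<..<x + de}. f s) = (LINT s|lebesgue. indicator {x<..<x + de} s * f s)"
   by (simp add: integral_restrict_space)
  moreover have "... = (LINT s|lborel. indicator {x<..<x + de} s * f s)"
   using m by (intro integral_completion) simp
  ultimately show ?thesis by (simp add: integral_open_interval_real divide_inverse mult.commute)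
 qed
 have "N \<in> null_sets lebesgue" using N(1) by (simp add: negligible_iff_null_sets)
 then have "AE x in lebesgue. x \<notin> N" by (rule AE_not_in)
 then have "AE x in lborel. x \<notin> N" by (simp add: AE_completion_iff)
 then show ?thesis by (rule eventually_mono) (use N(2) in \<open>simp only: eq real_norm_def, blast\<close>)
qed

lemma vanishing_initial_integral:
 fixes J :: "real => real"
 assumes J: "integrable lborel J" and e: "e > 0"
 shows "\<exists>de>0. \<forall>t\<le>de. \<bar>LINT r|lborel. indicator {0<..<t} r * J r\<bar> <= e"
proof -
 have i: "integrable lborel (%r. indicator {0<..<t} r * \<bar>J r\<bar>)" for t :: real
  using integrable_mult_indicator[of "{0<..<t}" lborel "%r. \<bar>J r\<bar>"] integrable_abs[OF J] by simp
 have i': "integrable lborel (%r. indicator {0<..<t} r * J r)" for t :: real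
  using integrable_mult_indicator[of "{0<..<t}" lborel J] J by simp
 have "(%n. LINT r|lborel. indicator {0<..<1 / real (Suc n)} r * \<bar>J r\<bar>) ----> (LINT r|(lborel::real measure). (0::real))"
 proof (rule integral_dominated_convergence[where w="%r. \<bar>J r\<bar>"])
  show "AE r in lborel. (%n. indicator {0<..<1 / real (Suc n)} r * \<bar>J r\<bar>) ----> 0"
  proof (rule AE_I2)
   fix r :: real
   have "eventually (%n. r <= 0 \<or> 1 / real (Suc n) < r) sequentially"
   proof (cases "r <= 0")
    case False
    then show ?thesis
     using order_tendstoD(2)[OF LIMSEQ_inverse_real_of_nat, of r] by (simp add: inverse_eq_divide)
   qed simp
   then have "eventually (%n. 0 = indicator {0<..<1 / real (Suc n)} r * \<bar>J r\<bar>) sequentially"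
    by eventually_elim auto
   from Lim_transform_eventually[OF tendsto_const this]
   show "(%n. indicator {0<..<1 / real (Suc n)} r * \<bar>J r\<bar>) ----> 0" .
  qed
  show "AE r in lborel. norm (indicator {0<..<1 / real (Suc n)} r * \<bar>J r\<bar>) <= \<bar>J r\<bar>" for n
   by (auto simp: indicator_def)
 qed (use J i in auto)
 then have "eventually (%n. (LINT r|lborel. indicator {0<..<1 / real (Suc n)} r * \<bar>J r\<bar>) < e) sequentially"
  using e by (intro order_tendstoD(2)) auto
 then obtain n where n: "(LINT r|lborel. indicator {0<..<1 / real (Suc n)} r * \<bar>J r\<bar>) < e"
  unfolding eventually_sequentially by blast
 show ?thesis
 proof (intro exI[of _ "1 / real (Suc n)"] conjI allI impI)
  fix t assume t: "t <= 1 / real (Suc n)"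
  have "\<bar>LINT r|lborel. indicator {0<..<t} r * J r\<bar> <= (LINT r|lborel. \<bar>indicator {0<..<t} r * J r\<bar>)"
   by (rule integral_abs_bound)
  also have "... <= (LINT r|lborel. indicator {0<..<1 / real (Suc n)} r * \<bar>J r\<bar>)"
   using t by (intro integral_mono integrable_abs i i') (auto simp: indicator_def)
  finally show "\<bar>LINT r|lborel. indicator {0<..<t} r * J r\<bar> <= e" using n by simp
 qed simp
qed

text \<open>A product rule for \<open>ga\<close>, whose increments are integrals of
  \<open>F1\<close> frozen at the right end and of \<open>F2\<close> frozen at the left end. Once
  the diagonal integral is subtracted, the increments over a step \<open>de\<close>, integrated over
  starting times in (0, ta), telescope to the difference of the integrals over an interval of length
  \<open>de\<close> after \<open>ta\<close> and one after 0. The shift hypotheses make this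
  difference o(de); division by \<open>de\<close> and Lebesgue differentiation conclude.\<close>

lemma diagonal_rule:
 fixes F1 F2 :: "real => real => real" and K G ga :: "real => real"
 assumes F1: "(%p. F1 (fst p) (snd p)) \<in> borel_measurable lborel2"
  and F2: "(%p. F2 (fst p) (snd p)) \<in> borel_measurable lborel2"
  and KG: "integrable lborel K" "integrable lborel G"
  and b1: "!!r t. \<bar>F1 r t\<bar> <= K t + G r" and b2: "!!r t. \<bar>F2 r t\<bar> <= K t + G r"
  and s1: "!!e. e > 0 ==> \<exists>de>0. \<forall>et. \<bar>et\<bar> < de --> (\<integral>\<^sup>+r. ennreal \<bar>F1 r (r + et) - F1 r r\<bar> \<partial>lborel) <= ennreal e"
  and s2: "!!e. e > 0 ==> \<exists>de>0. \<forall>et. \<bar>et\<bar> < de --> (\<integral>\<^sup>+r. ennreal \<bar>F2 r (r + et) - F2 r r\<bar> \<partial>lborel) <= ennreal e"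
  and ga: "ga \<in> borel_measurable borel" "!!t. \<bar>ga t\<bar> <= M"
  and rel: "!!de. de > 0 ==> AE s in lborel. 0 < s & s + de < T --> ga (s + de) - ga s =
   (LINT r|lborel. indicator {s<..<s + de} r * F1 r (s + de)) + (LINT r|lborel. indicator {s<..<s + de} r * F2 r s)"
  and ga0: "!!e. e > 0 ==> \<exists>de>0. AE s in lborel. 0 < s & s < de --> \<bar>ga s - ga\<^sub>0\<bar> <= e"
 shows "AE t in lborel. 0 < t & t < T --> ga t = ga\<^sub>0 + (LINT r|lborel. indicator {0<..<t} r * (F1 r r + F2 r r))"
proof (cases "T > 0")
 case T: True
 define Dg where "Dg r = F1 r r + F2 r r" for r
 have diag: "(%r. (r, r)) \<in> measurable lborel lborel2" by measurable
 have F1d: "(%r. F1 r r) \<in> borel_measurable borel" and F2d: "(%r. F2 r r) \<in> borel_measurable borel"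
  using measurable_compose[OF diag F1] measurable_compose[OF diag F2] by simp_all
 have Dm: "Dg \<in> borel_measurable borel" unfolding Dg_def using F1d F2d by measurable
 have i1: "integrable lborel (%r. F1 r r)" and i2: "integrable lborel (%r. F2 r r)"
  by (rule integrable_dominated[of _ "%r. K r + G r"],
    use KG F1d F2d order_trans[OF b1 abs_ge_self] order_trans[OF b2 abs_ge_self] in auto)+
 have Di: "integrable lborel Dg" unfolding Dg_def using i1 i2 by simp
 define L where "L s = (LINT r|lborel. indicator {0<..<s} r * Dg r)" for s
 have iind: "integrable lborel (%r. indicator {a<..<b} r * f r)" if "integrable lborel f" for f :: "real => real" and a b
  using integrable_mult_indicator[of "{a<..<b}" lborel f] that by simp
 have Lm: "L \<in> borel_measurable borel"
 proof -
  have "(%p. (if 0 < snd p & snd p < fst p then 1 else 0) * Dg (snd p)) \<in> borel_measurable (borel \<Otimes>\<^sub>M borel)"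
   using Dm by measurable
  then have "(%s. LINT r|lborel. (if 0 < r & r < s then 1 else 0) * Dg r) \<in> borel_measurable borel"
   by (intro lborel.borel_measurable_lebesgue_integral) (simp add: case_prod_beta cong: measurable_cong_sets)
  moreover have "L = (%s. LINT r|lborel. (if 0 < r & r < s then 1 else 0) * Dg r)"
   unfolding L_def by (intro ext Bochner_Integration.integral_cong) (auto simp: indicator_def)
  ultimately show ?thesis by simp
 qed
 define l where "l = (LINT r|lborel. \<bar>Dg r\<bar>)"
 have Lb: "\<bar>L s\<bar> <= l" for s
 proof -
  have "\<bar>L s\<bar> <= (LINT r|lborel. \<bar>indicator {0<..<s} r * Dg r\<bar>)"
   unfolding L_def by (rule integral_abs_bound)
  also have "... <= l"
   unfolding l_def by (intro integral_mono integrable_abs iind Di) (auto simp: indicator_def)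
  finally show ?thesis .
 qed
 have Ldiff: "L (s + de) - L s = (LINT r|lborel. indicator {s<..<s + de} r * Dg r)" if "0 < s" "0 < de" for s de
 proof -
  have "L (s + de) = (LINT r|lborel. indicator {0<..<s} r * Dg r + indicator {s<..<s + de} r * Dg r)"
   unfolding L_def
  proof (rule integral_cong_AE)
   have "AE r in lborel. r \<noteq> s" by (rule AE_lborel_singleton)
   then show "AE r in lborel. indicator {0<..<s + de} r * Dg r = indicator {0<..<s} r * Dg r + indicator {s<..<s + de} r * Dg r"
    by (rule eventually_mono) (use that in \<open>auto simp: indicator_def\<close>)
  qed (use Dm in measurable)
  then show ?thesis using iind[OF Di] by (simp add: L_def)
 qed
 \<comment> \<open>The deviation of \<open>ga\<close> from the diagonal integral. The claim is that
   it equals \<open>ga\<^sub>0\<close> almost everywhere on (0, T).\<close>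
 define b where "b s = indicator {0<..<T} s * (ga s - L s)" for s
 have bm: "b \<in> borel_measurable borel" unfolding b_def using ga Lm by measurable
 have bi: "integrable lborel b"
 proof (rule integrable_dominated)
  show "integrable lborel (%s. indicator {0<..<T} s * (\<bar>M\<bar> + \<bar>l\<bar>))"
   using T by (intro integrable_mult_left) (simp add: integrable_indicator_iff)
  show "AE s in lborel. norm (b s) <= norm (indicator {0<..<T} s * (\<bar>M\<bar> + \<bar>l\<bar>))"
  proof (rule AE_I2)
   fix s
   show "norm (b s) <= norm (indicator {0<..<T} s * (\<bar>M\<bar> + \<bar>l\<bar>))"
    using ga(2)[of s] Lb[of s] by (auto simp: b_def indicator_def)
  qed
 qed (use bm in simp)
 have key: "\<exists>de\<^sub>0>0. \<forall>de. 0 < de & de < de\<^sub>0 & ta + de < T -->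
   \<bar>(LINT s|lborel. indicator {ta<..<ta + de} s * b s) - (LINT s|lborel. indicator {0<..<de} s * b s)\<bar> <= e * de"
  if e: "e > 0" and ta: "0 < ta" "ta < T" for e ta
 proof -
  obtain d1 where d1: "d1 > 0" "!!et. \<bar>et\<bar> < d1 ==> (\<integral>\<^sup>+r. ennreal \<bar>F1 r (r + et) - F1 r r\<bar> \<partial>lborel) <= ennreal (e / 2)"
   using s1[of "e / 2"] e by auto
  obtain d2 where d2: "d2 > 0" "!!et. \<bar>et\<bar> < d2 ==> (\<integral>\<^sup>+r. ennreal \<bar>F2 r (r + et) - F2 r r\<bar> \<partial>lborel) <= ennreal (e / 2)"
   using s2[of "e / 2"] e by auto
  have "\<bar>(LINT s|lborel. indicator {ta<..<ta + de} s * b s) - (LINT s|lborel. indicator {0<..<de} s * b s)\<bar> <= e * de"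
   if de: "0 < de" "de < d1" "de < d2" "ta + de < T" for de
  proof -
   define H where "H s rh = (F1 (s + rh) (s + de) - F1 (s + rh) (s + rh)) + (F2 (s + rh) s - F2 (s + rh) (s + rh))" for s rh
   have bs: "integrable lborel (%s. b (s + de))" using integrable_translate[OF bi] by auto
   have "(LINT s|lborel. indicator {0<..<ta} s * (b (s + de) - b s))
    = (LINT s|lborel. indicator {0<..<ta} s * b (s + de)) - (LINT s|lborel. indicator {0<..<ta} s * b s)"
    using iind[OF bs] iind[OF bi] by (simp add: right_diff_distrib)
   also have "(LINT s|lborel. indicator {0<..<ta} s * b (s + de)) = (LINT s|lborel. indicator {de<..<ta + de} s * b s)"
   proof -
    have "(%s. indicator {0<..<ta} s * b (s + de)) = (%s. (%s. indicator {de<..<ta + de} s * b s) (s + de))"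
     by (auto simp: indicator_def)
    then show ?thesis using integrable_translate(2)[OF iind[OF bi, of de "ta + de"], of de] by simp
   qed
   also have "(LINT s|lborel. indicator {de<..<ta + de} s * b s) - (LINT s|lborel. indicator {0<..<ta} s * b s)
    = (LINT s|lborel. indicator {de<..<ta + de} s * b s - indicator {0<..<ta} s * b s)"
    using iind[OF bi] by simp
   \<comment> \<open>Adding (0, de) to the first interval and (ta, ta + de) to the second gives (0,
     ta + de) in both cases.\<close>
   also have "... = (LINT s|lborel. indicator {ta<..<ta + de} s * b s - indicator {0<..<de} s * b s)"
   proof (rule integral_cong_AE)
    have "AE s in lborel. s \<noteq> ta & s \<noteq> de"
     using AE_lborel_singleton[of ta] AE_lborel_singleton[of de] by eventually_elim simp
    then show "AE s in lborel. indicator {de<..<ta + de} s * b s - indicator {0<..<ta} s * b s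
     = indicator {ta<..<ta + de} s * b s - indicator {0<..<de} s * b s"
     by (rule eventually_mono) (use ta de in \<open>auto simp: indicator_def\<close>)
   qed (use bm in measurable)
   also have "... = (LINT s|lborel. indicator {ta<..<ta + de} s * b s) - (LINT s|lborel. indicator {0<..<de} s * b s)"
    using iind[OF bi] by simp
   finally have eq: "(LINT s|lborel. indicator {ta<..<ta + de} s * b s) - (LINT s|lborel. indicator {0<..<de} s * b s)
    = (LINT s|lborel. indicator {0<..<ta} s * (b (s + de) - b s))" by simp
   have inc: "AE s in lborel. 0 < s & s < ta --> b (s + de) - b s = (LINT rh|lborel. indicator {0<..<de} rh * H s rh)"
    using rel[OF de(1)]
   proof eventually_elim
    case (elim s)
    show ?case
    proof (intro impI, elim conjE)
     assume s: "0 < s" "s < ta"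
     then have sT: "s + de < T" using de by simp
     have sec: "(%r. f r t) \<in> borel_measurable borel"
      if "(%p. f (fst p) (snd p)) \<in> borel_measurable lborel2" for f :: "real => real => real" and t
     proof -
      have "(%r. (r, t)) \<in> measurable lborel lborel2" by measurable
      from measurable_compose[OF this that] show ?thesis by simp
     qed
     have iF: "integrable lborel (%r. indicator {s<..<s + de} r * f r t)"
      if fm: "(%p. f (fst p) (snd p)) \<in> borel_measurable lborel2" and fb: "!!r t. \<bar>f r t\<bar> <= K t + G r"
      for f :: "real => real => real" and t
     proof (rule integrable_dominated)
      show "integrable lborel (%r. indicator {s<..<s + de} r * \<bar>K t\<bar> + \<bar>G r\<bar>)"
       using KG(2) de(1) by (intro integrable_plus integrable_mult_left integrable_abs)
        (auto simp: integrable_indicator_iff)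
      show "(%r. indicator {s<..<s + de} r * f r t) \<in> borel_measurable lborel"
       using sec[OF fm, of t] by measurable
      show "AE r in lborel. norm (indicator {s<..<s + de} r * f r t) <= norm (indicator {s<..<s + de} r * \<bar>K t\<bar> + \<bar>G r\<bar>)"
      proof (rule AE_I2)
       fix r
       show "norm (indicator {s<..<s + de} r * f r t) <= norm (indicator {s<..<s + de} r * \<bar>K t\<bar> + \<bar>G r\<bar>)"
        using fb[of r t] by (auto simp: indicator_def)
      qed
     qed
     have "b (s + de) - b s = (ga (s + de) - ga s) - (L (s + de) - L s)" using s sT de ta by (simp add: b_def)
     also have "... = (LINT r|lborel. indicator {s<..<s + de} r * F1 r (s + de)) + (LINT r|lborel. indicator {s<..<s + de} r * F2 r s)
       - (LINT r|lborel. indicator {s<..<s + de} r * Dg r)" using elim s sT Ldiff[OF s(1) de(1)] by simp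
     also have "... = (LINT r|lborel. indicator {s<..<s + de} r * F1 r (s + de) + indicator {s<..<s + de} r * F2 r s
       - indicator {s<..<s + de} r * Dg r)"
      using iF[OF F1 b1, of "s + de"] iF[OF F2 b2, of s] iind[OF Di, of s "s + de"] by simp
     also have "... = (LINT r|lborel. indicator {s<..<s + de} r * ((F1 r (s + de) - F1 r r) + (F2 r s - F2 r r)))"
      by (intro Bochner_Integration.integral_cong) (auto simp: Dg_def algebra_simps)
     also have "... = (LINT rh|lborel. indicator {s<..<s + de} (s + rh) * ((F1 (s + rh) (s + de) - F1 (s + rh) (s + rh)) + (F2 (s + rh) s - F2 (s + rh) (s + rh))))"
      using lborel_integral_real_affine[of 1 "%r. indicator {s<..<s + de} r * ((F1 r (s + de) - F1 r r) + (F2 r s - F2 r r))" s] by simp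
     also have "... = (LINT rh|lborel. indicator {0<..<de} rh * H s rh)"
      by (intro Bochner_Integration.integral_cong) (auto simp: H_def indicator_def)
     finally show "b (s + de) - b s = (LINT rh|lborel. indicator {0<..<de} rh * H s rh)" .
    qed
   qed
   have cm: "(%p. f (T1 p) (T2 p)) \<in> borel_measurable lborel2"
    if "(%p. f (fst p) (snd p)) \<in> borel_measurable lborel2"
     "T1 \<in> borel_measurable lborel2" "T2 \<in> borel_measurable lborel2"
    for f :: "real => real => real" and T1 T2 :: "field"
   proof -
    have "(%p. (T1 p, T2 p)) \<in> measurable lborel2 lborel2" using that(2,3) by measurable
    from measurable_compose[OF this that(1)] show ?thesis by simp
   qed
   have Hm: "(%p. H (fst p) (snd p)) \<in> borel_measurable lborel2" unfolding H_def
    by (intro borel_measurable_add borel_measurable_diff cm[OF F1] cm[OF F2]; measurable)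
   have Hmm: "(%p. ennreal (indicator {0<..<ta} (fst p) * indicator {0<..<de} (snd p) * \<bar>H (fst p) (snd p)\<bar>)) \<in> borel_measurable lborel2"
    using Hm by measurable
   have "ennreal \<bar>LINT s|lborel. indicator {0<..<ta} s * (b (s + de) - b s)\<bar>
    <= (\<integral>\<^sup>+s. ennreal \<bar>indicator {0<..<ta} s * (b (s + de) - b s)\<bar> \<partial>lborel)"
    by (rule ennreal_abs_integral_le)
   also have "... <= (\<integral>\<^sup>+s. \<integral>\<^sup>+rh. ennreal (indicator {0<..<ta} s * indicator {0<..<de} rh * \<bar>H s rh\<bar>) \<partial>lborel \<partial>lborel)"
   proof (rule nn_integral_mono_AE)
    show "AE s in lborel. ennreal \<bar>indicator {0<..<ta} s * (b (s + de) - b s)\<bar>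
     <= (\<integral>\<^sup>+rh. ennreal (indicator {0<..<ta} s * indicator {0<..<de} rh * \<bar>H s rh\<bar>) \<partial>lborel)"
     using inc
    proof eventually_elim
     case (elim s)
     show ?case
     proof (cases "s \<in> {0<..<ta}")
      case True
      then show ?thesis
       using elim ennreal_abs_integral_le[of lborel "%rh. indicator {0<..<de} rh * H s rh"] by (simp add: abs_mult)
     qed simp
    qed
   qed
   also have "... = (\<integral>\<^sup>+rh. \<integral>\<^sup>+s. ennreal (indicator {0<..<ta} s * indicator {0<..<de} rh * \<bar>H s rh\<bar>) \<partial>lborel \<partial>lborel)"
    using lborel_pair.Fubini'[of "%s rh. ennreal (indicator {0<..<ta} s * indicator {0<..<de} rh * \<bar>H s rh\<bar>)"] Hmm
    by (simp add: case_prod_beta)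
   also have "... <= (\<integral>\<^sup>+rh. ennreal e * indicator {0<..<de} rh \<partial>lborel)"
   proof (rule nn_integral_mono)
    fix rh
    show "(\<integral>\<^sup>+s. ennreal (indicator {0<..<ta} s * indicator {0<..<de} rh * \<bar>H s rh\<bar>) \<partial>lborel) <= ennreal e * indicator {0<..<de} rh"
    proof (cases "rh \<in> {0<..<de}")
     case True
     let ?f1 = "%r. ennreal \<bar>F1 r (r + (de - rh)) - F1 r r\<bar>" and ?f2 = "%r. ennreal \<bar>F2 r (r + (- rh)) - F2 r r\<bar>"
     have dm: "(%r. f r (r + c)) \<in> borel_measurable borel"
      if "(%p. f (fst p) (snd p)) \<in> borel_measurable lborel2" for f :: "real => real => real" and c
     proof -
      have "(%r. (r, r + c)) \<in> measurable lborel lborel2" by measurable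
      from measurable_compose[OF this that] show ?thesis by simp
     qed
     have m: "?f1 \<in> borel_measurable borel" "?f2 \<in> borel_measurable borel"
      using dm[OF F1, of "de - rh"] dm[OF F2, of "- rh"] F1d F2d by measurable
     have "(\<integral>\<^sup>+s. ennreal (indicator {0<..<ta} s * indicator {0<..<de} rh * \<bar>H s rh\<bar>) \<partial>lborel)
      <= (\<integral>\<^sup>+s. ?f1 (s + rh) + ?f2 (s + rh) \<partial>lborel)"
     proof (rule nn_integral_mono)
      fix s
      have "indicator {0<..<ta} s * indicator {0<..<de} rh * \<bar>H s rh\<bar> <= \<bar>F1 (s + rh) (s + de) - F1 (s + rh) (s + rh)\<bar> + \<bar>F2 (s + rh) s - F2 (s + rh) (s + rh)\<bar>"
       by (auto simp: H_def indicator_def)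
      then have "ennreal (indicator {0<..<ta} s * indicator {0<..<de} rh * \<bar>H s rh\<bar>) <= ennreal (\<bar>F1 (s + rh) (s + de) - F1 (s + rh) (s + rh)\<bar> + \<bar>F2 (s + rh) s - F2 (s + rh) (s + rh)\<bar>)"
       by (rule ennreal_leI)
      then show "ennreal (indicator {0<..<ta} s * indicator {0<..<de} rh * \<bar>H s rh\<bar>) <= ?f1 (s + rh) + ?f2 (s + rh)"
       by (simp add: ennreal_plus)
     qed
     also have "... = (\<integral>\<^sup>+s. ?f1 s \<partial>lborel) + (\<integral>\<^sup>+s. ?f2 s \<partial>lborel)"
     proof -
      have "(\<integral>\<^sup>+s. ?f1 (s + rh) + ?f2 (s + rh) \<partial>lborel) = (\<integral>\<^sup>+s. ?f1 s + ?f2 s \<partial>lborel)"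
       using nn_integral_translate[of "%s. ?f1 s + ?f2 s" rh] m by simp
      also have "... = (\<integral>\<^sup>+s. ?f1 s \<partial>lborel) + (\<integral>\<^sup>+s. ?f2 s \<partial>lborel)"
       using m by (intro nn_integral_add) auto
      finally show ?thesis .
     qed
     also have "... <= ennreal (e / 2) + ennreal (e / 2)" using True de by (intro add_mono d1 d2) auto
     also have "... = ennreal e" using e by (simp add: ennreal_plus[symmetric] del: ennreal_plus)
     finally show ?thesis using True by simp
    qed simp
   qed
   also have "... = ennreal (e * de)" using e de by (simp add: nn_integral_cmult ennreal_mult)
   finally show ?thesis unfolding eq using e de by (simp add: ennreal_le_iff)
  qed
  then show ?thesis using d1(1) d2(1) by (intro exI[of _ "min d1 d2"]) auto
 qed
 \<comment> \<open>Near 0 both \<open>ga - ga\<^sub>0\<close> and the integral \<open>L\<close> are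
   small, each by e/2.\<close>
 have start: "\<exists>d>0. \<forall>de. 0 < de & de < d --> \<bar>(LINT s|lborel. indicator {0<..<de} s * b s) / de - ga\<^sub>0\<bar> <= e" if e: "e > 0" for e
 proof -
  obtain d1 where d1: "d1 > 0" "AE s in lborel. 0 < s & s < d1 --> \<bar>ga s - ga\<^sub>0\<bar> <= e / 2"
   using ga0[of "e / 2"] e by auto
  obtain d0 where d0: "d0 > 0" "!!t. t <= d0 ==> \<bar>LINT r|lborel. indicator {0<..<t} r * Dg r\<bar> <= e / 2"
   using vanishing_initial_integral[OF Di, of "e / 2"] e by auto
  then have Ls: "\<bar>L s\<bar> <= e / 2" if "s < d0" for s using that by (simp add: L_def)
  have "\<bar>(LINT s|lborel. indicator {0<..<de} s * b s) / de - ga\<^sub>0\<bar> <= e"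
   if de: "0 < de" "de < d1" "de < d0" "de < T" for de
  proof -
   have ic: "integrable lborel (%s. indicator {0<..<de} s * c)" "(LINT s|lborel. indicator {0<..<de} s * c) = de * c" for c :: real
    using de by (auto simp: integrable_indicator_iff intro!: integrable_mult_left)
   have "\<bar>(LINT s|lborel. indicator {0<..<de} s * b s) - de * ga\<^sub>0\<bar> = \<bar>LINT s|lborel. indicator {0<..<de} s * b s - indicator {0<..<de} s * ga\<^sub>0\<bar>"
    unfolding Bochner_Integration.integral_diff[OF iind[OF bi] ic(1)] ic(2) ..
   also have "... <= (LINT s|lborel. \<bar>indicator {0<..<de} s * b s - indicator {0<..<de} s * ga\<^sub>0\<bar>)"
    by (rule integral_abs_bound)
   also have "... <= (LINT s|lborel. indicator {0<..<de} s * e)"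
   proof (rule integral_mono_AE)
    show "AE s in lborel. \<bar>indicator {0<..<de} s * b s - indicator {0<..<de} s * ga\<^sub>0\<bar> <= indicator {0<..<de} s * e"
     using d1(2)
    proof eventually_elim
     case (elim s)
     show ?case
     proof (cases "s \<in> {0<..<de}")
      case True
      then have "\<bar>ga s - ga\<^sub>0\<bar> <= e / 2" "\<bar>L s\<bar> <= e / 2" "b s = ga s - L s"
       using elim Ls[of s] de by (auto simp: b_def)
      then have "\<bar>b s - ga\<^sub>0\<bar> <= e" by linarith
      then show ?thesis using True by simp
     qed simp
    qed
   qed (use iind[OF bi] ic in auto)
   also have "... = de * e" by (rule ic)
   finally have "\<bar>(LINT s|lborel. indicator {0<..<de} s * b s) - de * ga\<^sub>0\<bar> / de <= e"
    using de by (simp add: field_simps)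
   also have "\<bar>(LINT s|lborel. indicator {0<..<de} s * b s) - de * ga\<^sub>0\<bar> / de = \<bar>(LINT s|lborel. indicator {0<..<de} s * b s) / de - ga\<^sub>0\<bar>"
    using de by (simp add: abs_divide[symmetric, of _ de, unfolded abs_of_pos[OF de(1)]] diff_divide_distrib)
   finally show ?thesis .
  qed
  then show ?thesis using d1(1) d0(1) T by (intro exI[of _ "min (min d1 T) (d0)"]) auto
 qed
 show ?thesis using Lebesgue_differentiation[OF bi]
 proof eventually_elim
  case (elim ta)
  show ?case
  proof (intro impI, elim conjE)
   assume ta: "0 < ta" "ta < T"
   have "\<bar>b ta - ga\<^sub>0\<bar> <= 0"
   proof (rule field_le_epsilon)
    fix e :: real assume "e > 0"
    then have e3: "e / 3 > 0" by simp
    obtain a1 where a1: "a1 > 0" "!!de. 0 < de ==> de < a1 ==> \<bar>(LINT s|lborel. indicator {ta<..<ta + de} s * b s) / de - b ta\<bar> < e / 3"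
     using elim e3 by blast
    obtain a2 where a2: "a2 > 0" "!!de. 0 < de ==> de < a2 ==> \<bar>(LINT s|lborel. indicator {0<..<de} s * b s) / de - ga\<^sub>0\<bar> <= e / 3"
     using start[OF e3] by blast
    obtain a3 where a3: "a3 > 0" "!!de. 0 < de ==> de < a3 ==> ta + de < T ==>
      \<bar>(LINT s|lborel. indicator {ta<..<ta + de} s * b s) - (LINT s|lborel. indicator {0<..<de} s * b s)\<bar> <= e / 3 * de"
     using key[OF e3 ta] by blast
    define de where "de = min (min a1 a2) (min a3 (T - ta)) / 2"
    have de: "0 < de" "de < a1" "de < a2" "de < a3" "ta + de < T"
     using a1(1) a2(1) a3(1) ta by (auto simp: de_def min_def field_simps)
    let ?I = "LINT s|lborel. indicator {ta<..<ta + de} s * b s" and ?J = "LINT s|lborel. indicator {0<..<de} s * b s"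
    have "\<bar>?I / de - ?J / de\<bar> = \<bar>?I - ?J\<bar> / de"
     using de(1) by (simp add: diff_divide_distrib[symmetric] abs_divide)
    also have "... <= e / 3" using a3(2)[OF de(1,4,5)] de(1) by (simp add: divide_le_eq)
    finally show "\<bar>b ta - ga\<^sub>0\<bar> <= 0 + e"
     using a1(2)[OF de(1,2)] a2(2)[OF de(1,3)] by linarith
   qed
   then show "ga ta = ga\<^sub>0 + (LINT r|lborel. indicator {0<..<ta} r * (F1 r r + F2 r r))"
    using ta by (simp add: b_def L_def Dg_def)
  qed
 qed
qed auto

section \<open>Strongly measurable curves\<close>

text \<open>Bochner measurability in a convenient form: values and convergence at every time instead
  of almost every time, and a bare distance \<open>d\<close> on representatives. Composition with
  measurable maps and with continuous functionals is then immediate.\<close>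

definition scurve :: "'a measure => 'f set => ('f => 'f => real) => ('a => 'f) => bool" where
 "scurve M X d f \<longleftrightarrow> (\<forall>t. f t \<in> X) &
  (\<exists>s. (\<forall>n::nat. simple_function M (s n) & (\<forall>t. s n t \<in> X)) & (\<forall>t. (%n. d (s n t) (f t)) ----> 0))"

definition seq_cont :: "'f set => ('f => 'f => real) => (nat => 'f) => 'f => bool" where
 "seq_cont X d F f \<longleftrightarrow> (\<forall>n. F n \<in> X) & f \<in> X & (%n. d (F n) f) ----> 0"

lemma scurve_in: "scurve M X d f ==> f t \<in> X" by (simp add: scurve_def)

lemma scurve_compose:
 assumes "T \<in> measurable M M'" "scurve M' X d f"
 shows "scurve M X d (%x. f (T x))"
proof -
 obtain s where s: "!!n::nat. simple_function M' (s n)" "!!n t. s n t \<in> X" "!!t. (%n. d (s n t) (f t)) ----> 0"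
  using assms(2) unfolding scurve_def by blast
 have "simple_function M (%x. s n (T x))" for n by (rule simple_function_comp[OF assms(1) s(1)])
 then show ?thesis
  using s assms(2) unfolding scurve_def by (intro conjI allI exI[of _ "%n x. s n (T x)"]) auto
qed

text \<open>A functional of simple curves is a simple function, and sequential continuity gives
  pointwise convergence. After \<open>scurve_compose\<close> with projections this yields joint
  measurability of forms evaluated at two different times.\<close>

lemma scurve_measurable3:
 assumes f: "scurve M X d f" and g: "scurve M Y d' g" and k: "scurve M Z d'' k"
  and cont: "!!F f G g K k. seq_cont X d F f ==> seq_cont Y d' G g ==> seq_cont Z d'' K k ==>
   (%n. Fu (F n) (G n) (K n)) ----> (Fu f g k :: real)"
 shows "(%x. Fu (f x) (g x) (k x)) \<in> borel_measurable M"
proof -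
 obtain s1 where s1: "!!n::nat. simple_function M (s1 n)" "!!n t. s1 n t \<in> X" "!!t. (%n. d (s1 n t) (f t)) ----> 0"
  using f unfolding scurve_def by blast
 obtain s2 where s2: "!!n::nat. simple_function M (s2 n)" "!!n t. s2 n t \<in> Y" "!!t. (%n. d' (s2 n t) (g t)) ----> 0"
  using g unfolding scurve_def by blast
 obtain s3 where s3: "!!n::nat. simple_function M (s3 n)" "!!n t. s3 n t \<in> Z" "!!t. (%n. d'' (s3 n t) (k t)) ----> 0"
  using k unfolding scurve_def by blast
 show ?thesis
 proof (rule borel_measurable_LIMSEQ_real)
  fix x
  show "(%n. Fu (s1 n x) (s2 n x) (s3 n x)) ----> Fu (f x) (g x) (k x)"
   using s1 s2 s3 scurve_in[OF f] scurve_in[OF g] scurve_in[OF k] by (intro cont) (auto simp: seq_cont_def)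
 next
  fix n
  have "simple_function M (%x. (s1 n x, s2 n x, s3 n x))" by (intro simple_function_Pair s1 s2 s3)
  from simple_function_compose1[OF this, of "%(a, b, c). Fu a b c"]
  show "(%x. Fu (s1 n x) (s2 n x) (s3 n x)) \<in> borel_measurable M"
   by (intro borel_measurable_simple_function) simp
 qed
qed

lemma scurve_measurable2:
 assumes "scurve M X d f" "scurve M Y d' g"
  and "!!F f G g. seq_cont X d F f ==> seq_cont Y d' G g ==> (%n. Fu (F n) (G n)) ----> (Fu f g :: real)"
 shows "(%x. Fu (f x) (g x)) \<in> borel_measurable M"
 using scurve_measurable3[OF assms(1,2,2), of "%a b c. Fu a b"] assms(3) by blast

lemma scurve_measurable1:
 assumes "scurve M X d f"
  and "!!F f. seq_cont X d F f ==> (%n. Fu (F n)) ----> (Fu f :: real)"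
 shows "(%x. Fu (f x)) \<in> borel_measurable M"
 using scurve_measurable3[OF assms(1,1,1), of "%a b c. Fu a"] assms(2) by blast

lemma scurve_map2:
 assumes f: "scurve M X d f" and g: "scurve M Y d' g"
  and cont: "!!F f G g. seq_cont X d F f ==> seq_cont Y d' G g ==> seq_cont Z d'' (%n. Fu (F n) (G n)) (Fu f g)"
 shows "scurve M Z d'' (%x. Fu (f x) (g x))"
proof -
 obtain s1 where s1: "!!n::nat. simple_function M (s1 n)" "!!n t. s1 n t \<in> X" "!!t. (%n. d (s1 n t) (f t)) ----> 0"
  using f unfolding scurve_def by blast
 obtain s2 where s2: "!!n::nat. simple_function M (s2 n)" "!!n t. s2 n t \<in> Y" "!!t. (%n. d' (s2 n t) (g t)) ----> 0"
  using g unfolding scurve_def by blast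
 have c: "seq_cont Z d'' (%n. Fu (s1 n x) (s2 n x)) (Fu (f x) (g x))" for x
  using s1 s2 scurve_in[OF f] scurve_in[OF g] by (intro cont) (auto simp: seq_cont_def)
 have "simple_function M (%x. Fu (s1 n x) (s2 n x))" for n
  using simple_function_compose1[OF simple_function_Pair[OF s1(1)[of n] s2(1)[of n]], of "%(a, b). Fu a b"] by simp
 then show ?thesis
  using c unfolding scurve_def seq_cont_def by (intro conjI allI exI[of _ "%n x. Fu (s1 n x) (s2 n x)"]) auto
qed

lemma scurve_restrict:
 assumes f: "scurve M X d f" and G: "G \<in> sets M" "space M = UNIV" and z: "z \<in> X" "d z z = 0"
 shows "scurve M X d (%t. if t \<in> G then f t else z)"
proof -
 obtain s where s: "!!n::nat. simple_function M (s n)" "!!n t. s n t \<in> X" "!!t. (%n. d (s n t) (f t)) ----> 0"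
  using f unfolding scurve_def by blast
 have "simple_function M (%t. if t \<in> G then s n t else z)" for n
  using G by (intro simple_function_If_set s simple_function_const) auto
 moreover have "(%n. d (if t \<in> G then s n t else z) (if t \<in> G then f t else z)) ----> 0" for t
  using s(3) z by auto
 ultimately show ?thesis using s z scurve_in[OF f] unfolding scurve_def
  by (intro conjI allI exI[of _ "%n t. if t \<in> G then s n t else z"]) auto
qed

text \<open>Exceptional times go into a Borel null set that is removed from the interval to give
  \<open>G\<close>; Lebesgue simple functions are exchanged for Borel ones at the same cost, and off
  \<open>G\<close> the curve is set to \<open>z\<close>. Through \<open>P\<close> further
  almost-everywhere properties can be built into \<open>G\<close>.\<close>

lemma Bochner_measurable_scurve:
 fixes f :: "real => 'a => real"
 assumes B: "Bochner_measurable {0<..<T} V N f" and V: "V \<subseteq> X" and z: "z \<in> X" "d z z = 0"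
  and d: "!!f g. f \<in> V ==> g \<in> V ==> 0 <= d f g & d f g <= C * N (%x. f x - g x)"
  and P: "AE t in lebesgue_on {0<..<T}. P t"
 obtains G where "G \<in> sets borel" "G \<subseteq> {0<..<T}" "AE t in lebesgue_on {0<..<T}. t \<in> G"
  "!!t. t \<in> G ==> f t \<in> V & P t" "scurve lborel X d (%t. if t \<in> G then f t else z)"
proof -
 let ?I = "{0<..<T}"
 obtain s where fV: "AE t in lebesgue_on ?I. f t \<in> V" and s: "!!n::nat. simple_function (lebesgue_on ?I) (s n)" "!!n. s n ` ?I \<subseteq> V"
  "AE t in lebesgue_on ?I. (%n. N (%x. s n t x - f t x)) ----> 0"
  using B unfolding Bochner_measurable_def by blast
 define s' where "s' n t = (if t \<in> ?I then s n t else z)" for n t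
 have "simple_function lebesgue (s' n)" for n
 proof -
  have "s' n -` {x} = (if x = z then (s n -` {x} \<inter> ?I) \<union> (- ?I) else s n -` {x} \<inter> ?I)" for x
   by (auto simp: s'_def)
  moreover have "s n -` {x} \<inter> ?I \<in> sets lebesgue" for x
   using simple_functionD(2)[OF s(1)[of n], of "{x}"] sets.Int[of "{0<..<T}" lebesgue]
   by (fastforce simp: sets_restrict_space)
  moreover have "s' n ` UNIV \<subseteq> s n ` ?I \<union> {z}" by (auto simp: s'_def)
  then have "finite (s' n ` UNIV)" using simple_functionD(1)[OF s(1)[of n]] by (auto intro: finite_subset)
  ultimately show ?thesis unfolding simple_function_def by auto
 qed
 then have "\<forall>n. \<exists>k. simple_function lborel k & (AE t in lborel. s' n t = k t)"
  using completion_ex_simple_function by blast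
 then obtain k where k: "!!n. simple_function lborel (k n)" "!!n. AE t in lborel. s' n t = k n t" by metis
 have "AE t in lebesgue_on ?I. f t \<in> V & P t & (%n. N (%x. s n t x - f t x)) ----> 0"
  using fV s(3) P by eventually_elim simp
 then have "AE t in lborel. t \<in> ?I --> f t \<in> V & P t & (%n. N (%x. s n t x - f t x)) ----> 0"
  by (subst (asm) AE_lebesgue_on_iff_lborel) simp_all
 moreover have "AE t in lborel. \<forall>n. s' n t = k n t" using k(2) by (simp add: AE_all_countable)
 ultimately have "AE t in lborel. (t \<in> ?I --> f t \<in> V & P t & (%n. N (%x. s n t x - f t x)) ----> 0) & (\<forall>n. s' n t = k n t)"
  by eventually_elim simp
 then obtain Z where Z: "{t \<in> space lborel. \<not> ((t \<in> ?I --> f t \<in> V & P t & (%n. N (%x. s n t x - f t x)) ----> 0) & (\<forall>n. s' n t = k n t))} \<subseteq> Z"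
  "Z \<in> null_sets lborel" unfolding eventually_ae_filter by blast
 define G where "G = ?I - Z"
 have Gb: "G \<in> sets borel" unfolding G_def using Z(2) by auto
 have GG: "f t \<in> V" "P t" "(%n. N (%x. s n t x - f t x)) ----> 0" "k n t = s n t" "s n t \<in> V" if "t \<in> G" for t n
 proof -
  have t: "t \<in> ?I" "t \<notin> Z" using that by (auto simp: G_def)
  then have "f t \<in> V & P t & (%n. N (%x. s n t x - f t x)) ----> 0" "s' n t = k n t" using Z(1) by auto
  then show "f t \<in> V" "P t" "(%n. N (%x. s n t x - f t x)) ----> 0" "k n t = s n t"
   using t by (auto simp: s'_def)
  show "s n t \<in> V" using t(1) s(2)[of n] by blast
 qed
 have "AE t in lborel. t \<notin> Z" by (rule AE_not_in[OF Z(2)])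
 then have aeG: "AE t in lebesgue_on ?I. t \<in> G"
  unfolding G_def by (auto simp: AE_lebesgue_on_iff_lborel elim: eventually_mono)
 have "scurve lborel X d (%t. if t \<in> G then f t else z)" unfolding scurve_def
 proof (intro conjI allI exI[of _ "%n t. if t \<in> G then k n t else z"])
  fix n t
  show "(if t \<in> G then f t else z) \<in> X" "(if t \<in> G then k n t else z) \<in> X"
   using GG V z by auto
  show "simple_function lborel (%t. if t \<in> G then k n t else z)"
   using Gb k by (intro simple_function_If_set simple_function_const) auto
 next
  fix t
  show "(%n. d (if t \<in> G then k n t else z) (if t \<in> G then f t else z)) ----> 0"
  proof (cases "t \<in> G")
   case True
   have "(%n. C * N (%x. s n t x - f t x)) ----> 0" by (rule tendsto_mult_right_zero[OF GG(3)[OF True]])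
   then have "(%n. d (s n t) (f t)) ----> 0"
    by (rule LIMSEQ_null_bound[rotated 2]) (use d[OF GG(5)[OF True] GG(1)[OF True]] in auto)
   then show ?thesis using True GG(4) by simp
  qed (use z in simp)
 qed
 with Gb aeG GG(1,2) show thesis using that[of G] by (auto simp: G_def)
qed

context strip
begin

section \<open>Curves in the Sobolev space and in L2\<close>

abbreviation d1 :: "field => field => real" where
 "d1 f g \<equiv> N1 (%p. f p - g p)"

abbreviation d0 :: "field => field => real" where
 "d0 f g \<equiv> nrm (%p. f p - g p)"

lemma N1_zero [simp]: "N1 (%_. 0) = 0"
proof -
 have "N1 (%p. (0::real) * 0) = 0"
  using L2_norm_cong_AE[OF Sobolev1_cmult(2)[OF zero_Sobolev1, of 0] D_lebesgue]
   L2_norm_cong_AE[OF Sobolev1_cmult(3)[OF zero_Sobolev1, of 0] D_lebesgue] by (simp add: N1_def)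
 then show ?thesis by simp
qed

abbreviation hcurve :: "(real => field) => bool" where
 "hcurve \<equiv> scurve lborel (W1) d1"

abbreviation lcurve :: "(real => field) => bool" where
 "lcurve \<equiv> scurve lborel (L2 D) d0"

lemma seq_cont_L2:
 assumes "seq_cont (W1) d1 F f"
 shows "seq_cont (L2 D) d0 F f" "seq_cont (L2 D) d0 (%n. dx h (F n)) (dx h f)" "seq_cont (L2 D) d0 (%n. dz h (F n)) (dz h f)"
 using assms N1_tendstoD[of F f] unfolding seq_cont_def by (auto intro: Sobolev1_L2 dx_works)
  (auto intro: dz_works)

lemma seq_cont_norm: "seq_cont (L2 D) d0 F f ==> (%n. nrm (F n)) ----> nrm f"
 unfolding seq_cont_def by (intro L2_norm_tendsto) auto

lemma seq_cont_N1: "seq_cont (W1) d1 F f ==> (%n. N1 (F n)) ----> N1 f"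
 using tendsto_add[OF tendsto_add[OF seq_cont_norm[OF seq_cont_L2(1)] seq_cont_norm[OF seq_cont_L2(2)]]
  seq_cont_norm[OF seq_cont_L2(3)], of F f F f F f] by (simp add: N1_def)

lemma seq_cont_inner:
 "seq_cont (L2 D) d0 F f ==> seq_cont (L2 D) d0 G g ==> (%n. ip (F n) (G n)) ----> ip f g"
 unfolding seq_cont_def by (intro L2_inner_tendsto) auto

lemma seq_cont_B:
 "seq_cont (W1) d1 U u ==> seq_cont (W1) d1 F f ==> seq_cont (W1) d1 G g ==>
  (%n. B (U n) (F n) (G n)) ----> B u f g" unfolding seq_cont_def by (intro B_tendsto) auto

lemma seq_cont_a_form:
 assumes F: "seq_cont (W1) d1 F f" and G: "seq_cont (W1) d1 G g"
 shows "(%n. a_form h \<alpha> (F n) (G n)) ----> a_form h \<alpha> f g"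
proof -
 have S: "F n \<in> W1" "f \<in> W1" "G n \<in> W1" "g \<in> W1" for n using F G by (auto simp: seq_cont_def)
 let ?b = "%n. a_const \<alpha> * (d1 (F n) f * N1 (G n)) + a_const \<alpha> * (N1 f * d1 (G n) g)"
 have "(%n. a_form h \<alpha> (F n) (G n) - a_form h \<alpha> f g) ----> 0"
 proof (rule Lim_null_comparison[OF always_eventually])
  have "?b ----> a_const \<alpha> * (0 * N1 g) + a_const \<alpha> * (N1 f * 0)"
   using F G by (intro tendsto_intros seq_cont_N1[OF G]) (auto simp: seq_cont_def)
  then show "?b ----> 0" by simp
  show "\<forall>n. norm (a_form h \<alpha> (F n) (G n) - a_form h \<alpha> f g) <= ?b n"
  proof
   fix n
   have "a_form h \<alpha> (F n) (G n) - a_form h \<alpha> f g = a_form h \<alpha> (%p. F n p - f p) (G n) + a_form h \<alpha> f (%p. G n p - g p)"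
    by (simp add: a_form_diff_left a_form_diff_right S)
   then show "norm (a_form h \<alpha> (F n) (G n) - a_form h \<alpha> f g) <= ?b n"
    using a_form_bound[where \<alpha>=\<alpha>, OF Sobolev1_diff(1)[OF S(1)[of n] S(2)] S(3)[of n]]
     a_form_bound[where \<alpha>=\<alpha>, OF S(2) Sobolev1_diff(1)[OF S(3)[of n] S(4)]] by simp
  qed
 qed
 then show ?thesis by (simp add: LIM_zero_iff)
qed

lemma seq_cont_diff:
 assumes F: "seq_cont (W1) d1 F f" and G: "seq_cont (W1) d1 G g"
 shows "(%n. d1 (F n) (G n)) ----> d1 f g"
proof -
 have S: "F n \<in> W1" "f \<in> W1" "G n \<in> W1" "g \<in> W1" for n using F G by (auto simp: seq_cont_def)
 have "(%n. d1 (F n) (G n) - d1 f g) ----> 0"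
 proof (rule Lim_null_comparison[OF always_eventually])
  have "(%n. d1 (F n) f + d1 (G n) g) ----> 0 + 0" using F G by (intro tendsto_add) (auto simp: seq_cont_def)
  then show "(%n. d1 (F n) f + d1 (G n) g) ----> 0" by simp
  show "\<forall>n. norm (d1 (F n) (G n) - d1 f g) <= d1 (F n) f + d1 (G n) g"
  proof
   fix n
   show "norm (d1 (F n) (G n) - d1 f g) <= d1 (F n) f + d1 (G n) g"
    using N1_triangle[OF S(1,2,3), of n n] N1_triangle[OF S(2,4,3), of n]
     N1_triangle[OF S(2) S(1) S(4), of n] N1_triangle[OF S(1) S(3) S(4), of n n]
     N1_minus_commute[OF S(4) S(3)[of n]] N1_minus_commute[OF S(2) S(1)[of n]] by simp
  qed
 qed
 then show ?thesis by (simp add: LIM_zero_iff)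
qed

text \<open>Continuity of translations in L^1 with values in the Sobolev space. A simple curve close
  to \<open>f\<close> reduces the claim to finitely many indicator functions of time.\<close>

lemma hcurve_translate:
 assumes f: "hcurve f" and supp: "!!t. t \<notin> {0<..<T} ==> f t = (%_. 0)"
  and int: "integrable lborel (%t. N1 (f t))" and e: "e > 0"
 shows "\<exists>de>0. \<forall>et. \<bar>et\<bar> < de --> (\<integral>\<^sup>+r. ennreal (d1 (f (r + et)) (f r)) \<partial>lborel) <= ennreal e"
proof -
 let ?I = "{0<..<T}"
 obtain s where s: "!!n::nat. simple_function lborel (s n)" "!!n t. s n t \<in> W1" "!!t. (%n. d1 (s n t) (f t)) ----> 0"
  using f unfolding scurve_def by blast
 note fS = scurve_in[OF f]
 have Nf: "(%t. N1 (f t)) \<in> borel_measurable lborel" using int by simp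
 have Ns: "(%t. N1 (s n t)) \<in> borel_measurable lborel" for n
  using simple_function_compose1[OF s(1)[of n], of N1] by (rule borel_measurable_simple_function)
 \<comment> \<open>Truncation: where an approximation is much larger than \<open>f\<close> it is
   replaced by 0. This provides an integrable majorant and does not affect the limit.\<close>
 define E where "E n = {t. t \<in> ?I & N1 (s n t) <= N1 (f t) + 1}" for n
 have E: "E n \<in> sets borel" for n unfolding E_def using Nf Ns[of n] by measurable
 define si where "si n t = (if t \<in> E n then s n t else (%_. 0))" for n t
 have si: "simple_function lborel (si n)" "si n t \<in> W1" for n t
  unfolding si_def using E s zero_Sobolev1 by (auto intro!: simple_function_If_set simple_function_const)
 have sicurve: "hcurve (si n)" for n
  unfolding scurve_def using si by (intro conjI allI exI[of _ "%_. si n"]) auto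
 have dm: "(%t. d1 (si n t) (f t)) \<in> borel_measurable lborel" for n
  by (rule scurve_measurable2[OF sicurve f]) (rule seq_cont_diff)
 have bnd: "norm (d1 (si n t) (f t)) <= 2 * N1 (f t) + indicator ?I t" for n t
 proof -
  have "d1 (si n t) (f t) <= N1 (si n t) + N1 (f t)"
   using N1_triangle[OF si(2) zero_Sobolev1 fS, of n t t] N1_minus_commute[OF zero_Sobolev1 fS, of t] by simp
  moreover have "N1 (si n t) <= N1 (f t) + indicator ?I t" by (auto simp: si_def E_def)
  ultimately show ?thesis by simp
 qed
 have "(%n. LINT t|lborel. d1 (si n t) (f t)) ----> (LINT t|(lborel::real measure). (0::real))"
 proof (rule integral_dominated_convergence[where w="%t. 2 * N1 (f t) + indicator ?I t"])
  show "integrable lborel (%t. 2 * N1 (f t) + indicator ?I t)"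
   using int by (intro integrable_plus integrable_mult_right)
     (auto simp: integrable_indicator_iff intro: emeasure_bounded_finite[of ?I, unfolded infinity_ennreal_def])
  show "AE t in lborel. (%n. d1 (si n t) (f t)) ----> 0"
  proof (rule AE_I2)
   fix t
   show "(%n. d1 (si n t) (f t)) ----> 0"
   proof (cases "t \<in> ?I")
    case True
    have "eventually (%n. d1 (s n t) (f t) < 1) sequentially" by (rule order_tendstoD(2)[OF s(3)]) simp
    then have "eventually (%n. d1 (s n t) (f t) = d1 (si n t) (f t)) sequentially"
    proof eventually_elim
     case (elim n)
     then have "N1 (s n t) <= N1 (f t) + 1" using N1_diff_abs[OF s(2)[of n t] fS[of t]] by linarith
     then show ?case using True by (simp add: si_def E_def)
    qed
    from Lim_transform_eventually[OF s(3) this] show ?thesis .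
   next
    case False
    then have "si n t = (%_. 0)" "f t = (%_. 0)" for n using supp by (simp_all only: si_def E_def mem_Collect_eq if_False simp_thms)
    then show ?thesis by simp
   qed
  qed
  show "AE t in lborel. norm (d1 (si n t) (f t)) <= 2 * N1 (f t) + indicator ?I t" for n
   by (rule AE_I2) (rule bnd)
 qed (use dm in auto)
 then have "eventually (%n. (LINT t|lborel. d1 (si n t) (f t)) < e / 3) sequentially"
  using e by (intro order_tendstoD(2)) auto
 then obtain n where n: "(LINT t|lborel. d1 (si n t) (f t)) < e / 3"
  unfolding eventually_sequentially by blast
 define g where "g = si n"
 have gS: "g t \<in> W1" for t by (simp add: g_def si)
 have gi: "integrable lborel (%t. d1 (g t) (f t))"
 proof (rule integrable_dominated)
  show "integrable lborel (%t. 2 * N1 (f t) + indicator ?I t)"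
   using int by (intro integrable_plus integrable_mult_right)
     (auto simp: integrable_indicator_iff intro: emeasure_bounded_finite[of ?I, unfolded infinity_ennreal_def])
  show "AE t in lborel. norm (d1 (g t) (f t)) <= norm (2 * N1 (f t) + indicator ?I t)"
   unfolding g_def by (intro AE_I2 order_trans[OF bnd]) simp
 qed (use dm[of n] in \<open>simp add: g_def\<close>)
 have gf: "(\<integral>\<^sup>+t. ennreal (d1 (g t) (f t)) \<partial>lborel) <= ennreal (e / 3)"
  using n gi by (subst nn_integral_eq_integral) (auto simp: g_def intro!: ennreal_leI)
 \<comment> \<open>The value 0 is left out, since its level set has infinite measure.\<close>
 define R where "R = g ` UNIV - {%_. 0}"
 have fin: "finite (g ` UNIV)" using simple_functionD(1)[OF si(1)[of n]] by (simp add: g_def)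
 then have finR: "finite R" by (simp add: R_def)
 define Mx where "Mx = (\<Sum>v\<in>g ` UNIV. \<Sum>w\<in>g ` UNIV. d1 v w)"
 have gU: "v \<in> W1" if "v \<in> g ` UNIV" for v using that gS by auto
 have Mx: "d1 v w <= Mx" if "v \<in> g ` UNIV" "w \<in> g ` UNIV" for v w
 proof -
  have "d1 v w <= (\<Sum>w\<in>g ` UNIV. d1 v w)" using fin that by (intro member_le_sum) auto
  also have "... <= Mx"
   unfolding Mx_def using fin that by (intro member_le_sum[where f="%v. \<Sum>w\<in>g ` UNIV. d1 v w"]) (auto intro: sum_nonneg)
  finally show ?thesis .
 qed
 have Mx0: "Mx >= 0" unfolding Mx_def by (intro sum_nonneg) auto
 define Ev where "Ev v = g -` {v}" for v
 have Ev: "Ev v \<in> sets borel" for v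
  using simple_functionD(2)[OF si(1)[of n], of "{v}"] by (simp add: Ev_def g_def)
 have EvI: "Ev v \<subseteq> ?I" if "v \<in> R" for v
  using that by (auto simp: Ev_def R_def g_def si_def E_def split: if_splits)
 have "emeasure lborel (Ev v) < \<infinity>" if "v \<in> R" for v
 proof -
  have "emeasure lborel (Ev v) <= emeasure lborel ?I" using EvI[OF that] by (intro emeasure_mono) auto
  also have "... < \<infinity>" by (cases "0 <= T") auto
  finally show ?thesis .
 qed
 then have "\<forall>v\<in>R. \<exists>d>0. \<forall>et. \<bar>et\<bar> < d --> (LINT r|lborel. \<bar>indicator (Ev v) (r + et) - indicator (Ev v) r :: real\<bar>) < e / (3 * (Mx + 1) * (real (card R) + 1))"
  using e Mx0 by (intro ballI indicator_translate_L1 Ev) auto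
 from bchoice[OF this] obtain dl where "\<forall>v\<in>R. dl v > 0 & (\<forall>et. \<bar>et\<bar> < dl v -->
   (LINT r|lborel. \<bar>indicator (Ev v) (r + et) - indicator (Ev v) r :: real\<bar>) < e / (3 * (Mx + 1) * (real (card R) + 1)))" ..
 then have dl: "!!v. v \<in> R ==> dl v > 0" "!!v et. v \<in> R ==> \<bar>et\<bar> < dl v ==>
   (LINT r|lborel. \<bar>indicator (Ev v) (r + et) - indicator (Ev v) r :: real\<bar>) < e / (3 * (Mx + 1) * (real (card R) + 1))"
  by blast+
 define de where "de = Min (insert 1 (dl ` R))"
 have de: "de > 0" "!!v. v \<in> R ==> de <= dl v" unfolding de_def using finR dl(1) by auto
 have "(\<integral>\<^sup>+r. ennreal (d1 (f (r + et)) (f r)) \<partial>lborel) <= ennreal e" if et: "\<bar>et\<bar> < de" for et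
 proof -
  let ?ind = "%v r. \<bar>indicator (Ev v) (r + et) - indicator (Ev v) r :: real\<bar>"
  have indi: "integrable lborel (?ind v)" if "v \<in> R" for v
  proof -
   have "integrable lborel (indicator (Ev v) :: real => real)"
    using Ev \<open>v \<in> R\<close> \<open>!!v. v \<in> R ==> emeasure lborel (Ev v) < \<infinity>\<close> by (auto simp: integrable_indicator_iff)
   then show ?thesis using integrable_translate(1) by auto
  qed
  \<comment> \<open>Where the value jumps, one of the two values is nonzero and the indicator of its
    level set jumps by 1; \<open>Mx\<close> bounds the size of any jump.\<close>
  have gg: "d1 (g (r + et)) (g r) <= Mx * (\<Sum>v\<in>R. ?ind v r)" for r
  proof (cases "g (r + et) = g r")
   case True
   then show ?thesis using Mx0 by (simp add: sum_nonneg)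
  next
   case False
   then obtain v where v: "v \<in> R" "?ind v r = 1"
   proof (cases "g r = (%_. 0)")
    case True
    with False have "g (r + et) \<in> R" by (auto simp: R_def)
    moreover have "?ind (g (r + et)) r = 1" using False by (auto simp: Ev_def)
    ultimately show ?thesis by (rule that)
   next
    case nz: False
    then have "g r \<in> R" by (auto simp: R_def)
    moreover have "?ind (g r) r = 1" using False by (auto simp: Ev_def)
    ultimately show ?thesis by (rule that)
   qed
   have "1 <= (\<Sum>v\<in>R. ?ind v r)" using v finR by (subst v(2)[symmetric], intro member_le_sum) auto
   then have "Mx * 1 <= Mx * (\<Sum>v\<in>R. ?ind v r)" using Mx0 by (intro mult_left_mono) auto
   moreover have "d1 (g (r + et)) (g r) <= Mx" by (rule Mx) auto
   ultimately show ?thesis by linarith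
  qed
  have "(\<integral>\<^sup>+r. ennreal (d1 (g (r + et)) (g r)) \<partial>lborel) <= (\<integral>\<^sup>+r. ennreal (Mx * (\<Sum>v\<in>R. ?ind v r)) \<partial>lborel)"
   by (intro nn_integral_mono ennreal_leI gg)
  also have "... = ennreal (LINT r|lborel. Mx * (\<Sum>v\<in>R. ?ind v r))"
   using indi Mx0 by (intro nn_integral_eq_integral) (auto intro!: mult_nonneg_nonneg sum_nonneg)
  also have "(LINT r|lborel. Mx * (\<Sum>v\<in>R. ?ind v r)) = Mx * (\<Sum>v\<in>R. LINT r|lborel. ?ind v r)"
   using indi by (simp add: Bochner_Integration.integral_sum)
  also have "... <= Mx * (\<Sum>v\<in>R. e / (3 * (Mx + 1) * (real (card R) + 1)))"
   using dl(2) de(2) et by (intro mult_left_mono[OF sum_mono Mx0]) (meson less_imp_le less_le_trans)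
  also have "... = (Mx / (Mx + 1)) * (real (card R) / (real (card R) + 1)) * (e / 3)"
   by (simp add: field_simps)
  also have "... <= 1 * 1 * (e / 3)"
   using Mx0 e by (intro mult_right_mono mult_mono) (auto simp: divide_le_eq)
  finally have gg_int: "(\<integral>\<^sup>+r. ennreal (d1 (g (r + et)) (g r)) \<partial>lborel) <= ennreal (e / 3)"
   by (simp add: ennreal_leI)
  have gfm: "(%r. ennreal (d1 (g r) (f r))) \<in> borel_measurable borel" using gi by simp
  have gfm': "(%r. ennreal (d1 (g (r + et)) (f (r + et)))) \<in> borel_measurable borel"
   using gfm by measurable
  have ggm: "(%r. ennreal (d1 (g (r + et)) (g r))) \<in> borel_measurable borel"
  proof -
   have "(%r. r + et) \<in> measurable lborel lborel" by simp
   from scurve_measurable2[OF scurve_compose[OF this sicurve[of n]] sicurve[of n] seq_cont_diff]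
   show ?thesis by (simp add: g_def)
  qed
  have "(\<integral>\<^sup>+r. ennreal (d1 (f (r + et)) (f r)) \<partial>lborel)
   <= (\<integral>\<^sup>+r. ennreal (d1 (g (r + et)) (f (r + et))) + (ennreal (d1 (g (r + et)) (g r)) + ennreal (d1 (g r) (f r))) \<partial>lborel)"
  proof (rule nn_integral_mono)
   fix r
   have "d1 (f (r + et)) (f r) <= d1 (g (r + et)) (f (r + et)) + (d1 (g (r + et)) (g r) + d1 (g r) (f r))"
    using N1_triangle[OF fS[of "r + et"] gS[of "r + et"] fS[of r]] N1_triangle[OF gS[of "r + et"] gS[of r] fS[of r]]
     N1_minus_commute[OF fS[of "r + et"] gS[of "r + et"]] by linarith
   then show "ennreal (d1 (f (r + et)) (f r)) <= ennreal (d1 (g (r + et)) (f (r + et))) + (ennreal (d1 (g (r + et)) (g r)) + ennreal (d1 (g r) (f r)))"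
    by (subst ennreal_plus[symmetric], simp, simp)+ (rule ennreal_leI)
  qed
  also have "... = (\<integral>\<^sup>+r. ennreal (d1 (g (r + et)) (f (r + et))) \<partial>lborel)
   + ((\<integral>\<^sup>+r. ennreal (d1 (g (r + et)) (g r)) \<partial>lborel) + (\<integral>\<^sup>+r. ennreal (d1 (g r) (f r)) \<partial>lborel))"
   using gfm gfm' ggm by (simp add: nn_integral_add)
  also have "(\<integral>\<^sup>+r. ennreal (d1 (g (r + et)) (f (r + et))) \<partial>lborel) = (\<integral>\<^sup>+r. ennreal (d1 (g r) (f r)) \<partial>lborel)"
   by (rule nn_integral_translate[OF gfm])
  also have "(\<integral>\<^sup>+r. ennreal (d1 (g r) (f r)) \<partial>lborel) + ((\<integral>\<^sup>+r. ennreal (d1 (g (r + et)) (g r)) \<partial>lborel) + (\<integral>\<^sup>+r. ennreal (d1 (g r) (f r)) \<partial>lborel))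
   <= ennreal (e / 3) + (ennreal (e / 3) + ennreal (e / 3))" by (intro add_mono gf gg_int)
  also have "... = ennreal e" using e by (simp add: ennreal_plus[symmetric] del: ennreal_plus)
  finally show ?thesis .
 qed
 then show ?thesis using de(1) by blast
qed

text \<open>Plateaus on (s, t) are admissible functions of time. As \<open>n\<close> grows, the
  plateau tends to the indicator of (s, t) and its derivative to a unit mass at s minus one at t,
  which a continuous function of time resolves.\<close>

lemma weak_equation_integrated:
 assumes w: "weak_equation h T \<alpha> V f k" and ph: "ph \<in> V"
  and c: "continuous_on {0..T} (%t. ip (f t) ph)"
  and A: "integrable lborel A" and AE: "AE t in lebesgue_on {0<..<T}. a_form h \<alpha> (f t) ph + ip (k t) ph = A t"
  and st: "0 < s" "s < t" "t < T"
 shows "ip (f t) ph - ip (f s) ph = - (LINT r|lborel. indicator {s<..<t} r * A r)"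
proof -
 \<comment> \<open>Clamping the argument to [0, T] gives a bounded continuous function on the whole
   line.\<close>
 define C where "C x = ip (f (max 0 (min T x))) ph" for x
 have Cc: "continuous_on UNIV C"
  unfolding C_def using st by (intro continuous_on_compose2[OF c] continuous_intros) auto
 have Cb: "\<exists>K. \<forall>x. \<bar>C x\<bar> <= K"
 proof -
  have "compact ((%t. ip (f t) ph) ` {0..T})" by (intro compact_continuous_image c compact_Icc)
  from compact_imp_bounded[OF this] obtain K where K: "!!y. y \<in> (%t. ip (f t) ph) ` {0..T} ==> norm y <= K"
   unfolding bounded_iff by blast
  have "\<bar>C x\<bar> <= K" for x using K[of "C x"] st by (auto simp: C_def)
  then show ?thesis by blast
 qed
 then obtain K where K: "!!x. \<bar>C x\<bar> <= K" by blast
 let ?ps = "%n. plateau n s t"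
 let ?S' = "deriv smooth_step"
 have S'm: "?S' \<in> borel_measurable borel"
  by (rule smooth_measurable[OF smooth_deriv(2)[OF smooth_smooth_step]])
 have Cm: "C \<in> borel_measurable borel" by (rule borel_measurable_continuous_onI[OF Cc])
 obtain M where M: "M > 0" "!!x. \<bar>?S' x\<bar> <= M" by (rule smooth_step_deriv_bounded) (rule that, assumption, assumption)
 have S'1: "(LINT y|lborel. ?S' y) = 1"
 proof -
  have "(LINT y|lborel. ?S' y) = (LINT y|lborel. indicator {0<..<1} y * ?S' y)"
  proof (rule integral_cong_AE)
   have "AE y in lborel. y \<noteq> 0 & y \<noteq> (1::real)"
    using AE_lborel_singleton[of "0::real"] AE_lborel_singleton[of "1::real"] by eventually_elim simp
   then show "AE y in lborel. ?S' y = indicator {0<..<1} y * ?S' y"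
    by (rule eventually_mono) (auto simp: indicator_def intro!: smooth_step_deriv_eq_0)
  qed (use S'm in measurable)
  also have "... = (LINT y|lebesgue. indicator {0<..<1} y * ?S' y)"
   using S'm by (intro integral_completion[symmetric]) measurable
  also have "... = (LINT y|lebesgue_on {0<..<1}. ?S' y)" by (simp add: integral_restrict_space)
  also have "... = smooth_step 1 - smooth_step 0" by (rule integral_deriv_open_interval)
    (auto intro: smooth_deriv smooth_smooth_step smooth_continuous)
  finally show ?thesis by (simp add: smooth_step_left smooth_step_right)
 qed
 have lim_pt: "(%n. LINT y|lborel. C (a + si * (y / real n)) * ?S' y) ----> C a" for a si
 proof -
  have "(%n. LINT y|lborel. C (a + si * (y / real n)) * ?S' y) ----> (LINT y|lborel. C a * ?S' y)"
  proof (rule integral_dominated_convergence[where w="%y. indicator {0..1} y * (K * M)"])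
   show "AE y in lborel. (%n. C (a + si * (y / real n)) * ?S' y) ----> C a * ?S' y"
   proof (intro AE_I2 tendsto_mult tendsto_const)
    fix y
    have "(%n. a + si * (y / real n)) ----> a + si * 0" by (intro tendsto_intros lim_const_over_n)
    moreover have "isCont C (a + si * 0)" using Cc by (simp add: continuous_on_eq_continuous_at)
    ultimately show "(%n. C (a + si * (y / real n))) ----> C a"
     using isCont_tendsto_compose[of "a + si * 0" C] by simp
   qed
   show "AE y in lborel. norm (C (a + si * (y / real n)) * ?S' y) <= indicator {0..1} y * (K * M)" for n
   proof (rule AE_I2)
    fix y
    show "norm (C (a + si * (y / real n)) * ?S' y) <= indicator {0..1} y * (K * M)"
    proof (cases "y \<in> {0..1}")
     case True
     have "\<bar>C (a + si * (y / real n))\<bar> * \<bar>?S' y\<bar> <= K * M"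
      using K M order_trans[OF abs_ge_zero K] by (intro mult_mono) auto
     then show ?thesis using True by (simp add: abs_mult)
    next
     case False
     then have "?S' y = 0" by (intro smooth_step_deriv_eq_0) auto
     then show ?thesis using False by simp
    qed
   qed
   show "integrable lborel (%y::real. indicator {0..1} y * (K * M))"
    by (intro integrable_mult_left) (simp add: integrable_indicator_iff)
  qed (use S'm Cm in measurable)
  then show ?thesis using S'1 by simp
 qed
 \<comment> \<open>For n (t - s) \<ge> 2 the two ramps do not overlap, so the derivative is a
   difference of two rescaled copies of the bump \<open>?S'\<close>, each of integral 1.\<close>
 have main: "(LINT x|lborel. C x * deriv (?ps n) x)
   = (LINT y|lborel. C (s + 1 * (y / real n)) * ?S' y) - (LINT y|lborel. C (t + (-1) * (y / real n)) * ?S' y)"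
  if n: "2 <= real n * (t - s)" for n
 proof -
  have n0: "real n > 0" using n st by (cases "n = 0") auto
  have d: "deriv (?ps n) x = real n * ?S' (real n * (x - s)) - real n * ?S' (real n * (t - x))" for x
  proof -
   have sum: "real n * (x - s) + real n * (t - x) = real n * (t - s)" by (simp add: algebra_simps)
   have "deriv (?ps n) x = real n * ?S' (real n * (x - s)) * smooth_step (real n * (t - x))
     - real n * smooth_step (real n * (x - s)) * ?S' (real n * (t - x))"
    by (rule DERIV_imp_deriv[OF plateau_has_derivative])
   moreover have "?S' (real n * (x - s)) * smooth_step (real n * (t - x)) = ?S' (real n * (x - s))"
   proof (cases "real n * (x - s) <= 1")
    case True
    then have "1 <= real n * (t - x)" using sum n by linarith
    then show ?thesis by (simp add: smooth_step_right)
   next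
    case False
    then have "?S' (real n * (x - s)) = 0" by (intro smooth_step_deriv_eq_0) auto
    then show ?thesis by simp
   qed
   moreover have "smooth_step (real n * (x - s)) * ?S' (real n * (t - x)) = ?S' (real n * (t - x))"
   proof (cases "real n * (t - x) <= 1")
    case True
    then have "1 <= real n * (x - s)" using sum n by linarith
    then show ?thesis by (simp add: smooth_step_right)
   next
    case False
    then have "?S' (real n * (t - x)) = 0" by (intro smooth_step_deriv_eq_0) auto
    then show ?thesis by simp
   qed
   ultimately show ?thesis by (simp add: mult.assoc)
  qed
  let ?g1 = "%x. C x * (real n * ?S' (real n * (x - s)))" and ?g2 = "%x. C x * (real n * ?S' (real n * (t - x)))"
  have bound: "integrable lborel g" if "g \<in> borel_measurable borel" "!!x. \<bar>g x\<bar> <= K * (real n * M)" "!!x. x \<notin> {s..t} ==> g x = 0" for g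
  proof (rule integrable_dominated)
   show "integrable lborel (%x. indicator {s..t} x * (K * (real n * M)))"
    using st by (intro integrable_mult_left) (simp add: integrable_indicator_iff)
   show "AE x in lborel. norm (g x) <= norm (indicator {s..t} x * (K * (real n * M)))"
    using that(2,3) by (intro AE_I2) (auto simp: indicator_def intro: order_trans[OF _ abs_ge_self])
  qed (use that(1) in simp)
  have bnd: "\<bar>C x * (real n * ?S' y)\<bar> <= K * (real n * M)" for x y
   unfolding abs_mult using K M n0 order_trans[OF abs_ge_zero K] by (intro mult_mono) auto
  have i1: "integrable lborel ?g1"
  proof (rule bound)
   show "?g1 x = 0" if "x \<notin> {s..t}" for x
   proof -
    have "real n * (x - s) < 0 \<or> real n * (x - s) > 1"
    proof (cases "x < s")
     case True then show ?thesis using n0 by (simp add: mult_pos_neg)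
    next
     case False
     then have "real n * (t - s) <= real n * (x - s)" using that n0 by (intro mult_left_mono) auto
     then show ?thesis using n by linarith
    qed
    from smooth_step_deriv_eq_0[OF this] show ?thesis by simp
   qed
  qed (use S'm Cm bnd in \<open>auto intro!: borel_measurable_times measurable_compose[OF _ S'm]\<close>)
  have i2: "integrable lborel ?g2"
  proof (rule bound)
   show "?g2 x = 0" if "x \<notin> {s..t}" for x
   proof -
    have "real n * (t - x) < 0 \<or> real n * (t - x) > 1"
    proof (cases "x > t")
     case True then show ?thesis using n0 by (simp add: mult_pos_neg)
    next
     case False
     then have "real n * (t - s) <= real n * (t - x)" using that n0 by (intro mult_left_mono) auto
     then show ?thesis using n by linarith
    qed
    from smooth_step_deriv_eq_0[OF this] show ?thesis by simp
   qed
  qed (use S'm Cm bnd in \<open>auto intro!: borel_measurable_times measurable_compose[OF _ S'm]\<close>)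
  have "(LINT x|lborel. C x * deriv (?ps n) x) = (LINT x|lborel. ?g1 x) - (LINT x|lborel. ?g2 x)"
   by (subst Bochner_Integration.integral_diff[OF i1 i2, symmetric])
    (intro Bochner_Integration.integral_cong refl, simp only: d, simp add: algebra_simps)
  also have "(LINT x|lborel. ?g1 x) = (LINT y|lborel. C (s + 1 * (y / real n)) * ?S' y)"
   using lborel_integral_real_affine[of "1 / real n" ?g1 s] n0 by (simp add: field_simps)
  also have "(LINT x|lborel. ?g2 x) = (LINT y|lborel. C (t + (-1) * (y / real n)) * ?S' y)"
   using lborel_integral_real_affine[of "- (1 / real n)" ?g2 t] n0 by (simp add: field_simps)
  finally show ?thesis .
 qed
 have "eventually (%n. (LINT y|lborel. C (s + 1 * (y / real n)) * ?S' y) - (LINT y|lborel. C (t + (-1) * (y / real n)) * ?S' y)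
   = (LINT x|lborel. C x * deriv (?ps n) x)) sequentially"
  using eventually_ge_real_mult[of "t - s" 2] st main by (auto elim: eventually_mono)
 from Lim_transform_eventually[OF tendsto_diff[OF lim_pt lim_pt] this]
 have l1: "(%n. LINT x|lborel. C x * deriv (?ps n) x) ----> C s - C t" .
 have psm: "?ps n \<in> borel_measurable borel" "deriv (?ps n) \<in> borel_measurable borel" for n
  by (rule smooth_measurable, intro smooth_plateau smooth_deriv)+
 have l2: "(%n. LINT x|lborel. A x * ?ps n x) ----> (LINT x|lborel. A x * indicator {s<..<t} x)"
 proof (rule integral_dominated_convergence[where w="%x. \<bar>A x\<bar>"])
  show "AE x in lborel. (%n. A x * ?ps n x) ----> A x * indicator {s<..<t} x"
   by (intro AE_I2 tendsto_intros plateau_tendsto)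
  show "AE x in lborel. norm (A x * ?ps n x) <= \<bar>A x\<bar>" for n
   using plateau_abs by (intro AE_I2) (auto simp: abs_mult intro!: mult_left_le)
 qed (use A psm in auto)
 have "(LINT x|lborel. A x * ?ps n x) = (LINT x|lborel. C x * deriv (?ps n) x)" for n
 proof -
  have sm: "smooth (?ps n)" by (rule smooth_plateau)
  have cl: "closure {x. ?ps n x \<noteq> 0} \<subseteq> {s..t}"
  proof (rule closure_minimal)
   have "?ps n x = 0" if "x \<notin> {s..t}" for x using that by (intro plateau_outside) auto
   then show "{x. ?ps n x \<noteq> 0} \<subseteq> {s..t}" by blast
  qed simp
  have "compact ({s..t} \<inter> closure {x. ?ps n x \<noteq> 0})"
   by (intro compact_Int_closed compact_Icc closed_closure)
  then have "compact (closure {x. ?ps n x \<noteq> 0})" using cl by (simp only: Int_absorb1)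
  then have "test_function {0<..<T} (?ps n)" using cl sm st unfolding test_function_def by force
  then have eq: "(LINT r|lebesgue_on {0<..<T}. ip (f r) ph * deriv (?ps n) r)
    = (LINT r|lebesgue_on {0<..<T}. (a_form h \<alpha> (f r) ph + ip (k r) ph) * ?ps n r)"
   using w ph unfolding weak_equation_def by fastforce
  have out: "?ps n r = 0 & deriv (?ps n) r = 0" if "r \<notin> {0<..<T}" for r
  proof
   show "?ps n r = 0" using that st by (intro plateau_outside) auto
   have "eventually (%y. ?ps n y = 0) (nhds r)"
    using that st by (intro eventually_nhds_in_open[of "- {s..t}", THEN eventually_mono]) (auto intro!: plateau_outside)
   from deriv_cong_ev[OF this refl] show "deriv (?ps n) r = 0" by simp
  qed
  have "(LINT r|lebesgue_on {0<..<T}. ip (f r) ph * deriv (?ps n) r) = (LINT r|lebesgue_on {0<..<T}. C r * deriv (?ps n) r)"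
   by (intro Bochner_Integration.integral_cong) (auto simp: C_def)
  also have "... = (LINT r|lborel. C r * deriv (?ps n) r)"
   using Cm psm out by (intro lebesgue_on_borel_integral) auto
  finally have 1: "(LINT r|lebesgue_on {0<..<T}. ip (f r) ph * deriv (?ps n) r) = (LINT r|lborel. C r * deriv (?ps n) r)" .
  have "AE r in lebesgue_on {0<..<T}. (a_form h \<alpha> (f r) ph + ip (k r) ph) * ?ps n r = A r * ?ps n r"
   using AE by eventually_elim simp
  from integral_lebesgue_on_cong_AE(1)[OF this]
  have "(LINT r|lebesgue_on {0<..<T}. (a_form h \<alpha> (f r) ph + ip (k r) ph) * ?ps n r) = (LINT r|lebesgue_on {0<..<T}. A r * ?ps n r)" by simp
  also have "... = (LINT r|lborel. A r * ?ps n r)" using A psm out by (intro lebesgue_on_borel_integral) auto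
  finally show ?thesis using 1 eq by simp
 qed
 with l1 l2 have "C s - C t = (LINT x|lborel. A x * indicator {s<..<t} x)" using LIMSEQ_unique by simp
 then show ?thesis using st by (simp add: C_def mult.commute)
qed

end

section \<open>The cross energy inequality\<close>

lemma mult_absorb:
 fixes a b e :: real
 assumes "e > 0"
 shows "a * b <= e * b^2 + a^2 / (4 * e)"
proof -
 have "0 <= (2 * e * b - a)^2 / (4 * e)" using assms by simp
 also have "... = e * b^2 - a * b + a^2 / (4 * e)" using assms by (simp add: power2_eq_square field_simps)
 finally show ?thesis by simp
qed

lemma mult_le_squares: "a * b <= a^2 + (b::real)^2"
proof -
 have "a * b <= 1 * b^2 + a^2 / (4 * 1)" by (rule mult_absorb) simp
 then show ?thesis using zero_le_power2[of a] by linarith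
qed

context strip
begin

lemma B_zero: "f \<in> W1 ==> g \<in> W1 ==> B (%_. 0) f g = 0"
 using B_bound[OF zero_Sobolev1, of f g] by simp

text \<open>Weak solutions have L2 norms bounded in time, so in each of \<open>pz\<close> and
  \<open>rx\<close> one factor is bounded by \<open>M\<close> and a single power of
  \<open>N1\<close> is left.\<close>

lemma pz_rx_le:
 assumes M: "nrm u <= M" "nrm g <= M"
 shows "pz u * rx g <= 3 * (1 / h + 2) * M^2 * (N1 u * N1 g)"
proof -
 have M0: "M >= 0" using M(1) L2_norm_nonneg[of D u] by linarith
 have "pz u <= (1 / h + 2) * (M * N1 u)"
 proof -
  have "(nrm u)^2 <= M * N1 u" unfolding power2_eq_square using M N1_bounds M0 by (intro mult_mono) auto
  moreover have "nrm u * nrm (dz h u) <= M * N1 u" using M N1_bounds M0 by (intro mult_mono) auto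
  moreover from calculation(1) have "(nrm u)^2 / h <= M * N1 u / h"
   using h_pos by (intro divide_right_mono) auto
  ultimately show ?thesis unfolding pz_def distrib_right by simp
 qed
 moreover have "rx g <= 3 * (M * N1 g)"
 proof -
  have "(nrm g)^2 <= M * N1 g" unfolding power2_eq_square using M N1_bounds M0 by (intro mult_mono) auto
  moreover have "nrm g * nrm (dx h g) <= M * N1 g" using M N1_bounds M0 by (intro mult_mono) auto
  ultimately show ?thesis unfolding rx_def by simp
 qed
 ultimately have "pz u * rx g <= ((1 / h + 2) * (M * N1 u)) * (3 * (M * N1 g))"
  using rx_nonneg pz_nonneg M0 h_pos by (intro mult_mono) auto
 then show ?thesis by (simp add: power2_eq_square algebra_simps)
qed

text \<open>The common form of the two alternatives of the regularity class: in the first one may take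
  \<open>ka = \<parallel>f\<^sub>z\<parallel>\<close>, in the second one the square root of the norm of \<open>f\<^sub>z\<close> in \<open>L\<^sup>\<infinity>\<^sub>x(L\<^sup>2\<^sub>z)\<close>, each cut off below at 1.\<close>
definition regular_at :: "real => field => bool" where
 "regular_at ka f \<longleftrightarrow> 0 <= ka & (\<forall>u\<in>W1. \<forall>g\<in>W1. \<bar>Bz u f g\<bar> \<le>
  sqrt h * nrm (dx h u) * (ka^2 * nrm g + 2 * ka * sqrt (nrm g * nrm (dx h g))))"

text \<open>The factors are separated until \<open>ka\<close> occurs only as a square times a single
  Sobolev norm. With \<open>ka^4\<close> and the squared Sobolev norms integrable in time, every
  term is integrable.\<close>

lemma regular_at_bound:
 assumes reg: "regular_at ka f" and u: "u \<in> W1" and g: "g \<in> W1" and M: "nrm g <= M"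
 shows "\<bar>Bz u f g\<bar> <= sqrt h * M * (N1 u * ka^2) + (N1 u)^2 + ka^2 * (h * M * N1 g)"
proof -
 have M0: "M >= 0" using M L2_norm_nonneg[of D g] by linarith
 have k0: "ka >= 0" using reg by (simp add: regular_at_def)
 have le: "sqrt (nrm g * nrm (dx h g)) <= sqrt (M * N1 g)"
  using M M0 N1_bounds by (intro real_sqrt_le_mono mult_mono) auto
 have "\<bar>Bz u f g\<bar> <= sqrt h * nrm (dx h u) * (ka^2 * nrm g + 2 * ka * sqrt (nrm g * nrm (dx h g)))"
  using reg u g by (simp add: regular_at_def)
 also have "... <= sqrt h * N1 u * (ka^2 * M + 2 * ka * sqrt (M * N1 g))"
  using M N1_bounds k0 h_pos le by (intro mult_mono add_mono mult_left_mono) auto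
 also have "... = sqrt h * M * (N1 u * ka^2) + 2 * (N1 u * (sqrt h * ka * sqrt (M * N1 g)))"
  by (simp add: algebra_simps)
 also have "2 * (N1 u * (sqrt h * ka * sqrt (M * N1 g))) <= (N1 u)^2 + (sqrt h * ka * sqrt (M * N1 g))^2"
  using sum_squares_bound[of "N1 u" "sqrt h * ka * sqrt (M * N1 g)"] by simp
 also have "(sqrt h * ka * sqrt (M * N1 g))^2 = ka^2 * (h * M * N1 g)"
  using h_pos M0 by (simp add: power_mult_distrib)
 finally show ?thesis by simp
qed

text \<open>In the application \<open>u\<close> and \<open>p\<close> are taken at one time and
  \<open>q\<close> at the other, and \<open>q\<close> has to carry the small factor demanded by
  \<open>diagonal_shift\<close>. The regular function is \<open>p\<close>, so \<open>ka^4\<close>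
  stands with the large constant.\<close>

lemma B_growth_left:
 assumes M: "M >= 0" and e: "e > 0"
 obtains A where "A >= 0" "!!u p q ka. u \<in> W1 ==> p \<in> W1 ==> q \<in> W1 ==>
  nrm u <= M ==> nrm q <= M ==> regular_at ka p ==>
  \<bar>B u p q\<bar> <= e * (N1 q)^2 + A * ((N1 u)^2 + (N1 p)^2 + ka^4)"
proof -
 define c where "c = 3 * (1 / h + 2) * M^2"
 have c0: "c >= 0" using h_pos by (simp add: c_def)
 \<comment> \<open>The quotients stem from Young's inequality with weight e/2,
   \<open>sqrt h * M\<close> from the product of \<open>N1 u\<close> and \<open>ka^2\<close>, and 2
   covers the plain squares.\<close>
 define A where "A = c^2 / (2 * e) + 2 + sqrt h * M + (h * M)^2 / (2 * e)"
 have pos: "0 <= c^2 / (2 * e)" "0 <= sqrt h * M" "0 <= (h * M)^2 / (2 * e)" using M e h_pos by auto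
 show thesis
 proof (rule that[of A])
  show "A >= 0" unfolding A_def using pos by linarith
  fix u p q ka
  assume u: "u \<in> W1" and p: "p \<in> W1" and q: "q \<in> W1"
   and uM: "nrm u <= M" and qM: "nrm q <= M" and reg: "regular_at ka p"
  let ?y = "sqrt (pz u * rx q)"
  have "\<bar>Bx u p q\<bar> <= ?y * nrm (dx h p)" by (rule Bx_bound[OF u p q])
  also have "... <= ?y * N1 p" using N1_bounds pz_nonneg rx_nonneg by (intro mult_left_mono) auto
  also have "... <= ?y^2 + (N1 p)^2" by (rule mult_le_squares)
  also have "?y^2 = pz u * rx q" using pz_nonneg rx_nonneg by simp
  also have "... <= (c * N1 u) * N1 q" using pz_rx_le[OF uM qM] by (simp add: c_def)
  also have "... <= (e / 2) * (N1 q)^2 + (c * N1 u)^2 / (4 * (e / 2))" using e by (intro mult_absorb) simp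
  finally have 1: "\<bar>Bx u p q\<bar> <= (e / 2) * (N1 q)^2 + c^2 / (2 * e) * (N1 u)^2 + (N1 p)^2"
   by (simp add: power_mult_distrib)
  have "N1 u * ka^2 <= (N1 u)^2 + ka^4" using mult_le_squares[of "N1 u" "ka^2"] by simp
  then have 2: "sqrt h * M * (N1 u * ka^2) <= sqrt h * M * ((N1 u)^2 + ka^4)"
   using pos(2) by (rule mult_left_mono)
  have 3: "ka^2 * (h * M * N1 q) <= (e / 2) * (N1 q)^2 + (h * M)^2 / (2 * e) * ka^4"
   using mult_absorb[of "e / 2" "h * M * ka^2" "N1 q"] e by (simp add: power_mult_distrib mult_ac)
  have "\<bar>B u p q\<bar> <= e * (N1 q)^2 + (c^2 / (2 * e) * (N1 u)^2 + (N1 p)^2 + (N1 u)^2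
    + sqrt h * M * ((N1 u)^2 + ka^4) + (h * M)^2 / (2 * e) * ka^4)"
   using 1 2 3 regular_at_bound[OF reg u q qM] abs_triangle_ineq[of "Bx u p q" "Bz u p q"] unfolding B_def by linarith
  also have "... <= e * (N1 q)^2 + A * ((N1 u)^2 + (N1 p)^2 + ka^4)"
  proof -
   have "0 <= c^2 / (2 * e) * ((N1 p)^2 + ka^4)" "0 <= sqrt h * M * (N1 p)^2"
    "0 <= (h * M)^2 / (2 * e) * ((N1 u)^2 + (N1 p)^2)" "0 <= (N1 u)^2 + (N1 p)^2 + 2 * ka^4"
    by (intro pos mult_nonneg_nonneg add_nonneg_nonneg zero_le_power2; use M h_pos in simp)+
   then show ?thesis unfolding A_def by (simp add: algebra_simps)
  qed
  finally show "\<bar>B u p q\<bar> <= e * (N1 q)^2 + A * ((N1 u)^2 + (N1 p)^2 + ka^4)" .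
 qed
qed

text \<open>The counterpart for the second equation: now the regular function \<open>q\<close> is
  the one taken at the other time, so \<open>ka^4\<close> has to share the small factor.\<close>

lemma B_growth_right:
 assumes M: "M >= 0" and e: "e > 0"
 obtains A where "A >= 0" "!!u p q ka. u \<in> W1 ==> p \<in> W1 ==> q \<in> W1 ==>
  nrm u <= M ==> nrm p <= M ==> regular_at ka q ==>
  \<bar>B u q p\<bar> <= e * ((N1 q)^2 + ka^4) + A * ((N1 u)^2 + (N1 p)^2)"
proof -
 define c where "c = 3 * (1 / h + 2) * M^2"
 have c0: "c >= 0" using h_pos by (simp add: c_def)
 define A where "A = c / (4 * e) + 1 + h * M^2 / (2 * e) + (h * M)^2 / (2 * e)"
 have pos: "0 <= c / (4 * e)" "0 <= h * M^2 / (2 * e)" "0 <= (h * M)^2 / (2 * e)" using M e h_pos c0 by auto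
 show thesis
 proof (rule that[of A])
  show "A >= 0" unfolding A_def using pos by linarith
  fix u p q ka
  assume u: "u \<in> W1" and p: "p \<in> W1" and q: "q \<in> W1"
   and uM: "nrm u <= M" and pM: "nrm p <= M" and reg: "regular_at ka q"
  let ?y = "sqrt (pz u * rx p)"
  have "\<bar>Bx u q p\<bar> <= ?y * nrm (dx h q)" by (rule Bx_bound[OF u q p])
  also have "... <= ?y * N1 q" using N1_bounds pz_nonneg rx_nonneg by (intro mult_left_mono) auto
  also have "... <= e * (N1 q)^2 + ?y^2 / (4 * e)" by (rule mult_absorb[OF e])
  also have "?y^2 = pz u * rx p" using pz_nonneg rx_nonneg by simp
  also have "pz u * rx p / (4 * e) <= c * ((N1 u)^2 + (N1 p)^2) / (4 * e)"
   using order_trans[OF pz_rx_le[OF uM pM] mult_left_mono[OF mult_le_squares c0[unfolded c_def]]] e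
   by (intro divide_right_mono) (auto simp: c_def)
  finally have 1: "\<bar>Bx u q p\<bar> <= e * (N1 q)^2 + c / (4 * e) * ((N1 u)^2 + (N1 p)^2)" by simp
  have 2: "sqrt h * M * (N1 u * ka^2) <= (e / 2) * ka^4 + h * M^2 / (2 * e) * (N1 u)^2"
   using mult_absorb[of "e / 2" "sqrt h * M * N1 u" "ka^2"] e h_pos by (simp add: power_mult_distrib mult_ac)
  have 3: "ka^2 * (h * M * N1 p) <= (e / 2) * ka^4 + (h * M)^2 / (2 * e) * (N1 p)^2"
   using mult_absorb[of "e / 2" "h * M * N1 p" "ka^2"] e by (simp add: power_mult_distrib mult_ac)
  have "\<bar>B u q p\<bar> <= e * ((N1 q)^2 + ka^4) + (c / (4 * e) * ((N1 u)^2 + (N1 p)^2) + (N1 u)^2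
    + h * M^2 / (2 * e) * (N1 u)^2 + (h * M)^2 / (2 * e) * (N1 p)^2)"
   using 1 2 3 regular_at_bound[OF reg u p pM] abs_triangle_ineq[of "Bx u q p" "Bz u q p"]
   unfolding B_def distrib_left[of e] by linarith
  also have "... <= e * ((N1 q)^2 + ka^4) + A * ((N1 u)^2 + (N1 p)^2)"
  proof -
   have "0 <= h * M^2 / (2 * e) * (N1 p)^2" "0 <= (h * M)^2 / (2 * e) * (N1 u)^2" "0 <= (N1 p)^2"
    by (intro pos mult_nonneg_nonneg zero_le_power2; use M h_pos in simp)+
   then show ?thesis unfolding A_def by (simp add: algebra_simps add_divide_distrib)
  qed
  finally show "\<bar>B u q p\<bar> <= e * ((N1 q)^2 + ka^4) + A * ((N1 u)^2 + (N1 p)^2)" .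
 qed
qed

text \<open>The class of curves bounded in L2 and square integrable in time with values in the
  Sobolev space, extended by zero to all times and free of exceptional times.\<close>

definition energy_curve :: "real => (real => field) => bool" where
 "energy_curve T f \<longleftrightarrow> hcurve f & (\<forall>t. t \<notin> {0<..<T} --> f t = (%_. 0)) &
  (\<exists>M. \<forall>t. nrm (f t) <= M) & integrable lborel (%t. (N1 (f t))^2)"

lemma integrable_of_square:
 fixes g :: "real => real"
 assumes "g \<in> borel_measurable lborel" "!!t. t \<notin> {0<..<T} ==> g t = 0" "integrable lborel (%t. (g t)^2)"
 shows "integrable lborel g"
proof (rule integrable_dominated)
 show "integrable lborel (%t. indicator {0<..<T} t + (g t)^2)" using assms(3) by (intro integrable_plus)
   (auto simp: integrable_indicator_iff intro: emeasure_bounded_finite[of "{0<..<T}", unfolded infinity_ennreal_def])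
 show "AE t in lborel. norm (g t) <= norm (indicator {0<..<T} t + (g t)^2)"
 proof (rule AE_I2)
  fix t
  show "norm (g t) <= norm (indicator {0<..<T} t + (g t)^2)"
   using mult_absorb[of 1 1 "\<bar>g t\<bar>"] assms(2)[of t] by (cases "t \<in> {0<..<T}") auto
 qed
qed (rule assms(1))

lemma hcurve_N1_measurable: "hcurve f ==> (%t. N1 (f t)) \<in> borel_measurable lborel"
 by (rule scurve_measurable1[where Fu=N1, OF _ seq_cont_N1])

lemma energy_curve_N1:
 assumes "energy_curve T f"
 shows "integrable lborel (%t. N1 (f t))"
proof (rule integrable_of_square)
 show "N1 (f t) = 0" if "t \<notin> {0<..<T}" for t using assms that by (simp add: energy_curve_def)
qed (use assms hcurve_N1_measurable in \<open>simp_all add: energy_curve_def\<close>)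

lemma lcurve_norm_measurable: "lcurve k ==> (%t. nrm (k t)) \<in> borel_measurable lborel"
 by (rule scurve_measurable1[where Fu="nrm", OF _ seq_cont_norm])

lemma seq_cont_const: "f \<in> W1 ==> seq_cont (W1) d1 (%_. f) f" by (simp add: seq_cont_def)

end

text \<open>One half of the product rule: the equation of \<open>p\<close> at time \<open>r\<close>,
  tested with \<open>q\<close> at time \<open>t\<close>. \<open>E\<close> is a common integrable
  majorant of the squared norms and serves both as \<open>K\<close> and as \<open>G\<close> in
  \<open>diagonal_shift\<close>.\<close>

locale cross_form = strip +
 fixes T \<alpha> :: real and u p q k :: "real => field" and E :: "real => real"
 assumes u: "energy_curve T u" and p: "energy_curve T p" and q: "energy_curve T q" and k: "lcurve k"
  and E: "integrable lborel E" "!!t. (N1 (u t))^2 <= E t" "!!t. (N1 (p t))^2 <= E t" "!!t. (N1 (q t))^2 <= E t"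
   "!!t. (nrm (k t))^2 <= E t"
  and B_growth: "!!e. e > 0 ==> \<exists>A\<ge>0. \<forall>r t. \<bar>B (u r) (p r) (q t)\<bar> <= e * E t + A * E r"
begin

definition F :: "real => real => real" where
 "F r t = - (a_form h \<alpha> (p r) (q t) + B (u r) (p r) (q t) + ip (k r) (q t))"

lemma curves: "hcurve u" "hcurve p" "hcurve q" using u p q by (auto simp: energy_curve_def)

lemma curve_in: "u t \<in> W1" "p t \<in> W1" "q t \<in> W1" "k t \<in> L2 D"
 using scurve_in[OF curves(1)] scurve_in[OF curves(2)] scurve_in[OF curves(3)] scurve_in[OF k] by auto

lemma E_nonneg: "0 <= E t" using E(2)[of t] zero_le_power2[of "N1 (u t)"] by linarith

lemma F_measurable: "(%x. F (fst x) (snd x)) \<in> borel_measurable lborel2"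
proof -
 note c = scurve_compose[OF measurable_fst] scurve_compose[OF measurable_snd]
 have "(%x. a_form h \<alpha> (p (fst x)) (q (snd x))) \<in> borel_measurable lborel2"
  by (rule scurve_measurable2[OF c(1)[OF curves(2)] c(2)[OF curves(3)]]) (rule seq_cont_a_form)
 moreover have "(%x. B (u (fst x)) (p (fst x)) (q (snd x))) \<in> borel_measurable lborel2"
  by (rule scurve_measurable3[OF c(1)[OF curves(1)] c(1)[OF curves(2)] c(2)[OF curves(3)]]) (rule seq_cont_B)
 moreover have "(%x. ip (k (fst x)) (q (snd x))) \<in> borel_measurable lborel2"
  by (rule scurve_measurable2[OF c(1)[OF k] c(2)[OF curves(3)]]) (rule seq_cont_inner[OF _ seq_cont_L2(1)])
 ultimately show ?thesis unfolding F_def by (intro borel_measurable_uminus borel_measurable_add)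
qed

lemma F_growth:
 assumes e: "e > 0"
 shows "\<exists>A\<ge>0. \<forall>r t. \<bar>F r t\<bar> <= e * E t + A * E r"
proof -
 have e3: "e / 3 > 0" using e by simp
 obtain A where A: "A >= 0" "!!r t. \<bar>B (u r) (p r) (q t)\<bar> <= (e / 3) * E t + A * E r"
  using B_growth[OF e3] by blast
 let ?A = "A + (a_const \<alpha>)^2 / (4 * (e / 3)) + 1 / (4 * (e / 3))"
 show ?thesis
 proof (intro exI[of _ ?A] conjI allI)
  show "0 <= ?A" using A(1) e by simp
  fix r t
  have "\<bar>a_form h \<alpha> (p r) (q t)\<bar> <= (a_const \<alpha> * N1 (p r)) * N1 (q t)"
   using a_form_bound[OF curve_in(2,3), of \<alpha> r t] by (simp add: mult_ac)
  also have "... <= (e / 3) * (N1 (q t))^2 + (a_const \<alpha> * N1 (p r))^2 / (4 * (e / 3))"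
   by (rule mult_absorb[OF e3])
  also have "... <= (e / 3) * E t + (a_const \<alpha>)^2 / (4 * (e / 3)) * E r"
   using mult_left_mono[OF E(3)[of r], of "(a_const \<alpha>)^2 / (4 * (e / 3))"] e
   by (intro add_mono mult_left_mono E) (auto simp: power_mult_distrib)
  finally have 1: "\<bar>a_form h \<alpha> (p r) (q t)\<bar> <= (e / 3) * E t + (a_const \<alpha>)^2 / (4 * (e / 3)) * E r" .
  have "\<bar>ip (k r) (q t)\<bar> <= nrm (k r) * nrm (q t)" by (intro L2_Cauchy_Schwarz curve_in Sobolev1_L2)
  also have "... <= nrm (k r) * N1 (q t)" by (intro mult_left_mono N1_bounds) simp
  also have "... <= (e / 3) * (N1 (q t))^2 + (nrm (k r))^2 / (4 * (e / 3))" by (rule mult_absorb[OF e3])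
  also have "... <= (e / 3) * E t + E r / (4 * (e / 3))"
   using e by (intro add_mono mult_left_mono divide_right_mono E) auto
  finally show "\<bar>F r t\<bar> <= e * E t + ?A * E r"
   using 1 A(2)[of r t] unfolding F_def by (simp add: algebra_simps)
 qed
qed

text \<open>All three forms are linear and bounded in the last argument; the constant may be large
  but depends on \<open>r\<close> alone.\<close>

lemma F_Lipschitz:
 "\<bar>F r t - F r r\<bar> <= (a_const \<alpha> * N1 (p r) + B_const * (N1 (u r) * N1 (p r)) + nrm (k r)) * d1 (q t) (q r)"
proof -
 note S = curve_in[of r] curve_in(3)[of t]
 note d = Sobolev1_diff(1)[OF S(5) S(3)]
 have "F r t - F r r = - (a_form h \<alpha> (p r) (%x. q t x - q r x) + B (u r) (p r) (%x. q t x - q r x)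
   + ip (k r) (%x. q t x - q r x))"
  by (simp add: F_def a_form_diff_right S B_diff(3)[OF S(5) S(3) S(1) S(2)] L2_inner_diff_right Sobolev1_L2)
 moreover have "\<bar>ip (k r) (%x. q t x - q r x)\<bar> <= nrm (k r) * d1 (q t) (q r)"
  using L2_Cauchy_Schwarz[OF S(4) Sobolev1_L2[OF d]]
   mult_left_mono[OF N1_bounds(1)[of "%x. q t x - q r x"] L2_norm_nonneg[of D "k r"]] by linarith
 ultimately show ?thesis
  using a_form_bound[OF S(2) d, of \<alpha>] B_bound[OF S(1,2) d] by (simp add: algebra_simps)
qed

lemma F_shift:
 assumes "e > 0"
 shows "\<exists>de>0. \<forall>et. \<bar>et\<bar> < de --> (\<integral>\<^sup>+r. ennreal \<bar>F r (r + et) - F r r\<bar> \<partial>lborel) <= ennreal e"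
proof (rule diagonal_shift[OF F_measurable _ _ _ E(1) E(1) E_nonneg E_nonneg F_Lipschitz F_growth _ assms])
 show "(%x. d1 (q (snd x)) (q (fst x))) \<in> borel_measurable lborel2"
  by (rule scurve_measurable2[OF scurve_compose[OF measurable_snd curves(3)] scurve_compose[OF measurable_fst curves(3)]])
   (rule seq_cont_diff)
 show "(%r. a_const \<alpha> * N1 (p r) + B_const * (N1 (u r) * N1 (p r)) + nrm (k r)) \<in> borel_measurable borel"
  using hcurve_N1_measurable[OF curves(1)] hcurve_N1_measurable[OF curves(2)] lcurve_norm_measurable[OF k] by simp
 show "\<exists>de>0. \<forall>et. \<bar>et\<bar> < de --> (\<integral>\<^sup>+r. ennreal (d1 (q (r + et)) (q r)) \<partial>lborel) <= ennreal e" if "e > 0" for e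
  using q that by (intro hcurve_translate[OF curves(3) _ energy_curve_N1[OF q]]) (auto simp: energy_curve_def)
qed auto

lemma F_diagonal: "integrable lborel (%r. F r r)"
proof -
 obtain A where A: "A >= 0" "!!r t. \<bar>F r t\<bar> <= 1 * E t + A * E r" using F_growth[of 1] by auto
 have "(%r. (r, r)) \<in> measurable lborel lborel2" by measurable
 from measurable_compose[OF this F_measurable] have m: "(%r. F r r) \<in> borel_measurable lborel" by simp
 show ?thesis by (rule integrable_dominated[of _ "%r. E r + A * E r"])
   (use A(2) E m in \<open>auto intro: order_trans[OF _ abs_ge_self]\<close>)
qed

end

context strip
begin

section \<open>The equation of a single unknown\<close>

definition hat :: "real set => (real => field) => real => field" where
 "hat G f t = (if t \<in> G then f t else (%_. 0))"

text \<open>One of the three equations, for the unknown \<open>f\<close> with velocity \<open>u\<close> and source \<open>k\<close>. The set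
  \<open>G\<close> collects times at which everything is defined; off \<open>G\<close> all curves are replaced by zero.\<close>
definition component ::
  "real => real => field set => field set => real set =>
  (real => field) => (real => field) => (real => field) => bool" where
 "component T \<alpha> V H G f u k \<longleftrightarrow>
  G \<in> sets borel & G \<subseteq> {0<..<T} & (AE t in lebesgue_on {0<..<T}. t \<in> G) &
  energy_curve T (hat G f) & energy_curve T (hat G u) &
  lcurve (hat G k) & integrable lborel (%t. (nrm (hat G k t))^2) &
  (\<forall>t\<in>G. f t \<in> V & u t \<in> V_1 h) & V \<subseteq> W1 & V \<subseteq> H & H \<subseteq> L2 D &
  weakly_continuous_on {0..T} D H f &
  weak_equation h T \<alpha> V f (%t p. transport h (u t) (f t) p + k t p) &
  energy_bound_from h T \<alpha> f k 0"

context
 fixes T \<alpha> V H G f u k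
 assumes c: "component T \<alpha> V H G f u k"
begin

lemma component_facts:
 "G \<in> sets borel" "G \<subseteq> {0<..<T}" "AE t in lebesgue_on {0<..<T}. t \<in> G"
 "energy_curve T (hat G f)" "energy_curve T (hat G u)" "lcurve (hat G k)"
 "integrable lborel (%t. (nrm (hat G k t))^2)"
 "V \<subseteq> W1" "V \<subseteq> H" "H \<subseteq> L2 D" "weakly_continuous_on {0..T} D H f"
 "weak_equation h T \<alpha> V f (%t p. transport h (u t) (f t) p + k t p)" "energy_bound_from h T \<alpha> f k 0"
 using c by (simp_all add: component_def)

lemma component_good: "t \<in> G ==> f t \<in> V" "t \<in> G ==> u t \<in> V_1 h" "t \<in> G ==> 0 < t & t < T"
 using c by (auto simp: component_def)

lemma component_AE: "AE t in lborel. 0 < t & t < T --> t \<in> G"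
 using component_facts(3) AE_lebesgue_on_iff_lborel[of "{0<..<T}" "%t. t \<in> G"] by simp

lemma component_curves: "hcurve (hat G f)" "hcurve (hat G u)"
 using component_facts(4,5) by (simp_all add: energy_curve_def)

lemma component_in: "hat G f t \<in> W1" "hat G u t \<in> W1" "hat G k t \<in> L2 D"
 using scurve_in[OF component_curves(1)] scurve_in[OF component_curves(2)] scurve_in[OF component_facts(6)] by auto

lemma component_L2: "t \<in> {0..T} ==> f t \<in> H" "t \<in> {0..T} ==> f t \<in> L2 D"
 using component_facts(10,11) by (auto simp: weakly_continuous_on_def)

lemma component_continuous: "ph \<in> H ==> continuous_on {0..T} (%t. ip (f t) ph)"
 using component_facts(11) by (simp add: weakly_continuous_on_def)

lemma component_antisym:
 assumes "g \<in> W1" "g' \<in> W1"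
 shows "B (hat G u t) g g' = - B (hat G u t) g' g"
 using assms component_good(2)[of t] B_antisym[of "u t" g g'] by (simp add: hat_def B_zero)

text \<open>The integrated weak equation for a fixed \<open>ph\<close>. The integrand is written
  with the curves extended by zero, which agree with the original ones at almost every time of (0,
  T).\<close>

lemma component_increment:
 assumes ph: "ph \<in> V" and st: "0 < s" "s < t" "t < T"
 shows "ip (f t) ph - ip (f s) ph = (LINT r|lborel. indicator {s<..<t} r *
  - (a_form h \<alpha> (hat G f r) ph + B (hat G u r) (hat G f r) ph + ip (hat G k r) ph))"
proof -
 define A where "A r = a_form h \<alpha> (hat G f r) ph + B (hat G u r) (hat G f r) ph + ip (hat G k r) ph" for r
 have phS: "ph \<in> W1" using ph component_facts(8) by auto
 note cS = seq_cont_const[OF phS] and S = component_in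
 have "(%r. a_form h \<alpha> (hat G f r) ph) \<in> borel_measurable lborel"
  by (rule scurve_measurable1[where Fu="%a. a_form h \<alpha> a ph", OF component_curves(1) seq_cont_a_form[OF _ cS]])
 moreover have "(%r. B (hat G u r) (hat G f r) ph) \<in> borel_measurable lborel"
  by (rule scurve_measurable2[where Fu="%a b. B a b ph", OF component_curves(2,1) seq_cont_B[OF _ _ cS]])
 moreover have "(%r. ip (hat G k r) ph) \<in> borel_measurable lborel"
  by (rule scurve_measurable1[where Fu="%a. ip a ph", OF component_facts(6) seq_cont_inner[OF _ seq_cont_L2(1)[OF cS]]])
 ultimately have Am: "A \<in> borel_measurable lborel" unfolding A_def by (intro borel_measurable_add)
 have ki: "integrable lborel (%t. nrm (hat G k t))"
 proof (rule integrable_of_square[OF lcurve_norm_measurable[OF component_facts(6)] _ component_facts(7)])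
  show "nrm (hat G k t) = 0" if "t \<notin> {0<..<T}" for t
   using that component_facts(2) by (auto simp: hat_def)
 qed
 have f2: "integrable lborel (%t. (N1 (hat G f t))^2)" "integrable lborel (%t. (N1 (hat G u t))^2)"
  using component_facts(4,5) by (simp_all add: energy_curve_def)
 have Ai: "integrable lborel A"
 proof (rule integrable_dominated[OF _ Am])
  let ?W = "%r. (a_const \<alpha> * N1 ph) * N1 (hat G f r) + (B_const * N1 ph) * ((N1 (hat G u r))^2 + (N1 (hat G f r))^2)
   + nrm ph * nrm (hat G k r)"
  show "integrable lborel ?W"
   by (intro integrable_plus integrable_mult_right energy_curve_N1[OF component_facts(4)] f2 ki)
  show "AE r in lborel. norm (A r) <= norm (?W r)"
  proof (rule AE_I2)
   fix r
   have "\<bar>B (hat G u r) (hat G f r) ph\<bar> <= (B_const * N1 ph) * (N1 (hat G u r) * N1 (hat G f r))"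
    using B_bound[OF S(2,1) phS, of r r] by (simp add: mult_ac)
   also have "... <= (B_const * N1 ph) * ((N1 (hat G u r))^2 + (N1 (hat G f r))^2)"
    using B_const_nonneg by (intro mult_left_mono mult_le_squares) simp
   finally have "\<bar>A r\<bar> <= ?W r"
    using a_form_bound[OF S(1) phS, of \<alpha> r] L2_Cauchy_Schwarz[OF S(3) Sobolev1_L2[OF phS], of r]
    unfolding A_def by (simp add: mult_ac)
   then show "norm (A r) <= norm (?W r)" by simp
  qed
 qed
 have "AE t in lebesgue_on {0<..<T}. a_form h \<alpha> (f t) ph + ip (%p. transport h (u t) (f t) p + k t p) ph = A t"
  using component_facts(3)
 proof eventually_elim
  case (elim t)
  have "u t \<in> W1" "f t \<in> W1" "k t \<in> L2 D" using S[of t] elim by (simp_all add: hat_def)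
  then have "ip (%p. transport h (u t) (f t) p + k t p) ph = B (u t) (f t) ph + ip (k t) ph"
   using transport_product_integrable[of "u t" "f t" ph] phS L2_mult_integrable[of "k t" D ph] Sobolev1_L2
   by (simp add: L2_inner_def distrib_right)
  then show ?case using elim by (simp add: A_def hat_def)
 qed
 from weak_equation_integrated[OF component_facts(12) ph component_continuous Ai this st] ph component_facts(9)
 have "ip (f t) ph - ip (f s) ph = - (LINT r|lborel. indicator {s<..<t} r * A r)" by auto
 also have "... = (LINT r|lborel. indicator {s<..<t} r * - A r)" by simp
 finally show ?thesis unfolding A_def .
qed

text \<open>The integrand of the energy inequality; transport does not contribute to it.\<close>

definition comp_power :: "real => real" where
 "comp_power r = a_form h \<alpha> (hat G f r) (hat G f r) + ip (hat G k r) (hat G f r)"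

lemma comp_power_integrable: "integrable lborel comp_power"
proof -
 note S = component_in
 have "(%r. a_form h \<alpha> (hat G f r) (hat G f r)) \<in> borel_measurable lborel"
  by (rule scurve_measurable1[where Fu="%a. a_form h \<alpha> a a", OF component_curves(1)]) (rule seq_cont_a_form)
 moreover have "(%r. ip (hat G k r) (hat G f r)) \<in> borel_measurable lborel"
  by (rule scurve_measurable2[where Fu="%a b. ip a b", OF component_facts(6) component_curves(1) seq_cont_inner[OF _ seq_cont_L2(1)]])
 ultimately have m: "comp_power \<in> borel_measurable lborel"
  unfolding comp_power_def[abs_def] by (intro borel_measurable_add)
 have f2: "integrable lborel (%t. (N1 (hat G f t))^2)"
  using component_facts(4) by (simp add: energy_curve_def)
 show ?thesis
 proof (rule integrable_dominated[OF _ m])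
  let ?W = "%r. (a_const \<alpha> + 1) * (N1 (hat G f r))^2 + (nrm (hat G k r))^2"
  show "integrable lborel ?W" by (intro integrable_plus integrable_mult_right f2 component_facts(7))
  show "AE r in lborel. norm (comp_power r) <= norm (?W r)"
  proof (rule AE_I2)
   fix r
   have "\<bar>ip (hat G k r) (hat G f r)\<bar> <= nrm (hat G k r) * N1 (hat G f r)"
    using L2_Cauchy_Schwarz[OF S(3) Sobolev1_L2[OF S(1)], of r r]
     mult_left_mono[OF N1_bounds(1)[of "hat G f r"] L2_norm_nonneg[of D "hat G k r"]] by linarith
   then have "\<bar>comp_power r\<bar> <= ?W r"
    using a_form_bound[OF S(1) S(1), of \<alpha> r r] mult_le_squares[of "nrm (hat G k r)" "N1 (hat G f r)"]
    unfolding comp_power_def by (simp add: power2_eq_square distrib_right)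
   then show "norm (comp_power r) <= norm (?W r)" by simp
  qed
 qed
qed

lemma component_energy:
 assumes "\<alpha> >= 0"
 shows "AE t in lborel. 0 < t & t < T -->
  (nrm (f t))^2 + 2 * (LINT r|lborel. indicator {0<..<t} r * comp_power r) <= (nrm (f 0))^2"
proof -
 have eq: "(LINT s|lebesgue_on {0<..<t}. (V_norm h \<alpha> (f s))^2 + ip (k s) (f s))
   = (LINT r|lborel. indicator {0<..<t} r * comp_power r)" if t: "t < T" for t
 proof -
  have "AE s in lborel. s \<in> {0<..<t} --> (V_norm h \<alpha> (f s))^2 + ip (k s) (f s) = indicator {0<..<t} s * comp_power s"
   using component_AE
  proof eventually_elim
   case (elim s)
   show ?case
   proof
    assume s: "s \<in> {0<..<t}"
    then have g: "s \<in> G" using elim t by auto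
    then show "(V_norm h \<alpha> (f s))^2 + ip (k s) (f s) = indicator {0<..<t} s * comp_power s"
     using s V_norm_square_a_form[OF component_in(1)[of s] assms] by (simp add: comp_power_def hat_def)
   qed
  qed
  then have "AE s in lebesgue_on {0<..<t}. (V_norm h \<alpha> (f s))^2 + ip (k s) (f s) = indicator {0<..<t} s * comp_power s"
   by (subst AE_lebesgue_on_iff_lborel) simp_all
  from integral_lebesgue_on_cong_AE(1)[OF this] show ?thesis
   using comp_power_integrable by (subst lebesgue_on_borel_integral(1)[symmetric]) auto
 qed
 have "AE t in lborel. t \<in> {0<..<T} --> (nrm (f t))^2 +
   2 * (LINT s|lebesgue_on {0<..<t}. (V_norm h \<alpha> (f s))^2 + ip (k s) (f s)) <= (nrm (f 0))^2"
  using component_facts(13) unfolding energy_bound_from_def by (subst (asm) AE_lebesgue_on_iff_lborel) simp_all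
 then show ?thesis by eventually_elim (simp add: eq)
qed

text \<open>The energy inequality from time 0 turns weak into strong convergence to the initial value.\<close>
lemma component_initial:
 assumes "\<alpha> >= 0" and T: "T > 0" and e: "e > 0"
 shows "\<exists>de>0. AE s in lborel. 0 < s & s < de --> nrm (%p. f s p - f 0 p) <= e"
proof -
 have f0: "f 0 \<in> H" "f 0 \<in> L2 D" using component_L2[of 0] T by auto
 \<comment> \<open>The errors from weak continuity and from the energy integral each enter the
   squared distance with the factor 2.\<close>
 have e4: "e^2 / 4 > 0" using e by simp
 obtain de1 where d1: "de1 > 0" "!!s. s \<in> {0..T} ==> \<bar>s\<bar> < de1 ==> \<bar>ip (f s) (f 0) - ip (f 0) (f 0)\<bar> < e^2 / 4"
  using component_continuous[OF f0(1)] T e4 unfolding continuous_on_iff dist_real_def by (metis atLeastAtMost_iff diff_zero less_eq_real_def)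
 obtain de2 where d2: "de2 > 0" "!!t. t <= de2 ==> \<bar>LINT r|lborel. indicator {0<..<t} r * comp_power r\<bar> <= e^2 / 4"
  using vanishing_initial_integral[OF comp_power_integrable e4] by blast
 show ?thesis
 proof (intro exI[of _ "min T (min de1 de2)"] conjI)
  show "AE s in lborel. 0 < s & s < min T (min de1 de2) --> nrm (%p. f s p - f 0 p) <= e"
   using component_energy[OF assms(1)]
  proof eventually_elim
   case (elim s)
   show ?case
   proof
    assume s: "0 < s & s < min T (min de1 de2)"
    have fs: "f s \<in> L2 D" using component_L2[of s] s by auto
    have "(nrm (%p. f s p - f 0 p))^2 = (nrm (f s))^2 - 2 * ip (f s) (f 0) + ip (f 0) (f 0)"
     using fs f0 by (simp add: L2_norm_square L2_inner_diff_left L2_inner_diff_right L2_diff L2_inner_sym[of D "f 0" "f s"])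
    also have "... <= e^2"
    proof -
     have "\<bar>ip (f s) (f 0) - ip (f 0) (f 0)\<bar> < e^2 / 4" by (rule d1(2)) (use s in auto)
     moreover have "\<bar>LINT r|lborel. indicator {0<..<s} r * comp_power r\<bar> <= e^2 / 4" by (rule d2(2)) (use s in auto)
     moreover have "(nrm (f s))^2 + 2 * (LINT r|lborel. indicator {0<..<s} r * comp_power r) <= ip (f 0) (f 0)"
      using elim s L2_norm_square[of D "f 0"] by simp
     ultimately show ?thesis by linarith
    qed
    finally show "nrm (%p. f s p - f 0 p) <= e" by (rule power2_le_imp_le) (use e in simp)
   qed
  qed
 qed (use T d1 d2 in auto)
qed

end

text \<open>The rate at which half the energy of the difference \<open>d\<close> decreases. In the
  transport part only \<open>f1\<close> is differentiated, and its two terms combine to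
  \<open>B\<close> with the velocity u1 - u2.\<close>

definition diff_power where
 "diff_power \<alpha> G f1 u1 k1 f2 u2 k2 r = (let d = (%p. hat G f1 r p - hat G f2 r p) in
  a_form h \<alpha> d d + (ip (hat G k1 r) d - ip (hat G k2 r) d)
   + (B (hat G u1 r) (hat G f1 r) d - B (hat G u2 r) (hat G f1 r) d))"

text \<open>The squared distance is expanded: the energy inequalities bound the two squares from
  above, and \<open>diagonal_rule\<close> yields the mixed term as an identity. The inequality
  survives because the mixed term is known exactly.\<close>

lemma component_difference:
 assumes c1: "component T \<alpha> V H G f1 u1 k1" and c2: "component T \<alpha> V H G f2 u2 k2"
  and T: "T > 0" and \<alpha>: "\<alpha> >= 0"
  and ka: "integrable lborel (%t. ka t ^ 4)" "!!t. regular_at (ka t) (hat G f1 t)"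
  and init: "!!ph. ph \<in> H ==> ip (f1 0) ph = ip (f2 0) ph"
 shows "integrable lborel (diff_power \<alpha> G f1 u1 k1 f2 u2 k2)"
  and "AE t in lborel. 0 < t & t < T --> (nrm (%p. hat G f1 t p - hat G f2 t p))^2
   + 2 * (LINT r|lborel. indicator {0<..<t} r * diff_power \<alpha> G f1 u1 k1 f2 u2 k2 r) <= 0"
proof -
 note F1 = component_facts[OF c1] and F2 = component_facts[OF c2]
 note S1 = component_in[OF c1] and S2 = component_in[OF c2]
 note en = F1(4,5) F2(4,5)
 obtain M1 M2 M3 M4 where "!!t. nrm (hat G f1 t) <= M1" "!!t. nrm (hat G u1 t) <= M2"
  "!!t. nrm (hat G f2 t) <= M3" "!!t. nrm (hat G u2 t) <= M4" using en unfolding energy_curve_def by blast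
 then have Mx: "nrm (hat G f1 t) <= max (max M1 M2) (max M3 M4)" "nrm (hat G u1 t) <= max (max M1 M2) (max M3 M4)"
  "nrm (hat G f2 t) <= max (max M1 M2) (max M3 M4)" "nrm (hat G u2 t) <= max (max M1 M2) (max M3 M4)" for t
  by (simp_all add: le_max_iff_disj)
 define M where "M = max (max M1 M2) (max M3 M4)"
 note M = Mx[folded M_def]
 have M0: "M >= 0" using M(1)[of 0] L2_norm_nonneg[of D "hat G f1 0"] by linarith
 define E where "E t = (N1 (hat G f1 t))^2 + (N1 (hat G u1 t))^2 + (N1 (hat G f2 t))^2 + (N1 (hat G u2 t))^2
  + (nrm (hat G k1 t))^2 + (nrm (hat G k2 t))^2 + ka t ^ 4" for t
 have E: "integrable lborel E"
  using en ka(1) F1(7) F2(7) unfolding E_def energy_curve_def by (intro integrable_plus) auto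
 have Epos: "0 <= (N1 (hat G f1 t))^2" "0 <= (N1 (hat G u1 t))^2" "0 <= (N1 (hat G f2 t))^2" "0 <= (N1 (hat G u2 t))^2"
  "0 <= (nrm (hat G k1 t))^2" "0 <= (nrm (hat G k2 t))^2" "0 <= ka t ^ 4" for t by simp_all
 have Ele: "(N1 (hat G f1 t))^2 <= E t" "(N1 (hat G u1 t))^2 <= E t" "(N1 (hat G f2 t))^2 <= E t" "(N1 (hat G u2 t))^2 <= E t"
  "(nrm (hat G k1 t))^2 <= E t" "(nrm (hat G k2 t))^2 <= E t"
  "(N1 (hat G u1 t))^2 + (N1 (hat G f1 t))^2 + ka t ^ 4 <= E t" "(N1 (hat G u2 t))^2 + (N1 (hat G f2 t))^2 <= E t"
  "(N1 (hat G f1 t))^2 + ka t ^ 4 <= E t" for t using Epos[of t] unfolding E_def by linarith+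
 \<comment> \<open>First equation, tested with the second solution; here the regular function is
   already the differentiated one.\<close>
 interpret X1: cross_form h T \<alpha> "hat G u1" "hat G f1" "hat G f2" "hat G k1" E
 proof unfold_locales
  fix e :: real assume e: "e > 0"
  obtain A where A: "A >= 0" "!!u p q ka. u \<in> W1 ==> p \<in> W1 ==> q \<in> W1 ==>
    nrm u <= M ==> nrm q <= M ==> regular_at ka p ==>
    \<bar>B u p q\<bar> <= e * (N1 q)^2 + A * ((N1 u)^2 + (N1 p)^2 + ka^4)"
   by (rule B_growth_left[OF M0 e]) (rule that, assumption, assumption)
  show "\<exists>A\<ge>0. \<forall>r t. \<bar>B (hat G u1 r) (hat G f1 r) (hat G f2 t)\<bar> <= e * E t + A * E r"
  proof (intro exI[of _ A] conjI allI A(1))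
   fix r t
   show "\<bar>B (hat G u1 r) (hat G f1 r) (hat G f2 t)\<bar> <= e * E t + A * E r"
    using A(2)[OF S1(2) S1(1) S2(1) M(2) M(3) ka(2), of r r t] mult_left_mono[OF Ele(3)[of t] less_imp_le[OF e]]
     mult_left_mono[OF Ele(7)[of r] A(1)] e by linarith
  qed
 qed (use en E Ele F1(6) in auto)
 \<comment> \<open>Second equation, tested with the first solution. \<open>component_antisym\<close>
   exchanges the last two arguments, so that \<open>f1\<close> is differentiated and
   \<open>B_growth_right\<close> applies.\<close>
 interpret X2: cross_form h T \<alpha> "hat G u2" "hat G f2" "hat G f1" "hat G k2" E
 proof unfold_locales
  fix e :: real assume e: "e > 0"
  obtain A where A: "A >= 0" "!!u p q ka. u \<in> W1 ==> p \<in> W1 ==> q \<in> W1 ==>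
    nrm u <= M ==> nrm p <= M ==> regular_at ka q ==>
    \<bar>B u q p\<bar> <= e * ((N1 q)^2 + ka^4) + A * ((N1 u)^2 + (N1 p)^2)"
   by (rule B_growth_right[OF M0 e]) (rule that, assumption, assumption)
  show "\<exists>A\<ge>0. \<forall>r t. \<bar>B (hat G u2 r) (hat G f2 r) (hat G f1 t)\<bar> <= e * E t + A * E r"
  proof (intro exI[of _ A] conjI allI A(1))
   fix r t
   show "\<bar>B (hat G u2 r) (hat G f2 r) (hat G f1 t)\<bar> <= e * E t + A * E r"
    using A(2)[OF S2(2) S2(1) S1(1) M(4) M(3) ka(2), of r t r] mult_left_mono[OF Ele(9)[of t] less_imp_le[OF e]]
     mult_left_mono[OF Ele(8)[of r] A(1)] e component_antisym[OF c2 S2(1) S1(1), of r r t] by linarith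
  qed
 qed (use en E Ele F2(6) in auto)
 obtain A1 where A1: "A1 >= 0" "!!r t. \<bar>X1.F r t\<bar> <= 1 * E t + A1 * E r" using X1.F_growth[of 1] by auto
 obtain A2 where A2: "A2 >= 0" "!!r t. \<bar>X2.F r t\<bar> <= 1 * E t + A2 * E r" using X2.F_growth[of 1] by auto
 have f0: "f1 0 \<in> H" "f2 0 \<in> H" "f1 0 \<in> L2 D" "f2 0 \<in> L2 D"
  using component_L2[OF c1, of 0] component_L2[OF c2, of 0] T by auto
 define n0 where "n0 = (nrm (f1 0))^2"
 \<comment> \<open>The initial values agree when tested with \<open>H\<close> and both belong to
   \<open>H\<close>, so all these products coincide.\<close>
 have n0: "ip (f1 0) (f1 0) = n0" "ip (f2 0) (f1 0) = n0" "(nrm (f2 0))^2 = n0"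
  using init[OF f0(1)] init[OF f0(2)] L2_inner_sym[of D "f1 0" "f2 0"] by (simp_all add: n0_def L2_norm_square)
 define ga where "ga s = ip (hat G f1 s) (hat G f2 s)" for s
 note curves = component_curves(1)[OF c1] component_curves(1)[OF c2]
 have rule: "AE t in lborel. 0 < t & t < T --> ga t = n0 + (LINT r|lborel. indicator {0<..<t} r * (X1.F r r + X2.F r r))"
 proof (rule diagonal_rule[where K=E and G="%r. (A1 + A2) * E r" and M="M * M", OF X1.F_measurable X2.F_measurable E _ _ _ X1.F_shift X2.F_shift])
  show "integrable lborel (%r. (A1 + A2) * E r)" using E by simp
  show "\<bar>X1.F r t\<bar> <= E t + (A1 + A2) * E r" for r t
   using A1(2)[of r t] mult_nonneg_nonneg[OF A2(1) X1.E_nonneg[of r]] by (simp add: distrib_right)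
  show "\<bar>X2.F r t\<bar> <= E t + (A1 + A2) * E r" for r t
   using A2(2)[of r t] mult_nonneg_nonneg[OF A1(1) X1.E_nonneg[of r]] by (simp add: distrib_right)
  have "ga \<in> borel_measurable lborel" unfolding ga_def[abs_def]
   by (rule scurve_measurable2[where Fu="%a b. ip a b", OF curves seq_cont_inner[OF seq_cont_L2(1) seq_cont_L2(1)]])
  then show "ga \<in> borel_measurable borel" by simp
  show "\<bar>ga t\<bar> <= M * M" for t unfolding ga_def using M M0
   by (intro order_trans[OF L2_Cauchy_Schwarz] mult_mono Sobolev1_L2 S1 S2) auto
 next
  fix de :: real assume d: "de > 0"
  have pm: "Measurable.pred borel (%t. 0 < t & t < T --> t \<in> G)" using F1(1) by measurable
  have "AE s in lborel. 0 < de + 1 * s & de + 1 * s < T --> de + 1 * s \<in> G"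
   by (rule AE_borel_affine[OF _ pm component_AE[OF c1]]) simp
  with component_AE[OF c1]
  show "AE s in lborel. 0 < s & s + de < T --> ga (s + de) - ga s =
   (LINT r|lborel. indicator {s<..<s + de} r * X1.F r (s + de)) + (LINT r|lborel. indicator {s<..<s + de} r * X2.F r s)"
  proof eventually_elim
   case (elim s)
   show ?case
   proof
    assume s: "0 < s & s + de < T"
    then have g: "s \<in> G" "s + de \<in> G" using elim d by (auto simp: add.commute)
    have V: "f2 (s + de) \<in> V" "f1 s \<in> V" using g component_good(1)[OF c1] component_good(1)[OF c2] by auto
    have hat: "hat G f1 s = f1 s" "hat G f2 s = f2 s" "hat G f1 (s + de) = f1 (s + de)" "hat G f2 (s + de) = f2 (s + de)"
     using g by (simp_all add: hat_def)
    \<comment> \<open>Each increment is tested with a fixed function: f2 at the later time, f1 at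
      the earlier one.\<close>
    have "ga (s + de) - ga s = (ip (f1 (s + de)) (f2 (s + de)) - ip (f1 s) (f2 (s + de)))
     + (ip (f2 (s + de)) (f1 s) - ip (f2 s) (f1 s))" by (simp add: ga_def hat L2_inner_sym[of D "f1 s"])
    then show "ga (s + de) - ga s =
     (LINT r|lborel. indicator {s<..<s + de} r * X1.F r (s + de)) + (LINT r|lborel. indicator {s<..<s + de} r * X2.F r s)"
     using component_increment[OF c1 V(1), of s "s + de"] component_increment[OF c2 V(2), of s "s + de"] s d
     unfolding X1.F_def X2.F_def hat by linarith
   qed
  qed
 next
  fix e :: real assume e: "e > 0"
  have e': "e / (2 * (M + 1)) > 0" using e M0 by simp
  obtain de1 where d1: "de1 > 0" "AE s in lborel. 0 < s & s < de1 --> nrm (%p. f1 s p - f1 0 p) <= e / (2 * (M + 1))"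
   using component_initial[OF c1 \<alpha> T e'] by blast
  obtain de2 where d2: "de2 > 0" "!!s. s \<in> {0..T} ==> \<bar>s\<bar> < de2 ==> \<bar>ip (f2 s) (f1 0) - ip (f2 0) (f1 0)\<bar> < e / 2"
   using component_continuous[OF c2 f0(1)] T half_gt_zero[OF e] unfolding continuous_on_iff dist_real_def
   by (metis atLeastAtMost_iff diff_zero less_eq_real_def)
  show "\<exists>de>0. AE s in lborel. 0 < s & s < de --> \<bar>ga s - n0\<bar> <= e"
  proof (intro exI[of _ "min T (min de1 de2)"] conjI)
   show "AE s in lborel. 0 < s & s < min T (min de1 de2) --> \<bar>ga s - n0\<bar> <= e"
    using d1(2) component_AE[OF c1]
   proof eventually_elim
    case (elim s)
    show ?case
    proof
     assume s: "0 < s & s < min T (min de1 de2)"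
     then have g: "s \<in> G" using elim by auto
     have hat: "hat G f1 s = f1 s" "hat G f2 s = f2 s" using g by (simp_all add: hat_def)
     have L: "f1 s \<in> L2 D" "f2 s \<in> L2 D" using component_L2[OF c1, of s] component_L2[OF c2, of s] s by auto
     have "ga s - n0 = ip (%p. f1 s p - f1 0 p) (f2 s) + (ip (f2 s) (f1 0) - ip (f2 0) (f1 0))"
      by (simp add: ga_def hat L2_inner_diff_left L f0 n0 L2_inner_sym[of D "f1 0" "f2 s"])
     moreover have "\<bar>ip (%p. f1 s p - f1 0 p) (f2 s)\<bar> <= e / (2 * (M + 1)) * M"
      using elim s M(3)[of s] M0 e'
      by (intro order_trans[OF L2_Cauchy_Schwarz] mult_mono L2_diff L f0) (auto simp: hat)
     moreover have "e / (2 * (M + 1)) * M <= e / 2" using M0 e by (simp add: field_simps)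
     moreover have "\<bar>ip (f2 s) (f1 0) - ip (f2 0) (f1 0)\<bar> < e / 2" by (rule d2(2)) (use s in auto)
     ultimately show "\<bar>ga s - n0\<bar> <= e" by linarith
    qed
   qed
  qed (use T d1 d2 in auto)
 qed
 let ?P = "diff_power \<alpha> G f1 u1 k1 f2 u2 k2"
 \<comment> \<open>Since \<open>B u f f\<close> vanishes, the two mixed transport terms add up to
   minus the transport difference in \<open>diff_power\<close>.\<close>
 have P: "?P r = comp_power \<alpha> G f1 k1 r + comp_power \<alpha> G f2 k2 r + (X1.F r r + X2.F r r)" for r
 proof -
  note S = S1[of r] S2[of r]
  note L = Sobolev1_L2[OF S(1)] Sobolev1_L2[OF S(4)]
  have "B (hat G u1 r) (hat G f1 r) (hat G f1 r) = 0" "B (hat G u2 r) (hat G f1 r) (hat G f1 r) = 0"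
   using component_antisym[OF c1 S(1) S(1), of r] component_antisym[OF c2 S(1) S(1), of r] by simp_all
  then show ?thesis using component_antisym[OF c2 S(1) S(4), of r]
   by (simp add: diff_power_def Let_def comp_power_def[OF c1] comp_power_def[OF c2] X1.F_def X2.F_def
     a_form_diff_left a_form_diff_right S Sobolev1_diff(1) B_diff(3)[OF S(1,4)] L2_inner_diff_right L
     a_form_sym[of \<alpha> "hat G f2 r" "hat G f1 r"])
 qed
 have i: "integrable lborel (comp_power \<alpha> G f1 k1)" "integrable lborel (comp_power \<alpha> G f2 k2)"
  "integrable lborel (%r. X1.F r r + X2.F r r)"
  using comp_power_integrable[OF c1] comp_power_integrable[OF c2] X1.F_diagonal X2.F_diagonal by auto
 show "integrable lborel ?P" unfolding P[abs_def] by (intro integrable_plus[OF integrable_plus] i)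
 have split: "(LINT r|lborel. indicator {0<..<t} r * ?P r) = (LINT r|lborel. indicator {0<..<t} r * comp_power \<alpha> G f1 k1 r)
  + (LINT r|lborel. indicator {0<..<t} r * comp_power \<alpha> G f2 k2 r)
  + (LINT r|lborel. indicator {0<..<t} r * (X1.F r r + X2.F r r))" for t :: real
 proof -
  have "integrable lborel (%r. indicator {0<..<t} r * g r)" if "integrable lborel g" for g :: "real => real"
   using integrable_mult_indicator[of "{0<..<t}" lborel g] that by simp
  note j = this[OF i(1)] this[OF i(2)] this[OF i(3)]
  show ?thesis
   unfolding P distrib_left[of "indicator _ _" "_ + _" "X1.F _ _ + _"] distrib_left[of "indicator _ _" "comp_power _ _ _ _ _"]
   using j by (simp add: integral_plus)
 qed
 show "AE t in lborel. 0 < t & t < T --> (nrm (%p. hat G f1 t p - hat G f2 t p))^2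
   + 2 * (LINT r|lborel. indicator {0<..<t} r * ?P r) <= 0"
  using rule component_energy[OF c1 \<alpha>] component_energy[OF c2 \<alpha>] component_AE[OF c1]
 proof eventually_elim
  case (elim t)
  show ?case
  proof
   assume t: "0 < t & t < T"
   then have g: "hat G f1 t = f1 t" "hat G f2 t = f2 t" using elim(4) by (simp_all add: hat_def)
   have L: "f1 t \<in> L2 D" "f2 t \<in> L2 D" using component_L2[OF c1, of t] component_L2[OF c2, of t] t by auto
   have "(nrm (%p. hat G f1 t p - hat G f2 t p))^2 = (nrm (f1 t))^2 + (nrm (f2 t))^2 - 2 * ga t"
    by (simp add: g ga_def L L2_norm_square L2_inner_diff_left L2_inner_diff_right L2_diff L2_inner_sym[of D "f2 t" "f1 t"])
   then show "(nrm (%p. hat G f1 t p - hat G f2 t p))^2 + 2 * (LINT r|lborel. indicator {0<..<t} r * ?P r) <= 0"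
    using elim(1-3) t n0(3) n0_def split[of t] by simp
  qed
 qed
qed

end

section \<open>Gronwall's inequality and the uniqueness argument\<close>

text \<open>Reflection at \<open>a\<close> folds the two half intervals into (0, de), where
  \<open>vanishing_initial_integral\<close> applies.\<close>

lemma vanishing_symmetric_integral:
 fixes K :: "real => real"
 assumes K: "integrable lborel K" and e: "e > 0"
 shows "\<exists>de>0. \<bar>LINT r|lborel. indicator {a - de<..<a + de} r * K r\<bar> <= e"
proof -
 have i: "integrable lborel (%r. K (a + r))" "integrable lborel (%r. K (a - r))"
  using lborel_integrable_real_affine[OF K, of 1 a] lborel_integrable_real_affine[OF K, of "-1" a] by simp_all
 obtain de where d: "de > 0" "\<bar>LINT r|lborel. indicator {0<..<de} r * (K (a + r) + K (a - r))\<bar> <= e"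
  using vanishing_initial_integral[OF integrable_plus[OF i] e] by blast
 have j: "integrable lborel (%r. indicator {x<..<y} r * f r)" if "integrable lborel f" for f :: "real => real" and x y
  using integrable_mult_indicator[of "{x<..<y}" lborel f] that by simp
 have "(LINT r|lborel. indicator {a - de<..<a + de} r * K r)
   = (LINT r|lborel. indicator {a<..<a + de} r * K r + indicator {a - de<..<a} r * K r)"
  using AE_lborel_singleton[of a] by (intro integral_cong_AE borel_measurable_integrable integrable_plus j K)
   (auto elim!: eventually_mono simp: indicator_def)
 also have "... = (LINT r|lborel. indicator {a<..<a + de} r * K r) + (LINT r|lborel. indicator {a - de<..<a} r * K r)"
  by (intro integral_plus j K)
 also have "(LINT r|lborel. indicator {a<..<a + de} r * K r) = (LINT r|lborel. indicator {0<..<de} r * K (a + r))"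
  by (subst lborel_integral_real_affine[where c=1 and t=a]) (auto intro!: Bochner_Integration.integral_cong simp: indicator_def)
 also have "(LINT r|lborel. indicator {a - de<..<a} r * K r) = (LINT r|lborel. indicator {0<..<de} r * K (a - r))"
  by (subst lborel_integral_real_affine[where c="-1" and t=a]) (auto intro!: Bochner_Integration.integral_cong simp: indicator_def)
 also have "(LINT r|lborel. indicator {0<..<de} r * K (a + r)) + (LINT r|lborel. indicator {0<..<de} r * K (a - r))
   = (LINT r|lborel. indicator {0<..<de} r * (K (a + r) + K (a - r)))"
  unfolding distrib_left by (intro integral_plus[symmetric] j i)
 finally show ?thesis using d by (intro exI[of _ de]) simp
qed

text \<open>A continuation argument for a merely integrable \<open>K\<close>. Let \<open>a\<close>
  be the supremum of the times at which the integral \<open>Fu\<close> vanishes. Around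
  \<open>a\<close> the integral of \<open>K\<close> is at most 1/2, so at a time \<open>t\<close>
  slightly beyond, Fu t \<le> Fu t / 2 forces Fu t = 0; hence a = T.\<close>

lemma Gronwall_AE:
 fixes ph K :: "real => real"
 assumes K: "integrable lborel K" "!!t. 0 <= K t" and ph: "ph \<in> borel_measurable borel" "!!t. 0 <= ph t" "!!t. ph t <= C"
  and le: "AE t in lborel. 0 < t & t < T --> ph t <= (LINT r|lborel. indicator {0<..<t} r * (K r * ph r))"
  and T: "T > 0"
 shows "AE t in lborel. 0 < t & t < T --> ph t = 0"
proof -
 have ki: "integrable lborel (%r. K r * ph r)"
 proof (rule integrable_dominated)
  show "integrable lborel (%r. C * K r)" using K by simp
  show "AE r in lborel. norm (K r * ph r) <= norm (C * K r)"
  proof (rule AE_I2)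
   fix r
   have "K r * ph r <= K r * C" by (intro mult_left_mono ph K)
   moreover have "0 <= K r * ph r" by (intro mult_nonneg_nonneg ph K)
   ultimately show "norm (K r * ph r) <= norm (C * K r)" by (simp add: mult.commute)
  qed
 qed (use K ph in measurable)
 have j: "integrable lborel (%r. indicator {x<..<y} r * f r)" if "integrable lborel f" for f :: "real => real" and x y
  using integrable_mult_indicator[of "{x<..<y}" lborel f] that by simp
 define Fu where "Fu t = (LINT r|lborel. indicator {0<..<t} r * (K r * ph r))" for t
 have nn: "0 <= K r * ph r" for r by (intro mult_nonneg_nonneg ph K)
 have mono: "Fu s <= Fu t" if "s <= t" for s t
  unfolding Fu_def using that nn by (intro integral_mono j ki) (auto simp: indicator_def)
 have Fu0: "0 <= Fu t" for t
  unfolding Fu_def using nn by (intro Bochner_Integration.integral_nonneg) (auto simp: indicator_def)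
 define S where "S = {t \<in> {0..T}. Fu t = 0}"
 have S: "0 \<in> S" "bdd_above S" using T by (auto simp: S_def Fu_def bdd_above_def)
 define a where "a = Sup S"
 have a: "0 <= a" "a <= T"
  unfolding a_def by (rule cSup_upper[OF S], rule cSup_least) (use S(1) in \<open>auto simp: S_def\<close>)
 obtain de where d: "de > 0" "\<bar>LINT r|lborel. indicator {a - de<..<a + de} r * K r\<bar> <= 1 / 2"
  using vanishing_symmetric_integral[OF K(1), of "1 / 2" a] by auto
 \<comment> \<open>A zero of \<open>Fu\<close> close to the supremum is enough to start
   from.\<close>
 obtain s where s: "s \<in> S" "a - de < s"
  using less_cSup_iff[of S "a - de"] S d(1) unfolding a_def by fastforce
 have sa: "s <= a" using cSup_upper[OF s(1) S(2)] by (simp add: a_def)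
 define t where "t = min T (a + de / 2)"
 have t: "s <= t" "t <= T" "t < a + de" "a <= t" using sa a d by (auto simp: t_def)
 have "Fu t = Fu s + (LINT r|lborel. indicator {s<..<t} r * (K r * ph r))"
 proof -
  have "Fu t = (LINT r|lborel. indicator {0<..<s} r * (K r * ph r) + indicator {s<..<t} r * (K r * ph r))"
   unfolding Fu_def using AE_lborel_singleton[of s] s(1) t(1)
   by (intro integral_cong_AE borel_measurable_integrable integrable_plus j ki)
    (auto elim!: eventually_mono simp: indicator_def S_def)
  also have "... = Fu s + (LINT r|lborel. indicator {s<..<t} r * (K r * ph r))"
   unfolding Fu_def by (intro integral_plus j ki)
  finally show ?thesis .
 qed
 also have "Fu s = 0" using s by (simp add: S_def)
 also have "(LINT r|lborel. indicator {s<..<t} r * (K r * ph r)) <= (LINT r|lborel. Fu t * (indicator {a - de<..<a + de} r * K r))"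
 proof (rule integral_mono_AE)
  show "AE r in lborel. indicator {s<..<t} r * (K r * ph r) <= Fu t * (indicator {a - de<..<a + de} r * K r)"
   using le
  proof eventually_elim
   case (elim r)
   show ?case
   proof (cases "r \<in> {s<..<t}")
    case True
    then have "ph r <= Fu r" using elim s(1) t by (auto simp: Fu_def S_def)
    also have "... <= Fu t" using True by (intro mono) auto
    finally have "K r * ph r <= K r * Fu t" using K by (intro mult_left_mono)
    then show ?thesis using True s(2) t by (simp add: mult.commute)
   qed (use Fu0 K in auto)
  qed
 qed (intro j ki integrable_mult_right K)+
 also have "... <= Fu t * (1 / 2)"
  using d(2) mult_left_mono[OF _ Fu0[of t], of _ "1 / 2"] by (simp add: abs_le_iff)
 finally have "Fu t = 0" using Fu0[of t] by simp
 then have "t \<in> S" using t a by (auto simp: S_def)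
 then have "t <= a" using cSup_upper[of t S] S by (simp add: a_def)
 then have "t = T" using d a by (auto simp: t_def min_def split: if_splits)
 with \<open>Fu t = 0\<close> have FuT: "Fu T = 0" by simp
 show ?thesis using le
 proof eventually_elim
  case (elim r)
  show ?case using elim mono[of r T] FuT ph(2)[of r] unfolding Fu_def by fastforce
 qed
qed

lemma continuous_AE_zero:
 fixes w :: "real => real"
 assumes w: "continuous_on {0..T} w" and ae: "AE s in lborel. 0 < s & s < T --> w s = 0"
  and t: "t \<in> {0..T}" and T: "T > 0"
 shows "w t = 0"
proof (rule ccontr)
 assume nz: "w t \<noteq> 0"
 obtain e where e: "e > 0" "!!s. s \<in> {0..T} ==> \<bar>s - t\<bar> < e ==> \<bar>w s - w t\<bar> < \<bar>w t\<bar>"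
  using w t nz unfolding continuous_on_iff dist_real_def by (metis zero_less_abs_iff)
 define a b where "a = max 0 (t - e)" and "b = min T (t + e)"
 have ab: "a < b" using t T e by (auto simp: a_def b_def)
 have "AE s in lborel. s \<notin> {a<..<b}" using ae
 proof eventually_elim
  case (elim s)
  show ?case
  proof
   assume s: "s \<in> {a<..<b}"
   then have "s \<in> {0..T}" "\<bar>s - t\<bar> < e" "w s = 0" using elim by (auto simp: a_def b_def abs_less_iff)
   then show False using e(2)[of s] by simp
  qed
 qed
 then have "{a<..<b} \<in> null_sets lborel" by (subst AE_iff_null_sets) auto
 then show False using ab by (simp add: null_sets_def)
qed

context strip
begin

text \<open>Covers the times at which the curves have been replaced by zero.\<close>

lemma regular_at_zero: "regular_at 0 (%_. 0)"
proof -
 have "nrm (dz h (%_. 0)) <= 0" using N1_bounds(3)[of "%_. 0"] by simp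
 then have "nrm (dz h (%_. 0)) = 0" using L2_norm_nonneg[of D "dz h (%_. 0)"] by linarith
 then show ?thesis using Bz_bound[OF _ zero_Sobolev1] by (fastforce simp: regular_at_def)
qed

text \<open>The first alternative: the root of \<open>rx g\<close> splits into the norm of
  \<open>g\<close> and a geometric mean with the norm of its horizontal derivative. As
  \<open>ka \<ge> 1\<close>, the factor of the former may be raised from \<open>ka\<close> to
  \<open>ka^2\<close>.\<close>

lemma regular_at_energy:
 assumes f: "f \<in> W1" and ka: "1 <= ka" "nrm (dz h f) <= ka"
 shows "regular_at ka f" unfolding regular_at_def
proof (intro conjI ballI)
 fix u g assume u: "u \<in> W1" and g: "g \<in> W1"
 let ?s = "sqrt (nrm g * nrm (dx h g))"
 have s: "0 <= ?s" by simp
 have "sqrt (rx g) <= sqrt ((nrm g)^2) + sqrt (2 * (nrm g * nrm (dx h g)))"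
  unfolding rx_def by (intro sqrt_add_le_add_sqrt) auto
 also have "sqrt (2 * (nrm g * nrm (dx h g))) <= 2 * ?s"
  using s real_sqrt_le_mono[of 2 4] by (subst real_sqrt_mult) (intro mult_right_mono, auto)
 finally have 1: "sqrt (rx g) <= nrm g + 2 * ?s" by simp
 have "\<bar>Bz u f g\<bar> <= sqrt h * nrm (dx h u) * (sqrt (rx g) * nrm (dz h f))"
  using Bz_bound[OF u f g] by (simp add: mult.assoc)
 also have "... <= sqrt h * nrm (dx h u) * ((nrm g + 2 * ?s) * ka)"
  using 1 ka h_pos s by (intro mult_left_mono mult_mono) auto
 also have "... <= sqrt h * nrm (dx h u) * (ka^2 * nrm g + 2 * ka * ?s)"
 proof (rule mult_left_mono)
  have "ka * nrm g <= ka^2 * nrm g" using ka(1) self_le_power[of ka 2] by (intro mult_right_mono) auto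
  then show "(nrm g + 2 * ?s) * ka <= ka^2 * nrm g + 2 * ka * ?s" by (simp add: algebra_simps)
 qed (use h_pos in simp)
 finally show "\<bar>Bz u f g\<bar> <= sqrt h * nrm (dx h u) * (ka^2 * nrm g + 2 * ka * ?s)" .
qed (use ka in simp)

text \<open>The second alternative: \<open>ka^2\<close> dominates the supremum \<open>m\<close> of
  \<open>Bz_bound_sup\<close>, and the term with the horizontal derivative of \<open>g\<close> is
  only added.\<close>

lemma regular_at_sup:
 assumes f: "f \<in> W1" and m: "dz h f \<in> Linfx_L2z h" "0 <= ka" "enn2real (Linfx_L2z_norm h (dz h f)) <= ka^2"
 shows "regular_at ka f"
proof -
 define m0 where "m0 = enn2real (Linfx_L2z_norm h (dz h f))"
 have fin: "Linfx_L2z_norm h (dz h f) = ennreal m0" using m(1) by (simp add: m0_def Linfx_L2z_def)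
 have "AE x in IX. (LINT z|IZ. (dz h f (x, z))^2) <= m0^2"
  using esssup_AE[of "%x. ennreal (sqrt (LINT z|IZ. (dz h f (x, z))^2))" IX]
 proof eventually_elim
  case (elim x)
  then have "ennreal (sqrt (LINT z|IZ. (dz h f (x, z))^2)) <= ennreal m0"
   by (simp add: fin[symmetric] Linfx_L2z_norm_def)
  then have "sqrt (LINT z|IZ. (dz h f (x, z))^2) <= m0" by (simp add: m0_def ennreal_le_iff)
  then show ?case using real_sqrt_le_iff[of _ "m0^2"] by (simp add: m0_def)
 qed
 note bound = Bz_bound_sup[OF _ f _ _ this]
 show ?thesis unfolding regular_at_def
 proof (intro conjI ballI m(2))
  fix u g assume u: "u \<in> W1" and g: "g \<in> W1"
  have "\<bar>Bz u f g\<bar> <= sqrt h * nrm (dx h u) * (m0 * nrm g)"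
   using bound[OF u g] by (simp add: m0_def mult.assoc)
  also have "... <= sqrt h * nrm (dx h u) * (ka^2 * nrm g + 2 * ka * sqrt (nrm g * nrm (dx h g)))"
   using m h_pos by (intro mult_left_mono add_increasing2 mult_right_mono) (auto simp: m0_def)
  finally show "\<bar>Bz u f g\<bar> <= sqrt h * nrm (dx h u) * (ka^2 * nrm g + 2 * ka * sqrt (nrm g * nrm (dx h g)))" .
 qed
qed

text \<open>Either alternative makes \<kappa>^4 integrable: it is the fourth power of the L2 norm or
  the square of the mixed norm, cut off below at 1. A Borel representative \<open>g\<close> of
  \<kappa>^4 is returned, and \<kappa> is recovered as its fourth root.\<close>

lemma regularity_class_kappa:
 assumes reg: "(%t. dz h (f t)) \<in> regularity_class h T"
 obtains g where "integrable lborel g" "AE t in lebesgue_on {0<..<T}. f t \<in> W1 -->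
  sqrt (sqrt (g t)) ^ 4 = g t & regular_at (sqrt (sqrt (g t))) (f t)"
proof -
 note result = that
 have main: thesis if W: "integrable (lebesgue_on {0<..<T}) W"
  and r: "AE t in lebesgue_on {0<..<T}. f t \<in> W1 --> regular_at (sqrt (sqrt (max 1 (W t)))) (f t)" for W
 proof -
  have i: "integrable (lebesgue_on {0<..<T}) (%t. max 1 (W t))"
   by (intro integrable_max W finite_measure.integrable_const finite_measure_lebesgue_on) simp
  obtain g where g: "g \<in> borel_measurable borel" "AE t in lebesgue_on {0<..<T}. max 1 (W t) = g t" "!!t. t \<notin> {0<..<T} ==> g t = 0"
   by (rule borel_representative[OF _ borel_measurable_integrable[OF i]]) (simp, rule that, assumption+)
  have "integrable lborel g"
   using i integral_lebesgue_on_cong_AE(2)[OF g(2)] lebesgue_on_borel_integral(2)[of "{0<..<T}", OF _ g(1,3)] by simp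
  moreover have "AE t in lebesgue_on {0<..<T}. f t \<in> W1 -->
    sqrt (sqrt (g t)) ^ 4 = g t & regular_at (sqrt (sqrt (g t))) (f t)" using r g(2)
  proof eventually_elim
   case (elim t)
   have g0: "0 <= g t" using elim(2)[symmetric] by simp
   have "sqrt (sqrt (g t)) ^ 4 = ((sqrt (sqrt (g t)))^2)^2" by (simp only: power_mult[symmetric]) simp
   also have "... = g t" using g0 by (simp only: real_sqrt_pow2 real_sqrt_ge_zero)
   finally show ?case using elim by simp
  qed
  ultimately show thesis by (rule result)
 qed
 consider "(%t. dz h (f t)) \<in> Bochner_Lp 4 {0<..<T} (L2 D) (nrm)" | "(%t. dz h (f t)) \<in> L2_time_Linfx_L2z h T"
  using reg by (auto simp: regularity_class_def)
 then show thesis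
 proof cases
  case 1
  show thesis
  proof (rule main)
   show "integrable (lebesgue_on {0<..<T}) (%t. nrm (dz h (f t)) ^ 4)" using 1 by (simp add: Bochner_Lp_def)
   have "regular_at (sqrt (sqrt (max 1 (nrm (dz h (f t)) ^ 4)))) (f t)" if "f t \<in> W1" for t
   proof (rule regular_at_energy[OF that])
    have "nrm (dz h (f t)) ^ 4 = ((nrm (dz h (f t)))^2)^2" by (simp only: power_mult[symmetric]) simp
    then have "sqrt (nrm (dz h (f t)) ^ 4) = (nrm (dz h (f t)))^2" by (simp only: real_sqrt_abs abs_power2)
    then have "sqrt (sqrt (nrm (dz h (f t)) ^ 4)) = nrm (dz h (f t))" by (simp only: real_sqrt_abs) simp
    then show "nrm (dz h (f t)) <= sqrt (sqrt (max 1 (nrm (dz h (f t)) ^ 4)))"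
     using real_sqrt_le_mono[OF real_sqrt_le_mono[OF max.cobounded2[of "nrm (dz h (f t)) ^ 4" 1]]] by simp
   qed simp
   then show "AE t in lebesgue_on {0<..<T}. f t \<in> W1 --> regular_at (sqrt (sqrt (max 1 (nrm (dz h (f t)) ^ 4)))) (f t)"
    by simp
  qed
 next
  case 2
  show thesis
  proof (rule main)
   show "integrable (lebesgue_on {0<..<T}) (%t. (enn2real (Linfx_L2z_norm h (dz h (f t))))^2)"
    using 2 by (simp add: L2_time_Linfx_L2z_def)
   have "AE t in lebesgue_on {0<..<T}. dz h (f t) \<in> Linfx_L2z h"
    using 2 by (simp add: L2_time_Linfx_L2z_def)
   then show "AE t in lebesgue_on {0<..<T}. f t \<in> W1 -->
     regular_at (sqrt (sqrt (max 1 ((enn2real (Linfx_L2z_norm h (dz h (f t))))^2)))) (f t)"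
   proof eventually_elim
    case (elim t)
    let ?m = "enn2real (Linfx_L2z_norm h (dz h (f t)))"
    have "?m <= sqrt (max 1 (?m^2))" using real_sqrt_le_mono[OF max.cobounded2[of "?m^2" 1]] by simp
    then show ?case using regular_at_sup[OF _ elim] by simp
   qed
  qed
 qed
qed

text \<open>Coercivity turns convergence and integrability in \<open>V_norm\<close> into the same in
  \<open>N1\<close>. The freedom to pass to a Borel subset \<open>G'\<close> lets several curves be
  restricted to one common set of times.\<close>

lemma energy_curve_exists:
 assumes co: "coercive \<alpha> V" and f2: "f \<in> Bochner_Lp 2 {0<..<T} V (V_norm h \<alpha>)"
  and fi: "f \<in> Bochner_Linf {0<..<T} X (nrm)"
 obtains G where "AE t in lebesgue_on {0<..<T}. t \<in> G" "!!t. t \<in> G ==> f t \<in> V"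
  "!!G'. G' \<in> sets borel ==> G' \<subseteq> G ==> energy_curve T (hat G' f)"
proof -
 obtain M where M: "AE t in lebesgue_on {0<..<T}. nrm (f t) <= M" using fi by (auto simp: Bochner_Linf_def)
 obtain C where VS: "V \<subseteq> W1" and C: "!!f. f \<in> V ==> N1 f <= C * V_norm h \<alpha> f"
  "!!f g. f \<in> V ==> g \<in> V ==> d1 f g <= C * V_norm h \<alpha> (%p. f p - g p)"
  using co unfolding coercive_def by blast
 have Bm: "Bochner_measurable {0<..<T} V (V_norm h \<alpha>) f" and Bi: "integrable (lebesgue_on {0<..<T}) (%t. (V_norm h \<alpha> (f t))^2)"
  using f2 by (simp_all add: Bochner_Lp_def)
 obtain G where G: "G \<in> sets borel" "G \<subseteq> {0<..<T}" "AE t in lebesgue_on {0<..<T}. t \<in> G"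
  "!!t. t \<in> G ==> f t \<in> V & nrm (f t) <= M" "hcurve (%t. if t \<in> G then f t else (%_. 0))"
 proof (rule Bochner_measurable_scurve[where X="W1" and d=d1 and z="%_. 0" and C=C, OF Bm VS zero_Sobolev1 _ _ M])
  show "0 <= d1 f g & d1 f g <= C * V_norm h \<alpha> (%x. f x - g x)" if "f \<in> V" "g \<in> V" for f g
   using C(2)[OF that] by simp
 qed (simp, rule that, assumption+)
 have "energy_curve T (hat G' f)" if G': "G' \<in> sets borel" "G' \<subseteq> G" for G'
 proof -
  have eq: "hat G' f = (%t. if t \<in> G' then (if t \<in> G then f t else (%_. 0)) else (%_. 0))"
   using G'(2) by (auto simp: hat_def fun_eq_iff)
  have hc: "hcurve (hat G' f)" unfolding eq using G' zero_Sobolev1 by (intro scurve_restrict[OF G(5)]) auto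
  have out: "hat G' f t = (%_. 0)" if "t \<notin> {0<..<T}" for t using that G' G(2) by (auto simp: hat_def)
  have bd: "nrm (hat G' f t) <= max 0 M" for t using G(4)[of t] G'(2) by (auto simp: hat_def le_max_iff_disj)
  have m: "(%t. (N1 (hat G' f t))^2) \<in> borel_measurable lborel"
   by (intro borel_measurable_power hcurve_N1_measurable hc)
  have "integrable (lebesgue_on {0<..<T}) (%t. (N1 (hat G' f t))^2)"
  proof (rule integrable_dominated[OF integrable_mult_right[OF Bi, of "C^2"]])
   show "(%t. (N1 (hat G' f t))^2) \<in> borel_measurable (lebesgue_on {0<..<T})"
    by (intro measurable_restrict_space1 measurable_completion m)
   have "norm ((N1 (hat G' f t))^2) <= norm (C^2 * (V_norm h \<alpha> (f t))^2)" for t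
   proof (cases "t \<in> G'")
    case True
    then have "(N1 (f t))^2 <= (C * V_norm h \<alpha> (f t))^2"
     using C(1)[of "f t"] G(4)[of t] G'(2) by (intro power_mono) auto
    then show ?thesis using True by (simp add: hat_def power_mult_distrib)
   qed (simp add: hat_def)
   then show "AE t in lebesgue_on {0<..<T}. norm ((N1 (hat G' f t))^2) <= norm (C^2 * (V_norm h \<alpha> (f t))^2)" by simp
  qed
  then have "integrable lborel (%t. (N1 (hat G' f t))^2)"
   using m out by (subst lebesgue_on_borel_integral(2)[of "{0<..<T}", symmetric]) auto
  then show ?thesis unfolding energy_curve_def using hc out bd by blast
 qed
 with G(3,4) show thesis by (intro that) auto
qed

section \<open>Source terms\<close>

lemma buoyancy_L2:
 assumes v: "v \<in> L2 D" and k: "k \<in> L2 D"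
 shows "(%p. - v p + int_to_top k p) \<in> L2 D" "nrm (%p. - v p + int_to_top k p) <= nrm v + h * nrm k"
 using L2_add[OF L2_uminus[OF v] int_to_top_L2(1)[OF k]] L2_triangle[OF L2_uminus[OF v] int_to_top_L2(1)[OF k]] int_to_top_L2(2)[OF k]
 by (simp_all add: L2_norm_uminus)

lemma buoyancy_diff:
 assumes "v \<in> L2 D" "k \<in> L2 D" "v' \<in> L2 D" "k' \<in> L2 D"
 shows "nrm (%p. (- v p + int_to_top k p) - (- v' p + int_to_top k' p))
  <= nrm (%p. v p - v' p) + h * nrm (%p. k p - k' p)"
proof -
 have "AE p in ID. (- v p + int_to_top k p) - (- v' p + int_to_top k' p)
   = - (v p - v' p) + int_to_top (%p. k p - k' p) p"
  using int_to_top_diff[OF assms(2,4)] by eventually_elim simp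
 from L2_norm_cong_AE[OF this D_lebesgue] show ?thesis
  using buoyancy_L2(2)[OF L2_diff[OF assms(1,3)] L2_diff[OF assms(2,4)]] by (simp only:)
qed

text \<open>The vertical antiderivative is bounded on L2, so the source depends continuously on the
  two curves and inherits their measurability and square integrability.\<close>

lemma buoyancy_curve:
 assumes v: "energy_curve T (hat G v)" and th: "energy_curve T (hat G th)" and G: "G \<in> sets borel"
 shows "lcurve (hat G (%t p. - v t p + int_to_top (dx h (th t)) p))" (is "lcurve ?k")
  and "integrable lborel (%t. (nrm (hat G (%t p. - v t p + int_to_top (dx h (th t)) p) t))^2)"
proof -
 have hc: "hcurve (hat G v)" "hcurve (hat G th)" using v th by (simp_all add: energy_curve_def)
 note S = scurve_in[OF hc(1)] scurve_in[OF hc(2)]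
 have "lcurve (%t p. - hat G v t p + int_to_top (dx h (hat G th t)) p)"
 proof (rule scurve_map2[where Fu="%a b p. - a p + int_to_top (dx h b) p", OF hc])
  fix F f Q q
  assume F: "seq_cont (W1) d1 F f" and Q: "seq_cont (W1) d1 Q q"
  note A = seq_cont_L2(1)[OF F] seq_cont_L2(2)[OF Q]
  have L: "F n \<in> L2 D" "f \<in> L2 D" "dx h (Q n) \<in> L2 D" "dx h q \<in> L2 D" for n
   using A by (auto simp: seq_cont_def)
  have "(%n. d0 (F n) f + h * d0 (dx h (Q n)) (dx h q)) ----> 0 + h * 0"
   using A by (intro tendsto_add tendsto_mult tendsto_const) (auto simp: seq_cont_def)
  then have lim: "(%n. d0 (F n) f + h * d0 (dx h (Q n)) (dx h q)) ----> 0" by simp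
  have "(%n. d0 (%p. - F n p + int_to_top (dx h (Q n)) p) (%p. - f p + int_to_top (dx h q) p)) ----> 0"
   by (rule LIMSEQ_null_bound[OF L2_norm_nonneg buoyancy_diff[OF L(1,3) L(2,4)] lim])
  then show "seq_cont (L2 D) d0 (%n p. - F n p + int_to_top (dx h (Q n)) p) (%p. - f p + int_to_top (dx h q) p)"
   using buoyancy_L2(1) L by (simp add: seq_cont_def)
 qed
 from scurve_restrict[OF this, of G "%_. 0"] G L2_norm_zero[of D]
 have "lcurve (%t. if t \<in> G then (%p. - hat G v t p + int_to_top (dx h (hat G th t)) p) else (%_. 0))"
  using Sobolev1_L2[OF zero_Sobolev1] by simp
 also have "(%t. if t \<in> G then (%p. - hat G v t p + int_to_top (dx h (hat G th t)) p) else (%_. 0)) = ?k"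
  by (auto simp: hat_def fun_eq_iff)
 finally show k: "lcurve ?k" .
 show "integrable lborel (%t. (nrm (?k t))^2)"
 proof (rule integrable_dominated)
  show "integrable lborel (%t. 2 * (N1 (hat G v t))^2 + (2 * h^2) * (N1 (hat G th t))^2)"
   using v th by (intro integrable_plus integrable_mult_right) (simp_all add: energy_curve_def)
  show "AE t in lborel. norm ((nrm (?k t))^2) <= norm (2 * (N1 (hat G v t))^2 + (2 * h^2) * (N1 (hat G th t))^2)"
  proof (rule AE_I2)
   fix t
   have "(nrm (?k t))^2 <= 2 * (N1 (hat G v t))^2 + (2 * h^2) * (N1 (hat G th t))^2"
   proof (cases "t \<in> G")
    case True
    have "nrm (?k t) <= nrm (hat G v t) + h * nrm (dx h (hat G th t))"
     using buoyancy_L2(2)[OF Sobolev1_L2[OF S(1)] dx_works(1)[OF S(2)], of t t] True by (simp add: hat_def)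
    also have "... <= N1 (hat G v t) + h * N1 (hat G th t)"
     using N1_bounds h_pos by (intro add_mono mult_left_mono) auto
    finally have "(nrm (?k t))^2 <= (N1 (hat G v t) + h * N1 (hat G th t))^2" by (intro power_mono) auto
    also have "... <= 2 * (N1 (hat G v t))^2 + (2 * h^2) * (N1 (hat G th t))^2"
     using sum_squares_bound[of "N1 (hat G v t)" "h * N1 (hat G th t)"] by (simp add: power2_sum power_mult_distrib)
    finally show ?thesis .
   qed (simp add: hat_def)
   then show "norm ((nrm (?k t))^2) <= norm (2 * (N1 (hat G v t))^2 + (2 * h^2) * (N1 (hat G th t))^2)" by simp
  qed
 qed (intro borel_measurable_power lcurve_norm_measurable k)
qed

lemma energy_curve_lcurve: "energy_curve T f ==> lcurve f"
 unfolding energy_curve_def using scurve_map2[where Fu="%a b. a" and f=f and g=f, OF _ _ seq_cont_L2(1)] by blast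

lemma energy_curve_square: "energy_curve T f ==> integrable lborel (%t. (nrm (f t))^2)"
proof (rule integrable_dominated[of _ "%t. (N1 (f t))^2"])
 assume f: "energy_curve T f"
 then show "integrable lborel (%t. (N1 (f t))^2)" by (simp add: energy_curve_def)
 show "(%t. (nrm (f t))^2) \<in> borel_measurable lborel"
  by (intro borel_measurable_power lcurve_norm_measurable energy_curve_lcurve[OF f])
 show "AE t in lborel. norm ((nrm (f t))^2) <= norm ((N1 (f t))^2)"
  by (rule AE_I2) (simp add: power_mono N1_bounds)
qed

lemma constant_curve:
 assumes q: "q \<in> L2 D" and G: "G \<in> sets borel" "G \<subseteq> {0<..<T}"
 shows "lcurve (hat G (%t. q))" "integrable lborel (%t. (nrm (hat G (%t. q) t))^2)"
proof -
 have "lcurve (%t. q)" unfolding scurve_def using q by (intro conjI allI exI[of _ "%n t. q"]) auto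
 from scurve_restrict[OF this, of G "%_. 0"] G Sobolev1_L2[OF zero_Sobolev1]
 show k: "lcurve (hat G (%t. q))" by (simp add: hat_def[abs_def])
 show "integrable lborel (%t. (nrm (hat G (%t. q) t))^2)"
 proof (rule integrable_dominated)
  show "integrable lborel (%t. indicator {0<..<T} t * (nrm q)^2)" by (intro integrable_mult_left)
    (auto simp: integrable_indicator_iff intro: emeasure_bounded_finite[of "{0<..<T}", unfolded infinity_ennreal_def])
  show "AE t in lborel. norm ((nrm (hat G (%t. q) t))^2) <= norm (indicator {0<..<T} t * (nrm q)^2)"
   using G(2) by (intro AE_I2) (auto simp: hat_def indicator_def)
 qed (intro borel_measurable_power lcurve_norm_measurable k)
qed

text \<open>Stated for every smaller Borel set of full measure, so that the two solutions and the
  regularity of the first one can share the same good times.\<close>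

lemma solution_components:
 assumes sol: "weak_solution h \<alpha>\<^sub>1 \<alpha>\<^sub>2 \<alpha>\<^sub>3 Q u\<^sub>0 v\<^sub>0 th\<^sub>0 T u v th"
  and \<alpha>: "\<alpha>\<^sub>1 >= 0" "\<alpha>\<^sub>2 >= 0" "\<alpha>\<^sub>3 >= 0" and Q: "Q \<in> L2 D"
 obtains G where "AE t in lebesgue_on {0<..<T}. t \<in> G"
  "!!G'. G' \<in> sets borel ==> G' \<subseteq> G ==> G' \<subseteq> {0<..<T} ==> AE t in lebesgue_on {0<..<T}. t \<in> G' ==>
   component T \<alpha>\<^sub>1 (V_1 h) (H_1 h) G' u u (%t p. - v t p + int_to_top (dx h (th t)) p) &
   component T \<alpha>\<^sub>2 (V_2 h) (H_2 h) G' v u u & component T \<alpha>\<^sub>3 (V_3 h \<alpha>\<^sub>3) (H_3 h \<alpha>\<^sub>3) G' th u (%t p. - Q p)"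
proof -
 note s = sol[unfolded weak_solution_def]
 obtain Gu where Gu: "AE t in lebesgue_on {0<..<T}. t \<in> Gu" "!!t. t \<in> Gu ==> u t \<in> V_1 h"
  "!!G'. G' \<in> sets borel ==> G' \<subseteq> Gu ==> energy_curve T (hat G' u)"
  by (rule energy_curve_exists[OF coercive_V_1[OF \<alpha>(1)], of u T "H_1 h"]) (use s in blast, use s in blast, rule that, assumption+)
 obtain Gv where Gv: "AE t in lebesgue_on {0<..<T}. t \<in> Gv" "!!t. t \<in> Gv ==> v t \<in> V_2 h"
  "!!G'. G' \<in> sets borel ==> G' \<subseteq> Gv ==> energy_curve T (hat G' v)"
  by (rule energy_curve_exists[OF coercive_V_2[OF \<alpha>(2)], of v T "H_2 h"]) (use s in blast, use s in blast, rule that, assumption+)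
 obtain Gt where Gt: "AE t in lebesgue_on {0<..<T}. t \<in> Gt" "!!t. t \<in> Gt ==> th t \<in> V_3 h \<alpha>\<^sub>3"
  "!!G'. G' \<in> sets borel ==> G' \<subseteq> Gt ==> energy_curve T (hat G' th)"
  by (rule energy_curve_exists[OF coercive_V_3[OF \<alpha>(3)], of th T "H_3 h \<alpha>\<^sub>3"]) (use s in blast, use s in blast, rule that, assumption+)
 have sub: "V_1 h \<subseteq> W1" "V_2 h \<subseteq> W1" "V_3 h \<alpha>\<^sub>3 \<subseteq> W1"
  "V_1 h \<subseteq> H_1 h" "V_2 h \<subseteq> H_2 h" "V_3 h \<alpha>\<^sub>3 \<subseteq> H_3 h \<alpha>\<^sub>3" "H_1 h \<subseteq> L2 D" "H_2 h \<subseteq> L2 D" "H_3 h \<alpha>\<^sub>3 \<subseteq> L2 D"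
  by (auto simp: V_1_def V_2_def V_3_def H_1_def H_2_def H_3_def Sobolev1_L2 split: if_splits)
 have eqs: "(%t p. transport h (u t) (u t) p - v t p + int_to_top (dx h (th t)) p)
   = (%t p. transport h (u t) (u t) p + (- v t p + int_to_top (dx h (th t)) p))"
  "(%t p. transport h (u t) (th t) p - Q p) = (%t p. transport h (u t) (th t) p + - Q p)"
  by (simp_all add: fun_eq_iff)
 have we: "weak_equation h T \<alpha>\<^sub>1 (V_1 h) u (%t p. transport h (u t) (u t) p + (- v t p + int_to_top (dx h (th t)) p))"
  "weak_equation h T \<alpha>\<^sub>2 (V_2 h) v (%t p. transport h (u t) (v t) p + u t p)"
  "weak_equation h T \<alpha>\<^sub>3 (V_3 h \<alpha>\<^sub>3) th (%t p. transport h (u t) (th t) p + - Q p)"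
  using s unfolding eqs by blast+
 have wc: "weakly_continuous_on {0..T} D (H_1 h) u" "weakly_continuous_on {0..T} D (H_2 h) v" "weakly_continuous_on {0..T} D (H_3 h \<alpha>\<^sub>3) th"
  using s by blast+
 have ee: "energy_bound_from h T \<alpha>\<^sub>1 u (%t p. - v t p + int_to_top (dx h (th t)) p) 0" "energy_bound_from h T \<alpha>\<^sub>2 v u 0"
  "energy_bound_from h T \<alpha>\<^sub>3 th (%t p. - Q p) 0"
  using s unfolding energy_inequality_def by blast+
 show thesis
 proof (rule that[of "Gu \<inter> Gv \<inter> Gt"])
  show "AE t in lebesgue_on {0<..<T}. t \<in> Gu \<inter> Gv \<inter> Gt"
   using Gu(1) Gv(1) Gt(1) by eventually_elim simp
  fix G' assume G': "G' \<in> sets borel" "G' \<subseteq> Gu \<inter> Gv \<inter> Gt" "G' \<subseteq> {0<..<T}" "AE t in lebesgue_on {0<..<T}. t \<in> G'"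
  have e: "energy_curve T (hat G' u)" "energy_curve T (hat G' v)" "energy_curve T (hat G' th)"
   using Gu(3)[OF G'(1)] Gv(3)[OF G'(1)] Gt(3)[OF G'(1)] G'(2) by blast+
  note b = buoyancy_curve[OF e(2,3) G'(1)] energy_curve_lcurve[OF e(1)] energy_curve_square[OF e(1)]
   constant_curve[OF L2_uminus[OF Q] G'(1,3)]
  have V: "\<forall>t\<in>G'. u t \<in> V_1 h & u t \<in> V_1 h" "\<forall>t\<in>G'. v t \<in> V_2 h & u t \<in> V_1 h" "\<forall>t\<in>G'. th t \<in> V_3 h \<alpha>\<^sub>3 & u t \<in> V_1 h"
   using Gu(2) Gv(2) Gt(2) G'(2) by blast+
  show "component T \<alpha>\<^sub>1 (V_1 h) (H_1 h) G' u u (%t p. - v t p + int_to_top (dx h (th t)) p) &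
   component T \<alpha>\<^sub>2 (V_2 h) (H_2 h) G' v u u & component T \<alpha>\<^sub>3 (V_3 h \<alpha>\<^sub>3) (H_3 h \<alpha>\<^sub>3) G' th u (%t p. - Q p)"
   unfolding component_def by (intro conjI G' e b V sub we wc ee)
 qed
qed

end

lemma good_set:
 fixes T :: real
 assumes "AE t in lebesgue_on {0<..<T}. P t"
 obtains G where "G \<in> sets borel" "G \<subseteq> {0<..<T}" "AE t in lebesgue_on {0<..<T}. t \<in> G" "!!t. t \<in> G ==> P t"
proof -
 have "AE t in lborel. t \<in> {0<..<T} --> P t"
  using assms by (subst (asm) AE_lebesgue_on_iff_lborel) simp_all
 then obtain Z where Z: "{t \<in> space lborel. \<not> (t \<in> {0<..<T} --> P t)} \<subseteq> Z" "Z \<in> null_sets lborel"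
  unfolding eventually_ae_filter by blast
 show thesis
 proof (rule that[of "{0<..<T} - Z"])
  have "AE t in lborel. t \<notin> Z" by (rule AE_not_in[OF Z(2)])
  then have "AE t in lborel. t \<in> {0<..<T} --> t \<in> {0<..<T} - Z" by eventually_elim simp
  then show "AE t in lebesgue_on {0<..<T}. t \<in> {0<..<T} - Z" by (subst AE_lebesgue_on_iff_lborel) simp_all
 qed (use Z in auto)
qed

context strip
begin

section \<open>Initial values and equality at every time\<close>

lemma zero_mean_diff:
 assumes f: "f \<in> L2 D" "zero_vertical_mean h f" and g: "g \<in> L2 D" "zero_vertical_mean h g"
 shows "zero_vertical_mean h (%p. f p - g p)"
 using f(2) g(2) Fubini_D(1)[OF L2_integrable_D[OF f(1)]] Fubini_D(1)[OF L2_integrable_D[OF g(1)]]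
 unfolding zero_vertical_mean_def by eventually_elim (simp add: Bochner_Integration.integral_diff)

lemma H_diff:
 "f \<in> H_1 h ==> g \<in> H_1 h ==> (%p. f p - g p) \<in> H_1 h"
 "f \<in> H_2 h ==> g \<in> H_2 h ==> (%p. f p - g p) \<in> H_2 h"
 "f \<in> H_3 h \<alpha> ==> g \<in> H_3 h \<alpha> ==> (%p. f p - g p) \<in> H_3 h \<alpha>"
 using zero_mean_diff L2_diff L2_integrable_D
 by (auto simp: H_1_def H_2_def H_3_def Bochner_Integration.integral_diff split: if_splits)

text \<open>The difference at the fixed time \<open>t\<close> lies in \<open>H\<close>. Tested with
  it, the difference at time s is continuous in s and zero at almost every s, hence zero at s = t;
  this covers exceptional times and the endpoints.\<close>

lemma component_equal:
 assumes c1: "component T \<alpha> V H G f1 u1 k1" and c2: "component T \<alpha> V H G f2 u2 k2"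
  and H: "!!f g. f \<in> H ==> g \<in> H ==> (%p. f p - g p) \<in> H" and T: "T > 0"
  and eq: "AE t in lborel. 0 < t & t < T --> nrm (%p. hat G f1 t p - hat G f2 t p) = 0"
  and t: "t \<in> {0..T}"
 shows "AE p in ID. f1 t p = f2 t p"
proof -
 let ?d = "%s p. f1 s p - f2 s p"
 have L: "?d s \<in> L2 D" "f1 s \<in> L2 D" "f2 s \<in> L2 D" if "s \<in> {0..T}" for s
  using component_L2(2)[OF c1 that] component_L2(2)[OF c2 that] by (auto intro: L2_diff)
 have dH: "?d t \<in> H" using H component_L2(1)[OF c1 t] component_L2(1)[OF c2 t] by simp
 have "ip (f1 t) (?d t) - ip (f2 t) (?d t) = 0"
 proof (rule continuous_AE_zero[where w="%s. ip (f1 s) (?d t) - ip (f2 s) (?d t)", OF _ _ t T])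
  show "continuous_on {0..T} (%s. ip (f1 s) (?d t) - ip (f2 s) (?d t))"
   by (intro continuous_on_diff component_continuous[OF c1 dH] component_continuous[OF c2 dH])
  show "AE s in lborel. 0 < s & s < T --> ip (f1 s) (?d t) - ip (f2 s) (?d t) = 0"
   using eq component_AE[OF c1]
  proof eventually_elim
   case (elim s)
   show ?case
   proof
    assume s: "0 < s & s < T"
    then have s': "s \<in> {0..T}" by simp
    have "nrm (?d s) = 0" using elim s by (simp add: hat_def)
    then have "ip (?d s) (?d t) = 0" using L2_Cauchy_Schwarz[OF L(1)[OF s'] L(1)[OF t]] by simp
    then show "ip (f1 s) (?d t) - ip (f2 s) (?d t) = 0"
     using L[OF s'] L(1)[OF t] by (simp add: L2_inner_diff_left)
   qed
  qed
 qed
 then have "ip (?d t) (?d t) = 0" using L[OF t] by (simp add: L2_inner_diff_left)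
 then have "nrm (?d t) = 0" by (simp add: L2_norm_def)
 from L2_norm_eq_0_AE[OF L(1)[OF t] this] show ?thesis by eventually_elim simp
qed

text \<open>Two limits from the right at 0, one by weak continuity and one by the initial condition,
  have to agree.\<close>

lemma component_start:
 assumes c: "component T \<alpha> V H G f u k" and w: "weak_initial_value h H f f\<^sub>0" and T: "T > 0" and ph: "ph \<in> H"
 shows "ip (f 0) ph = ip f\<^sub>0 ph"
proof -
 have "((%t. ip (f t) ph) \<longlongrightarrow> ip (f 0) ph) (at 0 within {0..T})"
  using component_continuous[OF c ph] T by (simp add: continuous_on)
 then have "((%t. ip (f t) ph) \<longlongrightarrow> ip (f 0) ph) (at_right 0)"
  using T by (simp add: at_within_Icc_at_right)
 moreover have "((%t. ip (f t) ph) \<longlongrightarrow> ip f\<^sub>0 ph) (at_right 0)"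
  using w ph by (simp add: weak_initial_value_def)
 ultimately show ?thesis by (rule tendsto_unique[OF trivial_limit_at_right_real])
qed

lemma kappa_hat:
 assumes g: "integrable lborel g" and G: "G \<in> sets borel"
  and r: "!!t. t \<in> G ==> sqrt (sqrt (g t)) ^ 4 = g t & regular_at (sqrt (sqrt (g t))) (f t)"
 shows "integrable lborel (%t. (if t \<in> G then sqrt (sqrt (g t)) else 0) ^ 4)"
  and "regular_at (if t \<in> G then sqrt (sqrt (g t)) else 0) (hat G f t)"
proof -
 have "(%t. (if t \<in> G then sqrt (sqrt (g t)) else 0) ^ 4) = (%t. indicator G t *\<^sub>R g t)"
  using r by (auto simp: fun_eq_iff)
 then show "integrable lborel (%t. (if t \<in> G then sqrt (sqrt (g t)) else 0) ^ 4)"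
  using integrable_mult_indicator[of G lborel g] g G by simp
 show "regular_at (if t \<in> G then sqrt (sqrt (g t)) else 0) (hat G f t)"
  using r regular_at_zero by (simp add: hat_def)
qed

text \<open>1/h + 1 and 8 come from the horizontal part of the transport term, 8 h + 2048 h^2 from
  the vertical part. The number 2048 = 2 * 32^2 results from two successive uses of Young's
  inequality.\<close>

definition gron_const :: real where
 "gron_const = 1 / h + 9 + 8 * h + 2048 * h^2"

text \<open>Gradients of \<open>u\<close> and \<open>d\<close> are absorbed with weight 1/8 at each
  use of Young's inequality, at most twice for each derivative. The total of one quarter matters
  because the velocity difference transports all three unknowns and its gradient is charged in every
  equation.\<close>

lemma B_difference_bound:
 assumes u: "u \<in> W1" and f: "f \<in> W1" and d: "d \<in> W1" and reg: "regular_at ka f"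
 shows "2 * \<bar>B u f d\<bar> <= (grad2 u + grad2 d) / 4
  + gron_const * (1 + (N1 f)^2 + ka^4) * ((nrm u)^2 + (nrm d)^2)"
proof -
 define y Y U g X N where "y = nrm u" and "Y = nrm (dz h u)" and "U = nrm (dx h u)"
  and "g = nrm d" and "X = nrm (dx h d)" and "N = N1 f"
 note defs = y_def Y_def U_def g_def X_def N_def
 have nn: "0 <= y" "0 <= Y" "0 <= U" "0 <= g" "0 <= X" "0 <= N" "0 <= ka"
  using reg by (simp_all add: defs regular_at_def)
 have absorb: "a * b <= b^2 / 8 + 2 * a^2" for a b :: real using mult_absorb[of "1 / 8" a b] by simp
 have "2 * sqrt (pz u * rx d) <= pz u + rx d"
  using arith_geo_mean_sqrt[OF pz_nonneg[of u] rx_nonneg[of d]] by simp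
 then have "2 * \<bar>Bx u f d\<bar> <= (pz u + rx d) * N"
  using Bx_bound[OF u f d] mult_mono[of "2 * sqrt (pz u * rx d)" "pz u + rx d" "nrm (dx h f)" N]
   N1_bounds(2)[of f] pz_nonneg[of u] rx_nonneg[of d] by (simp add: N_def)
 also have "... = (y^2 / h + g^2) * N + (2 * y * N) * Y + (2 * g * N) * X"
  by (simp add: pz_def rx_def y_def[symmetric] Y_def[symmetric] g_def[symmetric] X_def[symmetric] algebra_simps)
 also have "... <= (y^2 / h + g^2) * (1 + N^2) + (Y^2 / 8 + 2 * (2 * y * N)^2) + (X^2 / 8 + 2 * (2 * g * N)^2)"
 proof (intro add_mono absorb mult_left_mono)
  show "N <= 1 + N^2" using mult_le_squares[of 1 N] by simp
 qed (use h_pos in auto)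
 also have "... <= ((1 / h + 1) * (y^2 + g^2)) * (1 + N^2) + Y^2 / 8 + X^2 / 8 + 8 * N^2 * (y^2 + g^2)"
 proof -
  have "(y^2 / h + g^2) * (1 + N^2) <= ((1 / h + 1) * (y^2 + g^2)) * (1 + N^2)"
   using h_pos by (intro mult_right_mono) (simp_all add: field_simps)
  then show ?thesis by (simp add: power_mult_distrib algebra_simps)
 qed
 finally have 1: "2 * \<bar>Bx u f d\<bar> <= ((1 / h + 1) * (y^2 + g^2)) * (1 + N^2) + Y^2 / 8 + X^2 / 8 + 8 * N^2 * (y^2 + g^2)" .
 have "2 * \<bar>Bz u f d\<bar> <= 2 * (sqrt h * U * (ka^2 * g + 2 * ka * sqrt (g * X)))"
  using reg u d by (simp add: regular_at_def defs)
 also have "... = (2 * sqrt h * ka^2 * g) * U + (4 * sqrt h * ka * sqrt (g * X)) * U" by (simp add: algebra_simps)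
 also have "... <= (U^2 / 8 + 2 * (2 * sqrt h * ka^2 * g)^2) + (U^2 / 8 + 2 * (4 * sqrt h * ka * sqrt (g * X))^2)"
  by (intro add_mono absorb)
 also have "... = U^2 / 4 + 8 * h * ka^4 * g^2 + (32 * h * ka^2 * g) * X"
  using nn h_pos by (simp add: power_mult_distrib)
 also have "(32 * h * ka^2 * g) * X <= X^2 / 8 + 2 * (32 * h * ka^2 * g)^2" by (rule absorb)
 also have "2 * (32 * h * ka^2 * g)^2 = 2048 * h^2 * ka^4 * g^2" by (simp add: power_mult_distrib)
 finally have 2: "2 * \<bar>Bz u f d\<bar> <= U^2 / 4 + X^2 / 8 + (8 * h + 2048 * h^2) * ka^4 * g^2" by (simp add: algebra_simps)
 have 3: "((1 / h + 1) * (y^2 + g^2)) * (1 + N^2) + 8 * N^2 * (y^2 + g^2) + (8 * h + 2048 * h^2) * ka^4 * g^2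
   <= gron_const * (1 + N^2 + ka^4) * (y^2 + g^2)"
 proof -
  have "0 <= (1 / h + 9) * ka^4 * (y^2 + g^2)" "0 <= (8 * h + 2048 * h^2) * ka^4 * y^2"
   "0 <= (8 * h + 2048 * h^2) * (1 + N^2) * (y^2 + g^2)" "0 <= 8 * (y^2 + g^2)" using h_pos by simp_all
  then show ?thesis unfolding gron_const_def by (simp add: algebra_simps add_divide_distrib)
 qed
 have "2 * \<bar>B u f d\<bar> <= Y^2 / 8 + U^2 / 4 + X^2 / 4 + gron_const * (1 + N^2 + ka^4) * (y^2 + g^2)"
 proof -
  have arith: "2 * c <= yy / 8 + uu / 4 + xx / 4 + k" if "2 * a <= p + yy / 8 + xx / 8 + q" "2 * b <= uu / 4 + xx / 8 + s"
   "p + q + s <= k" "c <= a + b" for a b c p q s k yy uu xx :: real using that by linarith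
  show ?thesis unfolding B_def by (rule arith[OF 1 2 3 abs_triangle_ineq])
 qed
 also have "... <= (grad2 u + grad2 d) / 4 + gron_const * (1 + N^2 + ka^4) * (y^2 + g^2)"
  using zero_le_power2[of Y] zero_le_power2[of "nrm (dz h d)"] unfolding Y_def U_def X_def by simp
 finally show ?thesis by (simp add: defs)
qed

lemma diff_power_bound:
 assumes S: "hat G f1 r \<in> W1" "hat G f2 r \<in> W1" "hat G u1 r \<in> W1" "hat G u2 r \<in> W1"
  and \<alpha>: "\<alpha> >= 0" and reg: "regular_at ka (hat G f1 r)"
  and src: "\<bar>ip (hat G k1 r) (%p. hat G f1 r p - hat G f2 r p) - ip (hat G k2 r) (%p. hat G f1 r p - hat G f2 r p)\<bar> <= s"
 shows "- 2 * diff_power \<alpha> G f1 u1 k1 f2 u2 k2 r <= - 2 * grad2 (%p. hat G f1 r p - hat G f2 r p) + 2 * s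
  + (grad2 (%p. hat G u1 r p - hat G u2 r p) + grad2 (%p. hat G f1 r p - hat G f2 r p)) / 4
  + gron_const * (1 + (N1 (hat G f1 r))^2 + ka^4) *
   ((d0 (hat G u1 r) (hat G u2 r))^2 + (d0 (hat G f1 r) (hat G f2 r))^2)"
proof -
 let ?d = "%p. hat G f1 r p - hat G f2 r p" and ?w = "%p. hat G u1 r p - hat G u2 r p"
 note d = Sobolev1_diff(1)[OF S(1,2)] and w = Sobolev1_diff(1)[OF S(3,4)]
 have "diff_power \<alpha> G f1 u1 k1 f2 u2 k2 r = a_form h \<alpha> ?d ?d + (ip (hat G k1 r) ?d - ip (hat G k2 r) ?d)
   + B ?w (hat G f1 r) ?d" by (simp add: diff_power_def Let_def B_diff(1)[OF S(3,4,1) d])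
 moreover have "grad2 ?d <= a_form h \<alpha> ?d ?d"
  using V_norm_square_ge[OF d \<alpha>] V_norm_square_a_form[OF d \<alpha>] by simp
 ultimately show ?thesis
  using B_difference_bound[OF w S(1) d reg] src abs_ge_minus_self[of "B ?w (hat G f1 r) ?d"]
   abs_ge_minus_self[of "ip (hat G k1 r) ?d - ip (hat G k2 r) ?d"] by argo
qed

lemma difference_measurable:
 assumes f: "hcurve f" and g: "hcurve g"
 shows "(%t. (d0 (f t) (g t))^2) \<in> borel_measurable borel"
proof -
 have "(%t. (d0 (f t) (g t))^2) = (%t. (nrm (f t))^2 + (nrm (g t))^2 - 2 * ip (f t) (g t))"
  using Sobolev1_L2[OF scurve_in[OF f]] Sobolev1_L2[OF scurve_in[OF g]]
  by (simp add: fun_eq_iff L2_norm_square L2_inner_diff_left L2_inner_diff_right L2_diff L2_inner_sym[of D "g _" "f _"])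
 moreover have "(%t. nrm (k t)) \<in> borel_measurable lborel" if "hcurve k" for k
  by (rule scurve_measurable1[where Fu="nrm", OF that seq_cont_norm[OF seq_cont_L2(1)]])
 moreover have "(%t. ip (f t) (g t)) \<in> borel_measurable lborel"
  by (rule scurve_measurable2[where Fu="%a b. ip a b", OF f g seq_cont_inner[OF seq_cont_L2(1) seq_cont_L2(1)]])
 ultimately show ?thesis using f g by simp
qed

lemma difference_bounded:
 assumes "energy_curve T f" "energy_curve T g"
 shows "\<exists>C. \<forall>t. (d0 (f t) (g t))^2 <= C"
proof -
 obtain M M' where M: "!!t. nrm (f t) <= M" "!!t. nrm (g t) <= M'" and c: "hcurve f" "hcurve g"
  using assms unfolding energy_curve_def by blast
 have "(d0 (f t) (g t))^2 <= (M + M')^2" for t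
  using L2_triangle_diff[OF Sobolev1_L2[OF scurve_in[OF c(1)]] Sobolev1_L2[OF scurve_in[OF c(2)]], of t t] M[of t]
  by (intro power_mono) auto
 then show ?thesis by blast
qed

text \<open>The three energies have to be added before Gronwall's inequality: the velocity
  difference enters the transport of v and \<theta>, and the buoyancy term brings the horizontal
  derivative of the temperature difference into the equation of u.\<close>

lemma weak_strong_uniqueness:
 assumes \<alpha>: "\<alpha>\<^sub>1 >= 0" "\<alpha>\<^sub>2 >= 0" "\<alpha>\<^sub>3 >= 0" and T: "T > 0" and Q: "Q \<in> L2 D"
  and sol1: "weak_solution h \<alpha>\<^sub>1 \<alpha>\<^sub>2 \<alpha>\<^sub>3 Q u\<^sub>0 v\<^sub>0 th\<^sub>0 T u1 v1 th1"
  and sol2: "weak_solution h \<alpha>\<^sub>1 \<alpha>\<^sub>2 \<alpha>\<^sub>3 Q u\<^sub>0 v\<^sub>0 th\<^sub>0 T u2 v2 th2"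
  and reg: "(%t. dz h (u1 t)) \<in> regularity_class h T" "(%t. dz h (v1 t)) \<in> regularity_class h T"
   "(%t. dz h (th1 t)) \<in> regularity_class h T"
  and t: "t \<in> {0..T}"
 shows "AE p in ID. u1 t p = u2 t p" "AE p in ID. v1 t p = v2 t p"
  "AE p in ID. th1 t p = th2 t p"
proof -
 let ?I = "{0<..<T}"
 let ?k1 = "%t p. - v1 t p + int_to_top (dx h (th1 t)) p" and ?k2 = "%t p. - v2 t p + int_to_top (dx h (th2 t)) p"
  and ?q = "%t::real. %p. - Q p"
 obtain G1 where G1: "AE t in lebesgue_on ?I. t \<in> G1"
  "!!G'. G' \<in> sets borel ==> G' \<subseteq> G1 ==> G' \<subseteq> ?I ==> AE t in lebesgue_on ?I. t \<in> G' ==>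
   component T \<alpha>\<^sub>1 (V_1 h) (H_1 h) G' u1 u1 ?k1 & component T \<alpha>\<^sub>2 (V_2 h) (H_2 h) G' v1 u1 u1 &
   component T \<alpha>\<^sub>3 (V_3 h \<alpha>\<^sub>3) (H_3 h \<alpha>\<^sub>3) G' th1 u1 ?q"
  by (rule solution_components[OF sol1 \<alpha> Q]) (rule that, assumption+)
 obtain G2 where G2: "AE t in lebesgue_on ?I. t \<in> G2"
  "!!G'. G' \<in> sets borel ==> G' \<subseteq> G2 ==> G' \<subseteq> ?I ==> AE t in lebesgue_on ?I. t \<in> G' ==>
   component T \<alpha>\<^sub>1 (V_1 h) (H_1 h) G' u2 u2 ?k2 & component T \<alpha>\<^sub>2 (V_2 h) (H_2 h) G' v2 u2 u2 &
   component T \<alpha>\<^sub>3 (V_3 h \<alpha>\<^sub>3) (H_3 h \<alpha>\<^sub>3) G' th2 u2 ?q"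
  by (rule solution_components[OF sol2 \<alpha> Q]) (rule that, assumption+)
 let ?R = "%f g t. f t \<in> W1 --> sqrt (sqrt (g t)) ^ 4 = g t & regular_at (sqrt (sqrt (g t))) (f t)"
 obtain gu where gu: "integrable lborel gu" "AE t in lebesgue_on ?I. ?R u1 gu t"
  by (rule regularity_class_kappa[OF reg(1)]) (rule that, assumption+)
 obtain gv where gv: "integrable lborel gv" "AE t in lebesgue_on ?I. ?R v1 gv t"
  by (rule regularity_class_kappa[OF reg(2)]) (rule that, assumption+)
 obtain gt where gt: "integrable lborel gt" "AE t in lebesgue_on ?I. ?R th1 gt t"
  by (rule regularity_class_kappa[OF reg(3)]) (rule that, assumption+)
 \<comment> \<open>One set of times is to serve both solutions and the regularity of the
   first.\<close>
 have "AE t in lebesgue_on ?I. t \<in> G1 & t \<in> G2 & ?R u1 gu t & ?R v1 gv t & ?R th1 gt t"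
  using G1(1) G2(1) gu(2) gv(2) gt(2) by eventually_elim blast
 then obtain G where G: "G \<in> sets borel" "G \<subseteq> ?I" "AE t in lebesgue_on ?I. t \<in> G"
  "!!t. t \<in> G ==> t \<in> G1 & t \<in> G2 & ?R u1 gu t & ?R v1 gv t & ?R th1 gt t"
  by (rule good_set) (rule that, assumption+)
 have sub: "G \<subseteq> G1" "G \<subseteq> G2" using G(4) by blast+
 note C1 = G1(2)[OF G(1) sub(1) G(2,3)] and C2 = G2(2)[OF G(1) sub(2) G(2,3)]
 note cu1 = C1[THEN conjunct1] and cv1 = C1[THEN conjunct2, THEN conjunct1] and ct1 = C1[THEN conjunct2, THEN conjunct2]
 note cu2 = C2[THEN conjunct1] and cv2 = C2[THEN conjunct2, THEN conjunct1] and ct2 = C2[THEN conjunct2, THEN conjunct2]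
 define kau kav kat where "kau t = (if t \<in> G then sqrt (sqrt (gu t)) else 0)" and "kav t = (if t \<in> G then sqrt (sqrt (gv t)) else 0)"
  and "kat t = (if t \<in> G then sqrt (sqrt (gt t)) else 0)" for t
 have in1: "u1 t \<in> W1" "v1 t \<in> W1" "th1 t \<in> W1" if "t \<in> G" for t
  using component_in(1)[OF cu1, of t] component_in(1)[OF cv1, of t] component_in(1)[OF ct1, of t] that by (simp_all add: hat_def)
 have ku: "integrable lborel (%t. kau t ^ 4)" "regular_at (kau t) (hat G u1 t)" for t
  unfolding kau_def by (rule kappa_hat[OF gu(1) G(1)]; use G(4) in1 in blast)+
 have kv: "integrable lborel (%t. kav t ^ 4)" "regular_at (kav t) (hat G v1 t)" for t
  unfolding kav_def by (rule kappa_hat[OF gv(1) G(1)]; use G(4) in1 in blast)+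
 have kt: "integrable lborel (%t. kat t ^ 4)" "regular_at (kat t) (hat G th1 t)" for t
  unfolding kat_def by (rule kappa_hat[OF gt(1) G(1)]; use G(4) in1 in blast)+
 have w: "weak_initial_value h (H_1 h) u1 u\<^sub>0" "weak_initial_value h (H_2 h) v1 v\<^sub>0" "weak_initial_value h (H_3 h \<alpha>\<^sub>3) th1 th\<^sub>0"
  "weak_initial_value h (H_1 h) u2 u\<^sub>0" "weak_initial_value h (H_2 h) v2 v\<^sub>0" "weak_initial_value h (H_3 h \<alpha>\<^sub>3) th2 th\<^sub>0"
  using sol1 sol2 by (simp_all add: weak_solution_def)
 have iu: "ip (u1 0) ph = ip (u2 0) ph" if "ph \<in> H_1 h" for ph
  using component_start[OF cu1 w(1) T that] component_start[OF cu2 w(4) T that] by simp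
 have iv: "ip (v1 0) ph = ip (v2 0) ph" if "ph \<in> H_2 h" for ph
  using component_start[OF cv1 w(2) T that] component_start[OF cv2 w(5) T that] by simp
 have it: "ip (th1 0) ph = ip (th2 0) ph" if "ph \<in> H_3 h \<alpha>\<^sub>3" for ph
  using component_start[OF ct1 w(3) T that] component_start[OF ct2 w(6) T that] by simp
 define Pu Pv Pt where "Pu = diff_power \<alpha>\<^sub>1 G u1 u1 ?k1 u2 u2 ?k2" and "Pv = diff_power \<alpha>\<^sub>2 G v1 u1 u1 v2 u2 u2"
  and "Pt = diff_power \<alpha>\<^sub>3 G th1 u1 ?q th2 u2 ?q"
 have Du: "integrable lborel Pu" "AE t in lborel. 0 < t & t < T --> (d0 (hat G u1 t) (hat G u2 t))^2
   + 2 * (LINT r|lborel. indicator {0<..<t} r * Pu r) <= 0"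
  unfolding Pu_def by (rule component_difference[OF cu1 cu2 T \<alpha>(1) ku iu], assumption)+
 have Dv: "integrable lborel Pv" "AE t in lborel. 0 < t & t < T --> (d0 (hat G v1 t) (hat G v2 t))^2
   + 2 * (LINT r|lborel. indicator {0<..<t} r * Pv r) <= 0"
  unfolding Pv_def by (rule component_difference[OF cv1 cv2 T \<alpha>(2) kv iv], assumption)+
 have Dt: "integrable lborel Pt" "AE t in lborel. 0 < t & t < T --> (d0 (hat G th1 t) (hat G th2 t))^2
   + 2 * (LINT r|lborel. indicator {0<..<t} r * Pt r) <= 0"
  unfolding Pt_def by (rule component_difference[OF ct1 ct2 T \<alpha>(3) kt it], assumption)+
 define X Y Z where "X r = d0 (hat G u1 r) (hat G u2 r)" and "Y r = d0 (hat G v1 r) (hat G v2 r)"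
  and "Z r = d0 (hat G th1 r) (hat G th2 r)" for r
 define E where "E r = (X r)^2 + (Y r)^2 + (Z r)^2" for r
 define N where "N r = (N1 (hat G u1 r))^2 + (N1 (hat G v1 r))^2 + (N1 (hat G th1 r))^2 + kau r ^ 4 + kav r ^ 4 + kat r ^ 4" for r
 have c0: "0 <= gron_const" using h_pos by (simp add: gron_const_def)
 have E0: "0 <= E r" for r by (simp add: E_def)
 have bound: "- 2 * (Pu r + Pv r + Pt r) <= (2 + h^2 + 2 * gron_const * (3 + N r)) * E r" for r
 proof -
  note S = component_in(1)[OF cu1, of r] component_in(1)[OF cu2, of r] component_in(1)[OF cv1, of r]
   component_in(1)[OF cv2, of r] component_in(1)[OF ct1, of r] component_in(1)[OF ct2, of r]
  note kL = component_in(3)[OF cu1, of r] component_in(3)[OF cu2, of r]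
  let ?du = "%p. hat G u1 r p - hat G u2 r p" and ?dv = "%p. hat G v1 r p - hat G v2 r p"
   and ?dt = "%p. hat G th1 r p - hat G th2 r p"
  note L = Sobolev1_L2[OF Sobolev1_diff(1)[OF S(1,2)]] Sobolev1_L2[OF Sobolev1_diff(1)[OF S(3,4)]]
  define x where "x = nrm (dx h ?dt)"
  have x0: "0 <= x" by (simp add: x_def)
  have "\<bar>ip (hat G ?k1 r) ?du - ip (hat G ?k2 r) ?du\<bar> = \<bar>ip (%p. hat G ?k1 r p - hat G ?k2 r p) ?du\<bar>"
   by (simp only: L2_inner_diff_left[OF kL L(1)])
  also have "... <= nrm (%p. hat G ?k1 r p - hat G ?k2 r p) * X r"
   unfolding X_def by (intro L2_Cauchy_Schwarz L2_diff kL L)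
  \<comment> \<open>The derivative \<open>x\<close> of the temperature difference is absorbed later
    by the dissipation in the equation of \<theta>.\<close>
  also have "... <= (Y r + h * x) * X r"
  proof (rule mult_right_mono)
   show "nrm (%p. hat G ?k1 r p - hat G ?k2 r p) <= Y r + h * x"
   proof (cases "r \<in> G")
    case True
    then show ?thesis
     using buoyancy_diff[OF Sobolev1_L2[OF S(3)] dx_works(1)[OF S(5)] Sobolev1_L2[OF S(4)] dx_works(1)[OF S(6)]] dx_diff_norm(1)[OF S(5,6)]
     by (simp add: hat_def Y_def x_def)
   next
    case False
    then show ?thesis using x0 h_pos by (simp add: hat_def Y_def)
   qed
  qed (simp add: X_def)
  finally have su: "\<bar>ip (hat G ?k1 r) ?du - ip (hat G ?k2 r) ?du\<bar> <= (Y r + h * x) * X r" .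
  have sv: "\<bar>ip (hat G u1 r) ?dv - ip (hat G u2 r) ?dv\<bar> <= X r * Y r"
   using L2_Cauchy_Schwarz[OF L] by (simp add: X_def Y_def L2_inner_diff_left L Sobolev1_L2 S)
  have st: "\<bar>ip (hat G ?q r) ?dt - ip (hat G ?q r) ?dt\<bar> <= 0" by simp
  have bu: "- 2 * Pu r <= - 2 * grad2 ?du + 2 * ((Y r + h * x) * X r) + (grad2 ?du + grad2 ?du) / 4
    + gron_const * (1 + (N1 (hat G u1 r))^2 + kau r ^ 4) * ((X r)^2 + (X r)^2)"
   unfolding Pu_def X_def by (rule diff_power_bound[OF S(1,2) S(1,2) \<alpha>(1) ku(2) su[unfolded X_def]])
  have bv: "- 2 * Pv r <= - 2 * grad2 ?dv + 2 * (X r * Y r) + (grad2 ?du + grad2 ?dv) / 4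
    + gron_const * (1 + (N1 (hat G v1 r))^2 + kav r ^ 4) * ((X r)^2 + (Y r)^2)"
   unfolding Pv_def X_def Y_def by (rule diff_power_bound[OF S(3,4) S(1,2) \<alpha>(2) kv(2) sv[unfolded X_def Y_def]])
  have bt: "- 2 * Pt r <= - 2 * grad2 ?dt + 2 * 0 + (grad2 ?du + grad2 ?dt) / 4
    + gron_const * (1 + (N1 (hat G th1 r))^2 + kat r ^ 4) * ((X r)^2 + (Z r)^2)"
   unfolding Pt_def X_def Z_def by (rule diff_power_bound[OF S(5,6) S(1,2) \<alpha>(3) kt(2) st])
  have mono: "gron_const * (1 + (N1 f)^2 + ka ^ 4) * e <= gron_const * (1 + (N1 f)^2 + ka ^ 4) * (2 * E r)"
   if "e <= 2 * E r" for f ka e using that c0 by (intro mult_left_mono mult_nonneg_nonneg) auto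
  have sq: "0 <= (X r)^2" "0 <= (Y r)^2" "0 <= (Z r)^2" by simp_all
  have Ele: "(X r)^2 + (X r)^2 <= 2 * E r" "(X r)^2 + (Y r)^2 <= 2 * E r" "(X r)^2 + (Z r)^2 <= 2 * E r"
   by (simp_all add: E_def)
  have lin1: "4 * (X r * Y r) <= 2 * E r"
  proof -
   have "2 * (X r * Y r) <= (X r)^2 + (Y r)^2" using sum_squares_bound[of "X r" "Y r"] by (simp only: mult.assoc)
   moreover have "(X r)^2 + (Y r)^2 <= E r" by (simp add: E_def)
   ultimately show ?thesis by linarith
  qed
  have lin2: "2 * (h * x * X r) <= x^2 + h^2 * E r"
  proof -
   have "2 * (h * x * X r) = 2 * x * (h * X r)" by (simp only: mult_ac)
   also have "... <= x^2 + (h * X r)^2" by (rule sum_squares_bound)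
   also have "(h * X r)^2 = h^2 * (X r)^2" by (rule power_mult_distrib)
   finally have "2 * (h * x * X r) <= x^2 + h^2 * (X r)^2" .
   moreover have "h^2 * (X r)^2 <= h^2 * E r" using sq by (intro mult_left_mono) (auto simp: E_def)
   ultimately show ?thesis by linarith
  qed
  have gr: "0 <= grad2 ?du" "0 <= grad2 ?dv" "x^2 <= grad2 ?dt" by (simp_all add: x_def)
  have "2 * ((Y r + h * x) * X r) = 2 * (X r * Y r) + 2 * (h * x * X r)" by (simp add: algebra_simps)
  then have lin: "2 * ((Y r + h * x) * X r) + 2 * (X r * Y r) <= 2 * E r + h^2 * E r + x^2" using lin1 lin2 by linarith
  \<comment> \<open>The gradient budget: the velocity gradient is charged with 1/2, 1/4 and 1/4,
    that of v with 1/4, that of \<theta> with 1/4 and once more through \<open>x\<close>. Each stays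
    within the dissipation, which has weight 2.\<close>
  have arith: "- 2 * (a + b + c) <= l + pu + pv + pt" if "- 2 * a <= - 2 * gu + ku + (gu + gu) / 4 + qu"
   "- 2 * b <= - 2 * gv + kv + (gu + gv) / 4 + qv" "- 2 * c <= - 2 * gt + 2 * 0 + (gu + gt) / 4 + qt" "qu <= pu" "qv <= pv" "qt <= pt"
   "ku + kv <= l + x2" "0 <= gu" "0 <= gv" "x2 <= gt" "0 <= x2" for a b c gu gv gt ku kv qu qv qt pu pv pt l x2 :: real
   using that by argo
  have "- 2 * (Pu r + Pv r + Pt r) <= (2 * E r + h^2 * E r)
    + gron_const * (1 + (N1 (hat G u1 r))^2 + kau r ^ 4) * (2 * E r)
    + gron_const * (1 + (N1 (hat G v1 r))^2 + kav r ^ 4) * (2 * E r)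
    + gron_const * (1 + (N1 (hat G th1 r))^2 + kat r ^ 4) * (2 * E r)"
   by (rule arith[OF bu bv bt mono[OF Ele(1)] mono[OF Ele(2)] mono[OF Ele(3)] lin gr]) simp
  then show ?thesis by (simp add: N_def algebra_simps)
 qed
 \<comment> \<open>On (0, T) this is the factor in \<open>bound\<close>; the indicator keeps its
   constant part integrable over the line.\<close>
 define K where "K r = indicator ?I r * (2 + h^2 + 6 * gron_const) + 2 * gron_const * N r" for r
 have Ni: "integrable lborel N"
  using component_facts(4)[OF cu1] component_facts(4)[OF cv1] component_facts(4)[OF ct1] ku(1) kv(1) kt(1)
  unfolding N_def energy_curve_def by (intro integrable_plus) auto
 have Ki: "integrable lborel K" unfolding K_def using Ni
  by (intro integrable_plus integrable_mult_right integrable_mult_left)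
   (auto simp: integrable_indicator_iff intro: emeasure_bounded_finite[of ?I, unfolded infinity_ennreal_def])
 have K0: "0 <= K r" for r unfolding K_def N_def using c0 by (intro add_nonneg_nonneg mult_nonneg_nonneg) auto
 have Em: "E \<in> borel_measurable borel" unfolding E_def X_def Y_def Z_def
  by (intro borel_measurable_add difference_measurable component_curves(1)[OF cu1] component_curves(1)[OF cu2]
    component_curves(1)[OF cv1] component_curves(1)[OF cv2] component_curves(1)[OF ct1] component_curves(1)[OF ct2])
 obtain C where C: "!!r. E r <= C"
 proof -
  obtain a b c where "!!r. (X r)^2 <= a" "!!r. (Y r)^2 <= b" "!!r. (Z r)^2 <= c"
   using difference_bounded[OF component_facts(4)[OF cu1] component_facts(4)[OF cu2]]
    difference_bounded[OF component_facts(4)[OF cv1] component_facts(4)[OF cv2]]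
    difference_bounded[OF component_facts(4)[OF ct1] component_facts(4)[OF ct2]]
   unfolding X_def Y_def Z_def by blast
  then have "E r <= a + b + c" for r unfolding E_def by (intro add_mono)
  then show thesis by (rule that)
 qed
 have KEi: "integrable lborel (%r. K r * E r)"
 proof (rule integrable_dominated)
  show "integrable lborel (%r. C * K r)" using Ki by simp
  have "norm (K r * E r) <= norm (C * K r)" for r
   using mult_left_mono[OF C[of r] K0[of r]] K0[of r] E0[of r] by (simp add: mult.commute)
  then show "AE r in lborel. norm (K r * E r) <= norm (C * K r)" by simp
 qed (use Ki Em in measurable)
 have j: "integrable lborel (%r. indicator {0<..<s} r * f r)" if "integrable lborel f" for f :: "real => real" and s
  using integrable_mult_indicator[of "{0<..<s}" lborel f] that by simp
 have "AE s in lborel. 0 < s & s < T --> E s <= (LINT r|lborel. indicator {0<..<s} r * (K r * E r))"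
  using Du(2) Dv(2) Dt(2)
 proof eventually_elim
  case (elim s)
  show ?case
  proof
   assume s: "0 < s & s < T"
   let ?P = "%r. indicator {0<..<s} r * Pu r + indicator {0<..<s} r * Pv r + indicator {0<..<s} r * Pt r"
   have Pi: "integrable lborel ?P" by (intro integrable_plus j Du(1) Dv(1) Dt(1))
   have "(LINT r|lborel. ?P r) = (LINT r|lborel. indicator {0<..<s} r * Pu r) + (LINT r|lborel. indicator {0<..<s} r * Pv r)
     + (LINT r|lborel. indicator {0<..<s} r * Pt r)" by (simp add: j Du(1) Dv(1) Dt(1))
   then have "E s <= - 2 * (LINT r|lborel. ?P r)" using elim s unfolding E_def X_def Y_def Z_def by linarith
   also have "... = (LINT r|lborel. - 2 * ?P r)" by (rule integral_mult_right_zero[symmetric])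
   also have "... <= (LINT r|lborel. indicator {0<..<s} r * (K r * E r))"
   proof (rule integral_mono)
    show "- 2 * ?P r <= indicator {0<..<s} r * (K r * E r)" for r
    proof (cases "r \<in> {0<..<s}")
     case True
     then have "K r = 2 + h^2 + 2 * gron_const * (3 + N r)" using s by (simp add: K_def algebra_simps)
     then show ?thesis using bound[of r] True by simp
    qed simp
   qed (intro integrable_mult_right Pi j KEi)+
   finally show "E s <= (LINT r|lborel. indicator {0<..<s} r * (K r * E r))" .
  qed
 qed
 from Gronwall_AE[OF Ki K0 Em E0 C this T] have E_zero: "AE s in lborel. 0 < s & s < T --> E s = 0" .
 have "AE s in lborel. 0 < s & s < T --> X s = 0" "AE s in lborel. 0 < s & s < T --> Y s = 0"
  "AE s in lborel. 0 < s & s < T --> Z s = 0"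
  using E_zero by (eventually_elim, simp add: E_def add_nonneg_eq_0_iff)+
 then show "AE p in ID. u1 t p = u2 t p" "AE p in ID. v1 t p = v2 t p" "AE p in ID. th1 t p = th2 t p"
  using component_equal[OF cu1 cu2 H_diff(1) T _ t] component_equal[OF cv1 cv2 H_diff(2) T _ t]
   component_equal[OF ct1 ct2 H_diff(3) T _ t] unfolding X_def Y_def Z_def by blast+
qed

end

theorem theorem4p1:
  fixes h \<alpha>\<^sub>1 \<alpha>\<^sub>2 \<alpha>\<^sub>3 T :: real
    and Q u\<^sub>0 v\<^sub>0 \<theta>\<^sub>0 :: "real \<times> real \<Rightarrow> real"
    and u\<^sub>1 v\<^sub>1 \<theta>\<^sub>1 u\<^sub>2 v\<^sub>2 \<theta>\<^sub>2 :: "real \<Rightarrow> real \<times> real \<Rightarrow> real"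
  assumes "h > 0" and "\<alpha>\<^sub>1 \<ge> 0" and "\<alpha>\<^sub>2 \<ge> 0" and "\<alpha>\<^sub>3 \<ge> 0" and "T > 0"
    and "Q \<in> L2 (Dom h)"
    and "(u\<^sub>0, v\<^sub>0, \<theta>\<^sub>0) \<in> H_1 h \<times> H_2 h \<times> H_3 h \<alpha>\<^sub>3"
    and "weak_solution h \<alpha>\<^sub>1 \<alpha>\<^sub>2 \<alpha>\<^sub>3 Q u\<^sub>0 v\<^sub>0 \<theta>\<^sub>0 T u\<^sub>1 v\<^sub>1 \<theta>\<^sub>1"
    and "weak_solution h \<alpha>\<^sub>1 \<alpha>\<^sub>2 \<alpha>\<^sub>3 Q u\<^sub>0 v\<^sub>0 \<theta>\<^sub>0 T u\<^sub>2 v\<^sub>2 \<theta>\<^sub>2"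
    and "(\<lambda>t. dz h (u\<^sub>1 t)) \<in> regularity_class h T"
    and "(\<lambda>t. dz h (v\<^sub>1 t)) \<in> regularity_class h T"
    and "(\<lambda>t. dz h (\<theta>\<^sub>1 t)) \<in> regularity_class h T"
  shows "\<forall>t\<in>{0..T}. AE p in lebesgue_on (Dom h).
    u\<^sub>1 t p = u\<^sub>2 t p \<and> v\<^sub>1 t p = v\<^sub>2 t p \<and> \<theta>\<^sub>1 t p = \<theta>\<^sub>2 t p"
proof
  interpret strip h by unfold_locales (rule assms(1))
  fix t assume t: "t \<in> {0..T}"
  note eq = weak_strong_uniqueness[OF assms(2-6) assms(8-12) t]
  show "AE p in lebesgue_on (Dom h). u\<^sub>1 t p = u\<^sub>2 t p \<and> v\<^sub>1 t p = v\<^sub>2 t p \<and> \<theta>\<^sub>1 t p = \<theta>\<^sub>2 t p"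
    using eq by eventually_elim blast
qed

end
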